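(* Let $M$ be a Riemannian manifold of dimension $n$, let $g\in C^\infty(M,M)$ and let $K\subset M$ be a Cantor set which is an expanding compact set for $g$. Assume that: (a) $K$ is totally projectively hyperbolic, with invariant splitting $F_1\oplus F_2\oplus\dots\oplus F_n\to\overleftarrow K$ over the inverse limit $\overleftarrow K$; (b) for any $1\le i\le n$ and any multiindex $k=(k_1,\dots,k_n)\in\mathbb N^n$ with $|k|=k_1+\dots+k_n\neq1$, it holds $\|D_{\mathsf a_0}g|F_{i\mathsf a}\|\ne\prod_{\ell=1}^n\|D_{\mathsf a_0}g|F_{\ell\mathsf a}\|^{k_\ell}$ for every $\mathsf a\in\overleftarrow K$, and the sign of the difference does not depend on $\mathsf a\in\overleftarrow K$. Then for $r>0$ sufficiently small there is a unique continuous family $(\varphi_{\mathsf a})_{\mathsf a\in\overleftarrow K}$ of $C^\infty$-charts $\varphi_{\mathsf a}$ from the closed $r$-ball $B_{\mathsf a_0}(r)$ of $T_{\mathsf a_0}M$ onto a neighborhood of $\mathsf a_0$ in $M$ such that for every $\mathsf a\in\overleftarrow K$: $$\varphi_{\mathsf a}(0)=\mathsf a_0,\qquad D_0\varphi_{\mathsf a}=\mathrm{id},\qquad \varphi_{\overleftarrow g(\mathsf a)}\circ D_{\mathsf a_0}g=g\circ\varphi_{\mathsf a}\quad\text{on }(D_{\mathsf a_0}g)^{-1}\big(B_{g(\mathsf a_0)}(r)\big).$$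
   Context: A compact set $K\subset M$ is invariant if $g(K)\subset K$, and expanding if moreover $\|D_xg(u)\|>1$ for all $x\in K$ and unit vectors $u\in T_xM$. A (continuous) sub-bundle $E\subset TM|K$ is $Dg$-invariant if $D_xg(E_x)=E_{g(x)}$ for all $x\in K$; then $Dg$ induces a map $D[g]$ on the quotient $TM/E$ (with quotient norm). $K$ is projectively hyperbolic at $E$ if $\|D_x[g](v)\|>\|D_xg(u)\|$ for all $x\in K$ and all $u\in E_x$, $v\in T_xM/E_x$ with $\|u\|=\|v\|=1$. $K$ is totally projectively hyperbolic if there is a flag of invariant sub-bundles $\{0\}=E_0\subsetneq E_1\subsetneq\dots\subsetneq E_n=TM|K$ such that $K$ is projectively hyperbolic at $E_i$ for every $1\le i<n$. The inverse limit of $K$ is $\overleftarrow K=\{\mathsf a=(\mathsf a_i)_{i\in\mathbb Z}\in K^{\mathbb Z}: g(\mathsf a_i)=\mathsf a_{i+1}\ \forall i\in\mathbb Z\}$, on which $g$ induces the homeomorphism $\overleftarrow g:(\mathsf a_i)_i\mapsto(\mathsf a_{i+1})_i$. Total projective hyperbolicity implies the existence of a unique continuous splitting by line bundles $F_{1\mathsf a}\oplus\dots\oplus F_{n\mathsf a}=T_{\mathsf a_0}M$, $\mathsf a\in\overleftarrow K$, with $D_{\mathsf a_0}g(F_{i\mathsf a})=F_{i\overleftarrow g(\mathsf a)}$ and $E_{i\mathsf a_0}=F_{1\mathsf a}\oplus\dots\oplus F_{i\mathsf a}$; this is the invariant splitting in (a). A family $(\varphi_{\mathsf a})$ is continuous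 if $\varphi_{\mathsf a}$ depends continuously on $\mathsf a$ in the $C^\infty$-topology. *)

theory Defs
  imports "HOL-Analysis.Analysis"
begin

(* Derivatives are taken within S. They are used only for S open (where they are the usual
   ones) or S a relatively open subset of a closed ball of positive radius (where they are
   one-sided at boundary points); in both cases the derivative within S is unique. *)

primrec iter_deriv ::
  "'a::real_normed_vector set \<Rightarrow> 'a list \<Rightarrow> ('a \<Rightarrow> 'b::real_normed_vector) \<Rightarrow> 'a \<Rightarrow> 'b" where
  "iter_deriv S [] f = f"
| "iter_deriv S (v # vs) f = (\<lambda>x. frechet_derivative (iter_deriv S vs f) (at x within S) v)"

definition smooth_on ::
  "'a::real_normed_vector set \<Rightarrow> ('a \<Rightarrow> 'b::real_normed_vector) \<Rightarrow> bool" where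
  "smooth_on S f \<longleftrightarrow> (\<forall>vs. \<forall>x\<in>S. iter_deriv S vs f differentiable (at x within S))"

(* The manifold is the whole type 'm; its dimension is CARD('n). *)

type_synonym ('m, 'n) chart = "'m set \<times> ('m \<Rightarrow> real ^ 'n)"

definition chart_inv :: "('m, 'n::finite) chart \<Rightarrow> real ^ 'n \<Rightarrow> 'm" where
  "chart_inv c = inv_into (fst c) (snd c)"

definition is_chart :: "('m::topological_space, 'n::finite) chart \<Rightarrow> bool" where
  "is_chart c \<longleftrightarrow> open (fst c) \<and> open (snd c ` fst c) \<and>
     homeomorphism (fst c) (snd c ` fst c) (snd c) (chart_inv c)"

definition compatible :: "('m, 'n::finite) chart \<Rightarrow> ('m, 'n) chart \<Rightarrow> bool" where
  "compatible c d \<longleftrightarrow>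
     smooth_on (snd c ` (fst c \<inter> fst d)) (snd d \<circ> chart_inv c) \<and>
     smooth_on (snd d ` (fst c \<inter> fst d)) (snd c \<circ> chart_inv d)"

definition smooth_atlas :: "('m::topological_space, 'n::finite) chart set \<Rightarrow> bool" where
  "smooth_atlas A \<longleftrightarrow>
     (\<forall>c\<in>A. is_chart c) \<and> (\<Union>c\<in>A. fst c) = UNIV \<and> (\<forall>c\<in>A. \<forall>d\<in>A. compatible c d)"

definition smooth_map ::
  "('m::topological_space, 'n::finite) chart set \<Rightarrow> ('m \<Rightarrow> 'm) \<Rightarrow> bool" where
  "smooth_map A g \<longleftrightarrow> continuous_on UNIV g \<and>
     (\<forall>c\<in>A. \<forall>d\<in>A. smooth_on (snd c ` (fst c \<inter> g -` fst d)) (snd d \<circ> g \<circ> chart_inv c))"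

(* The tangent space at x is the coordinate space real ^ 'n of a chart at x chosen once and for
   all, namely chart_at A x. Since the choice need not depend continuously on x, continuity and
   smoothness in the base point are always expressed through an arbitrary chart c of the atlas:
   to_coord A c x and of_coord A c x are the differential of c at x and its inverse. *)

definition chart_at :: "('m, 'n::finite) chart set \<Rightarrow> 'm \<Rightarrow> ('m, 'n) chart" where
  "chart_at A x = (SOME c. c \<in> A \<and> x \<in> fst c)"

definition to_coord ::
  "('m, 'n::finite) chart set \<Rightarrow> ('m, 'n) chart \<Rightarrow> 'm \<Rightarrow> real ^ 'n \<Rightarrow> real ^ 'n" where
  "to_coord A c x =
     frechet_derivative (snd c \<circ> chart_inv (chart_at A x)) (at (snd (chart_at A x) x))"

definition of_coord ::
  "('m, 'n::finite) chart set \<Rightarrow> ('m, 'n) chart \<Rightarrow> 'm \<Rightarrow> real ^ 'n \<Rightarrow> real ^ 'n" where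
  "of_coord A c x = frechet_derivative (snd (chart_at A x) \<circ> chart_inv c) (at (snd c x))"

definition tangent_map ::
  "('m, 'n::finite) chart set \<Rightarrow> ('m \<Rightarrow> 'm) \<Rightarrow> 'm \<Rightarrow> real ^ 'n \<Rightarrow> real ^ 'n" where
  "tangent_map A g x =
     frechet_derivative (snd (chart_at A (g x)) \<circ> g \<circ> chart_inv (chart_at A x))
       (at (snd (chart_at A x) x))"

definition riemannian_metric ::
  "('m, 'n::finite) chart set \<Rightarrow> ('m \<Rightarrow> real ^ 'n \<Rightarrow> real ^ 'n \<Rightarrow> real) \<Rightarrow> bool" where
  "riemannian_metric A G \<longleftrightarrow>
     (\<forall>x. bilinear (G x) \<and> (\<forall>u v. G x u v = G x v u) \<and> (\<forall>v. v \<noteq> 0 \<longrightarrow> G x v v > 0)) \<and>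
     (\<forall>c\<in>A. \<forall>u v. smooth_on (snd c ` fst c)
        (\<lambda>y. G (chart_inv c y) (of_coord A c (chart_inv c y) u) (of_coord A c (chart_inv c y) v)))"

definition tnorm ::
  "('m \<Rightarrow> real ^ 'n::finite \<Rightarrow> real ^ 'n \<Rightarrow> real) \<Rightarrow> 'm \<Rightarrow> real ^ 'n \<Rightarrow> real" where
  "tnorm G x v = sqrt (G x v v)"

definition tcball ::
  "('m \<Rightarrow> real ^ 'n::finite \<Rightarrow> real ^ 'n \<Rightarrow> real) \<Rightarrow> 'm \<Rightarrow> real \<Rightarrow> (real ^ 'n) set" where
  "tcball G x r = {v. tnorm G x v \<le> r}"

(* The bundle in question is the pull-back of the tangent bundle to the base S along p;
   its fibre over s is the tangent space at p s. *)

definition continuous_section ::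
  "('m, 'n::finite) chart set \<Rightarrow> 's::topological_space set \<Rightarrow> ('s \<Rightarrow> 'm) \<Rightarrow> ('s \<Rightarrow> real ^ 'n) \<Rightarrow> bool"
where
  "continuous_section A S p X \<longleftrightarrow>
     (\<forall>c\<in>A. continuous_on (S \<inter> p -` fst c) (\<lambda>s. to_coord A c (p s) (X s)))"

definition subbundle ::
  "('m, 'n::finite) chart set \<Rightarrow> 's::topological_space set \<Rightarrow> ('s \<Rightarrow> 'm) \<Rightarrow>
   ('s \<Rightarrow> (real ^ 'n) set) \<Rightarrow> bool" where
  "subbundle A S p V \<longleftrightarrow> (\<forall>s\<in>S. \<exists>U k X. open U \<and> s \<in> U \<and>
     (\<forall>i<k. continuous_section A (S \<inter> U) p (X i)) \<and>
     (\<forall>t\<in>S \<inter> U. inj_on (\<lambda>i. X i t) {..<k} \<and> independent ((\<lambda>i. X i t) ` {..<k::nat}) \<and>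
        span ((\<lambda>i. X i t) ` {..<k}) = V t))"

definition direct_sum :: "'i set \<Rightarrow> ('i \<Rightarrow> 'a::real_vector set) \<Rightarrow> 'a set \<Rightarrow> bool" where
  "direct_sum I V W \<longleftrightarrow>
     W = {\<Sum>i\<in>I. u i |u. \<forall>i\<in>I. u i \<in> V i} \<and>
     (\<forall>u. (\<forall>i\<in>I. u i \<in> V i) \<and> (\<Sum>i\<in>I. u i) = 0 \<longrightarrow> (\<forall>i\<in>I. u i = 0))"

definition cantor_set :: "'m::topological_space set \<Rightarrow> bool" where
  "cantor_set K \<longleftrightarrow> K \<noteq> {} \<and> compact K \<and> (\<forall>x\<in>K. x islimpt K) \<and>
     (\<forall>C. C \<subseteq> K \<and> connected C \<longrightarrow> (\<forall>x\<in>C. \<forall>y\<in>C. x = y))"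

definition expanding ::
  "('m::topological_space, 'n::finite) chart set \<Rightarrow> ('m \<Rightarrow> real ^ 'n \<Rightarrow> real ^ 'n \<Rightarrow> real) \<Rightarrow>
   ('m \<Rightarrow> 'm) \<Rightarrow> 'm set \<Rightarrow> bool" where
  "expanding A G g K \<longleftrightarrow> compact K \<and> g ` K \<subseteq> K \<and>
     (\<forall>x\<in>K. \<forall>u. tnorm G x u = 1 \<longrightarrow> tnorm G (g x) (tangent_map A g x u) > 1)"

definition invariant_subbundle ::
  "('m::topological_space, 'n::finite) chart set \<Rightarrow> ('m \<Rightarrow> 'm) \<Rightarrow> 'm set \<Rightarrow>
   ('m \<Rightarrow> (real ^ 'n) set) \<Rightarrow> bool" where
  "invariant_subbundle A g K E \<longleftrightarrow>
     subbundle A K id E \<and> (\<forall>x\<in>K. tangent_map A g x ` E x = E (g x))"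

definition quotient_space :: "'a::ab_group_add set \<Rightarrow> 'a set set" where
  "quotient_space W = range (\<lambda>v. (\<lambda>w. v + w) ` W)"

definition quotient_norm ::
  "('m \<Rightarrow> real ^ 'n::finite \<Rightarrow> real ^ 'n \<Rightarrow> real) \<Rightarrow> 'm \<Rightarrow> (real ^ 'n) set \<Rightarrow> real" where
  "quotient_norm G x C = (INF v\<in>C. tnorm G x v)"

(* For an invariant sub-bundle, the map induced on the quotient sends the coset v + E x to
   the coset of the image of v, which is the image of the coset v + E x. *)

definition projectively_hyperbolic_at ::
  "('m::topological_space, 'n::finite) chart set \<Rightarrow> ('m \<Rightarrow> real ^ 'n \<Rightarrow> real ^ 'n \<Rightarrow> real) \<Rightarrow>
   ('m \<Rightarrow> 'm) \<Rightarrow> 'm set \<Rightarrow> ('m \<Rightarrow> (real ^ 'n) set) \<Rightarrow> bool" where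
  "projectively_hyperbolic_at A G g K E \<longleftrightarrow> invariant_subbundle A g K E \<and>
     (\<forall>x\<in>K. \<forall>u\<in>E x. \<forall>C\<in>quotient_space (E x). tnorm G x u = 1 \<and> quotient_norm G x C = 1 \<longrightarrow>
        quotient_norm G (g x) (tangent_map A g x ` C) > tnorm G (g x) (tangent_map A g x u))"

definition totally_projectively_hyperbolic ::
  "('m::topological_space, 'n::finite) chart set \<Rightarrow> ('m \<Rightarrow> real ^ 'n \<Rightarrow> real ^ 'n \<Rightarrow> real) \<Rightarrow>
   ('m \<Rightarrow> 'm) \<Rightarrow> 'm set \<Rightarrow> (nat \<Rightarrow> 'm \<Rightarrow> (real ^ 'n) set) \<Rightarrow> bool" where
  "totally_projectively_hyperbolic A G g K E \<longleftrightarrow>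
     (\<forall>i\<le>CARD('n). invariant_subbundle A g K (E i)) \<and>
     (\<forall>x\<in>K. E 0 x = {0} \<and> E CARD('n) x = UNIV \<and> (\<forall>i<CARD('n). E i x \<subset> E (Suc i) x)) \<and>
     (\<forall>i. 1 \<le> i \<and> i < CARD('n) \<longrightarrow> projectively_hyperbolic_at A G g K (E i))"

definition inverse_limit :: "('m \<Rightarrow> 'm) \<Rightarrow> 'm set \<Rightarrow> (int \<Rightarrow> 'm) set" where
  "inverse_limit g K = {a. \<forall>i. a i \<in> K \<and> g (a i) = a (i + 1)}"

definition shift :: "(int \<Rightarrow> 'm) \<Rightarrow> int \<Rightarrow> 'm" where
  "shift a = (\<lambda>i. a (i + 1))"

definition invariant_splitting ::
  "('m::topological_space, 'n::finite) chart set \<Rightarrow> ('m \<Rightarrow> 'm) \<Rightarrow> 'm set \<Rightarrow>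
   (nat \<Rightarrow> 'm \<Rightarrow> (real ^ 'n) set) \<Rightarrow> (nat \<Rightarrow> (int \<Rightarrow> 'm) \<Rightarrow> (real ^ 'n) set) \<Rightarrow> bool" where
  "invariant_splitting A g K E F \<longleftrightarrow>
     (\<forall>i\<in>{1..CARD('n)}. subbundle A (inverse_limit g K) (\<lambda>a. a 0) (F i)) \<and>
     (\<forall>a\<in>inverse_limit g K.
        direct_sum {1..CARD('n)} (\<lambda>l. F l a) UNIV \<and>
        (\<forall>i\<in>{1..CARD('n)}.
           dim (F i a) = 1 \<and>
           tangent_map A g (a 0) ` F i a = F i (shift a) \<and>
           direct_sum {1..i} (\<lambda>l. F l a) (E i (a 0))))"

(* operator norm of the restriction to the subspace V of the tangent space at x *)
definition restricted_norm ::
  "('m, 'n::finite) chart set \<Rightarrow> ('m \<Rightarrow> real ^ 'n \<Rightarrow> real ^ 'n \<Rightarrow> real) \<Rightarrow>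
   ('m \<Rightarrow> 'm) \<Rightarrow> 'm \<Rightarrow> (real ^ 'n) set \<Rightarrow> real" where
  "restricted_norm A G g x V =
     (SUP u\<in>{u\<in>V. tnorm G x u = 1}. tnorm G (g x) (tangent_map A g x u))"

(* f is the restriction to a closed ball of the inverse of a chart of the maximal atlas *)
definition ball_chart ::
  "('m::topological_space, 'n::finite) chart set \<Rightarrow> ('m \<Rightarrow> real ^ 'n \<Rightarrow> real ^ 'n \<Rightarrow> real) \<Rightarrow>
   'm \<Rightarrow> real \<Rightarrow> (real ^ 'n \<Rightarrow> 'm) \<Rightarrow> bool" where
  "ball_chart A G x r f \<longleftrightarrow>
     (\<exists>d. is_chart d \<and> (\<forall>c\<in>A. compatible d c) \<and> tcball G x r \<subseteq> snd d ` fst d \<and>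
        (\<forall>v\<in>tcball G x r. f v = chart_inv d v)) \<and>
     x \<in> interior (f ` tcball G x r)"

definition smooth_ball_map ::
  "('m::topological_space, 'n::finite) chart set \<Rightarrow> real \<Rightarrow> (real ^ 'n \<Rightarrow> 'm) \<Rightarrow> bool" where
  "smooth_ball_map A r f \<longleftrightarrow> continuous_on (cball 0 r) f \<and>
     (\<forall>c\<in>A. smooth_on (cball 0 r \<inter> f -` fst c) (snd c \<circ> f))"

(* The C^infinity topology on the smooth maps from the Euclidean closed ball of radius r to
   the manifold. Maps are considered as functions on the whole space, but values outside the
   ball play no role. *)
definition smooth_topology ::
  "('m::topological_space, 'n::finite) chart set \<Rightarrow> real \<Rightarrow> (real ^ 'n \<Rightarrow> 'm) topology" where
  "smooth_topology A r = topology_generated_by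
     {{h. smooth_ball_map A r h \<and> h ` L \<subseteq> fst c \<and>
          (\<forall>v\<in>L. dist (iter_deriv (cball 0 r) vs (snd c \<circ> h) v)
                        (iter_deriv (cball 0 r) vs (snd c \<circ> f) v) < e)}
      |f c L vs e. smooth_ball_map A r f \<and> c \<in> A \<and> compact L \<and> L \<subseteq> cball 0 r \<and>
          f ` L \<subseteq> fst c \<and> e > 0}"

definition orthonormal_frame ::
  "('m::topological_space, 'n::finite) chart set \<Rightarrow> ('m \<Rightarrow> real ^ 'n \<Rightarrow> real ^ 'n \<Rightarrow> real) \<Rightarrow>
   'm set \<Rightarrow> ('m \<Rightarrow> real ^ 'n \<Rightarrow> real ^ 'n) \<Rightarrow> bool" where
  "orthonormal_frame A G U \<sigma> \<longleftrightarrow>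
     (\<forall>x\<in>U. linear (\<sigma> x) \<and> (\<forall>v. tnorm G x (\<sigma> x v) = norm v)) \<and>
     (\<forall>v. continuous_section A U id (\<lambda>x. \<sigma> x v))"

(* The members of the family are defined on balls of different tangent spaces. A continuous
   local orthonormal frame identifies these with the Euclidean ball of the same radius;
   the resulting notion does not depend on the choice of the frame. *)
definition continuous_family ::
  "('m::topological_space, 'n::finite) chart set \<Rightarrow> ('m \<Rightarrow> real ^ 'n \<Rightarrow> real ^ 'n \<Rightarrow> real) \<Rightarrow>
   (int \<Rightarrow> 'm) set \<Rightarrow> real \<Rightarrow> ((int \<Rightarrow> 'm) \<Rightarrow> real ^ 'n \<Rightarrow> 'm) \<Rightarrow> bool" where
  "continuous_family A G S r \<phi> \<longleftrightarrow> (\<forall>b\<in>S. \<exists>U \<sigma>. open U \<and> b 0 \<in> U \<and>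
     orthonormal_frame A G U \<sigma> \<and>
     continuous_map (top_of_set {a\<in>S. a 0 \<in> U}) (smooth_topology A r) (\<lambda>a. \<phi> a \<circ> \<sigma> (a 0)))"

(* In the coordinates defining the tangent space at x = f 0, the differential of f at 0 is the
   derivative of f followed by the chart chart_at A x. *)
definition linearizing_family ::
  "('m::topological_space, 'n::finite) chart set \<Rightarrow> ('m \<Rightarrow> real ^ 'n \<Rightarrow> real ^ 'n \<Rightarrow> real) \<Rightarrow>
   ('m \<Rightarrow> 'm) \<Rightarrow> 'm set \<Rightarrow> real \<Rightarrow> ((int \<Rightarrow> 'm) \<Rightarrow> real ^ 'n \<Rightarrow> 'm) \<Rightarrow> bool" where
  "linearizing_family A G g K r \<phi> \<longleftrightarrow>
     continuous_family A G (inverse_limit g K) r \<phi> \<and>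
     (\<forall>a\<in>inverse_limit g K.
        ball_chart A G (a 0) r (\<phi> a) \<and>
        \<phi> a 0 = a 0 \<and>
        ((snd (chart_at A (a 0)) \<circ> \<phi> a) has_derivative id) (at 0) \<and>
        (\<forall>v. tangent_map A g (a 0) v \<in> tcball G (g (a 0)) r \<longrightarrow>
           \<phi> (shift a) (tangent_map A g (a 0) v) = g (\<phi> a v)))"

end

theory Submission
  imports Defs "HOL-Library.Multiset"
begin

text \<open>Let \<open>S\<close> be the inverse limit and \<open>s\<close> its shift. Since \<open>K\<close> is a Cantor set, \<open>S\<close> is
  compact and totally disconnected, so charts and unit sections of the line bundles can be chosen
  locally constantly; in the resulting coordinates \<open>g\<close> is a family of expansions \<open>G a\<close> fixing
  \<open>0\<close>, with diagonal derivative \<open>\<mu> a\<close> there. One constructs the inverse \<open>\<psi>\<close> of the linearization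
  instead of the linearization itself: its equation \<open>\<psi> (s a) \<circ> G a = diag (\<mu> a) \<circ> \<psi> a\<close> is linear
  and splits into scalar equations. Each component is a fixed point of the operator
  \<open>(T u) a = m a * u (t a) \<circ> f a\<close>, where \<open>t\<close> is the inverse of \<open>s\<close> and \<open>f a\<close> the contraction
  inverse to \<open>G (t a)\<close>. A Taylor coefficient \<open>c\<close> of a fixed point solves a cohomological equation
  \<open>c a = e a + \<rho> a * c (t a)\<close>, and by nonresonance and compactness \<open>\<bar>\<rho>\<bar>\<close> stays on one side of \<open>1\<close>,
  so there is exactly one continuous solution. If \<open>p\<close> is an approximate solution to order \<open>q\<close>,
  then \<open>T ^^ N\<close> contracts the error \<open>T p - p\<close> geometrically in \<open>C\<^sup>k\<close> as soon as \<open>q\<close> is large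
  compared with \<open>k\<close>, and \<open>p + (\<Sum>N. (T ^^ N) (T p - p))\<close> is a fixed point. A fixed point that is
  flat at \<open>0\<close> to high order vanishes; hence the solutions for different \<open>k\<close> agree. For uniqueness,
  if \<open>\<theta>\<close> is another linearization, the components of \<open>\<psi> \<circ> \<theta>\<close> are fixed points of the operator
  for the linear cocycle, and the same argument shows that \<open>\<psi> \<circ> \<theta>\<close> is the identity near \<open>0\<close>.\<close>

section \<open>Smooth families of functions\<close>

text \<open>The conjugacy equation is linear in \<open>\<psi>\<close> because the nonlinear
  \<open>G a\<close> is composed on the right of it; for the linearization itself the unknown would
  stand inside \<open>G a\<close>. The inverse limit makes the base dynamics invertible, so that
  each equation can be solved along \<open>s\<close> or along \<open>t\<close>, whichever contracts.
  In component \<open>i\<close> the multiplier of the monomial \<open>x^k\<close> is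
  \<open>\<mu>_i / \<mu>^k\<close>, which is how hypothesis (b) becomes
  \<open>\<bar>\<rho>\<bar> \<noteq> 1\<close>. The obstacle is smoothness on one fixed ball: the
  derivatives of \<open>T ^^ N\<close> up to order \<open>k\<close> may grow by a factor
  \<open>B ^ N\<close>, with \<open>B\<close> depending on \<open>k\<close>. A higher order of
  vanishing pays for this, so the order \<open>q\<close>, not the radius, is made to depend on
  \<open>k\<close>. Derivatives are taken in the fibre variable only; dependence on the totally
  disconnected parameter is joint continuity throughout. Finally, an identity near \<open>0\<close>
  fixes a linearization only near \<open>0\<close>. The dynamics carries it to the whole ball of
  radius \<open>r\<close>, since each vector there is the image under \<open>Dg\<close> of a vector
  that is no longer and sits over the preceding point of the orbit.\<close>

definition partial :: "'n::finite \<Rightarrow> ('x \<Rightarrow> real^'n \<Rightarrow> real) \<Rightarrow> 'x \<Rightarrow> real^'n \<Rightarrow> real" where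
  "partial j u a x = frechet_derivative (u a) (at x) (axis j 1)"

text \<open>Only the fibres are required to be open. The set itself need not be: in
  \<open>S \<times> ball 0 R\<close> the parameter set \<open>S\<close> will be a compact set of
  orbits in a function space, and no derivative is taken in that direction.\<close>

definition slice_open :: "('x \<times> (real^'n::finite)) set \<Rightarrow> bool" where
  "slice_open \<Omega> \<longleftrightarrow> (\<forall>a. open {x. (a, x) \<in> \<Omega>})"

text \<open>A family \<open>u a\<close> of functions on the fibres of \<open>\<Omega>\<close>: all derivatives in the second variable up to
  order \<open>k\<close> exist and are jointly continuous. No differentiability in the parameter \<open>a\<close> is meant.\<close>

primrec Ck_family :: "nat \<Rightarrow> ('x::topological_space \<times> (real^'n::finite)) set \<Rightarrow>
    ('x \<Rightarrow> real^'n \<Rightarrow> real) \<Rightarrow> bool" where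
  "Ck_family 0 \<Omega> u \<longleftrightarrow> continuous_on \<Omega> (case_prod u)"
| "Ck_family (Suc k) \<Omega> u \<longleftrightarrow> continuous_on \<Omega> (case_prod u) \<and>
     (\<forall>(a, x)\<in>\<Omega>. u a differentiable (at x)) \<and> (\<forall>j. Ck_family k \<Omega> (partial j u))"

definition smooth_family :: "('x::topological_space \<times> (real^'n::finite)) set \<Rightarrow>
    ('x \<Rightarrow> real^'n \<Rightarrow> real) \<Rightarrow> bool" where
  "smooth_family \<Omega> u \<longleftrightarrow> (\<forall>k. Ck_family k \<Omega> u)"

definition smooth_vfamily :: "('x::topological_space \<times> (real^'n::finite)) set \<Rightarrow>
    ('x \<Rightarrow> real^'n \<Rightarrow> real^'m) \<Rightarrow> bool" where
  "smooth_vfamily \<Omega> U \<longleftrightarrow> (\<forall>i. smooth_family \<Omega> (\<lambda>a x. U a x $ i))"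

primrec partials :: "'n::finite list \<Rightarrow> ('x \<Rightarrow> real^'n \<Rightarrow> real) \<Rightarrow> 'x \<Rightarrow> real^'n \<Rightarrow> real" where
  "partials [] u = u"
| "partials (j # vs) u = partial j (partials vs u)"

lemma slice_open_times [simp]: "open B \<Longrightarrow> slice_open (S \<times> B)"
  unfolding slice_open_def by (simp add: Collect_conj_eq)

lemma slice_openD: "slice_open \<Omega> \<Longrightarrow> open {x. (a, x) \<in> \<Omega>}"
  by (simp add: slice_open_def)

lemma has_derivative_vec:
  fixes f :: "'a::euclidean_space \<Rightarrow> real^'m"
  assumes "\<And>i. ((\<lambda>x. f x $ i) has_derivative (\<lambda>h. f' h $ i)) (at x within S)"
  shows "(f has_derivative f') (at x within S)"
  by (subst has_derivative_componentwise_within) (auto simp: Basis_vec_def inner_axis assms)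

lemma continuous_on_vecI:
  fixes f :: "'a::topological_space \<Rightarrow> real^'m"
  assumes "\<And>i. continuous_on S (\<lambda>x. f x $ i)"
  shows "continuous_on S f"
  using continuous_on_vec_lambda[of S "\<lambda>i x. f x $ i"] assms by simp

lemma sum_axis: "(\<Sum>j\<in>UNIV. axis i (1::real) $ j * d j) = d (i::'n::finite)"
  by (simp add: axis_def if_distrib[of "\<lambda>x. x * _"] cong: if_cong)

lemma partial_has_derivative:
  fixes u :: "'x \<Rightarrow> real^'n::finite \<Rightarrow> real"
  assumes "u a differentiable (at x)"
  shows "(u a has_derivative (\<lambda>h. \<Sum>j\<in>UNIV. h $ j * partial j u a x)) (at x)"
proof -
  let ?f = "frechet_derivative (u a) (at x)"
  have d: "(u a has_derivative ?f) (at x)" using assms frechet_derivative_works by blast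
  then interpret bounded_linear ?f by (rule has_derivative_bounded_linear)
  have "?f = (\<lambda>h. \<Sum>j\<in>UNIV. h $ j * partial j u a x)"
  proof
    fix h :: "real^'n"
    have "h = (\<Sum>j\<in>UNIV. h $ j *\<^sub>R axis j 1)"
      using basis_expansion[of h] by (simp add: scalar_mult_eq_scaleR)
    then have "?f h = ?f (\<Sum>j\<in>UNIV. h $ j *\<^sub>R axis j 1)" by simp
    then show "?f h = (\<Sum>j\<in>UNIV. h $ j * partial j u a x)"
      by (simp only: sum scaleR partial_def real_scaleR_def)
  qed
  then show ?thesis using d by metis
qed

lemma partial_eqI:
  assumes "(u a has_derivative (\<lambda>h. \<Sum>j\<in>UNIV. h $ j * d j)) (at x)"
  shows "partial j u a x = d j"
  unfolding partial_def frechet_derivative_at[OF assms, symmetric] by (simp add: sum_axis)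

lemma has_derivative_cong_open:
  assumes "open S" "x \<in> S" "\<And>y. y \<in> S \<Longrightarrow> f y = g y"
  shows "(f has_derivative f') (at x) \<longleftrightarrow> (g has_derivative f') (at x)"
  using assms has_derivative_transform_within_open by metis

lemma frechet_derivative_cong_open:
  assumes "open S" "x \<in> S" "\<And>y. y \<in> S \<Longrightarrow> f y = g y"
  shows "frechet_derivative f (at x) = frechet_derivative g (at x)"
  unfolding frechet_derivative_def using has_derivative_cong_open[OF assms] by simp

lemma partial_cong:
  assumes "slice_open \<Omega>" "\<And>a x. (a, x) \<in> \<Omega> \<Longrightarrow> u a x = v a x" "(a, x) \<in> \<Omega>"
  shows "partial j u a x = partial j v a x"
  unfolding partial_def
  by (subst frechet_derivative_cong_open[OF slice_openD[OF assms(1), of a], of x "u a" "v a"])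
    (use assms in auto)

lemma continuous_on_case_prod_cong:
  assumes "\<And>a x. (a, x) \<in> \<Omega> \<Longrightarrow> u a x = v a x" "continuous_on \<Omega> (case_prod u)"
  shows "continuous_on \<Omega> (case_prod v)"
  by (rule continuous_on_eq[OF assms(2)]) (use assms(1) in auto)

lemma Ck_family_cong:
  assumes "slice_open \<Omega>" "\<And>a x. (a, x) \<in> \<Omega> \<Longrightarrow> u a x = v a x" "Ck_family k \<Omega> u"
  shows "Ck_family k \<Omega> v"
  using assms(2,3)
proof (induction k arbitrary: u v)
  case 0
  then show ?case using continuous_on_case_prod_cong[of \<Omega> u v] by simp
next
  case (Suc k)
  have "Ck_family k \<Omega> (partial j v)" for j
    using Suc.IH[of "partial j u" "partial j v"] partial_cong[OF assms(1) Suc.prems(1)] Suc.prems(2) by auto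
  moreover have "v a differentiable (at x)" if "(a, x) \<in> \<Omega>" for a x
  proof -
    have "u a differentiable (at x)" using Suc.prems(2) that by auto
    then obtain D where "(u a has_derivative D) (at x)" unfolding differentiable_def by blast
    then have "(v a has_derivative D) (at x)"
      using has_derivative_cong_open[OF slice_openD[OF assms(1), of a], of x "u a" "v a"] that Suc.prems(1)
      by auto
    then show ?thesis by (rule differentiableI)
  qed
  moreover have "continuous_on \<Omega> (case_prod v)"
    using Suc.prems continuous_on_case_prod_cong[of \<Omega> u v] by simp
  ultimately show ?case by auto
qed

lemma Ck_family_continuous: "Ck_family k \<Omega> u \<Longrightarrow> continuous_on \<Omega> (case_prod u)"
  by (cases k) auto

text \<open>This is the induction step of the closure properties below: explicit formulas
  \<open>d\<close> for the partial derivatives replace \<open>partial j u\<close>, which has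
  arbitrary values outside \<open>\<Omega>\<close>. Total differentiability is demanded, so that the
  chain rule applies directly.\<close>

lemma Ck_family_SucI:
  assumes "slice_open \<Omega>" "continuous_on \<Omega> (case_prod u)"
    "\<And>a x. (a, x) \<in> \<Omega> \<Longrightarrow> (u a has_derivative (\<lambda>h. \<Sum>j\<in>UNIV. h $ j * d j a x)) (at x)"
    "\<And>j. Ck_family k \<Omega> (d j)"
  shows "Ck_family (Suc k) \<Omega> u"
proof -
  have "Ck_family k \<Omega> (partial j u)" for j
    by (rule Ck_family_cong[OF assms(1) _ assms(4)[of j]]) (rule partial_eqI[OF assms(3), symmetric])
  moreover have "u a differentiable (at x)" if "(a, x) \<in> \<Omega>" for a x
    using assms(3)[OF that] by (rule differentiableI)
  ultimately show ?thesis using assms(2) by auto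
qed

lemma Ck_family_SucD:
  assumes "Ck_family (Suc k) \<Omega> u"
  shows "(a, x) \<in> \<Omega> \<Longrightarrow> (u a has_derivative (\<lambda>h. \<Sum>j\<in>UNIV. h $ j * partial j u a x)) (at x)"
    "Ck_family k \<Omega> (partial j u)"
  using assms partial_has_derivative[of u a x] by auto

lemma Ck_family_Suc_le: "Ck_family (Suc k) \<Omega> u \<Longrightarrow> Ck_family k \<Omega> u"
  by (induction k arbitrary: u) auto

lemma Ck_family_subset: "Ck_family k \<Omega> u \<Longrightarrow> \<Omega>' \<subseteq> \<Omega> \<Longrightarrow> Ck_family k \<Omega>' u"
  by (induction k arbitrary: u) (auto intro: continuous_on_subset)

lemma Ck_family_add:
  assumes so: "slice_open \<Omega>" and "Ck_family k \<Omega> u" "Ck_family k \<Omega> v"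
  shows "Ck_family k \<Omega> (\<lambda>a x. u a x + v a x)"
  using assms(2,3)
proof (induction k arbitrary: u v)
  case 0
  then show ?case by (auto intro!: continuous_intros simp: case_prod_beta)
next
  case (Suc k)
  show ?case
  proof (rule Ck_family_SucI[OF so, where d = "\<lambda>j a x. partial j u a x + partial j v a x"])
    show "continuous_on \<Omega> (\<lambda>(a, x). u a x + v a x)"
      using Suc.prems by (auto intro!: continuous_intros simp: case_prod_beta)
    show "((\<lambda>x. u a x + v a x) has_derivative (\<lambda>h. \<Sum>j\<in>UNIV. h $ j * (partial j u a x + partial j v a x))) (at x)"
      if "(a, x) \<in> \<Omega>" for a x
      using has_derivative_add[OF Ck_family_SucD(1)[OF Suc.prems(1) that] Ck_family_SucD(1)[OF Suc.prems(2) that]]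
      by (simp add: sum.distrib distrib_left)
  qed (use Suc Ck_family_SucD(2) in blast)
qed

lemma Ck_family_mult:
  assumes so: "slice_open \<Omega>" and "Ck_family k \<Omega> u" "Ck_family k \<Omega> v"
  shows "Ck_family k \<Omega> (\<lambda>a x. u a x * v a x)"
  using assms(2,3)
proof (induction k arbitrary: u v)
  case 0
  then show ?case by (auto intro!: continuous_intros simp: case_prod_beta)
next
  case (Suc k)
  show ?case
  proof (rule Ck_family_SucI[OF so, where d = "\<lambda>j a x. u a x * partial j v a x + partial j u a x * v a x"])
    show "continuous_on \<Omega> (\<lambda>(a, x). u a x * v a x)"
      using Suc.prems by (auto intro!: continuous_intros simp: case_prod_beta)
    show "((\<lambda>x. u a x * v a x) has_derivative
        (\<lambda>h. \<Sum>j\<in>UNIV. h $ j * (u a x * partial j v a x + partial j u a x * v a x))) (at x)"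
      if "(a, x) \<in> \<Omega>" for a x
      using has_derivative_mult[OF Ck_family_SucD(1)[OF Suc.prems(1) that] Ck_family_SucD(1)[OF Suc.prems(2) that]]
      by (simp add: sum.distrib distrib_left sum_distrib_left sum_distrib_right mult_ac)
    show "Ck_family k \<Omega> (\<lambda>a x. u a x * partial j v a x + partial j u a x * v a x)" for j
      by (intro Ck_family_add so Suc.IH Ck_family_SucD(2)[OF Suc.prems(1)] Ck_family_SucD(2)[OF Suc.prems(2)]
          Ck_family_Suc_le[OF Suc.prems(1)] Ck_family_Suc_le[OF Suc.prems(2)])
  qed
qed

lemma Ck_family_param:
  assumes so: "slice_open \<Omega>" and "continuous_on (fst ` \<Omega>) c"
  shows "Ck_family k \<Omega> (\<lambda>a x. c a)"
proof -
  have c: "continuous_on \<Omega> (\<lambda>(a, x). c a)"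
    using continuous_on_compose2[OF assms(2) continuous_on_fst[OF continuous_on_id]]
    by (auto simp: case_prod_beta)
  have z: "Ck_family k \<Omega> (\<lambda>a x. 0)" for k
  proof (induction k)
    case (Suc k)
    then show ?case by (intro Ck_family_SucI[OF so, where d = "\<lambda>j a x. 0"]) auto
  qed auto
  show ?thesis
  proof (cases k)
    case (Suc k)
    show ?thesis unfolding Suc
      by (rule Ck_family_SucI[OF so, where d = "\<lambda>j a x. 0"]) (use z c in auto)
  qed (use c in auto)
qed

lemma Ck_family_const: "slice_open \<Omega> \<Longrightarrow> Ck_family k \<Omega> (\<lambda>a x. c)"
  by (rule Ck_family_param) auto

lemma Ck_family_coord:
  assumes so: "slice_open \<Omega>"
  shows "Ck_family k \<Omega> (\<lambda>a x. x $ i)"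
proof -
  have c: "continuous_on \<Omega> (\<lambda>(a, x). x $ i)"
    by (auto intro!: continuous_intros simp: case_prod_beta)
  show ?thesis
  proof (cases k)
    case (Suc k)
    have "((\<lambda>x. x $ i) has_derivative (\<lambda>h. \<Sum>j\<in>UNIV. h $ j * (if j = i then 1 else 0))) (at x)" for x :: "real^'b"
      by (simp add: if_distrib[of "\<lambda>x. _ * x"] bounded_linear_imp_has_derivative bounded_linear_vec_nth cong: if_cong)
    then show ?thesis unfolding Suc using c
      by (intro Ck_family_SucI[OF so, where d = "\<lambda>j a x. if j = i then 1 else 0"]) (auto intro: Ck_family_const[OF so])
  qed (use c in auto)
qed

lemma Ck_family_sum:
  assumes "slice_open \<Omega>" "\<And>i. i \<in> I \<Longrightarrow> Ck_family k \<Omega> (u i)"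
  shows "Ck_family k \<Omega> (\<lambda>a x. \<Sum>i\<in>I. u i a x)"
  using assms(2) by (induction I rule: infinite_finite_induct) (auto intro: Ck_family_const Ck_family_add assms(1))

lemma Ck_family_prod:
  assumes "slice_open \<Omega>" "\<And>i. i \<in> I \<Longrightarrow> Ck_family k \<Omega> (u i)"
  shows "Ck_family k \<Omega> (\<lambda>a x. \<Prod>i\<in>I. u i a x)"
  using assms(2) by (induction I rule: infinite_finite_induct) (auto intro: Ck_family_const Ck_family_mult assms(1))

lemma Ck_family_uminus:
  assumes "slice_open \<Omega>" "Ck_family k \<Omega> u"
  shows "Ck_family k \<Omega> (\<lambda>a x. - u a x)"
  using Ck_family_mult[OF assms(1) Ck_family_const[OF assms(1), of k "-1"] assms(2)] by simp

lemma Ck_family_diff: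
  assumes "slice_open \<Omega>" "Ck_family k \<Omega> u" "Ck_family k \<Omega> v"
  shows "Ck_family k \<Omega> (\<lambda>a x. u a x - v a x)"
  using Ck_family_add[OF assms(1,2) Ck_family_uminus[OF assms(1,3)]] by simp

lemma Ck_family_inverse:
  assumes so: "slice_open \<Omega>" and "Ck_family k \<Omega> u" and nz: "\<And>a x. (a, x) \<in> \<Omega> \<Longrightarrow> u a x \<noteq> 0"
  shows "Ck_family k \<Omega> (\<lambda>a x. inverse (u a x))"
  using assms(2)
proof (induction k)
  case 0
  then show ?case using nz by (auto intro!: continuous_intros simp: case_prod_beta)
next
  case (Suc k)
  show ?case
  proof (rule Ck_family_SucI[OF so, where d = "\<lambda>j a x. - (inverse (u a x) * partial j u a x * inverse (u a x))"])
    show "continuous_on \<Omega> (\<lambda>(a, x). inverse (u a x))"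
      using Suc.prems nz by (auto intro!: continuous_intros simp: case_prod_beta)
    show "((\<lambda>x. inverse (u a x)) has_derivative
        (\<lambda>h. \<Sum>j\<in>UNIV. h $ j * - (inverse (u a x) * partial j u a x * inverse (u a x)))) (at x)"
      if "(a, x) \<in> \<Omega>" for a x
      using Deriv.has_derivative_inverse[OF nz[OF that] Ck_family_SucD(1)[OF Suc.prems that]]
      by (simp add: sum_distrib_left sum_distrib_right mult_ac sum_negf)
    show "Ck_family k \<Omega> (\<lambda>a x. - (inverse (u a x) * partial j u a x * inverse (u a x)))" for j
      by (intro Ck_family_uminus Ck_family_mult so Suc.IH Ck_family_SucD(2)[OF Suc.prems] Ck_family_Suc_le[OF Suc.prems])
  qed
qed

text \<open>Serves Cramer's rule: the entries of an inverse Jacobian are quotients of determinants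
  and inherit the smoothness of the Jacobian.\<close>

lemma Ck_family_det:
  fixes M :: "'x::topological_space \<Rightarrow> real^'n::finite \<Rightarrow> real^'k^'k"
  assumes so: "slice_open \<Omega>" and "\<And>i j. Ck_family k \<Omega> (\<lambda>a x. M a x $ i $ j)"
  shows "Ck_family k \<Omega> (\<lambda>a x. det (M a x))"
  unfolding det_def by (intro Ck_family_sum so Ck_family_mult Ck_family_const Ck_family_prod assms(2))

text \<open>The outer family is evaluated at a moved parameter \<open>s a\<close>, as in a skew
  product; this is the form in which compositions enter the conjugacy equation. The induction
  generalizes \<open>u\<close> and keeps \<open>V\<close> fixed, since the chain rule replaces
  \<open>u\<close> by its partial derivatives but composes them with the same
  \<open>V\<close>.\<close>

lemma Ck_family_comp:
  fixes V :: "'x::topological_space \<Rightarrow> real^'n::finite \<Rightarrow> real^'k::finite"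
    and u :: "'y::topological_space \<Rightarrow> real^'k \<Rightarrow> real"
  assumes so: "slice_open \<Omega>" and "Ck_family k \<Psi> u" and "\<And>i. Ck_family k \<Omega> (\<lambda>a x. V a x $ i)"
    and s: "continuous_on (fst ` \<Omega>) s" and im: "\<And>a x. (a, x) \<in> \<Omega> \<Longrightarrow> (s a, V a x) \<in> \<Psi>"
  shows "Ck_family k \<Omega> (\<lambda>a x. u (s a) (V a x))"
proof -
  have cont: "continuous_on \<Omega> (\<lambda>(a, x). u (s a) (V a x))"
    if u: "continuous_on \<Psi> (case_prod u)" and V: "\<And>i. continuous_on \<Omega> (\<lambda>(a, x). V a x $ i)"
    for u :: "'y \<Rightarrow> real^'k \<Rightarrow> real"
  proof -
    have "continuous_on \<Omega> (\<lambda>(a, x). V a x)"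
      using V by (intro continuous_on_vecI) (simp add: case_prod_beta)
    then have "continuous_on \<Omega> (\<lambda>(a, x). (s a, V a x))"
      using continuous_on_compose2[OF s continuous_on_fst[OF continuous_on_id]]
      by (auto intro!: continuous_on_Pair simp: case_prod_beta)
    then show ?thesis
      using continuous_on_compose2[OF u, of \<Omega> "\<lambda>(a, x). (s a, V a x)"] im by (auto simp: split_beta image_subset_iff)
  qed
  show ?thesis using assms(2,3)
  proof (induction k arbitrary: u)
    case 0
    then show ?case using cont by simp
  next
    case (Suc k)
    have V: "Ck_family k \<Omega> (\<lambda>a x. V a x $ i)" for i
      by (rule Ck_family_Suc_le[OF Suc.prems(2)])
    let ?d = "\<lambda>j a x. \<Sum>i\<in>UNIV. partial i u (s a) (V a x) * partial j (\<lambda>a x. V a x $ i) a x"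
    show ?case
    proof (rule Ck_family_SucI[OF so, where d = ?d])
      show "continuous_on \<Omega> (\<lambda>(a, x). u (s a) (V a x))"
        by (rule cont[OF Ck_family_continuous[OF Suc.prems(1)] Ck_family_continuous[OF Suc.prems(2)]])
      show "((\<lambda>x. u (s a) (V a x)) has_derivative (\<lambda>h. \<Sum>j\<in>UNIV. h $ j * ?d j a x)) (at x)"
        if ax: "(a, x) \<in> \<Omega>" for a x
      proof -
        have "(V a has_derivative (\<lambda>h. \<chi> i. \<Sum>j\<in>UNIV. h $ j * partial j (\<lambda>a x. V a x $ i) a x)) (at x)"
          by (rule has_derivative_vec) (use Ck_family_SucD(1)[OF Suc.prems(2) ax] in simp)
        from has_derivative_compose[OF this Ck_family_SucD(1)[OF Suc.prems(1) im[OF ax]]]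
        show ?thesis
          by (simp add: sum_distrib_left sum_distrib_right mult_ac) (subst sum.swap, simp)
      qed
      show "Ck_family k \<Omega> (?d j)" for j
        by (rule Ck_family_sum[OF so], rule Ck_family_mult[OF so], rule Suc.IH[OF Ck_family_SucD(2)[OF Suc.prems(1)] V])
          (rule Ck_family_SucD(2)[OF Suc.prems(2)])
    qed
  qed
qed

lemma smooth_family_Ck_family: "smooth_family \<Omega> u \<Longrightarrow> Ck_family k \<Omega> u" by (simp add: smooth_family_def)

lemma smooth_family_partial: "smooth_family \<Omega> u \<Longrightarrow> smooth_family \<Omega> (partial j u)"
  unfolding smooth_family_def using Ck_family_SucD(2) by blast

lemma smooth_family_partials: "smooth_family \<Omega> u \<Longrightarrow> smooth_family \<Omega> (partials vs u)"
  by (induction vs) (auto intro: smooth_family_partial)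

lemma smooth_family_continuous: "smooth_family \<Omega> u \<Longrightarrow> continuous_on \<Omega> (case_prod u)"
  using smooth_family_Ck_family Ck_family_continuous by blast

lemma smooth_family_has_derivative:
  "smooth_family \<Omega> u \<Longrightarrow> (a, x) \<in> \<Omega> \<Longrightarrow> (u a has_derivative (\<lambda>h. \<Sum>j\<in>UNIV. h $ j * partial j u a x)) (at x)"
  using Ck_family_SucD(1) smooth_family_Ck_family by blast

lemma smooth_family_cong:
  "slice_open \<Omega> \<Longrightarrow> (\<And>a x. (a, x) \<in> \<Omega> \<Longrightarrow> u a x = v a x) \<Longrightarrow> smooth_family \<Omega> u \<Longrightarrow> smooth_family \<Omega> v"
  unfolding smooth_family_def using Ck_family_cong by blast

lemma smooth_family_subset: "smooth_family \<Omega> u \<Longrightarrow> \<Omega>' \<subseteq> \<Omega> \<Longrightarrow> smooth_family \<Omega>' u"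
  unfolding smooth_family_def using Ck_family_subset by blast

lemma smooth_family_add: "slice_open \<Omega> \<Longrightarrow> smooth_family \<Omega> u \<Longrightarrow> smooth_family \<Omega> v \<Longrightarrow> smooth_family \<Omega> (\<lambda>a x. u a x + v a x)"
  unfolding smooth_family_def using Ck_family_add by blast

lemma smooth_family_diff: "slice_open \<Omega> \<Longrightarrow> smooth_family \<Omega> u \<Longrightarrow> smooth_family \<Omega> v \<Longrightarrow> smooth_family \<Omega> (\<lambda>a x. u a x - v a x)"
  unfolding smooth_family_def using Ck_family_diff by blast

lemma smooth_family_mult: "slice_open \<Omega> \<Longrightarrow> smooth_family \<Omega> u \<Longrightarrow> smooth_family \<Omega> v \<Longrightarrow> smooth_family \<Omega> (\<lambda>a x. u a x * v a x)"
  unfolding smooth_family_def using Ck_family_mult by blast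

lemma smooth_family_sum:
  "slice_open \<Omega> \<Longrightarrow> (\<And>i. i \<in> I \<Longrightarrow> smooth_family \<Omega> (u i)) \<Longrightarrow> smooth_family \<Omega> (\<lambda>a x. \<Sum>i\<in>I. u i a x)"
  unfolding smooth_family_def by (intro allI Ck_family_sum) auto

lemma smooth_family_prod:
  "slice_open \<Omega> \<Longrightarrow> (\<And>i. i \<in> I \<Longrightarrow> smooth_family \<Omega> (u i)) \<Longrightarrow> smooth_family \<Omega> (\<lambda>a x. \<Prod>i\<in>I. u i a x)"
  unfolding smooth_family_def by (intro allI Ck_family_prod) auto

lemma smooth_family_param: "slice_open \<Omega> \<Longrightarrow> continuous_on (fst ` \<Omega>) c \<Longrightarrow> smooth_family \<Omega> (\<lambda>a x. c a)"
  unfolding smooth_family_def using Ck_family_param by blast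

lemma smooth_family_const: "slice_open \<Omega> \<Longrightarrow> smooth_family \<Omega> (\<lambda>a x. c)"
  unfolding smooth_family_def using Ck_family_const by blast

lemma smooth_family_coord: "slice_open \<Omega> \<Longrightarrow> smooth_family \<Omega> (\<lambda>a x. x $ i)"
  unfolding smooth_family_def using Ck_family_coord by blast

lemma smooth_family_comp:
  fixes V :: "'x::topological_space \<Rightarrow> real^'n::finite \<Rightarrow> real^'k::finite"
    and u :: "'y::topological_space \<Rightarrow> real^'k \<Rightarrow> real"
  assumes so: "slice_open \<Omega>" and u: "smooth_family \<Psi> u" and V: "smooth_vfamily \<Omega> V"
    and s: "continuous_on (fst ` \<Omega>) s" and im: "\<And>a x. (a, x) \<in> \<Omega> \<Longrightarrow> (s a, V a x) \<in> \<Psi>"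
  shows "smooth_family \<Omega> (\<lambda>a x. u (s a) (V a x))"
  unfolding smooth_family_def
proof
  fix k show "Ck_family k \<Omega> (\<lambda>a x. u (s a) (V a x))"
    by (rule Ck_family_comp[OF so smooth_family_Ck_family[OF u] _ s im]) (use V in \<open>auto simp: smooth_vfamily_def smooth_family_def\<close>)
qed

lemma smooth_vfamily_comp:
  fixes V :: "'x::topological_space \<Rightarrow> real^'n::finite \<Rightarrow> real^'k::finite"
    and U :: "'y::topological_space \<Rightarrow> real^'k \<Rightarrow> real^'m"
  assumes so: "slice_open \<Omega>" and U: "smooth_vfamily \<Psi> U" and V: "smooth_vfamily \<Omega> V"
    and s: "continuous_on (fst ` \<Omega>) s" and im: "\<And>a x. (a, x) \<in> \<Omega> \<Longrightarrow> (s a, V a x) \<in> \<Psi>"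
  shows "smooth_vfamily \<Omega> (\<lambda>a x. U (s a) (V a x))"
  unfolding smooth_vfamily_def
proof
  fix i show "smooth_family \<Omega> (\<lambda>a x. U (s a) (V a x) $ i)"
    by (rule smooth_family_comp[where \<Psi> = \<Psi> and u = "\<lambda>a x. U a x $ i", OF so _ V s im])
      (use U in \<open>auto simp: smooth_vfamily_def\<close>)
qed

lemma smooth_vfamily_subset: "smooth_vfamily \<Omega> u \<Longrightarrow> \<Omega>' \<subseteq> \<Omega> \<Longrightarrow> smooth_vfamily \<Omega>' u"
  unfolding smooth_vfamily_def using smooth_family_subset by blast

lemma smooth_vfamily_cong:
  "slice_open \<Omega> \<Longrightarrow> (\<And>a x. (a, x) \<in> \<Omega> \<Longrightarrow> u a x = v a x) \<Longrightarrow> smooth_vfamily \<Omega> u \<Longrightarrow> smooth_vfamily \<Omega> v"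
  unfolding smooth_vfamily_def using smooth_family_cong[of \<Omega> "\<lambda>a x. u a x $ i" "\<lambda>a x. v a x $ i" for i] by metis

lemma smooth_vfamily_continuous: 
  fixes U :: "'x::topological_space \<Rightarrow> real^'n::finite \<Rightarrow> real^'k::finite"
  assumes "smooth_vfamily \<Omega> U" shows "continuous_on \<Omega> (case_prod U)"
  using assms smooth_family_continuous[of \<Omega> "\<lambda>a x. U a x $ i" for i] unfolding smooth_vfamily_def
  by (intro continuous_on_vecI) (simp add: case_prod_beta)

lemma smooth_vfamily_has_derivative:
  fixes U :: "'x::topological_space \<Rightarrow> real^'n::finite \<Rightarrow> real^'k::finite"
  assumes "smooth_vfamily \<Omega> U" "(a, x) \<in> \<Omega>"
  shows "(U a has_derivative (\<lambda>h. \<chi> i. \<Sum>j\<in>UNIV. h $ j * partial j (\<lambda>a x. U a x $ i) a x)) (at x)"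
  by (rule has_derivative_vec) 
    (use assms smooth_family_has_derivative[of \<Omega> "\<lambda>a x. U a x $ i" a x for i] in \<open>auto simp: smooth_vfamily_def\<close>)

lemma smooth_vfamily_affine:
  fixes B :: "'x::topological_space \<Rightarrow> real^'n^'k" and p :: "'x \<Rightarrow> real^'k"
  assumes so: "slice_open \<Omega>" and "continuous_on (fst ` \<Omega>) B" "continuous_on (fst ` \<Omega>) p" "smooth_vfamily \<Omega> V"
  shows "smooth_vfamily \<Omega> (\<lambda>a x. p a + B a *v V a x)"
  using assms(4)
  unfolding smooth_vfamily_def matrix_vector_mult_def vector_add_component vec_lambda_beta
  by (intro allI smooth_family_add smooth_family_sum smooth_family_mult smooth_family_param so continuous_on_component assms(2,3)) auto

section \<open>Calculus of iterated partial derivatives\<close>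

lemma partials_cong:
  assumes "slice_open \<Omega>" "\<And>a x. (a, x) \<in> \<Omega> \<Longrightarrow> u a x = v a x" "(a, x) \<in> \<Omega>"
  shows "partials vs u a x = partials vs v a x"
  using assms(3)
proof (induction vs arbitrary: a x)
  case (Cons j vs)
  then show ?case using partial_cong[OF assms(1), of "partials vs u" "partials vs v"] by simp
qed (simp add: assms(2))

lemma partials_append: "partials (vs @ ws) u = partials vs (partials ws u)"
  by (induction vs) auto

lemma partial_add:
  assumes "smooth_family \<Omega> u" "smooth_family \<Omega> v" "(a, x) \<in> \<Omega>"
  shows "partial j (\<lambda>a x. u a x + v a x) a x = partial j u a x + partial j v a x"
  by (rule partial_eqI) (use has_derivative_add[OF smooth_family_has_derivative[OF assms(1,3)] smooth_family_has_derivative[OF assms(2,3)]]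
      in \<open>simp add: sum.distrib distrib_left\<close>)

lemma partial_mult:
  assumes "smooth_family \<Omega> u" "smooth_family \<Omega> v" "(a, x) \<in> \<Omega>"
  shows "partial j (\<lambda>a x. u a x * v a x) a x = u a x * partial j v a x + partial j u a x * v a x"
  by (rule partial_eqI) (use has_derivative_mult[OF smooth_family_has_derivative[OF assms(1,3)] smooth_family_has_derivative[OF assms(2,3)]]
      in \<open>simp add: sum.distrib distrib_left sum_distrib_left sum_distrib_right mult_ac\<close>)

lemma partial_sum:
  assumes "\<And>i. i \<in> I \<Longrightarrow> smooth_family \<Omega> (u i)" "(a, x) \<in> \<Omega>"
  shows "partial j (\<lambda>a x. \<Sum>i\<in>I. u i a x) a x = (\<Sum>i\<in>I. partial j (u i) a x)"
proof (rule partial_eqI)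
  have "((\<lambda>x. \<Sum>i\<in>I. u i a x) has_derivative (\<lambda>h. \<Sum>i\<in>I. \<Sum>j\<in>UNIV. h $ j * partial j (u i) a x)) (at x)"
    by (intro has_derivative_sum smooth_family_has_derivative[OF assms])
  then show "((\<lambda>x. \<Sum>i\<in>I. u i a x) has_derivative (\<lambda>h. \<Sum>j\<in>UNIV. h $ j * (\<Sum>i\<in>I. partial j (u i) a x))) (at x)"
    by (subst (asm) sum.swap) (simp add: sum_distrib_left)
qed

lemma partial_param [simp]: "partial j (\<lambda>a x. c a) a x = 0"
  by (rule partial_eqI) simp

lemma partial_coord [simp]: "partial j (\<lambda>a x. x $ i) a x = (if j = i then 1 else 0)"
  by (rule partial_eqI)
    (simp add: if_distrib[of "\<lambda>x. _ * x"] bounded_linear_imp_has_derivative bounded_linear_vec_nth cong: if_cong)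

lemma partial_comp:
  fixes V :: "'x::topological_space \<Rightarrow> real^'n::finite \<Rightarrow> real^'k::finite"
  assumes "smooth_family \<Psi> u" "smooth_vfamily \<Omega> V" "(a, x) \<in> \<Omega>" "(s a, V a x) \<in> \<Psi>"
  shows "partial j (\<lambda>a x. u (s a) (V a x)) a x
    = (\<Sum>i\<in>UNIV. partial i u (s a) (V a x) * partial j (\<lambda>a x. V a x $ i) a x)"
proof (rule partial_eqI)
  show "((\<lambda>x. u (s a) (V a x)) has_derivative
      (\<lambda>h. \<Sum>j\<in>UNIV. h $ j * (\<Sum>i\<in>UNIV. partial i u (s a) (V a x) * partial j (\<lambda>a x. V a x $ i) a x))) (at x)"
    using has_derivative_compose[OF smooth_vfamily_has_derivative[OF assms(2,3)] smooth_family_has_derivative[OF assms(1,4)]]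
    by (simp add: sum_distrib_left sum_distrib_right mult_ac) (subst sum.swap, simp)
qed

lemma partials_add:
  assumes so: "slice_open \<Omega>" and u: "smooth_family \<Omega> u" and v: "smooth_family \<Omega> v" and "(a, x) \<in> \<Omega>"
  shows "partials vs (\<lambda>a x. u a x + v a x) a x = partials vs u a x + partials vs v a x"
  using assms(4)
proof (induction vs arbitrary: a x)
  case (Cons j vs)
  have "partial j (partials vs (\<lambda>a x. u a x + v a x)) a x = partial j (\<lambda>a x. partials vs u a x + partials vs v a x) a x"
    by (rule partial_cong[OF so]) (use Cons in auto)
  then show ?case
    using partial_add[OF smooth_family_partials[OF u] smooth_family_partials[OF v] Cons.prems] by simp
qed simp

lemma partials_sum:
  assumes so: "slice_open \<Omega>" and u: "\<And>i. i \<in> I \<Longrightarrow> smooth_family \<Omega> (u i)" and "(a, x) \<in> \<Omega>"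
  shows "partials vs (\<lambda>a x. \<Sum>i\<in>I. u i a x) a x = (\<Sum>i\<in>I. partials vs (u i) a x)"
  using assms(3)
proof (induction vs arbitrary: a x)
  case (Cons j vs)
  have "partial j (partials vs (\<lambda>a x. \<Sum>i\<in>I. u i a x)) a x = partial j (\<lambda>a x. \<Sum>i\<in>I. partials vs (u i) a x) a x"
    by (rule partial_cong[OF so]) (use Cons in auto)
  also have "\<dots> = (\<Sum>i\<in>I. partial j (partials vs (u i)) a x)"
    by (rule partial_sum[where \<Omega> = \<Omega>]) (use smooth_family_partials[OF u] Cons.prems in auto)
  finally show ?case by simp
qed simp

lemma partials_cmult:
  assumes so: "slice_open \<Omega>" and u: "smooth_family \<Omega> u" and c: "continuous_on (fst ` \<Omega>) c" and "(a, x) \<in> \<Omega>"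
  shows "partials vs (\<lambda>a x. c a * u a x) a x = c a * partials vs u a x"
  using assms(4)
proof (induction vs arbitrary: a x)
  case (Cons j vs)
  have "partial j (partials vs (\<lambda>a x. c a * u a x)) a x = partial j (\<lambda>a x. c a * partials vs u a x) a x"
    by (rule partial_cong[OF so]) (use Cons in auto)
  then show ?case
    using partial_mult[OF smooth_family_param[OF so c] smooth_family_partials[OF u] Cons.prems] by simp
qed simp

lemma partials_diff:
  assumes so: "slice_open \<Omega>" and u: "smooth_family \<Omega> u" and v: "smooth_family \<Omega> v" and ax: "(a, x) \<in> \<Omega>"
  shows "partials vs (\<lambda>a x. u a x - v a x) a x = partials vs u a x - partials vs v a x"
proof -
  have v': "smooth_family \<Omega> (\<lambda>a x. (-1) * v a x)" by (intro smooth_family_mult smooth_family_const so v)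
  show ?thesis
    using partials_add[OF so u v' ax, of vs] partials_cmult[OF so v _ ax, of "\<lambda>_. -1" vs] by simp
qed

lemma has_real_derivative_line:
  assumes "smooth_family \<Omega> u" "(a, c + s *\<^sub>R axis i 1) \<in> \<Omega>"
  shows "((\<lambda>s. u a (c + s *\<^sub>R axis i 1)) has_real_derivative partial i u a (c + s *\<^sub>R axis i 1)) (at s)"
proof -
  have "((\<lambda>s. c + s *\<^sub>R axis i 1) has_derivative (\<lambda>h. h *\<^sub>R axis i 1)) (at s)"
    by (auto intro!: derivative_eq_intros)
  from has_derivative_compose[OF this smooth_family_has_derivative[OF assms]]
  have "((\<lambda>s. u a (c + s *\<^sub>R axis i 1)) has_derivative (\<lambda>h. h * partial i u a (c + s *\<^sub>R axis i 1))) (at s)"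
    by (simp add: sum_axis mult.assoc flip: sum_distrib_left)
  then show ?thesis by (simp add: has_field_derivative_def mult.commute[of _ "partial _ _ _ _"] fun_eq_iff)
qed

text \<open>Two applications of the mean value theorem, one in each direction, to the second
  difference over a square of side \<open>h\<close>. That difference is symmetric in
  \<open>i\<close> and \<open>j\<close>, whereas the mixed derivative on the right is taken in one
  order.\<close>

lemma mixed_difference:
  assumes u: "smooth_family \<Omega> u" and h: "h > 0"
    and sq: "\<And>s t. 0 \<le> s \<Longrightarrow> s \<le> h \<Longrightarrow> 0 \<le> t \<Longrightarrow> t \<le> h \<Longrightarrow>
      (a, x + s *\<^sub>R axis i 1 + t *\<^sub>R axis j 1) \<in> \<Omega>"
  shows "\<exists>s t. 0 < s \<and> s < h \<and> 0 < t \<and> t < h \<and>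
    u a (x + h *\<^sub>R axis i 1 + h *\<^sub>R axis j 1) - u a (x + h *\<^sub>R axis i 1)
      - (u a (x + h *\<^sub>R axis j 1) - u a x)
    = h * (h * partial j (partial i u) a (x + s *\<^sub>R axis i 1 + t *\<^sub>R axis j 1))"
proof -
  define gg where "gg s = u a (x + h *\<^sub>R axis j 1 + s *\<^sub>R axis i 1) - u a (x + s *\<^sub>R axis i 1)" for s
  have "(gg has_real_derivative partial i u a (x + h *\<^sub>R axis j 1 + s *\<^sub>R axis i 1) - partial i u a (x + s *\<^sub>R axis i 1)) (at s)"
    if "0 \<le> s" "s \<le> h" for s
    unfolding gg_def
    by (intro DERIV_diff has_real_derivative_line[OF u])
      (use sq[of s h] sq[of s 0] that h in \<open>auto simp: add_ac\<close>)
  from MVT2[OF h this] obtain s where s: "0 < s" "s < h" and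
    gs: "gg h - gg 0 = h * (partial i u a (x + h *\<^sub>R axis j 1 + s *\<^sub>R axis i 1) - partial i u a (x + s *\<^sub>R axis i 1))"
    by auto
  have "((\<lambda>t. partial i u a (x + s *\<^sub>R axis i 1 + t *\<^sub>R axis j 1)) has_real_derivative
      partial j (partial i u) a (x + s *\<^sub>R axis i 1 + t *\<^sub>R axis j 1)) (at t)" if "0 \<le> t" "t \<le> h" for t
    by (rule has_real_derivative_line[OF smooth_family_partial[OF u]]) (use sq that s in auto)
  from MVT2[OF h this] obtain t where t: "0 < t" "t < h" and
    "partial i u a (x + s *\<^sub>R axis i 1 + h *\<^sub>R axis j 1) - partial i u a (x + s *\<^sub>R axis i 1)
      = h * partial j (partial i u) a (x + s *\<^sub>R axis i 1 + t *\<^sub>R axis j 1)"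
    by auto
  then have "gg h - gg 0 = h * (h * partial j (partial i u) a (x + s *\<^sub>R axis i 1 + t *\<^sub>R axis j 1))"
    using gs by (simp add: add_ac)
  then show ?thesis using s t by (auto simp: gg_def add_ac)
qed

text \<open>Schwarz's theorem: one second difference is expressed by either mixed derivative at a
  point near \<open>x\<close>, and both mixed derivatives are continuous at
  \<open>x\<close>.\<close>

lemma partial_partial_commute:
  assumes so: "slice_open \<Omega>" and u: "smooth_family \<Omega> u" and ax: "(a, x) \<in> \<Omega>"
  shows "partial i (partial j u) a x = partial j (partial i u) a x"
proof (rule ccontr)
  assume ne: "partial i (partial j u) a x \<noteq> partial j (partial i u) a x"
  define e where "e = \<bar>partial i (partial j u) a x - partial j (partial i u) a x\<bar> / 2"
  have e: "e > 0" using ne by (simp add: e_def)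
  have isc: "isCont (w a) x" if "smooth_family \<Omega> w" for w
    using smooth_family_has_derivative[OF that ax] has_derivative_continuous by blast
  obtain d1 where d1: "d1 > 0" "\<And>y. dist y x < d1 \<Longrightarrow> \<bar>partial i (partial j u) a y - partial i (partial j u) a x\<bar> < e"
    using isc[OF smooth_family_partial[OF smooth_family_partial[OF u]], of i j] e unfolding continuous_at_eps_delta dist_real_def by (metis dist_norm real_norm_def)
  obtain d2 where d2: "d2 > 0" "\<And>y. dist y x < d2 \<Longrightarrow> \<bar>partial j (partial i u) a y - partial j (partial i u) a x\<bar> < e"
    using isc[OF smooth_family_partial[OF smooth_family_partial[OF u]], of j i] e unfolding continuous_at_eps_delta dist_real_def by (metis dist_norm real_norm_def)
  obtain d3 where d3: "d3 > 0" "\<And>y. dist y x < d3 \<Longrightarrow> (a, y) \<in> \<Omega>"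
    using slice_openD[OF so, of a] ax unfolding open_dist by auto
  \<comment> \<open>All points of the square lie within \<open>2 * h\<close> of \<open>x\<close>;
    the divisor 3 makes this strictly smaller than each of the three radii.\<close>
  define h where "h = Min {d1, d2, d3} / 3"
  have h: "h > 0" "2 * h < d1" "2 * h < d2" "2 * h < d3" using d1 d2 d3 by (auto simp: h_def min_def)
  have near: "dist (x + s *\<^sub>R axis i 1 + t *\<^sub>R axis j 1) x \<le> 2 * h"
    if "0 \<le> s" "s \<le> h" "0 \<le> t" "t \<le> h" for s t i j
  proof -
    have "norm (s *\<^sub>R axis i (1::real) + t *\<^sub>R axis j 1) \<le> norm (s *\<^sub>R axis i (1::real)) + norm (t *\<^sub>R axis j (1::real))"
      by (rule norm_triangle_ineq)
    then show ?thesis using that by (simp add: dist_norm norm_axis_1)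
  qed
  have in1: "(a, x + s *\<^sub>R axis i 1 + t *\<^sub>R axis j 1) \<in> \<Omega>"
    if "0 \<le> s" "s \<le> h" "0 \<le> t" "t \<le> h" for s t i j
    using near[OF that, of i j] d3 h by force
  obtain s t where st: "0 < s" "s < h" "0 < t" "t < h" and
    1: "u a (x + h *\<^sub>R axis i 1 + h *\<^sub>R axis j 1) - u a (x + h *\<^sub>R axis i 1)
      - (u a (x + h *\<^sub>R axis j 1) - u a x)
    = h * (h * partial j (partial i u) a (x + s *\<^sub>R axis i 1 + t *\<^sub>R axis j 1))"
    using mixed_difference[OF u h(1) in1] by blast
  obtain s' t' where st': "0 < s'" "s' < h" "0 < t'" "t' < h" and
    2: "u a (x + h *\<^sub>R axis j 1 + h *\<^sub>R axis i 1) - u a (x + h *\<^sub>R axis j 1)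
      - (u a (x + h *\<^sub>R axis i 1) - u a x)
    = h * (h * partial i (partial j u) a (x + s' *\<^sub>R axis j 1 + t' *\<^sub>R axis i 1))"
    using mixed_difference[OF u h(1) in1] by blast
  have "h * (h * partial j (partial i u) a (x + s *\<^sub>R axis i 1 + t *\<^sub>R axis j 1))
    = h * (h * partial i (partial j u) a (x + s' *\<^sub>R axis j 1 + t' *\<^sub>R axis i 1))"
    unfolding 1[symmetric] 2[symmetric] by (simp add: add_ac)
  then have "partial j (partial i u) a (x + s *\<^sub>R axis i 1 + t *\<^sub>R axis j 1)
    = partial i (partial j u) a (x + s' *\<^sub>R axis j 1 + t' *\<^sub>R axis i 1)" using h by simp
  moreover have "\<bar>partial j (partial i u) a (x + s *\<^sub>R axis i 1 + t *\<^sub>R axis j 1) - partial j (partial i u) a x\<bar> < e"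
    using d2(2) near[of s t i j] st h by force
  moreover have "\<bar>partial i (partial j u) a (x + s' *\<^sub>R axis j 1 + t' *\<^sub>R axis i 1) - partial i (partial j u) a x\<bar> < e"
    using d1(2) near[of s' t' j i] st' h by force
  moreover have False if "p = q" "\<bar>p - \<beta>\<bar> < \<bar>\<alpha> - \<beta>\<bar> / 2" "\<bar>q - \<alpha>\<bar> < \<bar>\<alpha> - \<beta>\<bar> / 2" for p q \<alpha> \<beta> :: real
    using that by (smt (verit) field_sum_of_halves)
  ultimately show False unfolding e_def by blast
qed

lemma partials_move:
  assumes so: "slice_open \<Omega>" and u: "smooth_family \<Omega> u" and "(a, x) \<in> \<Omega>"
  shows "partials (vs @ j # ws) u a x = partials (j # vs @ ws) u a x"
  using assms(3)
proof (induction vs arbitrary: a x)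
  case (Cons i vs)
  have "partials ((i # vs) @ j # ws) u a x = partial i (partials (j # vs @ ws) u) a x"
    using partial_cong[OF so, of "partials (vs @ j # ws) u" "partials (j # vs @ ws) u" a x i] Cons by simp
  also have "\<dots> = partial j (partial i (partials (vs @ ws) u)) a x"
    using partial_partial_commute[OF so smooth_family_partials[OF u] Cons.prems] by simp
  finally show ?case by simp
qed simp

text \<open>Taylor coefficients are thus indexed by multisets of directions. One unknown per
  multiset can then satisfy the equations for all words with these letters.\<close>

lemma partials_mset:
  assumes so: "slice_open \<Omega>" and u: "smooth_family \<Omega> u" and "(a, x) \<in> \<Omega>" "mset vs = mset ws"
  shows "partials vs u a x = partials ws u a x"
  using assms(3,4)
proof (induction vs arbitrary: ws a x)
  case (Cons j vs)
  then have "j \<in> set ws" by (metis list.set_intros(1) set_mset_mset)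
  then obtain ws1 ws2 where ws: "ws = ws1 @ j # ws2" by (meson split_list)
  then have "mset vs = mset (ws1 @ ws2)" using Cons.prems by simp
  then have "partials (j # vs) u a x = partials (j # ws1 @ ws2) u a x"
    unfolding partials.simps by (intro partial_cong[OF so] Cons.IH Cons.prems(1))
  also have "\<dots> = partials ws u a x"
    unfolding ws by (rule partials_move[OF so u Cons.prems(1), symmetric])
  finally show ?case .
qed simp

section \<open>Smoothness on domains with boundary\<close>

text \<open>Derivatives within \<open>T\<close> are unique; this covers open sets and closed balls.\<close>

definition unique_deriv_domain :: "(real^'n::finite) set \<Rightarrow> bool" where
  "unique_deriv_domain T \<longleftrightarrow> (\<forall>x\<in>T. \<forall>d::real^'n \<Rightarrow> real^'n.
     ((\<lambda>_. 0) has_derivative d) (at x within T) \<longrightarrow> d = (\<lambda>_. 0))"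

lemma unique_deriv_domain_unique:
  fixes f :: "real^'n::finite \<Rightarrow> real^'n"
  assumes "unique_deriv_domain T" "x \<in> T" "(f has_derivative f') (at x within T)" "(f has_derivative f'') (at x within T)"
  shows "f' = f''"
proof -
  have "((\<lambda>_. 0) has_derivative (\<lambda>h. f' h - f'' h)) (at x within T)"
    using has_derivative_diff[OF assms(3,4)] by simp
  then have "(\<lambda>h. f' h - f'' h) = (\<lambda>_. 0)"
    using assms(1)[unfolded unique_deriv_domain_def, rule_format, OF assms(2)] by simp
  then show ?thesis by (simp add: fun_eq_iff)
qed

lemma unique_deriv_domain_open:
  fixes T :: "(real^'n::finite) set"
  assumes "open T" shows "unique_deriv_domain T"
  unfolding unique_deriv_domain_def
proof (intro ballI allI impI)
  fix x and d :: "real^'n \<Rightarrow> real^'n"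
  assume x: "x \<in> T" and d: "((\<lambda>_. 0) has_derivative d) (at x within T)"
  have "((\<lambda>_. 0) has_derivative d) (at x)" using d unfolding at_within_open[OF x assms] .
  from has_derivative_unique[OF this has_derivative_const] show "d = (\<lambda>_. 0)" .
qed

text \<open>For \<open>z\<close> in \<open>C\<close> the segment from \<open>x\<close> towards
  \<open>z\<close> stays in \<open>C\<close> and, near \<open>x\<close>, in \<open>Q\<close>; hence
  a derivative of the zero function vanishes on \<open>z - x\<close>. An interior point
  \<open>c\<close> of \<open>C\<close> supplies enough points \<open>z\<close> to reach every
  direction as a difference.\<close>

lemma unique_deriv_domain_convex:
  fixes C :: "(real^'n::finite) set"
  assumes C: "convex C" "interior C \<noteq> {}" and Q: "open Q"
  shows "unique_deriv_domain (C \<inter> Q)"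
  unfolding unique_deriv_domain_def
proof (intro ballI allI impI)
  fix x and d :: "real^'n \<Rightarrow> real^'n"
  assume x: "x \<in> C \<inter> Q" and d: "((\<lambda>_. 0) has_derivative d) (at x within C \<inter> Q)"
  interpret bounded_linear d using d by (rule has_derivative_bounded_linear)
  have dz: "d (z - x) = 0" if z: "z \<in> C" for z
  proof (cases "z = x")
    case False
    have "norm (d (z - x)) \<le> e" if "e > 0" for e
    proof -
      define e' where "e' = e / norm (z - x)"
      have "e' > 0" using that False by (simp add: e'_def)
      then obtain r where r: "r > 0"
        "\<And>y. y \<in> C \<inter> Q \<Longrightarrow> norm (y - x) < r \<Longrightarrow> norm (0 - 0 - d (y - x)) \<le> e' * norm (y - x)"
        using d unfolding has_derivative_within_alt by blast
      obtain r' where r': "r' > 0" "ball x r' \<subseteq> Q" using Q x open_contains_ball by blast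
      \<comment> \<open>The bound 1 keeps \<open>y\<close> on the segment; the other bound brings it
        into the range \<open>r\<close> of the derivative estimate and into the ball of radius
        \<open>r'\<close> in \<open>Q\<close>.\<close>
      define t where "t = min 1 (min r r' / (2 * norm (z - x)))"
      have t: "0 < t" "t \<le> 1" using r r' False by (auto simp: t_def)
      have "t * norm (z - x) \<le> min r r' / (2 * norm (z - x)) * norm (z - x)"
        unfolding t_def by (intro mult_right_mono) auto
      also have "\<dots> < min r r'" using False r r' by (simp add: min_def)
      finally have tn: "t * norm (z - x) < min r r'" .
      define y where "y = x + t *\<^sub>R (z - x)"
      have yx: "norm (y - x) = t * norm (z - x)" using t by (simp add: y_def)
      have "y = (1 - t) *\<^sub>R x + t *\<^sub>R z" by (simp add: y_def algebra_simps)
      then have "y \<in> C" using C(1) x z t unfolding convex_alt by auto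
      moreover have "y \<in> Q" using r' yx tn by (auto simp: dist_norm norm_minus_commute)
      ultimately have "norm (d (y - x)) \<le> e' * norm (y - x)" using r(2)[of y] yx tn by simp
      moreover have "d (y - x) = t *\<^sub>R d (z - x)" by (simp add: y_def scaleR)
      ultimately have "t * norm (d (z - x)) \<le> t * (e' * norm (z - x))" using t yx by (simp add: mult_ac)
      then show ?thesis using t False by (simp add: e'_def)
    qed
    then have "norm (d (z - x)) \<le> 0" by (rule field_le_epsilon[where y = 0, simplified])
    then show ?thesis by simp
  qed (simp add: zero)
  obtain c where "c \<in> interior C" using C by blast
  then obtain r where r: "r > 0" "ball c r \<subseteq> C" by (meson mem_interior)
  show "d = (\<lambda>_. 0)"
  proof
    fix h :: "real^'n"
    \<comment> \<open>The summand 1 avoids a division by zero for \<open>h = 0\<close> and keeps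
      \<open>s\<close> positive.\<close>
    define s where "s = r / (2 * (norm h + 1))"
    have s: "s > 0" using r by (simp add: s_def add_nonneg_pos)
    have "s * norm h \<le> s * (norm h + 1)" using s by (intro mult_left_mono) auto
    also have "\<dots> = r / 2" by (simp add: s_def field_simps add_nonneg_eq_0_iff)
    finally have "c + s *\<^sub>R h \<in> C" using r s by (intro subsetD[OF r(2)]) (auto simp: dist_norm)
    from dz[OF this] dz[of c] r have "d (s *\<^sub>R h) = 0"
      by (metis (no_types, lifting) add_diff_cancel_left' add_diff_eq centre_in_ball diff_0_right diff diff_diff_eq2 diff_self subsetD)
    then show "d h = 0" using s by (simp add: scaleR)
  qed
qed

section \<open>Passage between smooth families and \<open>smooth_on\<close>\<close>

lemma linear_expand_axis:
  fixes F :: "real^'n::finite \<Rightarrow> 'b::real_vector"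
  assumes "linear F" shows "F h = (\<Sum>j\<in>UNIV. h $ j *\<^sub>R F (axis j 1))"
proof -
  have "h = (\<Sum>j\<in>UNIV. h $ j *\<^sub>R axis j 1)"
    using basis_expansion[of h] by (simp add: scalar_mult_eq_scaleR)
  then have "F h = F (\<Sum>j\<in>UNIV. h $ j *\<^sub>R axis j 1)" by simp
  then show ?thesis by (simp only: linear_sum[OF assms] linear_scale[OF assms])
qed

text \<open>A derivative within \<open>T\<close> is unique, so it is the restriction of the ambient
  derivative and one \<open>W\<close> serves all domains \<open>T\<close>. In this way derivatives
  on a closed ball, one-sided at its boundary, are controlled by a family that is jointly continuous
  on a neighbourhood.\<close>

lemma iter_deriv_smooth_vfamily:
  fixes U :: "'x::topological_space \<Rightarrow> real^'n::finite \<Rightarrow> real^'n"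
  assumes so: "slice_open \<Omega>" and U: "smooth_vfamily \<Omega> U"
  shows "\<exists>W. smooth_vfamily \<Omega> W \<and> (\<forall>a T x. T \<subseteq> {x. (a, x) \<in> \<Omega>} \<longrightarrow> unique_deriv_domain T \<longrightarrow> x \<in> T \<longrightarrow>
    iter_deriv T vs (U a) x = W a x)"
proof (induction vs)
  case Nil
  then show ?case using U by auto
next
  case (Cons v vs)
  then obtain W where W: "smooth_vfamily \<Omega> W"
    "\<And>a T x. T \<subseteq> {x. (a, x) \<in> \<Omega>} \<Longrightarrow> unique_deriv_domain T \<Longrightarrow> x \<in> T \<Longrightarrow> iter_deriv T vs (U a) x = W a x"
    by blast
  let ?W = "\<lambda>a x. \<chi> i. \<Sum>j\<in>UNIV. v $ j * partial j (\<lambda>a x. W a x $ i) a x"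
  have "smooth_vfamily \<Omega> ?W"
    unfolding smooth_vfamily_def vec_lambda_beta
    by (intro allI smooth_family_sum smooth_family_mult smooth_family_const smooth_family_partial so) (use W(1) in \<open>simp add: smooth_vfamily_def\<close>)
  moreover have "iter_deriv T (v # vs) (U a) x = ?W a x"
    if T: "T \<subseteq> {x. (a, x) \<in> \<Omega>}" "unique_deriv_domain T" "x \<in> T" for a T x
  proof -
    have "(W a has_derivative (\<lambda>h. \<chi> i. \<Sum>j\<in>UNIV. h $ j * partial j (\<lambda>a x. W a x $ i) a x)) (at x within T)"
      by (rule has_derivative_at_withinI[OF smooth_vfamily_has_derivative[OF W(1)]]) (use T in auto)
    then have *: "(iter_deriv T vs (U a) has_derivative (\<lambda>h. \<chi> i. \<Sum>j\<in>UNIV. h $ j * partial j (\<lambda>a x. W a x $ i) a x)) (at x within T)"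
      by (rule has_derivative_transform[OF T(3), where f = "W a", rotated]) (rule W(2)[OF T(1,2)])
    from differentiableI[OF *]
    have "(iter_deriv T vs (U a) has_derivative frechet_derivative (iter_deriv T vs (U a)) (at x within T)) (at x within T)"
      by (simp only: frechet_derivative_works)
    from unique_deriv_domain_unique[OF T(2,3) this *] show ?thesis by simp
  qed
  ultimately show ?case by (intro exI[of _ ?W]) simp
qed

lemma smooth_vfamily_smooth_on:
  fixes U :: "'x::topological_space \<Rightarrow> real^'n::finite \<Rightarrow> real^'n"
  assumes so: "slice_open \<Omega>" and U: "smooth_vfamily \<Omega> U" and T: "T \<subseteq> {x. (a, x) \<in> \<Omega>}" "unique_deriv_domain T"
  shows "smooth_on T (U a)"
  unfolding smooth_on_def
proof (intro allI ballI)
  fix vs x assume x: "x \<in> T"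
  obtain W where W: "smooth_vfamily \<Omega> W" "\<And>x. x \<in> T \<Longrightarrow> iter_deriv T vs (U a) x = W a x"
    using iter_deriv_smooth_vfamily[OF so U, of vs] T by blast
  have "W a differentiable (at x within T)"
    by (rule differentiableI[OF has_derivative_at_withinI[OF smooth_vfamily_has_derivative[OF W(1)]]]) (use x T in auto)
  then obtain D where "(W a has_derivative D) (at x within T)" unfolding differentiable_def by blast
  then have "(iter_deriv T vs (U a) has_derivative D) (at x within T)"
    by (rule has_derivative_transform[OF x, where f = "W a", rotated]) (rule W(2))
  then show "iter_deriv T vs (U a) differentiable (at x within T)" by (rule differentiableI)
qed

text \<open>\<open>smooth_on\<close> speaks of one function at a time, hence the separate hypothesis
  of joint continuity. Iterated derivatives in the directions \<open>axis j 1\<close> are the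
  partial derivatives, and they suffice by linearity.\<close>

lemma smooth_on_smooth_vfamily:
  fixes U :: "'x::topological_space \<Rightarrow> real^'n::finite \<Rightarrow> real^'n"
  assumes so: "slice_open \<Omega>" and sm: "\<And>a. smooth_on {x. (a, x) \<in> \<Omega>} (U a)"
    and cont: "\<And>vs. continuous_on \<Omega> (\<lambda>(a, x). iter_deriv {x. (a, x) \<in> \<Omega>} vs (U a) x)"
  shows "smooth_vfamily \<Omega> U"
proof -
  have "Ck_family k \<Omega> (\<lambda>a x. iter_deriv {x. (a, x) \<in> \<Omega>} vs (U a) x $ i)" for k vs i
  proof (induction k arbitrary: vs)
    case 0
    then show ?case using continuous_on_component[OF cont[of vs], of i] by (simp add: case_prod_beta)
  next
    case (Suc k)
    let ?D = "\<lambda>vs a x. iter_deriv {x. (a, x) \<in> \<Omega>} vs (U a) x"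
    show ?case
    proof (rule Ck_family_SucI[OF so, where d = "\<lambda>j a x. ?D (axis j 1 # vs) a x $ i"])
      show "continuous_on \<Omega> (\<lambda>(a, x). ?D vs a x $ i)"
        using continuous_on_component[OF cont[of vs], of i] by (simp add: case_prod_beta)
      fix a x assume ax: "(a, x) \<in> \<Omega>"
      let ?F = "frechet_derivative (?D vs a) (at x)"
      have awo: "at x within {x. (a, x) \<in> \<Omega>} = at x"
        by (rule at_within_open) (use ax slice_openD[OF so, of a] in auto)
      have "?D vs a differentiable (at x within {x. (a, x) \<in> \<Omega>})"
        using sm[of a, unfolded smooth_on_def, rule_format, of x vs] ax by simp
      then have "?D vs a differentiable (at x)" unfolding awo .
      then have F: "(?D vs a has_derivative ?F) (at x)" by (simp only: frechet_derivative_works)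
      then have lin: "linear ?F" by (rule has_derivative_linear)
      have "((\<lambda>x. ?D vs a x $ i) has_derivative (\<lambda>h. ?F h $ i)) (at x)"
        using bounded_linear.has_derivative[OF bounded_linear_vec_nth F] .
      moreover have "?F h $ i = (\<Sum>j\<in>UNIV. h $ j * ?D (axis j 1 # vs) a x $ i)" for h
        by (subst linear_expand_axis[OF lin]) (simp add: awo)
      ultimately show "((\<lambda>x. ?D vs a x $ i) has_derivative (\<lambda>h. \<Sum>j\<in>UNIV. h $ j * ?D (axis j 1 # vs) a x $ i)) (at x)"
        by simp
    qed (rule Suc.IH)
  qed
  from this[of _ "[]"] show ?thesis unfolding smooth_vfamily_def smooth_family_def by simp
qed

lemma smooth_on_imp_continuous: "smooth_on S f \<Longrightarrow> continuous_on S f"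
  unfolding smooth_on_def using differentiable_imp_continuous_on[of f S]
  by (metis differentiable_on_def iter_deriv.simps(1))

lemma smooth_on_smooth_vfamily_const:
  fixes f :: "real^'n::finite \<Rightarrow> real^'n"
  assumes Q: "open Q" and f: "smooth_on Q f"
  shows "smooth_vfamily (S \<times> Q) (\<lambda>_::'x::topological_space. f)"
proof -
  \<comment> \<open>Over \<open>UNIV\<close> every slice is \<open>Q\<close>; over \<open>S\<close>
    the slices at parameters outside \<open>S\<close> would be empty and the iterated derivatives
    within them would be junk.\<close>
  have "smooth_vfamily (UNIV \<times> Q) (\<lambda>_::'x. f)"
  proof (rule smooth_on_smooth_vfamily)
    fix vs
    have "continuous_on Q (iter_deriv Q vs f)"
      using f unfolding smooth_on_def
      by (intro differentiable_imp_continuous_on) (auto simp: differentiable_on_def)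
    then have "continuous_on (UNIV \<times> Q) (\<lambda>z::'x \<times> (real^'n). iter_deriv Q vs f (snd z))"
      by (rule continuous_on_compose2[OF _ continuous_on_snd[OF continuous_on_id]]) auto
    then show "continuous_on (UNIV \<times> Q) (\<lambda>(a::'x, x). iter_deriv {x. (a, x) \<in> UNIV \<times> Q} vs f x)"
      by (simp add: case_prod_beta)
  qed (use Q f in auto)
  then show ?thesis by (rule smooth_vfamily_subset) auto
qed

lemma has_derivative_within_cong:
  assumes "x \<in> T" "\<And>y. y \<in> T \<Longrightarrow> f y = g y"
  shows "(f has_derivative f') (at x within T) \<longleftrightarrow> (g has_derivative f') (at x within T)"
  using has_derivative_transform[OF assms(1), of f g] has_derivative_transform[OF assms(1), of g f] assms(2)
  by metis

lemma iter_deriv_cong: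
  assumes "\<And>y. y \<in> T \<Longrightarrow> f y = g y" "x \<in> T"
  shows "iter_deriv T vs f x = iter_deriv T vs g x"
  using assms(2)
proof (induction vs arbitrary: x)
  case (Cons v vs)
  then show ?case
    unfolding iter_deriv.simps frechet_derivative_def
    using has_derivative_within_cong[OF Cons.prems, of "iter_deriv T vs f" "iter_deriv T vs g"] by simp
qed (simp add: assms)

lemma smooth_on_cong:
  assumes "\<And>y. y \<in> T \<Longrightarrow> f y = g y" "smooth_on T f"
  shows "smooth_on T g"
  unfolding smooth_on_def
proof (intro allI ballI)
  fix vs x assume x: "x \<in> T"
  then have "iter_deriv T vs f differentiable (at x within T)"
    using assms(2)[unfolded smooth_on_def, rule_format, of x vs] by simp
  then obtain D where "(iter_deriv T vs f has_derivative D) (at x within T)"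
    unfolding differentiable_def by blast
  then have "(iter_deriv T vs g has_derivative D) (at x within T)"
    by (rule has_derivative_transform[OF x, where f = "iter_deriv T vs f", rotated]) (rule iter_deriv_cong, use assms(1) in auto)
  then show "iter_deriv T vs g differentiable (at x within T)" by (rule differentiableI)
qed

lemma iter_deriv_open_subset:
  assumes W: "open W" "W \<subseteq> T" and "x \<in> W"
  shows "iter_deriv T vs f x = iter_deriv W vs f x"
  using assms(3)
proof (induction vs arbitrary: x)
  case (Cons v vs)
  have "x \<in> interior T" using W Cons.prems by (meson interior_maximal subsetD)
  then have "at x within T = at x" by (rule at_within_interior)
  moreover have "frechet_derivative (iter_deriv T vs f) (at x) = frechet_derivative (iter_deriv W vs f) (at x)"
    by (rule frechet_derivative_cong_open[OF W(1) Cons.prems Cons.IH])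
  ultimately show ?case using at_within_open[OF Cons.prems W(1)] by simp
qed simp

lemma smooth_on_subset_open:
  assumes W: "open W" "W \<subseteq> T" and f: "smooth_on T f"
  shows "smooth_on W f"
  unfolding smooth_on_def
proof (intro allI ballI)
  fix vs x assume x: "x \<in> W"
  then have "x \<in> interior T" using W by (meson interior_maximal subsetD)
  then have "at x within T = at x" by (rule at_within_interior)
  then have "iter_deriv T vs f differentiable (at x)"
    using f[unfolded smooth_on_def, rule_format, of x vs] x W(2) by auto
  then obtain D where "(iter_deriv T vs f has_derivative D) (at x)" unfolding differentiable_def by auto
  then have "(iter_deriv W vs f has_derivative D) (at x)"
    by (rule has_derivative_transform_within_open[OF _ W(1) x]) (rule iter_deriv_open_subset[OF W])
  then have "iter_deriv W vs f differentiable (at x)" by (rule differentiableI)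
  then show "iter_deriv W vs f differentiable (at x within W)" by (rule differentiable_at_withinI)
qed

text \<open>The two maps are treated as families constant in a parameter, so that the chain rule for
  families applies; \<open>bool\<close> merely supplies a parameter space.\<close>

lemma smooth_on_compose:
  fixes f h :: "real^'n::finite \<Rightarrow> real^'n"
  assumes "open A" "open B" "smooth_on A f" "smooth_on B h" "f ` A \<subseteq> B"
  shows "smooth_on A (h \<circ> f)"
proof -
  have "smooth_vfamily ((UNIV::bool set) \<times> A) (\<lambda>a x. h (f x))"
    by (rule smooth_vfamily_comp[where \<Psi> = "(UNIV::bool set) \<times> B" and U = "\<lambda>_. h" and s = "\<lambda>a. a",
          OF _ smooth_on_smooth_vfamily_const smooth_on_smooth_vfamily_const]) (use assms in auto)
  from smooth_vfamily_smooth_on[OF _ this, of A True] show ?thesis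
    using assms unique_deriv_domain_open[OF assms(1)] by (simp add: comp_def)
qed

section \<open>Inverse functions in families\<close>

text \<open>The tube lemma around the zero section. Openness is relative to
  \<open>S \<times> UNIV\<close>, and compactness of \<open>S\<close> makes the radius uniform in
  the parameter.\<close>

lemma tube_radius:
  fixes S :: "'x::topological_space set" and W :: "('x \<times> 'e::real_normed_vector) set"
  assumes S: "compact S" and W: "openin (top_of_set (S \<times> UNIV)) W" and z: "\<And>a. a \<in> S \<Longrightarrow> (a, 0) \<in> W"
  shows "\<exists>\<rho>>0. S \<times> ball 0 \<rho> \<subseteq> W"
proof -
  obtain T where T: "open T" "W = (S \<times> UNIV) \<inter> T" using W by (auto simp: openin_open)
  have "\<exists>A r. open A \<and> a \<in> A \<and> r > 0 \<and> A \<times> ball (0::'e) r \<subseteq> T" if "a \<in> S" for a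
  proof -
    have "(a, 0) \<in> T" using z[OF that] T by auto
    then obtain A B where AB: "open A" "open B" "(a, 0) \<in> A \<times> B" "A \<times> B \<subseteq> T"
      by (rule open_prod_elim[OF T(1)])
    then obtain r where "r > 0" "ball 0 r \<subseteq> B" using open_contains_ball[of B] by auto
    then show ?thesis using AB by (intro exI[of _ A] exI[of _ r]) auto
  qed
  then obtain A r where Ar: "\<And>a. a \<in> S \<Longrightarrow> open (A a) \<and> a \<in> A a \<and> r a > 0 \<and> A a \<times> ball (0::'e) (r a) \<subseteq> T"
    by metis
  obtain C where C: "C \<subseteq> S" "finite C" "S \<subseteq> (\<Union>c\<in>C. A c)"
    using compactE_image[OF S, of S A] Ar by blast
  \<comment> \<open>The inserted 1 keeps the minimum meaningful when \<open>S\<close>, and with it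
    the finite cover, is empty.\<close>
  define \<rho> where "\<rho> = Min (insert 1 (r ` C))"
  have "\<rho> > 0" unfolding \<rho>_def using C Ar by (subst Min_gr_iff) auto
  moreover have "(a, x) \<in> W" if ax: "a \<in> S" "x \<in> ball 0 \<rho>" for a x
  proof -
    obtain c where c: "c \<in> C" "a \<in> A c" using C(3) ax(1) by auto
    then have "\<rho> \<le> r c" unfolding \<rho>_def using C by (intro Min_le) auto
    then have "x \<in> ball 0 (r c)" using that by auto
    then have "(a, x) \<in> T" using Ar[of c] c C by blast
    then show ?thesis using T that by auto
  qed
  ultimately show ?thesis by blast
qed

lemma small_near_zero:
  fixes w :: "'x::topological_space \<Rightarrow> 'e::real_normed_vector \<Rightarrow> real"
  assumes S: "compact S" and R: "R > 0" and c: "continuous_on (S \<times> ball 0 R) (case_prod w)"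
    and z: "\<And>a. a \<in> S \<Longrightarrow> \<bar>w a 0\<bar> < e"
  shows "\<exists>\<rho>>0. \<rho> < R \<and> (\<forall>a\<in>S. \<forall>x\<in>ball 0 \<rho>. \<bar>w a x\<bar> < e)"
proof -
  have "continuous_on (S \<times> ball 0 R) (\<lambda>z. \<bar>case_prod w z\<bar>)"
    by (intro continuous_intros c)
  then have "openin (top_of_set (S \<times> ball 0 R)) ((S \<times> ball 0 R) \<inter> (\<lambda>z. \<bar>case_prod w z\<bar>) -` {..<e})"
    by (intro continuous_openin_preimage_gen) auto
  moreover have "openin (top_of_set (S \<times> UNIV)) (S \<times> ball (0::'e) R)"
    by (intro openin_Times) auto
  ultimately have "openin (top_of_set (S \<times> UNIV)) ((S \<times> ball 0 R) \<inter> (\<lambda>z. \<bar>case_prod w z\<bar>) -` {..<e})"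
    by (rule openin_trans)
  from tube_radius[OF S this] obtain \<rho> where \<rho>: "\<rho> > 0"
    "S \<times> ball 0 \<rho> \<subseteq> (S \<times> ball 0 R) \<inter> (\<lambda>z. \<bar>case_prod w z\<bar>) -` {..<e}"
    using z R by auto
  define \<rho>' where "\<rho>' = min \<rho> (R / 2)"
  have "\<bar>w a x\<bar> < e" if "a \<in> S" "x \<in> ball 0 \<rho>'" for a x
  proof -
    have "(a, x) \<in> S \<times> ball 0 \<rho>" using that by (auto simp: \<rho>'_def)
    from subsetD[OF \<rho>(2) this] show ?thesis by simp
  qed
  moreover have "\<rho>' > 0" "\<rho>' < R" using \<rho> R by (auto simp: \<rho>'_def)
  ultimately show ?thesis by blast
qed

section \<open>Diagonal derivatives and a parametrized inverse function theorem\<close>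

definition diag :: "real^'n \<Rightarrow> real^'n \<Rightarrow> real^'n" where
  "diag m x = (\<chi> i. m $ i * x $ i)"

lemma diag_nth [simp]: "diag m x $ i = m $ i * x $ i" by (simp add: diag_def)

lemma diag_diff: "diag m (x - y) = diag m x - diag m y"
  by (simp add: vec_eq_iff algebra_simps)

lemma diag_zero [simp]: "diag m 0 = 0"
  by (simp add: vec_eq_iff)

lemma norm_diag_ge:
  fixes m :: "real^'n::finite"
  assumes "\<And>i. c \<le> \<bar>m $ i\<bar>" "c \<ge> 0"
  shows "c * norm x \<le> norm (diag m x)"
proof -
  have "norm (c *\<^sub>R x) \<le> norm (diag m x)"
    by (rule norm_le_componentwise_cart) (use assms in \<open>simp add: abs_mult mult_right_mono\<close>)
  then show ?thesis using assms by simp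
qed

lemma norm_matrix_le:
  fixes h :: "real^'n::finite"
  shows "norm (\<chi> i. \<Sum>j\<in>UNIV. h $ j * (C i j)) \<le> (\<Sum>i\<in>(UNIV::'m::finite set). \<Sum>j\<in>UNIV. \<bar>C i j\<bar>) * norm h"
proof -
  have "norm (\<chi> i. \<Sum>j\<in>UNIV. h $ j * (C i j)) \<le> (\<Sum>i\<in>(UNIV::'m set). \<bar>\<Sum>j\<in>UNIV. h $ j * (C i j)\<bar>)"
    using norm_le_l1_cart[of "\<chi> i. \<Sum>j\<in>UNIV. h $ j * (C i j)"] by simp
  also have "\<dots> \<le> (\<Sum>i\<in>(UNIV::'m set). \<Sum>j\<in>UNIV. \<bar>C i j\<bar> * norm h)"
  proof (rule sum_mono)
    fix i :: 'm
    have "\<bar>\<Sum>j\<in>UNIV. h $ j * (C i j)\<bar> \<le> (\<Sum>j\<in>UNIV. \<bar>h $ j * (C i j)\<bar>)" by (rule sum_abs)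
    also have "\<dots> \<le> (\<Sum>j\<in>UNIV. \<bar>C i j\<bar> * norm h)"
      by (intro sum_mono) (simp add: abs_mult mult.commute[of "\<bar>h $ _\<bar>"] mult_left_mono component_le_norm_cart)
    finally show "\<bar>\<Sum>j\<in>UNIV. h $ j * (C i j)\<bar> \<le> (\<Sum>j\<in>UNIV. \<bar>C i j\<bar> * norm h)" .
  qed
  finally show ?thesis by (simp add: sum_distrib_right)
qed

text \<open>The sum of the absolute values of the entries of \<open>DU - diag \<mu>\<close> is
  jointly continuous and vanishes on the zero section, hence is below \<open>\<epsilon>\<close> on a
  uniform ball. Convexity of the ball and the mean value inequality turn this into the Lipschitz
  estimate.\<close>

lemma near_diag:
  fixes U :: "'x::topological_space \<Rightarrow> real^'n::finite \<Rightarrow> real^'n" and \<mu> :: "'x \<Rightarrow> real^'n"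
  assumes S: "compact S" and R: "R > 0" and U: "smooth_vfamily (S \<times> ball 0 R) U"
    and dU: "\<And>a i j. a \<in> S \<Longrightarrow> partial j (\<lambda>a x. U a x $ i) a 0 = (if i = j then \<mu> a $ i else 0)"
    and \<mu>: "continuous_on S \<mu>" and \<epsilon>: "\<epsilon> > 0"
  shows "\<exists>\<rho>>0. \<rho> < R \<and> (\<forall>a\<in>S. \<forall>x\<in>ball 0 \<rho>.
      (\<forall>h. norm ((\<chi> i. \<Sum>j\<in>UNIV. h $ j * partial j (\<lambda>a x. U a x $ i) a x) - diag (\<mu> a) h) \<le> \<epsilon> * norm h) \<and>
      (\<forall>y\<in>ball 0 \<rho>. norm (U a x - U a y - diag (\<mu> a) (x - y)) \<le> \<epsilon> * norm (x - y)))"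
proof -
  let ?D = "\<lambda>i j a x. partial j (\<lambda>a x. U a x $ i) a x"
  let ?e = "\<lambda>i j a x. ?D i j a x - (if i = j then \<mu> a $ i else 0)"
  define w where "w a x = (\<Sum>i\<in>UNIV. \<Sum>j\<in>UNIV. \<bar>?e i j a x\<bar>)" for a x
  have so: "slice_open (S \<times> ball (0::real^'n) R)" by simp
  have Dc: "continuous_on (S \<times> ball 0 R) (\<lambda>z. ?D i j (fst z) (snd z))" for i j
    using smooth_family_continuous[OF smooth_family_partial[of "S \<times> ball 0 R" "\<lambda>a x. U a x $ i" j]] U by (simp add: smooth_vfamily_def case_prod_beta)
  have \<mu>c: "continuous_on (S \<times> ball (0::real^'n) R) (\<lambda>z. if i = j then \<mu> (fst z) $ i else 0)" for i j :: 'n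
  proof (cases "i = j")
    case True
    have "continuous_on (S \<times> ball (0::real^'n) R) (\<lambda>z. \<mu> (fst z))"
      by (rule continuous_on_compose2[OF \<mu> continuous_on_fst[OF continuous_on_id]]) auto
    then show ?thesis using True by (simp add: continuous_on_component)
  qed simp
  have "continuous_on (S \<times> ball 0 R) (case_prod w)"
    unfolding w_def case_prod_beta by (intro continuous_on_sum continuous_on_rabs continuous_on_diff Dc \<mu>c)
  from small_near_zero[OF S R this, of \<epsilon>] obtain \<rho> where \<rho>: "\<rho> > 0" "\<rho> < R"
    "\<And>a x. a \<in> S \<Longrightarrow> x \<in> ball 0 \<rho> \<Longrightarrow> \<bar>w a x\<bar> < \<epsilon>"
    using dU \<epsilon> by (auto simp: w_def)
  have 1: "norm ((\<chi> i. \<Sum>j\<in>UNIV. h $ j * ?D i j a x) - diag (\<mu> a) h) \<le> \<epsilon> * norm h"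
    if "a \<in> S" "x \<in> ball 0 \<rho>" for a x h
  proof -
    have "(\<Sum>j\<in>UNIV. h $ j * (if i = j then \<mu> a $ i else 0)) = \<mu> a $ i * h $ i" for i
      by (simp add: if_distrib[of "\<lambda>x. _ * x"] mult.commute cong: if_cong)
    then have "(\<chi> i. \<Sum>j\<in>UNIV. h $ j * ?D i j a x) - diag (\<mu> a) h = (\<chi> i. \<Sum>j\<in>UNIV. h $ j * ?e i j a x)"
      by (simp add: vec_eq_iff right_diff_distrib sum_subtractf)
    then have "norm ((\<chi> i. \<Sum>j\<in>UNIV. h $ j * ?D i j a x) - diag (\<mu> a) h) \<le> w a x * norm h"
      unfolding w_def using norm_matrix_le[of h "\<lambda>i j. ?e i j a x"] by simp
    also have "\<dots> \<le> \<epsilon> * norm h" using \<rho>(3)[OF that] by (intro mult_right_mono) auto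
    finally show ?thesis .
  qed
  have 2: "norm (U a x - U a y - diag (\<mu> a) (x - y)) \<le> \<epsilon> * norm (x - y)"
    if a: "a \<in> S" and x: "x \<in> ball 0 \<rho>" and y: "y \<in> ball 0 \<rho>" for a x y
  proof -
    have lin: "linear (diag (\<mu> a))" by (rule linearI) (simp_all add: vec_eq_iff algebra_simps)
    have "norm ((\<lambda>z. U a z - diag (\<mu> a) z) x - (\<lambda>z. U a z - diag (\<mu> a) z) y) \<le> \<epsilon> * norm (x - y)"
    proof (rule differentiable_bound[OF convex_ball _ _ x y])
      fix z assume z: "z \<in> ball (0::real^'n) \<rho>"
      have "(a, z) \<in> S \<times> ball 0 R" using z a \<rho> by auto
      from has_derivative_diff[OF smooth_vfamily_has_derivative[OF U this] linear_imp_has_derivative[OF lin]]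
      show "((\<lambda>z. U a z - diag (\<mu> a) z) has_derivative
          (\<lambda>h. (\<chi> i. \<Sum>j\<in>UNIV. h $ j * ?D i j a z) - diag (\<mu> a) h)) (at z within ball 0 \<rho>)"
        by (rule has_derivative_at_withinI)
      show "onorm (\<lambda>h. (\<chi> i. \<Sum>j\<in>UNIV. h $ j * ?D i j a z) - diag (\<mu> a) h) \<le> \<epsilon>"
        by (rule onorm_le) (rule 1[OF a z])
    qed
    then show ?thesis by (simp add: diag_diff algebra_simps)
  qed
  show ?thesis using \<rho>(1,2) 1 2 by blast
qed

text \<open>Bootstrapping: the derivative of \<open>V\<close> is the inverse Jacobian of
  \<open>U\<close> evaluated at \<open>V\<close>. If \<open>V\<close> is of class
  \<open>C^m\<close>, so is this derivative, and \<open>V\<close> is of class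
  \<open>C^(m+1)\<close>.\<close>

lemma inverse_family_aux:
  fixes U V :: "'x::topological_space \<Rightarrow> real^'n::finite \<Rightarrow> real^'n"
  assumes U: "smooth_vfamily (S \<times> ball 0 \<rho>) U"
    and inj: "\<And>a x h. a \<in> S \<Longrightarrow> x \<in> ball 0 \<rho> \<Longrightarrow>
      (\<chi> i. \<Sum>j\<in>UNIV. h $ j * partial j (\<lambda>a x. U a x $ i) a x) = 0 \<Longrightarrow> h = 0"
    and V: "\<And>a y. a \<in> S \<Longrightarrow> y \<in> ball 0 r \<Longrightarrow> V a y \<in> ball 0 \<rho> \<and> U a (V a y) = y"
    and Vc: "continuous_on (S \<times> ball 0 r) (case_prod V)"
  shows "smooth_vfamily (S \<times> ball 0 r) V"
proof -
  let ?\<Omega> = "S \<times> ball (0::real^'n) \<rho>" and ?\<Psi> = "S \<times> ball (0::real^'n) r"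
  have so: "slice_open ?\<Omega>" "slice_open ?\<Psi>" by auto
  have inv_l: "matrix_inv A ** A = mat 1" and inv_r: "A ** matrix_inv A = mat 1" if "invertible A" for A :: "real^'n^'n"
    using someI_ex[OF that[unfolded invertible_def]] by (simp_all add: matrix_inv_def)
  define M where "M a x = (\<chi> i j. partial j (\<lambda>a x. U a x $ i) a x)" for a x
  \<comment> \<open>By Cramer's rule this is the entry in row \<open>k\<close> and column
    \<open>j\<close> of the inverse of \<open>M a x\<close>.\<close>
  define N where "N k j a x = det (\<chi> i l. if l = k then axis j 1 $ i else M a x $ i $ l) * inverse (det (M a x))"
    for k j a x
  have Mv: "M a x *v h = (\<chi> i. \<Sum>j\<in>UNIV. h $ j * partial j (\<lambda>a x. U a x $ i) a x)" for a x h
    by (simp add: M_def matrix_vector_mult_def vec_eq_iff mult.commute)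
  have inv: "invertible (M a x)" if "a \<in> S" "x \<in> ball 0 \<rho>" for a x
  proof -
    have "inj ((*v) (M a x))"
    proof (rule injI)
      fix h k assume "M a x *v h = M a x *v k"
      then have "M a x *v (h - k) = 0" by (simp add: matrix_vector_mult_diff_distrib)
      then have "h - k = 0" using inj[OF that, of "h - k"] by (simp only: Mv)
      then show "h = k" by simp
    qed
    then show ?thesis using matrix_left_invertible_injective[of "M a x"] invertible_left_inverse[of "M a x"] by simp
  qed
  then have dnz: "det (M a x) \<noteq> 0" if "a \<in> S" "x \<in> ball 0 \<rho>" for a x
    using that invertible_det_nz by blast
  have MSF: "smooth_family ?\<Omega> (\<lambda>a x. M a x $ i $ j)" for i j
    unfolding M_def vec_lambda_beta by (rule smooth_family_partial) (use U in \<open>simp add: smooth_vfamily_def\<close>)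
  have NCF: "Ck_family m ?\<Omega> (N k j)" for m k j
    unfolding N_def
  proof (intro Ck_family_mult Ck_family_inverse so Ck_family_det)
    show "Ck_family m ?\<Omega> (\<lambda>a x. (\<chi> i l. if l = k then axis j 1 $ i else M a x $ i $ l) $ i $ l)" for i l
      by (cases "l = k") (simp_all add: Ck_family_const[OF so(1)] smooth_family_Ck_family[OF MSF])
    show "Ck_family m ?\<Omega> (\<lambda>a x. M a x $ i $ j)" for i j by (rule smooth_family_Ck_family[OF MSF])
  qed (use dnz in auto)
  have Vd: "((\<lambda>y. V a y $ k) has_derivative (\<lambda>h. \<Sum>j\<in>UNIV. h $ j * N k j a (V a y))) (at y)"
    if ay: "(a, y) \<in> ?\<Psi>" for a y k
  proof -
    have a: "a \<in> S" and y: "y \<in> ball 0 r" using ay by auto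
    let ?x = "V a y" let ?I = "matrix_inv (M a (V a y))"
    have x: "?x \<in> ball 0 \<rho>" using V[OF a y] by simp
    have "(U a has_derivative (\<lambda>h. M a ?x *v h)) (at ?x)"
      unfolding Mv by (rule smooth_vfamily_has_derivative[OF U]) (use a x in auto)
    moreover have "bounded_linear ((*v) ?I)" by (rule matrix_vector_mul_bounded_linear)
    moreover have "(*v) ?I \<circ> (\<lambda>h. M a ?x *v h) = id"
      by (rule ext) (simp add: matrix_vector_mul_assoc inv_l[OF inv[OF a x]])
    moreover have "continuous (at y) (V a)"
    proof -
      have "continuous_on (ball 0 r) (\<lambda>y. case_prod V (a, y))"
        by (rule continuous_on_compose2[OF Vc]) (use a in \<open>auto intro!: continuous_intros\<close>)
      then show ?thesis using y by (simp add: continuous_on_eq_continuous_at)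
    qed
    ultimately have "(V a has_derivative (*v) ?I) (at y)"
      by (rule has_derivative_inverse_basic[OF _ _ _ _ open_ball y]) (use V a in auto)
    from bounded_linear.has_derivative[OF bounded_linear_vec_nth this]
    have *: "((\<lambda>y. V a y $ k) has_derivative (\<lambda>h. (?I *v h) $ k)) (at y)" .
    have "(?I *v h) $ k = (\<Sum>j\<in>UNIV. h $ j * N k j a ?x)" for h
    proof -
      have ax: "?I *v axis j 1 = (\<chi> k. N k j a ?x)" for j
      proof -
        have "M a ?x *v (?I *v axis j 1) = axis j 1"
          by (simp add: matrix_vector_mul_assoc inv_r[OF inv[OF a x]])
        then show ?thesis
          using cramer[OF dnz[OF a x], of "?I *v axis j 1" "axis j 1"]
          by (simp add: N_def divide_inverse)
      qed
      have "?I *v h = (\<Sum>j\<in>UNIV. h $ j *\<^sub>R (?I *v axis j 1))"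
        by (rule linear_expand_axis) (rule matrix_vector_mul_linear)
      then show ?thesis by (simp add: ax)
    qed
    then show ?thesis using * by simp
  qed
  have "Ck_family m ?\<Psi> (\<lambda>a y. V a y $ k)" for m k
  proof (induction m arbitrary: k)
    case 0
    show ?case using continuous_on_component[OF Vc, of k] by (simp add: case_prod_beta)
  next
    case (Suc m)
    show ?case
    proof (rule Ck_family_SucI[OF so(2), where d = "\<lambda>j a y. N k j a (V a y)"])
      show "continuous_on ?\<Psi> (\<lambda>(a, y). V a y $ k)"
        using continuous_on_component[OF Vc, of k] by (simp add: case_prod_beta)
      show "Ck_family m ?\<Psi> (\<lambda>a y. N k j a (V a y))" for j
        by (rule Ck_family_comp[where s = "\<lambda>a. a" and V = V and u = "N k j", OF so(2) NCF Suc.IH])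
          (use V in auto)
    qed (rule Vd)
  qed
  then show ?thesis by (simp add: smooth_vfamily_def smooth_family_def)
qed

text \<open>The inverse function theorem with radii independent of the parameter. The distance from
  \<open>diag (\<mu> a)\<close> is a Lipschitz constant at most \<open>1/2\<close>, while that
  diagonal map does not shrink vectors; so \<open>U a\<close> is injective and a Newton iteration
  with the fixed slope \<open>diag (\<mu> a)\<close> converges. The last conclusion is kept for
  estimating how strongly \<open>V\<close> contracts.\<close>

lemma inverse_family:
  fixes U :: "'x::topological_space \<Rightarrow> real^'n::finite \<Rightarrow> real^'n" and \<mu> :: "'x \<Rightarrow> real^'n"
  assumes S: "compact S" and R: "R > 0" and U: "smooth_vfamily (S \<times> ball 0 R) U"
    and U0: "\<And>a. a \<in> S \<Longrightarrow> U a 0 = 0"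
    and dU: "\<And>a i j. a \<in> S \<Longrightarrow> partial j (\<lambda>a x. U a x $ i) a 0 = (if i = j then \<mu> a $ i else 0)"
    and \<mu>: "continuous_on S \<mu>" "\<And>a i. a \<in> S \<Longrightarrow> 1 \<le> \<bar>\<mu> a $ i\<bar>"
    and \<epsilon>: "0 < \<epsilon>" "\<epsilon> \<le> 1/2"
  shows "\<exists>\<rho> r V. 0 < \<rho> \<and> \<rho> < R \<and> 0 < r \<and> smooth_vfamily (S \<times> ball 0 r) V \<and>
    (\<forall>a\<in>S. \<forall>y\<in>ball 0 r. V a y \<in> ball 0 \<rho> \<and> U a (V a y) = y) \<and>
    (\<forall>a\<in>S. \<forall>x\<in>ball 0 \<rho>. U a x \<in> ball 0 r \<longrightarrow> V a (U a x) = x) \<and>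
    (\<forall>a\<in>S. \<forall>x\<in>ball 0 \<rho>. norm (U a x - diag (\<mu> a) x) \<le> \<epsilon> * norm x)"
proof -
  obtain \<rho> where \<rho>: "\<rho> > 0" "\<rho> < R" and
    D: "\<And>a x h. a \<in> S \<Longrightarrow> x \<in> ball 0 \<rho> \<Longrightarrow>
      norm ((\<chi> i. \<Sum>j\<in>UNIV. h $ j * partial j (\<lambda>a x. U a x $ i) a x) - diag (\<mu> a) h) \<le> \<epsilon> * norm h" and
    E: "\<And>a x y. a \<in> S \<Longrightarrow> x \<in> ball 0 \<rho> \<Longrightarrow> y \<in> ball 0 \<rho> \<Longrightarrow>
      norm (U a x - U a y - diag (\<mu> a) (x - y)) \<le> \<epsilon> * norm (x - y)"
    using near_diag[OF S R U dU \<mu>(1) \<epsilon>(1)] by blast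
  have L: "norm h \<le> norm (diag (\<mu> a) h)" if "a \<in> S" for a h
    using norm_diag_ge[of 1 "\<mu> a" h] \<mu>(2)[OF that] by simp
  have \<epsilon>h: "\<epsilon> * norm z \<le> norm z / 2" for z :: "real^'n"
    using mult_right_mono[OF \<epsilon>(2), of "norm z"] by simp
  have expand: "norm (x - y) \<le> 2 * norm (U a x - U a y)"
    if "a \<in> S" "x \<in> ball 0 \<rho>" "y \<in> ball 0 \<rho>" for a x y
    using E[OF that] L[OF that(1), of "x - y"] \<epsilon>h[of "x - y"]
      norm_triangle_ineq2[of "diag (\<mu> a) (x - y)" "U a x - U a y"]
    by (simp add: norm_minus_commute)
  have inj: "h = 0" if "a \<in> S" "x \<in> ball 0 \<rho>"
    "(\<chi> i. \<Sum>j\<in>UNIV. h $ j * partial j (\<lambda>a x. U a x $ i) a x) = 0" for a x h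
  proof -
    have "norm (diag (\<mu> a) h) \<le> \<epsilon> * norm h" using D[OF that(1,2), of h] unfolding that(3) by simp
    then have "norm h \<le> 0" using L[OF that(1), of h] \<epsilon>h[of h] by linarith
    then show ?thesis by simp
  qed
  \<comment> \<open>The iteration below moves \<open>0\<close> by at most \<open>r\<close> and
    halves distances; \<open>r + \<rho> / 4 \<le> \<rho> / 2\<close> then makes it preserve the
    closed ball of radius \<open>\<rho> / 2\<close>.\<close>
  define r where "r = \<rho> / 4"
  have r: "r > 0" using \<rho> by (simp add: r_def)
  have ex: "\<exists>x. x \<in> ball 0 \<rho> \<and> U a x = y" if a: "a \<in> S" and y: "y \<in> ball 0 r" for a y
  proof -
    define Li where "Li z = (\<chi> i. z $ i / \<mu> a $ i)" for z :: "real^'n"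
    have \<mu>0: "\<mu> a $ i \<noteq> 0" for i using \<mu>(2)[OF a, of i] by auto
    have DLi: "diag (\<mu> a) (Li z) = z" for z using \<mu>0 by (simp add: Li_def vec_eq_iff)
    have nLi: "norm (Li z) \<le> norm z" for z using L[OF a, of "Li z"] DLi by simp
    \<comment> \<open>A simplified Newton step for \<open>U a x = y\<close>, with the derivative
      replaced by \<open>diag (\<mu> a)\<close>, whose inverse is \<open>Li\<close>.\<close>
    define \<Phi> where "\<Phi> x = x + Li (y - U a x)" for x
    have dP: "norm (\<Phi> x - \<Phi> x') \<le> norm (x - x') / 2" if "x \<in> ball 0 \<rho>" "x' \<in> ball 0 \<rho>" for x x'
    proof -
      have "\<Phi> x - \<Phi> x' = - Li (U a x - U a x' - diag (\<mu> a) (x - x'))"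
        using \<mu>0 by (simp add: \<Phi>_def Li_def vec_eq_iff field_simps)
      then have "norm (\<Phi> x - \<Phi> x') \<le> norm (U a x - U a x' - diag (\<mu> a) (x - x'))" using nLi by simp
      also have "\<dots> \<le> norm (x - x') / 2" using E[OF a that] \<epsilon>h[of "x - x'"] by linarith
      finally show ?thesis .
    qed
    have \<Phi>0: "norm (\<Phi> 0) \<le> r" using nLi[of y] y U0[OF a] by (simp add: \<Phi>_def)
    let ?B = "cball (0::real^'n) (\<rho> / 2)"
    have sub: "?B \<subseteq> ball 0 \<rho>" using \<rho> by auto
    have "\<exists>!x\<in>?B. \<Phi> x = x"
    proof (rule Banach_fix[where c = "1/2"])
      show "\<Phi> ` ?B \<subseteq> ?B"
      proof (clarify)
        fix x assume x: "x \<in> ?B"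
        have "norm (\<Phi> x) \<le> norm (\<Phi> 0) + norm (\<Phi> x - \<Phi> 0)" by (metis add.commute diff_add_cancel norm_triangle_ineq)
        also have "\<dots> \<le> r + norm x / 2" using \<Phi>0 dP[of x 0] x \<rho> sub by (intro add_mono) auto
        also have "\<dots> \<le> \<rho> / 2" using x by (simp add: r_def)
        finally show "\<Phi> x \<in> ?B" by simp
      qed
      show "dist (\<Phi> x) (\<Phi> x') \<le> 1 / 2 * dist x x'" if "x \<in> ?B" "x' \<in> ?B" for x x'
        using dP[OF subsetD[OF sub that(1)] subsetD[OF sub that(2)]] by (simp add: dist_norm)
    qed (use \<rho> in \<open>auto simp: complete_eq_closed\<close>)
    then obtain x where x: "x \<in> ?B" "\<Phi> x = x" by auto
    then have "Li (y - U a x) = 0" by (simp add: \<Phi>_def)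
    then have "y - U a x = 0" using DLi[of "y - U a x"] by simp
    moreover have "x \<in> ball 0 \<rho>" using sub x(1) by blast
    ultimately show ?thesis by (intro exI[of _ x]) auto
  qed
  define V where "V a y = (SOME x. x \<in> ball 0 \<rho> \<and> U a x = y)" for a y
  have V: "V a y \<in> ball 0 \<rho> \<and> U a (V a y) = y" if "a \<in> S" "y \<in> ball 0 r" for a y
    unfolding V_def by (rule someI_ex[OF ex[OF that]])
  have VU: "V a (U a x) = x" if "a \<in> S" "x \<in> ball 0 \<rho>" for a x
  proof -
    have *: "V a (U a x) \<in> ball 0 \<rho> \<and> U a (V a (U a x)) = U a x"
      unfolding V_def by (rule someI[of _ x]) (use that in simp)
    then have "norm (V a (U a x) - x) \<le> 2 * norm (U a (V a (U a x)) - U a x)"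
      using expand[OF that(1) _ that(2)] by blast
    then show ?thesis using * by simp
  qed
  have Vc: "continuous_on (S \<times> ball 0 r) (case_prod V)"
    unfolding continuous_on_def
  proof
    fix z assume z: "z \<in> S \<times> ball (0::real^'n) r"
    obtain b y' where by': "z = (b, y')" by (cases z)
    have b: "b \<in> S" and y': "y' \<in> ball 0 r" using z by' by auto
    define x' where "x' = V b y'"
    have x': "x' \<in> ball 0 \<rho>" "U b x' = y'" using V[OF b y'] by (auto simp: x'_def)
    \<comment> \<open>The estimate \<open>expand\<close>, applied to \<open>V a y\<close> and the
      fixed point \<open>x'\<close>, bounds \<open>V a y - x'\<close> by \<open>k (a, y)\<close>.
      This is continuous and vanishes at \<open>z\<close>, so continuity of \<open>V\<close> in both
      variables follows from that of \<open>U\<close>.\<close>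
    define k where "k q = 2 * norm (snd q - U (fst q) x')" for q
    have "continuous_on (S \<times> ball 0 r) (\<lambda>q. case_prod U (fst q, x'))"
      by (rule continuous_on_compose2[OF smooth_vfamily_continuous[OF U]])
        (use x' \<rho> in \<open>auto intro!: continuous_intros\<close>)
    then have "continuous_on (S \<times> ball 0 r) k" unfolding k_def by (auto intro!: continuous_intros)
    then have "(k \<longlongrightarrow> k z) (at z within S \<times> ball 0 r)"
      using z unfolding continuous_on_def by (rule bspec)
    moreover have "k z = 0" using x' by (simp add: k_def by')
    ultimately have k: "(k \<longlongrightarrow> 0) (at z within S \<times> ball 0 r)" by simp
    have "\<forall>\<^sub>F q in at z within S \<times> ball 0 r. norm (case_prod V q - x') \<le> k q"
      unfolding eventually_at_topological
    proof (intro exI[of _ UNIV] conjI ballI impI)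
      fix q assume "q \<in> S \<times> ball (0::real^'n) r"
      then obtain a y where q: "q = (a, y)" "a \<in> S" "y \<in> ball 0 r" by auto
      show "norm (case_prod V q - x') \<le> k q"
        using expand[OF q(2) _ x'(1), of "V a y"] V[OF q(2,3)] q(1) by (simp add: k_def)
    qed auto
    then have "((\<lambda>q. case_prod V q - x') \<longlongrightarrow> 0) (at z within S \<times> ball 0 r)"
      using k by (rule Lim_null_comparison)
    then show "(case_prod V \<longlongrightarrow> case_prod V z) (at z within S \<times> ball 0 r)"
      by (simp add: LIM_zero_iff by' x'_def)
  qed
  have "smooth_vfamily (S \<times> ball 0 \<rho>) U" by (rule smooth_vfamily_subset[OF U]) (use \<rho> in auto)
  from inverse_family_aux[OF this inj V Vc] have "smooth_vfamily (S \<times> ball 0 r) V" .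
  moreover have "norm (U a x - diag (\<mu> a) x) \<le> \<epsilon> * norm x" if "a \<in> S" "x \<in> ball 0 \<rho>" for a x
    using E[OF that, of 0] U0[OF that(1)] \<rho> by simp
  ultimately show ?thesis using \<rho> r V VU by blast
qed

section \<open>Cohomological equations\<close>

text \<open>Unrolling the equation along \<open>t\<close> gives the series of \<open>e\<close> at
  the iterates of \<open>a\<close>, weighted with the products of \<open>\<rho>\<close>. By
  compactness \<open>\<bar>\<rho>\<bar>\<close> has a bound below 1, so the series converges
  uniformly and its sum is continuous.\<close>

lemma cohomological_contracting:
  fixes S :: "'x::topological_space set" and \<rho> e :: "'x \<Rightarrow> real"
  assumes S: "compact S" and t: "continuous_on S t" "t ` S \<subseteq> S"
    and \<rho>: "continuous_on S \<rho>" and e: "continuous_on S e" and lt: "\<And>a. a \<in> S \<Longrightarrow> \<bar>\<rho> a\<bar> < 1"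
  shows "\<exists>c. continuous_on S c \<and> (\<forall>a\<in>S. c a = e a + \<rho> a * c (t a))"
proof (cases "S = {}")
  case False
  obtain b where b: "b \<in> S" "\<And>a. a \<in> S \<Longrightarrow> \<bar>\<rho> a\<bar> \<le> \<bar>\<rho> b\<bar>"
    using continuous_attains_sup[OF S False continuous_on_rabs[OF \<rho>]] by blast
  define \<kappa> where "\<kappa> = \<bar>\<rho> b\<bar>"
  have \<kappa>: "\<kappa> \<ge> 0" "\<kappa> < 1" "\<And>a. a \<in> S \<Longrightarrow> \<bar>\<rho> a\<bar> \<le> \<kappa>" using b lt by (auto simp: \<kappa>_def)
  obtain b' where b': "b' \<in> S" "\<And>a. a \<in> S \<Longrightarrow> \<bar>e a\<bar> \<le> \<bar>e b'\<bar>"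
    using continuous_attains_sup[OF S False continuous_on_rabs[OF e]] by blast
  define f where "f N a = (\<Prod>m<N. \<rho> ((t ^^ m) a)) * e ((t ^^ N) a)" for N a
  have tS: "(t ^^ m) a \<in> S" if "a \<in> S" for m a
    using that t(2) by (induction m) auto
  have tc: "continuous_on S (t ^^ m)" for m
  proof (induction m)
    case (Suc m)
    then show ?case using continuous_on_compose2[OF t(1) Suc] tS by (auto simp: comp_def)
  qed (simp add: continuous_on_id)
  have fc: "continuous_on S (f N)" for N
    unfolding f_def
    by (intro continuous_intros continuous_on_compose2[OF \<rho> tc] continuous_on_compose2[OF e tc]) (use tS in auto)
  have fb: "norm (f N a) \<le> \<kappa> ^ N * \<bar>e b'\<bar>" if "a \<in> S" for N a
  proof -
    have "\<bar>\<Prod>m<N. \<rho> ((t ^^ m) a)\<bar> \<le> (\<Prod>m<N. \<kappa>)"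
      unfolding abs_prod by (intro prod_mono) (use \<kappa> tS[OF that] in auto)
    then show ?thesis unfolding f_def using b'(2)[OF tS[OF that]] \<kappa>
      by (simp add: abs_mult mult_mono)
  qed
  have sm: "summable (\<lambda>N. \<kappa> ^ N * \<bar>e b'\<bar>)" using \<kappa> by (intro summable_mult2 summable_geometric) auto
  define c where "c a = (\<Sum>N. f N a)" for a
  have "continuous_on S c"
    unfolding c_def
    by (rule uniform_limit_theorem[OF _ Weierstrass_m_test[OF fb sm]])
      (auto intro!: always_eventually continuous_on_sum fc)
  moreover have "c a = e a + \<rho> a * c (t a)" if a: "a \<in> S" for a
  proof -
    have s: "summable (\<lambda>N. f N a)" if "a \<in> S" for a
      by (rule summable_comparison_test'[OF sm, of 0]) (use fb[OF that] in auto)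
    have shift: "f (Suc N) a = \<rho> a * f N (t a)" for N
      unfolding f_def prod.lessThan_Suc_shift by (simp add: funpow_swap1)
    have ta: "t a \<in> S" using a t(2) by auto
    have "c a = (\<Sum>N. f (Suc N) a) + f 0 a"
      using suminf_split_head[OF s[OF a]] by (simp add: c_def)
    also have "(\<Sum>N. f (Suc N) a) = \<rho> a * c (t a)"
      unfolding shift c_def by (rule suminf_mult[OF s[OF ta]])
    finally show ?thesis by (simp add: f_def)
  qed
  ultimately show ?thesis by blast
qed auto

text \<open>If \<open>\<bar>\<rho>\<bar> > 1\<close>, the equation at \<open>s a\<close> is solved
  for the value at \<open>t (s a) = a\<close>. This is an equation of the same kind along
  \<open>s\<close>, with factor \<open>1 / \<rho> (s a)\<close> of modulus below 1.\<close>

lemma cohomological_solve: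
  fixes S :: "'x::topological_space set" and \<rho> e :: "'x \<Rightarrow> real"
  assumes S: "compact S" and t: "continuous_on S t" "t ` S \<subseteq> S" and s: "continuous_on S s" "s ` S \<subseteq> S"
    and ts: "\<And>a. a \<in> S \<Longrightarrow> t (s a) = a" "\<And>a. a \<in> S \<Longrightarrow> s (t a) = a"
    and \<rho>: "continuous_on S \<rho>" and e: "continuous_on S e"
    and ne: "(\<forall>a\<in>S. \<bar>\<rho> a\<bar> < 1) \<or> (\<forall>a\<in>S. \<bar>\<rho> a\<bar> > 1)"
  shows "\<exists>c. continuous_on S c \<and> (\<forall>a\<in>S. c a = e a + \<rho> a * c (t a))"
  using ne
proof
  assume "\<forall>a\<in>S. \<bar>\<rho> a\<bar> < 1"
  then show ?thesis using cohomological_contracting[OF S t \<rho> e] by blast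
next
  assume gt: "\<forall>a\<in>S. \<bar>\<rho> a\<bar> > 1"
  have sS: "s a \<in> S" if "a \<in> S" for a using s that by auto
  have nz: "\<rho> (s a) \<noteq> 0" if "a \<in> S" for a using gt sS[OF that] by force
  have \<rho>s: "continuous_on S (\<lambda>a. \<rho> (s a))" "continuous_on S (\<lambda>a. e (s a))"
    by (rule continuous_on_compose2[OF \<rho> s], rule continuous_on_compose2[OF e s])
  obtain c where c: "continuous_on S c" "\<And>a. a \<in> S \<Longrightarrow> c a = - e (s a) / \<rho> (s a) + inverse (\<rho> (s a)) * c (s a)"
  proof -
    have "\<exists>c. continuous_on S c \<and> (\<forall>a\<in>S. c a = - e (s a) / \<rho> (s a) + inverse (\<rho> (s a)) * c (s a))"
    proof (rule cohomological_contracting[OF S s])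
      show "\<bar>inverse (\<rho> (s a))\<bar> < 1" if "a \<in> S" for a
      proof -
        have "\<bar>\<rho> (s a)\<bar> > 1" using gt sS[OF that] by blast
        then show ?thesis unfolding abs_inverse by (rule inverse_less_1_iff[THEN iffD2, OF disjI2])
      qed
    qed (use \<rho>s nz in \<open>auto intro!: continuous_intros\<close>)
    then show ?thesis using that by blast
  qed
  have "c a = e a + \<rho> a * c (t a)" if a: "a \<in> S" for a
  proof -
    have ta: "t a \<in> S" using t(2) a by auto
    have "\<rho> a \<noteq> 0" using gt a by force
    then show ?thesis using c(2)[OF ta] ts(2)[OF a] by (simp add: field_simps)
  qed
  then show ?thesis using c(1) by blast
qed

text \<open>A maximum principle. Let \<open>\<bar>c\<bar>\<close> be largest at \<open>b\<close>. If
  \<open>\<bar>\<rho>\<bar> < 1\<close>, the equation at \<open>b\<close> makes a nonzero maximum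
  smaller than itself; if \<open>\<bar>\<rho>\<bar> > 1\<close>, the equation at \<open>s b\<close>
  gives a larger value there.\<close>

lemma cohomological_unique:
  fixes S :: "'x::topological_space set" and \<rho> c :: "'x \<Rightarrow> real"
  assumes S: "compact S" and t: "t ` S \<subseteq> S" "s ` S \<subseteq> S"
    and ts: "\<And>a. a \<in> S \<Longrightarrow> t (s a) = a" and cc: "continuous_on S c"
    and eq: "\<And>a. a \<in> S \<Longrightarrow> c a = \<rho> a * c (t a)"
    and ne: "(\<forall>a\<in>S. \<bar>\<rho> a\<bar> < 1) \<or> (\<forall>a\<in>S. \<bar>\<rho> a\<bar> > 1)" and a: "a \<in> S"
  shows "c a = 0"
proof -
  obtain b where b: "b \<in> S" "\<And>a. a \<in> S \<Longrightarrow> \<bar>c a\<bar> \<le> \<bar>c b\<bar>"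
    using continuous_attains_sup[OF S _ continuous_on_rabs[OF cc]] a by blast
  have "\<bar>c b\<bar> \<le> 0"
    using ne
  proof
    assume lt: "\<forall>a\<in>S. \<bar>\<rho> a\<bar> < 1"
    have tb: "t b \<in> S" using b t by auto
    show ?thesis
    proof (rule ccontr)
      assume "\<not> \<bar>c b\<bar> \<le> 0"
      then have pos: "\<bar>c b\<bar> > 0" by simp
      have "\<bar>c b\<bar> = \<bar>\<rho> b\<bar> * \<bar>c (t b)\<bar>" using eq[OF b(1)] by (simp add: abs_mult)
      also have "\<dots> \<le> \<bar>\<rho> b\<bar> * \<bar>c b\<bar>" using b(2)[OF tb] by (intro mult_left_mono) auto
      also have "\<dots> < 1 * \<bar>c b\<bar>" using lt b(1) pos by (intro mult_strict_right_mono) auto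
      finally show False by simp
    qed
  next
    assume gt: "\<forall>a\<in>S. \<bar>\<rho> a\<bar> > 1"
    have sb: "s b \<in> S" using b t by auto
    show ?thesis
    proof (rule ccontr)
      assume "\<not> \<bar>c b\<bar> \<le> 0"
      then have "1 * \<bar>c b\<bar> < \<bar>\<rho> (s b)\<bar> * \<bar>c b\<bar>" using gt sb by (intro mult_strict_right_mono) auto
      also have "\<dots> = \<bar>c (s b)\<bar>" using eq[OF sb] ts[OF b(1)] by (simp add: abs_mult)
      finally show False using b(2)[OF sb] by simp
    qed
  qed
  then show ?thesis using b(2)[OF a] by simp
qed

section \<open>Eigenfunctions of a contracting cocycle\<close>

text \<open>Used with \<open>I\<close> the set of words of length at most \<open>k\<close>, to
  obtain one constant for all derivatives up to order \<open>k\<close>.\<close>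

lemma finite_common_bound:
  fixes P :: "'i \<Rightarrow> real \<Rightarrow> bool"
  assumes "finite I" "\<And>i. i \<in> I \<Longrightarrow> \<exists>C\<ge>0. P i C" "\<And>i C D. P i C \<Longrightarrow> C \<le> D \<Longrightarrow> P i D"
  shows "\<exists>C\<ge>0. \<forall>i\<in>I. P i C"
proof -
  define c where "c i = (SOME C. 0 \<le> C \<and> P i C)" for i
  have c: "0 \<le> c i \<and> P i (c i)" if "i \<in> I" for i
    unfolding c_def by (rule someI_ex[OF assms(2)[OF that, simplified]])
  have "P i (\<Sum>i\<in>I. c i)" if "i \<in> I" for i
  proof -
    have "c i \<le> (\<Sum>i\<in>I. c i)"
      by (rule member_le_sum[OF that]) (simp_all add: c assms(1))
    then show ?thesis by (rule assms(3)[OF conjunct2[OF c[OF that]]])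
  qed
  moreover have "0 \<le> (\<Sum>i\<in>I. c i)" by (rule sum_nonneg) (simp add: c)
  ultimately show ?thesis by auto
qed

lemma finite_words: "finite {vs::'n::finite list. length vs \<le> k}"
  using finite_lists_length_le[of "UNIV::'n set" k] by simp

section \<open>Normalized monomials and termwise differentiation of series\<close>

lemma smooth_family_power: "slice_open \<Omega> \<Longrightarrow> smooth_family \<Omega> u \<Longrightarrow> smooth_family \<Omega> (\<lambda>a x. u a x ^ n)"
  by (induction n) (auto intro: smooth_family_const smooth_family_mult)

lemma partial_line:
  assumes "smooth_family \<Omega> u" "(a, x) \<in> \<Omega>"
    and "((\<lambda>s. u a (x + s *\<^sub>R axis j 1)) has_real_derivative d) (at 0)"
  shows "partial j u a x = d"
proof -
  have "((\<lambda>s. u a (x + s *\<^sub>R axis j 1)) has_real_derivative partial j u a (x + 0 *\<^sub>R axis j 1)) (at 0)"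
    by (rule has_real_derivative_line[OF assms(1)]) (use assms(2) in simp)
  from DERIV_unique[OF this assms(3)] show ?thesis by simp
qed

text \<open>Division by the factorials makes these monomials dual to the derivatives at
  \<open>0\<close>: differentiation along a word removes its letters from \<open>M\<close> without
  producing a factor.\<close>

definition mset_monom :: "'n::finite multiset \<Rightarrow> real^'n \<Rightarrow> real" where
  "mset_monom M x = (\<Prod>j\<in>UNIV. x $ j ^ count M j / fact (count M j))"

lemma smooth_family_mset_monom: "slice_open \<Omega> \<Longrightarrow> smooth_family \<Omega> (\<lambda>a. mset_monom M)"
  unfolding mset_monom_def[abs_def] divide_inverse
  by (intro smooth_family_prod smooth_family_mult smooth_family_power smooth_family_coord smooth_family_const) auto

lemma mset_monom_zero: "mset_monom M 0 = (if M = {#} then 1 else 0)"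
proof (cases "M = {#}")
  case False
  then obtain j where "j \<in># M" by blast
  then have "\<exists>j\<in>UNIV. (0::real^'a) $ j ^ count M j / fact (count M j) = 0"
    by (intro bexI[of _ j]) (auto simp: power_0_left)
  from prod_zero[OF finite this] show ?thesis using False by (simp only: mset_monom_def if_False)
qed (simp add: mset_monom_def)

lemma partial_mset_monom:
  fixes M :: "'n::finite multiset"
  shows "partial j (\<lambda>_::'x::topological_space. mset_monom M) a x = (if j \<in># M then mset_monom (M - {#j#}) x else 0)"
proof (rule partial_line[of UNIV])
  let ?K = "\<Prod>i\<in>UNIV - {j}. x $ i ^ count M i / fact (count M i)"
  let ?c = "count M j"
  have ax: "(x + s *\<^sub>R axis j 1) $ i = (if i = j then x $ j + s else x $ i)" for s i
    by (simp add: axis_def)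
  have split: "mset_monom N y = (y $ j ^ count N j / fact (count N j)) * (\<Prod>i\<in>UNIV - {j}. y $ i ^ count N i / fact (count N i))" for N :: "'n multiset" and y
    unfolding mset_monom_def by (rule prod.remove) auto
  have *: "mset_monom M (x + s *\<^sub>R axis j 1) = (x $ j + s) ^ ?c / fact ?c * ?K" for s
    unfolding split ax by (intro arg_cong2[where f = "(*)"] prod.cong) auto
  have "((\<lambda>s. (x $ j + s) ^ ?c / fact ?c * ?K) has_real_derivative
      of_nat ?c * (x $ j + 0) ^ (?c - 1) / fact ?c * ?K) (at 0)"
    by (auto intro!: derivative_eq_intros)
  moreover have "of_nat ?c * (x $ j + 0) ^ (?c - 1) / fact ?c * ?K = (if j \<in># M then mset_monom (M - {#j#}) x else 0)"
  proof (cases "j \<in># M")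
    case True
    then obtain c' where c': "?c = Suc c'" by (metis count_greater_zero_iff gr0_implies_Suc)
    have "mset_monom (M - {#j#}) x = (x $ j) ^ c' / fact c' * ?K"
      unfolding split using c' by (intro arg_cong2[where f = "(*)"] prod.cong) auto
    moreover have "fact (Suc c') = real (Suc c') * fact c'" by (rule fact_Suc)
    ultimately show ?thesis using True unfolding c' by (simp del: of_nat_Suc fact_Suc)
  qed (simp add: not_in_iff[symmetric])
  ultimately show "((\<lambda>s. mset_monom M (x + s *\<^sub>R axis j 1)) has_real_derivative
     (if j \<in># M then mset_monom (M - {#j#}) x else 0)) (at 0)" unfolding * by simp
qed (simp_all add: smooth_family_mset_monom slice_open_def)

lemma partials_mset_monom:
  fixes M :: "'n::finite multiset"
  shows "partials vs (\<lambda>_::'x::topological_space. mset_monom M) = (\<lambda>_ x. if mset vs \<subseteq># M then mset_monom (M - mset vs) x else 0)"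
proof (induction vs)
  case (Cons j vs)
  show ?case
  proof (intro ext)
    fix a :: 'x and x :: "real^'n"
    have step: "j \<in># M - N \<longleftrightarrow> add_mset j N \<subseteq># M" if "N \<subseteq># M" for N
      using that by (auto simp: subseteq_mset_def in_diff_count Suc_le_eq split: if_splits)
    show "partials (j # vs) (\<lambda>_::'x. mset_monom M) a x
      = (if mset (j # vs) \<subseteq># M then mset_monom (M - mset (j # vs)) x else 0)"
    proof (cases "mset vs \<subseteq># M")
      case True
      then have "partials (j # vs) (\<lambda>_::'x. mset_monom M) a x = partial j (\<lambda>_::'x. mset_monom (M - mset vs)) a x"
        using Cons.IH by simp
      also have "\<dots> = (if j \<in># M - mset vs then mset_monom (M - mset vs - {#j#}) x else 0)"
        by (rule partial_mset_monom)
      also have "M - mset vs - {#j#} = M - mset (j # vs)" by simp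
      finally show ?thesis by (simp only: step[OF True] mset.simps)
    next
      case False
      moreover have "\<not> add_mset j (mset vs) \<subseteq># M"
        using False subset_mset.order_trans[of "mset vs" "add_mset j (mset vs)" M] by auto
      ultimately show ?thesis by (simp only: partials.simps Cons.IH if_False mset.simps partial_param)
    qed
  qed
qed simp

text \<open>One summable majorant for all derivatives up to order \<open>k\<close> lets the series
  be differentiated term by term. In the induction the differentiated series falls under the same
  hypothesis, with words extended by \<open>j\<close> on the right.\<close>

lemma Ck_family_suminf:
  fixes w :: "nat \<Rightarrow> 'x::topological_space \<Rightarrow> real^'n::finite \<Rightarrow> real"
  assumes K: "summable K" and w: "\<And>N. smooth_family (S \<times> ball 0 \<rho>) (w N)"
    and b: "\<And>vs N a x. length vs \<le> k \<Longrightarrow> a \<in> S \<Longrightarrow> x \<in> ball 0 \<rho> \<Longrightarrow> \<bar>partials vs (w N) a x\<bar> \<le> K N"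
  shows "Ck_family k (S \<times> ball 0 \<rho>) (\<lambda>a x. \<Sum>N. w N a x)"
  using w b
proof (induction k arbitrary: w)
  have cont: "continuous_on (S \<times> ball 0 \<rho>) (\<lambda>z. \<Sum>N. w N (fst z) (snd z))"
    if w: "\<And>N. smooth_family (S \<times> ball 0 \<rho>) (w N)"
      and b: "\<And>N a x. a \<in> S \<Longrightarrow> x \<in> ball 0 \<rho> \<Longrightarrow> \<bar>w N a x\<bar> \<le> K N"
    for w :: "nat \<Rightarrow> 'x \<Rightarrow> real^'n \<Rightarrow> real"
  proof (rule uniform_limit_theorem)
    show "uniform_limit (S \<times> ball 0 \<rho>) (\<lambda>n z. \<Sum>N<n. w N (fst z) (snd z)) (\<lambda>z. \<Sum>N. w N (fst z) (snd z)) sequentially"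
      by (rule Weierstrass_m_test[OF _ K]) (use b in auto)
    show "\<forall>\<^sub>F n in sequentially. continuous_on (S \<times> ball 0 \<rho>) (\<lambda>z. \<Sum>N<n. w N (fst z) (snd z))"
      by (intro always_eventually allI continuous_on_sum)
        (use smooth_family_continuous[OF w] in \<open>simp add: case_prod_beta\<close>)
  qed auto
  {
    case 0
    then show ?case using cont[of w] 0(2)[of "[]"] by (simp add: case_prod_beta)
  next
    case (Suc k)
    have b0: "\<bar>w N a x\<bar> \<le> K N" if "a \<in> S" "x \<in> ball 0 \<rho>" for N a x
      using Suc.prems(2)[of "[]" a x N] that by simp
    have b1: "\<bar>partial j (w N) a x\<bar> \<le> K N" if "a \<in> S" "x \<in> ball 0 \<rho>" for j N a x
      using Suc.prems(2)[of "[j]" a x N] that by simp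
    show ?case
    proof (rule Ck_family_SucI[where d = "\<lambda>j a x. \<Sum>N. partial j (w N) a x"])
      show "continuous_on (S \<times> ball 0 \<rho>) (\<lambda>(a, x). \<Sum>N. w N a x)"
        using cont[of w, OF Suc.prems(1) b0] by (simp add: case_prod_beta)
      show "Ck_family k (S \<times> ball 0 \<rho>) (\<lambda>a x. \<Sum>N. partial j (w N) a x)" for j
      proof (rule Suc.IH)
        show "smooth_family (S \<times> ball 0 \<rho>) (partial j (w N))" for N by (rule smooth_family_partial[OF Suc.prems(1)])
        show "\<bar>partials vs (partial j (w N)) a x\<bar> \<le> K N" if "length vs \<le> k" "a \<in> S" "x \<in> ball 0 \<rho>" for vs N a x
          using Suc.prems(2)[of "vs @ [j]" a x N] that by (simp add: partials_append)
      qed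
      fix a x assume "(a, x) \<in> S \<times> ball (0::real^'n) \<rho>"
      then have a: "a \<in> S" and x: "x \<in> ball 0 \<rho>" by auto
      let ?g = "\<lambda>x h. \<Sum>j\<in>UNIV. h $ j * (\<Sum>N. partial j (w N) a x)"
      have "\<exists>g. \<forall>x\<in>ball 0 \<rho>. (\<lambda>n. w n a x) sums g x \<and> (g has_derivative ?g x) (at x within ball 0 \<rho>)"
      proof (rule has_derivative_series[OF convex_ball _ _ x])
        show "(w n a has_derivative (\<lambda>h. \<Sum>j\<in>UNIV. h $ j * partial j (w n) a y)) (at y within ball 0 \<rho>)"
          if "y \<in> ball 0 \<rho>" for n y
          by (rule has_derivative_at_withinI[OF smooth_family_has_derivative[OF Suc.prems(1)]]) (use that a in auto)
        show "(\<lambda>n. w n a x) sums (\<Sum>n. w n a x)"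
          by (rule summable_sums, rule summable_comparison_test'[OF K, of 0]) (use b0[OF a x] in auto)
        fix e :: real assume e: "e > 0"
        \<comment> \<open>The admissible error \<open>e\<close> is shared among the partial
          derivatives, one for each coordinate.\<close>
        define e' where "e' = e / real CARD('n)"
        have e': "e' > 0" using e by (simp add: e'_def)
        have "uniform_limit (ball 0 \<rho>) (\<lambda>n y. \<Sum>N<n. partial j (w N) a y) (\<lambda>y. \<Sum>N. partial j (w N) a y) sequentially" for j
          by (rule Weierstrass_m_test[OF _ K]) (use b1[OF a] in auto)
        then have "\<forall>\<^sub>F n in sequentially. \<forall>y\<in>ball 0 \<rho>. dist (\<Sum>N<n. partial j (w N) a y) (\<Sum>N. partial j (w N) a y) < e'" for j
          using e' by (rule uniform_limitD)
        then have "\<forall>\<^sub>F n in sequentially. \<forall>j\<in>UNIV. \<forall>y\<in>ball 0 \<rho>. dist (\<Sum>N<n. partial j (w N) a y) (\<Sum>N. partial j (w N) a y) < e'"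
          by (intro eventually_ball_finite) auto
        then show "\<forall>\<^sub>F n in sequentially. \<forall>y\<in>ball 0 \<rho>. \<forall>h.
            norm ((\<Sum>i<n. \<Sum>j\<in>UNIV. h $ j * partial j (w i) a y) - ?g y h) \<le> e * norm h"
        proof (rule eventually_mono, intro ballI allI)
          fix n and y h :: "real^'n"
          assume n: "\<forall>j\<in>UNIV. \<forall>y\<in>ball 0 \<rho>. dist (\<Sum>N<n. partial j (w N) a y) (\<Sum>N. partial j (w N) a y) < e'" and y: "y \<in> ball 0 \<rho>"
          have "(\<Sum>i<n. \<Sum>j\<in>UNIV. h $ j * partial j (w i) a y) - ?g y h
            = (\<Sum>j\<in>UNIV. h $ j * ((\<Sum>N<n. partial j (w N) a y) - (\<Sum>N. partial j (w N) a y)))"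
            by (subst sum.swap) (simp add: sum_subtractf right_diff_distrib sum_distrib_left)
          also have "norm \<dots> \<le> (\<Sum>j\<in>(UNIV::'n set). norm h * e')"
          proof (rule sum_norm_le)
            fix j
            have "\<bar>(\<Sum>N<n. partial j (w N) a y) - (\<Sum>N. partial j (w N) a y)\<bar> \<le> e'"
              using n[rule_format, of j y] y by (simp add: dist_real_def)
            then show "norm (h $ j * ((\<Sum>N<n. partial j (w N) a y) - (\<Sum>N. partial j (w N) a y))) \<le> norm h * e'"
              unfolding real_norm_def abs_mult
              by (intro mult_mono component_le_norm_cart[of h j, unfolded real_norm_def]) auto
          qed
          also have "\<dots> = e * norm h" by (simp add: e'_def)
          finally show "norm ((\<Sum>i<n. \<Sum>j\<in>UNIV. h $ j * partial j (w i) a y) - ?g y h) \<le> e * norm h" .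
        qed
      qed
      then obtain g where g: "\<forall>x\<in>ball 0 \<rho>. (\<lambda>n. w n a x) sums g x \<and> (g has_derivative ?g x) (at x within ball 0 \<rho>)"
        by (rule exE)
      have "(g has_derivative ?g x) (at x)"
        using conjunct2[OF bspec[OF g x]] unfolding at_within_open[OF x open_ball] .
      moreover have "g y = (\<Sum>N. w N a y)" if "y \<in> ball 0 \<rho>" for y
        by (rule sums_unique[OF conjunct1[OF bspec[OF g that]]])
      ultimately show "((\<lambda>x. \<Sum>N. w N a x) has_derivative ?g x) (at x)"
        by (rule has_derivative_transform_within_open[OF _ open_ball x])
    qed simp
  }
qed

text \<open>\<open>f a\<close> maps the fibre over \<open>a\<close> into the fibre over
  \<open>t a\<close>, that is, backwards along \<open>s\<close>. The bound \<open>R \<le> 1\<close>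
  lets higher powers of \<open>norm x\<close> be estimated by lower ones. \<open>nonres\<close> is
  stated for words of directions, the indexing of derivatives used by
  \<open>partials\<close>.\<close>

locale contraction_cocycle =
  fixes S :: "'x::topological_space set" and s t :: "'x \<Rightarrow> 'x" and R \<theta> :: real
    and f :: "'x \<Rightarrow> real^'n::finite \<Rightarrow> real^'n" and \<nu> :: "'x \<Rightarrow> real^'n" and m :: "'x \<Rightarrow> real"
  assumes compact_S: "compact S" and t_cont: "continuous_on S t" and t_S: "t ` S \<subseteq> S"
    and s_cont: "continuous_on S s" and s_S: "s ` S \<subseteq> S"
    and ts: "\<And>a. a \<in> S \<Longrightarrow> t (s a) = a" and st: "\<And>a. a \<in> S \<Longrightarrow> s (t a) = a"
    and R_pos: "R > 0" and R_le1: "R \<le> 1" and \<theta>: "0 < \<theta>" "\<theta> < 1"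
    and f_smooth_vfamily: "smooth_vfamily (S \<times> ball 0 R) f"
    and f_contr: "\<And>a x. a \<in> S \<Longrightarrow> x \<in> ball 0 R \<Longrightarrow> norm (f a x) \<le> \<theta> * norm x"
    and df: "\<And>a i j. a \<in> S \<Longrightarrow> partial j (\<lambda>a x. f a x $ i) a 0 = (if i = j then \<nu> a $ i else 0)"
    and m_cont: "continuous_on S m"
    and \<nu>_cont: "continuous_on S \<nu>"
    and nonres: "\<And>vs. 2 \<le> length vs \<Longrightarrow> (\<forall>a\<in>S. \<bar>m a * prod_list (map (($) (\<nu> a)) vs)\<bar> < 1)
      \<or> (\<forall>a\<in>S. \<bar>m a * prod_list (map (($) (\<nu> a)) vs)\<bar> > 1)"
begin

abbreviation "\<Omega> \<equiv> S \<times> ball (0::real^'n) R"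

definition T :: "('x \<Rightarrow> real^'n \<Rightarrow> real) \<Rightarrow> 'x \<Rightarrow> real^'n \<Rightarrow> real" where
  "T u a x = m a * u (t a) (f a x)"

lemma so: "slice_open \<Omega>" by simp

lemma tS: "a \<in> S \<Longrightarrow> t a \<in> S" using t_S by auto

lemma f_ball: "a \<in> S \<Longrightarrow> norm x < r \<Longrightarrow> r \<le> R \<Longrightarrow> norm (f a x) < r"
  using f_contr[of a x] mult_right_mono[of \<theta> 1 "norm x"] \<theta> by force

lemma f_cball: "a \<in> S \<Longrightarrow> norm x \<le> r \<Longrightarrow> r < R \<Longrightarrow> norm (f a x) \<le> r"
  using f_contr[of a x] mult_right_mono[of \<theta> 1 "norm x"] \<theta> by force

lemma f0: "a \<in> S \<Longrightarrow> f a 0 = 0"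
  using f_contr[of a 0] R_pos by simp

lemma skew_im: "(a, x) \<in> \<Omega> \<Longrightarrow> (t a, f a x) \<in> \<Omega>"
  using tS f_ball[of a x R] by auto

lemma fst_\<Omega>: "continuous_on S c \<Longrightarrow> continuous_on (fst ` \<Omega>) c"
  by (rule continuous_on_subset) auto

lemma smooth_family_skew: "smooth_family \<Omega> u \<Longrightarrow> smooth_family \<Omega> (\<lambda>a x. u (t a) (f a x))"
  by (rule smooth_family_comp[where \<Psi> = \<Omega> and u = u and s = t and V = f, OF so _ f_smooth_vfamily fst_\<Omega>[OF t_cont] skew_im])

lemma smooth_family_m: "smooth_family \<Omega> (\<lambda>a x. m a)"
  by (rule smooth_family_param[OF so fst_\<Omega>[OF m_cont]])

lemma smooth_family_T: "smooth_family \<Omega> u \<Longrightarrow> smooth_family \<Omega> (T u)"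
  unfolding T_def[abs_def] by (rule smooth_family_mult[OF so smooth_family_m smooth_family_skew])

lemma smooth_family_f: "smooth_family \<Omega> (\<lambda>a x. f a x $ i)" using f_smooth_vfamily by (simp add: smooth_vfamily_def)

text \<open>The last letter of a word is differentiated first. The product and chain rules then
  yield terms of the original shape, a multiplier times a function composed with the cocycle, so
  that inductions over words run from the right with the multiplier arbitrary.\<close>

lemma partials_step:
  assumes M: "smooth_family \<Omega> M" and u: "smooth_family \<Omega> u" and ax: "(a, x) \<in> \<Omega>"
  shows "partials (vs @ [j]) (\<lambda>a x. M a x * u (t a) (f a x)) a x
    = partials vs (\<lambda>a x. partial j M a x * u (t a) (f a x)) a x
      + (\<Sum>i\<in>UNIV. partials vs (\<lambda>a x. (M a x * partial j (\<lambda>a x. f a x $ i) a x) * partial i u (t a) (f a x)) a x)"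
proof -
  have S1: "smooth_family \<Omega> (\<lambda>a x. partial j M a x * u (t a) (f a x))"
    by (rule smooth_family_mult[OF so smooth_family_partial[OF M] smooth_family_skew[OF u]])
  have S2: "smooth_family \<Omega> (\<lambda>a x. (M a x * partial j (\<lambda>a x. f a x $ i) a x) * partial i u (t a) (f a x))" for i
    by (rule smooth_family_mult[OF so smooth_family_mult[OF so M smooth_family_partial[OF smooth_family_f]] smooth_family_skew[OF smooth_family_partial[OF u]]])
  have e: "partial j (\<lambda>a x. M a x * u (t a) (f a x)) a x = partial j M a x * u (t a) (f a x)
      + (\<Sum>i\<in>UNIV. (M a x * partial j (\<lambda>a x. f a x $ i) a x) * partial i u (t a) (f a x))"
    if ax: "(a, x) \<in> \<Omega>" for a x
    unfolding partial_mult[OF M smooth_family_skew[OF u] ax] partial_comp[where u = u and V = f and s = t and \<Psi> = \<Omega> and \<Omega> = \<Omega> and a = a and x = x, OF u f_smooth_vfamily ax skew_im[OF ax]]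
    by (simp add: sum_distrib_left mult_ac)
  have "partials (vs @ [j]) (\<lambda>a x. M a x * u (t a) (f a x)) a x
    = partials vs (partial j (\<lambda>a x. M a x * u (t a) (f a x))) a x" by (simp add: partials_append)
  also have "\<dots> = partials vs (\<lambda>a x. partial j M a x * u (t a) (f a x)
      + (\<Sum>i\<in>UNIV. (M a x * partial j (\<lambda>a x. f a x $ i) a x) * partial i u (t a) (f a x))) a x"
    by (rule partials_cong[OF so e ax])
  also have "\<dots> = partials vs (\<lambda>a x. partial j M a x * u (t a) (f a x)) a x
      + partials vs (\<lambda>a x. \<Sum>i\<in>UNIV. (M a x * partial j (\<lambda>a x. f a x $ i) a x) * partial i u (t a) (f a x)) a x"
    by (rule partials_add[OF so S1 smooth_family_sum[OF so S2] ax])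
  also have "partials vs (\<lambda>a x. \<Sum>i\<in>UNIV. (M a x * partial j (\<lambda>a x. f a x $ i) a x) * partial i u (t a) (f a x)) a x
      = (\<Sum>i\<in>UNIV. partials vs (\<lambda>a x. (M a x * partial j (\<lambda>a x. f a x $ i) a x) * partial i u (t a) (f a x)) a x)"
    by (rule partials_sum[OF so S2 ax])
  finally show ?thesis .
qed

lemma bounded_cball:
  assumes u: "smooth_family \<Omega> u" and \<rho>: "\<rho> < R"
  shows "\<exists>B\<ge>0. \<forall>a\<in>S. \<forall>x\<in>cball 0 \<rho>. \<bar>u a x\<bar> \<le> B"
proof -
  have "continuous_on (S \<times> cball 0 \<rho>) (case_prod u)"
    by (rule continuous_on_subset[OF smooth_family_continuous[OF u]]) (use \<rho> in auto)
  then have "compact (case_prod u ` (S \<times> cball 0 \<rho>))"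
    by (rule compact_continuous_image) (intro compact_Times compact_S compact_cball)
  from compact_imp_bounded[OF this, unfolded bounded_iff]
  obtain B where B: "\<forall>y\<in>case_prod u ` (S \<times> cball 0 \<rho>). norm y \<le> B" by (rule exE)
  have "\<bar>u a x\<bar> \<le> \<bar>B\<bar>" if "a \<in> S" "x \<in> cball 0 \<rho>" for a x
    using bspec[OF B imageI[of "(a, x)" "S \<times> cball 0 \<rho>" "case_prod u"]] that by simp
  then show ?thesis by (intro exI[of _ "\<bar>B\<bar>"]) simp
qed

text \<open>An estimate in place of the formula of Faa di Bruno: a derivative of the composed
  function is bounded by the derivatives of \<open>u\<close> of no higher order at the image point.
  The essential point is that \<open>B\<close> is chosen before \<open>u\<close>.\<close>

lemma partials_bound:
  assumes \<rho>: "\<rho> < R" and M: "smooth_family \<Omega> M"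
  shows "\<exists>B\<ge>0. \<forall>u. smooth_family \<Omega> u \<longrightarrow> (\<forall>a\<in>S. \<forall>x\<in>cball 0 \<rho>. \<forall>C.
    (\<forall>ws. length ws \<le> length vs \<longrightarrow> \<bar>partials ws u (t a) (f a x)\<bar> \<le> C) \<longrightarrow>
    \<bar>partials vs (\<lambda>a x. M a x * u (t a) (f a x)) a x\<bar> \<le> B * C)"
  using M
proof (induction vs arbitrary: M rule: rev_induct)
  case Nil
  from bounded_cball[OF Nil \<rho>]
  obtain B where B: "B \<ge> 0" "\<forall>a\<in>S. \<forall>x\<in>cball 0 \<rho>. \<bar>M a x\<bar> \<le> B" by (elim exE conjE)
  show ?case
  proof (intro exI[of _ B] conjI allI ballI impI)
    fix u a x C
    assume a: "a \<in> S" "x \<in> cball (0::real^'n) \<rho>"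
      and C: "\<forall>ws. length ws \<le> length ([]::'n list) \<longrightarrow> \<bar>partials ws u (t a) (f a x)\<bar> \<le> C"
    show "\<bar>partials [] (\<lambda>a x. M a x * u (t a) (f a x)) a x\<bar> \<le> B * C"
      using C[rule_format, of "[]"] B(1) B(2)[rule_format, OF a] by (simp add: abs_mult mult_mono)
  qed (rule B)
next
  case (snoc j vs)
  define Mi where "Mi i a x = M a x * partial j (\<lambda>a x. f a x $ i) a x" for i a x
  have Mi: "smooth_family \<Omega> (Mi i)" for i
    unfolding Mi_def[abs_def] by (rule smooth_family_mult[OF so snoc.prems smooth_family_partial[OF smooth_family_f]])
  from snoc.IH[OF smooth_family_partial[OF snoc.prems, of j]]
  obtain B0 where B0: "B0 \<ge> 0" and B0': "\<forall>u. smooth_family \<Omega> u \<longrightarrow> (\<forall>a\<in>S. \<forall>x\<in>cball 0 \<rho>. \<forall>C.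
    (\<forall>ws. length ws \<le> length vs \<longrightarrow> \<bar>partials ws u (t a) (f a x)\<bar> \<le> C) \<longrightarrow>
    \<bar>partials vs (\<lambda>a x. partial j M a x * u (t a) (f a x)) a x\<bar> \<le> B0 * C)" by (elim exE conjE)
  have "\<forall>i. \<exists>B. B \<ge> 0 \<and> (\<forall>u. smooth_family \<Omega> u \<longrightarrow> (\<forall>a\<in>S. \<forall>x\<in>cball 0 \<rho>. \<forall>C.
    (\<forall>ws. length ws \<le> length vs \<longrightarrow> \<bar>partials ws u (t a) (f a x)\<bar> \<le> C) \<longrightarrow>
    \<bar>partials vs (\<lambda>a x. Mi i a x * u (t a) (f a x)) a x\<bar> \<le> B * C))"
    by (rule allI, rule snoc.IH[OF Mi])
  from choice[OF this] obtain B where B: "\<forall>i. B i \<ge> 0 \<and> (\<forall>u. smooth_family \<Omega> u \<longrightarrow> (\<forall>a\<in>S. \<forall>x\<in>cball 0 \<rho>. \<forall>C.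
    (\<forall>ws. length ws \<le> length vs \<longrightarrow> \<bar>partials ws u (t a) (f a x)\<bar> \<le> C) \<longrightarrow>
    \<bar>partials vs (\<lambda>a x. Mi i a x * u (t a) (f a x)) a x\<bar> \<le> B i * C))" by (rule exE)
  show ?case
  proof (intro exI[of _ "B0 + (\<Sum>i\<in>UNIV. B i)"] conjI allI ballI impI)
    show "0 \<le> B0 + (\<Sum>i\<in>UNIV. B i)" using B0 B by (simp add: sum_nonneg)
    fix u a x C
    assume u: "smooth_family \<Omega> u" and a: "a \<in> S" and x: "x \<in> cball (0::real^'n) \<rho>"
      and C: "\<forall>ws. length ws \<le> length (vs @ [j]) \<longrightarrow> \<bar>partials ws u (t a) (f a x)\<bar> \<le> C"
    have ax: "(a, x) \<in> \<Omega>" using a x \<rho> by auto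
    have 1: "\<bar>partials vs (\<lambda>a x. partial j M a x * u (t a) (f a x)) a x\<bar> \<le> B0 * C"
      by (rule B0'[rule_format, OF u a x]) (use C in simp)
    have 2: "\<bar>partials vs (\<lambda>a x. Mi i a x * partial i u (t a) (f a x)) a x\<bar> \<le> B i * C" for i
    proof -
      have "\<bar>partials ws (partial i u) (t a) (f a x)\<bar> \<le> C" if "length ws \<le> length vs" for ws
        using C[rule_format, of "ws @ [i]"] that by (simp add: partials_append)
      then show ?thesis
        by (intro conjunct2[OF spec[OF B, of i], rule_format, OF smooth_family_partial[OF u] a x])
    qed
    have "\<bar>partials (vs @ [j]) (\<lambda>a x. M a x * u (t a) (f a x)) a x\<bar>
      \<le> \<bar>partials vs (\<lambda>a x. partial j M a x * u (t a) (f a x)) a x\<bar>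
        + (\<Sum>i\<in>UNIV. \<bar>partials vs (\<lambda>a x. Mi i a x * partial i u (t a) (f a x)) a x\<bar>)"
      unfolding partials_step[OF snoc.prems u ax] Mi_def
      by (intro order_trans[OF abs_triangle_ineq] add_left_mono sum_abs)
    also have "\<dots> \<le> B0 * C + (\<Sum>i\<in>UNIV. B i * C)" by (intro add_mono sum_mono 1 2)
    finally show "\<bar>partials (vs @ [j]) (\<lambda>a x. M a x * u (t a) (f a x)) a x\<bar> \<le> (B0 + (\<Sum>i\<in>UNIV. B i)) * C"
      by (simp add: distrib_right sum_distrib_right)
  qed
qed

text \<open>\<open>u\<close> vanishes to order \<open>q\<close> at the origin: derivatives of order less than \<open>q\<close> are zero.\<close>

definition flat :: "nat \<Rightarrow> ('x \<Rightarrow> real^'n \<Rightarrow> real) \<Rightarrow> bool" where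
  "flat q u \<longleftrightarrow> (\<forall>ws. length ws < q \<longrightarrow> (\<forall>a\<in>S. partials ws u a 0 = 0))"

lemma flatD: "flat q u \<Longrightarrow> length ws < q \<Longrightarrow> a \<in> S \<Longrightarrow> partials ws u a 0 = 0"
  by (simp add: flat_def)

lemma flat_partials: "flat q u \<Longrightarrow> flat (q - length vs) (partials vs u)"
  by (auto simp: flat_def simp flip: partials_append)

text \<open>As the lower derivatives of \<open>u\<close> vanish at \<open>0\<close>, only the term
  survives in which every derivative hits \<open>u\<close> and never a multiplier. Since
  \<open>Df\<close> is diagonal at \<open>0\<close>, each letter of the word contributes its own
  \<open>\<nu>\<close>.\<close>

lemma partials_at_zero:
  assumes M: "smooth_family \<Omega> M" and u: "smooth_family \<Omega> u" and fl: "flat (length vs) u" and a: "a \<in> S"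
  shows "partials vs (\<lambda>a x. M a x * u (t a) (f a x)) a 0
    = M a 0 * prod_list (map (($) (\<nu> a)) vs) * partials vs u (t a) 0"
  using M u fl
proof (induction vs arbitrary: M u rule: rev_induct)
  case Nil
  then show ?case by (simp add: f0[OF a])
next
  case (snoc j vs)
  have a0: "(a, 0) \<in> \<Omega>" using a R_pos by simp
  have flu: "flat (length vs) u" using snoc.prems(3) by (simp add: flat_def)
  have fli: "flat (length vs) (partial i u)" for i
    using flat_partials[OF snoc.prems(3), of "[i]"] by simp
  have Mi: "smooth_family \<Omega> (\<lambda>a x. M a x * partial j (\<lambda>a x. f a x $ i) a x)" for i
    by (rule smooth_family_mult[OF so snoc.prems(1) smooth_family_partial[OF smooth_family_f]])
  have 0: "partials vs u (t a) 0 = 0" using flatD[OF snoc.prems(3), of vs "t a"] tS[OF a] by simp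
  have "partials (vs @ [j]) (\<lambda>a x. M a x * u (t a) (f a x)) a 0
    = partial j M a 0 * prod_list (map (($) (\<nu> a)) vs) * partials vs u (t a) 0
      + (\<Sum>i\<in>UNIV. M a 0 * partial j (\<lambda>a x. f a x $ i) a 0 * prod_list (map (($) (\<nu> a)) vs) * partials vs (partial i u) (t a) 0)"
    unfolding partials_step[OF snoc.prems(1,2) a0]
    by (intro arg_cong2[where f = "(+)"] sum.cong refl snoc.IH[OF smooth_family_partial[OF snoc.prems(1)] snoc.prems(2) flu]
      snoc.IH[OF Mi smooth_family_partial[OF snoc.prems(2)] fli])
  also have "\<dots> = (\<Sum>i\<in>UNIV. if i = j then M a 0 * \<nu> a $ i * prod_list (map (($) (\<nu> a)) vs) * partials vs (partial i u) (t a) 0 else 0)"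
    unfolding 0 df[OF a] mult_zero_right add_0 by (rule sum.cong) auto
  also have "\<dots> = M a 0 * prod_list (map (($) (\<nu> a)) (vs @ [j])) * partials (vs @ [j]) u (t a) 0"
    by (simp add: partials_append mult_ac)
  finally show ?case .
qed

text \<open>Taylor's estimate without a Taylor formula: the gradient is flat to one order less, and
  the mean value inequality recovers the lost power of \<open>norm x\<close>.\<close>

lemma flat_pointwise:
  assumes \<rho>: "\<rho> < R" and u: "smooth_family \<Omega> u" and fl: "flat q u"
  shows "\<exists>C\<ge>0. \<forall>a\<in>S. \<forall>x\<in>cball 0 \<rho>. \<bar>u a x\<bar> \<le> C * norm x ^ q"
  using u fl
proof (induction q arbitrary: u)
  case 0
  show ?case using bounded_cball[OF 0(1) \<rho>] by simp
next
  case (Suc q)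
  have "\<exists>C\<ge>0. \<forall>a\<in>S. \<forall>x\<in>cball 0 \<rho>. \<bar>partial j u a x\<bar> \<le> C * norm x ^ q" for j
    by (rule Suc.IH[OF smooth_family_partial[OF Suc.prems(1)]]) (use flat_partials[OF Suc.prems(2), of "[j]"] in simp)
  then have "\<forall>j. \<exists>C. C \<ge> 0 \<and> (\<forall>a\<in>S. \<forall>x\<in>cball 0 \<rho>. \<bar>partial j u a x\<bar> \<le> C * norm x ^ q)" by (rule allI)
  from choice[OF this] obtain C where
    C': "\<forall>j. C j \<ge> 0 \<and> (\<forall>a\<in>S. \<forall>x\<in>cball 0 \<rho>. \<bar>partial j u a x\<bar> \<le> C j * norm x ^ q)" by (rule exE)
  have C: "C j \<ge> 0" "a \<in> S \<Longrightarrow> x \<in> cball 0 \<rho> \<Longrightarrow> \<bar>partial j u a x\<bar> \<le> C j * norm x ^ q" for j a x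
    using spec[OF C', of j] by auto
  define D where "D = (\<Sum>j\<in>UNIV. C j)"
  have D: "D \<ge> 0" unfolding D_def by (rule sum_nonneg) (rule C)
  have "\<bar>u a x\<bar> \<le> D * norm x ^ Suc q" if a: "a \<in> S" and x: "x \<in> cball 0 \<rho>" for a x
  proof -
    have "norm (u a x - u a 0) \<le> (D * norm x ^ q) * norm (x - 0)"
    \<comment> \<open>The ball of radius \<open>norm x\<close> is taken instead of the one of radius
      \<open>\<rho>\<close>: on it the gradient is bounded by \<open>norm x ^ q\<close>.\<close>
    proof (rule differentiable_bound[OF convex_cball[of 0 "norm x"]])
      fix y assume y: "y \<in> cball (0::real^'n) (norm x)"
      then have y': "(a, y) \<in> \<Omega>" "y \<in> cball 0 \<rho>" using x \<rho> a by auto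
      show "(u a has_derivative (\<lambda>h. \<Sum>j\<in>UNIV. h $ j * partial j u a y)) (at y within cball 0 (norm x))"
        by (rule has_derivative_at_withinI[OF smooth_family_has_derivative[OF Suc.prems(1) y'(1)]])
      show "onorm (\<lambda>h. \<Sum>j\<in>UNIV. h $ j * partial j u a y) \<le> D * norm x ^ q"
      proof (rule onorm_le)
        fix h :: "real^'n"
        have "norm (\<Sum>j\<in>UNIV. h $ j * partial j u a y) \<le> (\<Sum>j\<in>UNIV. norm h * (C j * norm x ^ q))"
        proof (rule sum_norm_le)
          fix j
          have "\<bar>partial j u a y\<bar> \<le> C j * norm x ^ q"
            by (rule order_trans[OF C(2)[OF a y'(2)]]) (use y C(1) in \<open>intro mult_left_mono power_mono, auto\<close>)
          then show "norm (h $ j * partial j u a y) \<le> norm h * (C j * norm x ^ q)"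
            unfolding real_norm_def abs_mult
            by (intro mult_mono component_le_norm_cart[of h j, unfolded real_norm_def]) auto
        qed
        then show "norm (\<Sum>j\<in>UNIV. h $ j * partial j u a y) \<le> D * norm x ^ q * norm h"
          by (simp add: D_def sum_distrib_left sum_distrib_right mult_ac)
      qed
    qed auto
    moreover have "u a 0 = 0" using flatD[OF Suc.prems(2), of "[]" a] a by simp
    ultimately show ?thesis by (simp add: mult_ac)
  qed
  then show ?case using D by blast
qed

text \<open>A word of length at most \<open>k\<close> costs at most \<open>k\<close> orders of
  vanishing; the common exponent \<open>q - k\<close> is admissible for shorter words too because
  \<open>norm x \<le> 1\<close>.\<close>

lemma flat_bounds:
  assumes \<rho>: "\<rho> < R" and u: "smooth_family \<Omega> u" and fl: "flat q u"
  shows "\<exists>C\<ge>0. \<forall>vs. length vs \<le> k \<longrightarrow> (\<forall>a\<in>S. \<forall>x\<in>cball 0 \<rho>. \<bar>partials vs u a x\<bar> \<le> C * norm x ^ (q - k))"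
proof -
  have "\<exists>C\<ge>0. \<forall>vs\<in>{vs. length vs \<le> k}. \<forall>a\<in>S. \<forall>x\<in>cball 0 \<rho>. \<bar>partials vs u a x\<bar> \<le> C * norm x ^ (q - k)"
  proof (rule finite_common_bound[OF finite_words])
    fix vs :: "'n list" assume vs: "vs \<in> {vs. length vs \<le> k}"
    from flat_pointwise[OF \<rho> smooth_family_partials[OF u, of vs] flat_partials[OF fl, of vs]]
    obtain C where C: "C \<ge> 0" "\<forall>a\<in>S. \<forall>x\<in>cball 0 \<rho>. \<bar>partials vs u a x\<bar> \<le> C * norm x ^ (q - length vs)"
      by (elim exE conjE)
    have "\<bar>partials vs u a x\<bar> \<le> C * norm x ^ (q - k)" if "a \<in> S" "x \<in> cball 0 \<rho>" for a x
    proof -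
      have "norm x ^ (q - length vs) \<le> norm x ^ (q - k)"
        using vs that \<rho> R_le1 by (intro power_decreasing) auto
      from mult_left_mono[OF this C(1)] show ?thesis using C(2)[rule_format, OF that] by linarith
    qed
    then show "\<exists>C\<ge>0. \<forall>a\<in>S. \<forall>x\<in>cball 0 \<rho>. \<bar>partials vs u a x\<bar> \<le> C * norm x ^ (q - k)" using C(1) by (intro exI[of _ C]) simp
  next
    fix vs :: "'n list" and C D :: real
    assume C: "\<forall>a\<in>S. \<forall>x\<in>cball 0 \<rho>. \<bar>partials vs u a x\<bar> \<le> C * norm x ^ (q - k)" and CD: "C \<le> D"
    show "\<forall>a\<in>S. \<forall>x\<in>cball 0 \<rho>. \<bar>partials vs u a x\<bar> \<le> D * norm x ^ (q - k)"
    proof (intro ballI)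
      fix a x assume "a \<in> S" "x \<in> cball (0::real^'n) \<rho>"
      from C[rule_format, OF this] mult_right_mono[OF CD, of "norm x ^ (q - k)"]
      show "\<bar>partials vs u a x\<bar> \<le> D * norm x ^ (q - k)" by simp
    qed
  qed
  then show ?thesis by simp
qed

end

lemma has_derivative_zero_of_quadratic:
  fixes w :: "real^'n::finite \<Rightarrow> real"
  assumes \<rho>: "\<rho> > 0" and C: "C \<ge> 0" and b: "\<And>x. x \<in> ball 0 \<rho> \<Longrightarrow> \<bar>w x\<bar> \<le> C * norm x ^ 2"
  shows "(w has_derivative (\<lambda>h. 0)) (at 0)"
  unfolding has_derivative_at_alt
proof (intro conjI allI impI)
  have w0: "w 0 = 0" using b[of 0] \<rho> by simp
  fix e :: real assume e: "e > 0"
  define d where "d = min \<rho> (e / (C + 1))"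
  have d: "d > 0" using \<rho> C e by (simp add: d_def)
  have "norm (w y - w 0 - 0) \<le> e * norm (y - 0)" if y: "norm (y - 0) < d" for y
  proof -
    have y1: "norm y < \<rho>" "norm y < e / (C + 1)" using y by (auto simp: d_def)
    have "C * norm y \<le> (C + 1) * norm y" by (simp add: mult_right_mono)
    also have "\<dots> \<le> e" using y1(2) C by (simp add: pos_less_divide_eq mult.commute)
    finally have "C * norm y * norm y \<le> e * norm y" by (rule mult_right_mono) simp
    then show ?thesis using b[of y] y1 w0 by (simp add: power2_eq_square mult.assoc)
  qed
  then show "\<exists>d>0. \<forall>y. norm (y - 0) < d \<longrightarrow> norm (w y - w 0 - 0) \<le> e * norm (y - 0)"
    using d by (intro exI[of _ d]) simp
qed simp

section \<open>Fixed points of the operator: iteration, uniqueness, existence\<close>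

context contraction_cocycle
begin

lemma m_bounded: "\<exists>mb\<ge>0. \<forall>a\<in>S. \<bar>m a\<bar> \<le> mb"
  using bounded_cball[OF smooth_family_m, of 0] R_pos by simp

text \<open>Beyond this order the contraction of \<open>f\<close> beats the multiplier \<open>m\<close>.\<close>

lemma ex_contraction_order: "\<exists>Q mb. Q \<ge> 2 \<and> mb \<ge> 0 \<and> (\<forall>a\<in>S. \<bar>m a\<bar> \<le> mb) \<and> mb * \<theta> ^ Q < 1"
proof -
  obtain mb where mb: "mb \<ge> 0" "\<forall>a\<in>S. \<bar>m a\<bar> \<le> mb" using m_bounded by (elim exE conjE)
  obtain n where n: "\<theta> ^ n < 1 / (mb + 1)" using real_arch_pow_inv[of "1 / (mb + 1)" \<theta>] \<theta> mb(1) by auto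
  have "\<theta> ^ (n + 2) \<le> \<theta> ^ n" using \<theta> by (intro power_decreasing) auto
  then have "\<theta> ^ (n + 2) < 1 / (mb + 1)" using n by linarith
  then have "(mb + 1) * \<theta> ^ (n + 2) < 1" using mb(1) by (simp add: pos_less_divide_eq mult.commute)
  moreover have "mb * \<theta> ^ (n + 2) \<le> (mb + 1) * \<theta> ^ (n + 2)" using \<theta> by (intro mult_right_mono) auto
  ultimately have "mb * \<theta> ^ (n + 2) < 1" by linarith
  then show ?thesis using mb by (intro exI[of _ "n + 2"] exI[of _ mb]) simp
qed

text \<open>Each application of \<open>T\<close> costs at most the factor \<open>B\<close> in the
  derivatives and gains \<open>\<theta> ^ p\<close> from
  \<open>norm (f a x) \<le> \<theta> * norm x\<close>; the ball is mapped into itself, so this can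
  be iterated. \<open>B\<close> depends on \<open>k\<close> and \<open>\<rho>\<close> but is chosen
  before \<open>p\<close>, which can therefore be taken so large that
  \<open>B * \<theta> ^ p < 1\<close>.\<close>

lemma T_iter_bound:
  assumes \<rho>: "\<rho> < R"
  shows "\<exists>B\<ge>0. \<forall>b C p. smooth_family \<Omega> b \<longrightarrow> C \<ge> 0 \<longrightarrow>
    (\<forall>vs. length vs \<le> k \<longrightarrow> (\<forall>a\<in>S. \<forall>x\<in>cball 0 \<rho>. \<bar>partials vs b a x\<bar> \<le> C * norm x ^ p)) \<longrightarrow>
    (\<forall>N vs. length vs \<le> k \<longrightarrow> (\<forall>a\<in>S. \<forall>x\<in>cball 0 \<rho>. \<bar>partials vs ((T ^^ N) b) a x\<bar> \<le> C * (B * \<theta> ^ p) ^ N * norm x ^ p))"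
proof -
  define P where "P vs B \<longleftrightarrow> (\<forall>u. smooth_family \<Omega> u \<longrightarrow> (\<forall>a\<in>S. \<forall>x\<in>cball 0 \<rho>. \<forall>C.
    (\<forall>ws. length ws \<le> length vs \<longrightarrow> \<bar>partials ws u (t a) (f a x)\<bar> \<le> C) \<longrightarrow> \<bar>partials vs (T u) a x\<bar> \<le> B * C))" for vs B
  have "\<exists>B\<ge>0. \<forall>vs\<in>{vs. length vs \<le> k}. P vs B"
  proof (rule finite_common_bound[OF finite_words])
    fix vs :: "'n list"
    show "\<exists>B\<ge>0. P vs B" unfolding P_def T_def[abs_def] by (rule partials_bound[OF \<rho> smooth_family_m])
  next
    fix vs C D assume P: "P vs C" and CD: "C \<le> D"
    show "P vs D"
      unfolding P_def
    proof (intro allI impI ballI)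
      fix u a x c assume u: "smooth_family \<Omega> u" "a \<in> S" "x \<in> cball (0::real^'n) \<rho>"
        and c: "\<forall>ws. length ws \<le> length vs \<longrightarrow> \<bar>partials ws u (t a) (f a x)\<bar> \<le> c"
      have "c \<ge> 0" using c[rule_format, of "[]"] by simp
      from mult_right_mono[OF CD this] P[unfolded P_def, rule_format, OF u c[rule_format]]
      show "\<bar>partials vs (T u) a x\<bar> \<le> D * c" by simp
    qed
  qed
  then obtain B where B: "B \<ge> 0" "\<forall>vs\<in>{vs. length vs \<le> k}. P vs B" by (elim exE conjE)
  show ?thesis
  proof (intro exI[of _ B] conjI allI impI)
    fix b C p N vs
    assume b: "smooth_family \<Omega> b" and C: "(0::real) \<le> C"
      and bd: "\<forall>vs. length vs \<le> k \<longrightarrow> (\<forall>a\<in>S. \<forall>x\<in>cball 0 \<rho>. \<bar>partials vs b a x\<bar> \<le> C * norm x ^ p)"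
      and vs: "length (vs :: 'n list) \<le> k"
    have SFN: "smooth_family \<Omega> ((T ^^ N) b)" for N
      by (induction N) (simp_all add: b smooth_family_T)
    show "\<forall>a\<in>S. \<forall>x\<in>cball 0 \<rho>. \<bar>partials vs ((T ^^ N) b) a x\<bar> \<le> C * (B * \<theta> ^ p) ^ N * norm x ^ p"
      using vs
    proof (induction N arbitrary: vs)
      case 0
      then show ?case using bd by simp
    next
      case (Suc N)
      show ?case
      proof (intro ballI)
        fix a x assume a: "a \<in> S" and x: "x \<in> cball (0::real^'n) \<rho>"
        define c where "c = C * (B * \<theta> ^ p) ^ N * norm (f a x) ^ p"
        have fx: "f a x \<in> cball 0 \<rho>" using f_cball[OF a _ \<rho>, of x] x by simp
        have "\<bar>partials ws ((T ^^ N) b) (t a) (f a x)\<bar> \<le> c" if "length ws \<le> length vs" for ws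
          unfolding c_def by (rule Suc.IH[rule_format, OF _ tS[OF a] fx]) (use that Suc.prems in simp)
        from bspec[OF B(2), of vs, unfolded P_def, rule_format, OF _ SFN a x this]
        have "\<bar>partials vs (T ((T ^^ N) b)) a x\<bar> \<le> B * c" using Suc.prems by simp
        also have "norm (f a x) ^ p \<le> (\<theta> * norm x) ^ p"
          by (rule power_mono[OF f_contr[OF a]]) (use x \<rho> in auto)
        then have "B * c \<le> B * (C * (B * \<theta> ^ p) ^ N * (\<theta> * norm x) ^ p)"
          unfolding c_def using B(1) C \<theta> by (intro mult_left_mono) auto
        also have "\<dots> = C * (B * \<theta> ^ p) ^ Suc N * norm x ^ p" by (simp add: power_mult_distrib mult_ac)
        finally show "\<bar>partials vs ((T ^^ Suc N) b) a x\<bar> \<le> C * (B * \<theta> ^ p) ^ Suc N * norm x ^ p" by simp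
      qed
    qed
  qed (rule B(1))
qed

text \<open>A fixed point equals its image under every iterate of \<open>T\<close>, and these images
  shrink by \<open>mb * \<theta> ^ Q\<close> at each step. Only pointwise bounds enter, so fixed
  points of different regularity can be compared.\<close>

lemma fixed_point_zero:
  assumes \<rho>: "\<rho> \<le> R" and mb: "mb \<ge> 0" "\<forall>a\<in>S. \<bar>m a\<bar> \<le> mb" "mb * \<theta> ^ Q < 1" and C: "C \<ge> 0"
    and fp: "\<And>a x. a \<in> S \<Longrightarrow> x \<in> ball 0 \<rho> \<Longrightarrow> w a x = T w a x"
    and bd: "\<And>a x. a \<in> S \<Longrightarrow> x \<in> ball 0 \<rho> \<Longrightarrow> \<bar>w a x\<bar> \<le> C * norm x ^ Q"
    and a: "a \<in> S" and x: "x \<in> ball 0 \<rho>"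
  shows "w a x = 0"
proof -
  have key: "\<bar>w a x\<bar> \<le> (mb * \<theta> ^ Q) ^ N * (C * norm x ^ Q)" if "a \<in> S" "x \<in> ball 0 \<rho>" for N a x
    using that
  proof (induction N arbitrary: a x)
    case 0
    then show ?case using bd[OF 0] by simp
  next
    case (Suc N)
    have fx: "f a x \<in> ball 0 \<rho>" using f_ball[OF Suc.prems(1) _ \<rho>, of x] Suc.prems(2) by simp
    have q: "0 \<le> (mb * \<theta> ^ Q) ^ N" using mb \<theta> by simp
    have "\<bar>w a x\<bar> = \<bar>m a\<bar> * \<bar>w (t a) (f a x)\<bar>"
      using fp[OF Suc.prems] by (simp add: T_def abs_mult)
    also have "\<dots> \<le> mb * ((mb * \<theta> ^ Q) ^ N * (C * norm (f a x) ^ Q))"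
      by (intro mult_mono Suc.IH tS fx) (use mb Suc.prems in auto)
    also have "norm (f a x) ^ Q \<le> (\<theta> * norm x) ^ Q"
      by (rule power_mono[OF f_contr[OF Suc.prems(1)]]) (use Suc.prems \<rho> in auto)
    then have "mb * ((mb * \<theta> ^ Q) ^ N * (C * norm (f a x) ^ Q)) \<le> mb * ((mb * \<theta> ^ Q) ^ N * (C * (\<theta> * norm x) ^ Q))"
      by (intro mult_left_mono C q mb)
    also have "\<dots> = (mb * \<theta> ^ Q) ^ Suc N * (C * norm x ^ Q)" by (simp add: power_mult_distrib mult_ac)
    finally show ?case .
  qed
  note le = key[OF a x]
  have "(\<lambda>N. (mb * \<theta> ^ Q) ^ N * (C * norm x ^ Q)) \<longlonglongrightarrow> 0 * (C * norm x ^ Q)"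
    by (intro tendsto_mult tendsto_const LIMSEQ_realpow_zero) (use mb \<theta> in auto)
  from LIMSEQ_le_const[OF this, of "\<bar>w a x\<bar>"] le show ?thesis by simp
qed

lemma cont_at_zero: "smooth_family \<Omega> u \<Longrightarrow> continuous_on S (\<lambda>a. u a 0)"
  using continuous_on_compose2[OF smooth_family_continuous[of \<Omega> u], of S "\<lambda>a. (a, 0)"] R_pos
  by (simp add: continuous_on_Pair image_subset_iff)

lemma \<nu>prod_cont: "continuous_on S (\<lambda>a. m a * prod_list (map (($) (\<nu> a)) vs))"
proof -
  have "continuous_on S (\<lambda>a. prod_list (map (($) (\<nu> a)) vs))"
    by (induction vs) (auto intro!: continuous_on_mult continuous_on_component \<nu>_cont)
  then show ?thesis by (intro continuous_on_mult m_cont)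
qed

lemma partials_T_zero:
  assumes "smooth_family \<Omega> u" "flat (length vs) u" "a \<in> S"
  shows "partials vs (T u) a 0 = (m a * prod_list (map (($) (\<nu> a)) vs)) * partials vs u (t a) 0"
  unfolding T_def[abs_def] by (rule partials_at_zero[OF smooth_family_m assms])

text \<open>The order of flatness is raised one step at a time: the lowest derivatives that may be
  nonzero satisfy a homogeneous cohomological equation, whose only continuous solution is zero. Once
  the order \<open>Q\<close> is reached, the pointwise contraction takes over.\<close>

lemma flat_unique:
  assumes \<rho>: "\<rho> < R" and w: "smooth_family \<Omega> w" and fl: "flat 2 w"
    and fp: "\<And>a x. (a, x) \<in> \<Omega> \<Longrightarrow> w a x = T w a x"
    and a: "a \<in> S" and x: "x \<in> ball 0 \<rho>"
  shows "w a x = 0"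
proof -
  have flat: "flat (d + 2) w" for d
  proof (induction d)
    case (Suc d)
    have "partials ws w a 0 = 0" if ws: "length ws = d + 2" and a: "a \<in> S" for ws a
    proof (rule cohomological_unique[OF compact_S t_S s_S ts cont_at_zero[OF smooth_family_partials[OF w]] _ _ a,
          where \<rho> = "\<lambda>a. m a * prod_list (map (($) (\<nu> a)) ws)"])
      fix a assume a: "a \<in> S"
      then have "partials ws w a 0 = partials ws (T w) a 0" using R_pos by (intro partials_cong[OF so fp]) auto
      also have "\<dots> = (m a * prod_list (map (($) (\<nu> a)) ws)) * partials ws w (t a) 0"
        by (rule partials_T_zero[OF w _ a]) (use Suc ws in simp)
      finally show "partials ws w a 0 = (m a * prod_list (map (($) (\<nu> a)) ws)) * partials ws w (t a) 0" .
    qed (use nonres[of ws] ws in auto)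
    then show ?case using Suc unfolding flat_def by (metis add_Suc less_Suc_eq)
  qed (use fl in \<open>simp add: numeral_2_eq_2\<close>)
  obtain Q mb where Q: "Q \<ge> 2" "mb \<ge> 0" "\<forall>a\<in>S. \<bar>m a\<bar> \<le> mb" "mb * \<theta> ^ Q < 1"
    using ex_contraction_order by (elim exE conjE)
  have "flat Q w" using flat[of "Q - 2"] unfolding le_add_diff_inverse2[OF Q(1)] .
  from flat_pointwise[OF \<rho> w this]
  obtain C where C: "C \<ge> 0" "\<forall>a\<in>S. \<forall>x\<in>cball 0 \<rho>. \<bar>w a x\<bar> \<le> C * norm x ^ Q" by (elim exE conjE)
  show ?thesis
    by (rule fixed_point_zero[where w = w, OF _ Q(2-4) C(1) _ _ a x]) (use \<rho> C(2) in \<open>auto intro: fp\<close>)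
qed

text \<open>The error \<open>e\<close> is flat to order \<open>q\<close>, and adding
  \<open>h\<close> changes it by \<open>T h - h\<close>. For \<open>h\<close> homogeneous of degree
  \<open>q\<close> with coefficients \<open>c\<close>, the derivatives of order \<open>q\<close>
  cancel exactly when \<open>c\<close> solves the cohomological equation whose right-hand side is
  the derivative of \<open>e\<close>.\<close>

lemma jet_step:
  assumes p: "smooth_family \<Omega> p" and q: "q \<ge> 2" and fl: "flat q (\<lambda>a x. T p a x - p a x)"
  shows "\<exists>h. smooth_family \<Omega> h \<and> flat q h \<and>
    flat (Suc q) (\<lambda>a x. T (\<lambda>a x. p a x + h a x) a x - (p a x + h a x))"
proof -
  define e where "e = (\<lambda>a x. T p a x - p a x)"
  have eS: "smooth_family \<Omega> e" unfolding e_def by (rule smooth_family_diff[OF so smooth_family_T[OF p] p])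
  \<comment> \<open>One word per multiset: there is one unknown coefficient for each monomial, not
    for each word.\<close>
  define rep where "rep M = (SOME vs. mset vs = M)" for M :: "'n multiset"
  have rep: "mset (rep M) = M" for M unfolding rep_def by (rule someI_ex[OF ex_mset])
  define \<rho> where "\<rho> M a = m a * prod_list (map (($) (\<nu> a)) (rep M))" for M a
  have "\<exists>c. continuous_on S c \<and> (\<forall>a\<in>S. c a = partials (rep M) e a 0 + \<rho> M a * c (t a))" if "size M = q" for M
  proof (rule cohomological_solve[OF compact_S t_cont t_S s_cont s_S ts st])
    show "continuous_on S (\<rho> M)" unfolding \<rho>_def by (rule \<nu>prod_cont)
    show "continuous_on S (\<lambda>a. partials (rep M) e a 0)" by (rule cont_at_zero[OF smooth_family_partials[OF eS]])
    have "length (rep M) = q" using rep[of M] that size_mset[of "rep M"] by simp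
    then show "(\<forall>a\<in>S. \<bar>\<rho> M a\<bar> < 1) \<or> (\<forall>a\<in>S. 1 < \<bar>\<rho> M a\<bar>)"
      unfolding \<rho>_def using nonres[of "rep M"] q by simp
  qed
  then have "\<forall>M. \<exists>c. size M = q \<longrightarrow> continuous_on S c \<and> (\<forall>a\<in>S. c a = partials (rep M) e a 0 + \<rho> M a * c (t a))"
    by blast
  from choice[OF this] obtain c where
    c': "\<forall>M. size M = q \<longrightarrow> continuous_on S (c M) \<and> (\<forall>a\<in>S. c M a = partials (rep M) e a 0 + \<rho> M a * c M (t a))"
    by (rule exE)
  define I where "I = mset ` {vs::'n list. length vs = q}"
  have I: "finite I" unfolding I_def
    by (rule finite_imageI, rule finite_subset[OF _ finite_words[of q]]) auto
  have Iq: "M \<in> I \<longleftrightarrow> size M = q" for M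
    unfolding I_def using ex_mset[of M] by auto
  define h where "h a x = (\<Sum>M\<in>I. c M a * mset_monom M x)" for a x
  have hM: "smooth_family \<Omega> (\<lambda>a x. c M a * mset_monom M x)" if "M \<in> I" for M
    by (intro smooth_family_mult[OF so smooth_family_param[OF so fst_\<Omega>] smooth_family_mset_monom[OF so]]) (use c' that Iq in auto)
  have hS: "smooth_family \<Omega> h" unfolding h_def[abs_def] by (rule smooth_family_sum[OF so hM])
  have wdh: "partials vs h a 0 = (if length vs = q then c (mset vs) a else 0)"
    if vs: "length vs \<le> q" and a: "a \<in> S" for vs a
  proof -
    have a0: "(a, 0) \<in> \<Omega>" using a R_pos by simp
    have "partials vs h a 0 = (\<Sum>M\<in>I. partials vs (\<lambda>a x. c M a * mset_monom M x) a 0)"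
      unfolding h_def[abs_def] by (rule partials_sum[OF so hM a0])
    also have "\<dots> = (\<Sum>M\<in>I. if M = mset vs then c M a else 0)"
    proof (rule sum.cong[OF refl])
      fix M assume M: "M \<in> I"
      have cM: "continuous_on (fst ` \<Omega>) (c M)" by (rule fst_\<Omega>) (use c' M Iq in auto)
      have "partials vs (\<lambda>a x. c M a * mset_monom M x) a 0 = c M a * partials vs (\<lambda>_. mset_monom M) a 0"
        by (rule partials_cmult[OF so smooth_family_mset_monom[OF so] cM a0])
      also have "partials vs (\<lambda>_::'x. mset_monom M) a 0 = (if M = mset vs then 1 else 0)"
      proof -
        have "mset vs \<subseteq># M \<and> M - mset vs = {#} \<longleftrightarrow> M = mset vs"
          by (metis Diff_eq_empty_iff_mset subset_mset.antisym subset_mset.order_refl)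
        then show ?thesis unfolding partials_mset_monom mset_monom_zero by auto
      qed
      finally show "partials vs (\<lambda>a x. c M a * mset_monom M x) a 0 = (if M = mset vs then c M a else 0)" by simp
    qed
    also have "\<dots> = (if length vs = q then c (mset vs) a else 0)"
      using I Iq[of "mset vs"] by (simp add: sum.delta)
    finally show ?thesis .
  qed
  have hfl: "flat q h" unfolding flat_def using wdh by simp
  have TE: "T (\<lambda>a x. p a x + h a x) a x - (p a x + h a x) = e a x + (T h a x - h a x)" for a x
    by (simp add: T_def e_def algebra_simps)
  have "partials vs (\<lambda>a x. e a x + (T h a x - h a x)) a 0 = 0" if vs: "length vs < Suc q" and a: "a \<in> S" for vs a
  proof -
    have a0: "(a, 0) \<in> \<Omega>" using a R_pos by simp
    have flv: "flat (length vs) h" using hfl vs by (simp add: flat_def)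
    have "partials vs (\<lambda>a x. e a x + (T h a x - h a x)) a 0 = partials vs e a 0 + (partials vs (T h) a 0 - partials vs h a 0)"
      unfolding partials_add[OF so eS smooth_family_diff[OF so smooth_family_T[OF hS] hS] a0] partials_diff[OF so smooth_family_T[OF hS] hS a0] ..
    also have "partials vs (T h) a 0 = (m a * prod_list (map (($) (\<nu> a)) vs)) * partials vs h (t a) 0"
      by (rule partials_T_zero[OF hS flv a])
    finally have eq: "partials vs (\<lambda>a x. e a x + (T h a x - h a x)) a 0
      = partials vs e a 0 + ((m a * prod_list (map (($) (\<nu> a)) vs)) * partials vs h (t a) 0 - partials vs h a 0)" .
    show ?thesis
    proof (cases "length vs = q")
      case False
      then have "length vs < q" using vs by simp
      then have "partials vs e a 0 = 0" using flatD[OF fl _ a] unfolding e_def by simp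
      then show ?thesis unfolding eq using wdh[of vs a] wdh[of vs "t a"] a tS[OF a] False vs by simp
    next
      case True
      \<comment> \<open>The coefficient was determined from the representative word only; symmetry
        of the derivatives of \<open>e\<close> and commutativity of the product of the
        \<open>\<nu>\<close> transfer the equation to every rearrangement.\<close>
      have 1: "partials vs e a 0 = partials (rep (mset vs)) e a 0"
        by (rule partials_mset[OF so eS a0]) (simp add: rep)
      have "prod_list (map (($) (\<nu> a)) vs) = prod_mset (image_mset (($) (\<nu> a)) (mset vs))" for vs
        by (simp add: prod_mset_prod_list[symmetric])
      then have 2: "m a * prod_list (map (($) (\<nu> a)) vs) = \<rho> (mset vs) a" unfolding \<rho>_def by (simp add: rep)
      have "c (mset vs) a = partials (rep (mset vs)) e a 0 + \<rho> (mset vs) a * c (mset vs) (t a)"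
        using c'[rule_format, of "mset vs"] True a by simp
      then show ?thesis unfolding eq 1 2 using wdh[of vs a] wdh[of vs "t a"] a tS[OF a] True by simp
    qed
  qed
  then have "flat (Suc q) (\<lambda>a x. T (\<lambda>a x. p a x + h a x) a x - (p a x + h a x))"
    unfolding TE flat_def by simp
  then show ?thesis using hS hfl by (intro exI[of _ h] conjI)
qed

lemma flat_add:
  assumes "smooth_family \<Omega> u" "smooth_family \<Omega> v" "flat q u" "flat q v"
  shows "flat q (\<lambda>a x. u a x + v a x)"
  unfolding flat_def
proof (intro allI impI ballI)
  fix ws :: "'n list" and a assume ws: "length ws < q" and a: "a \<in> S"
  have "partials ws (\<lambda>a x. u a x + v a x) a 0 = partials ws u a 0 + partials ws v a 0"
    by (rule partials_add[OF so assms(1,2)]) (use a R_pos in simp)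
  then show "partials ws (\<lambda>a x. u a x + v a x) a 0 = 0"
    using flatD[OF assms(3) ws a] flatD[OF assms(4) ws a] by simp
qed

lemma flat_mono: "flat q u \<Longrightarrow> q' \<le> q \<Longrightarrow> flat q' u"
  by (simp add: flat_def)

lemma flat2I:
  assumes "\<And>a. a \<in> S \<Longrightarrow> u a 0 = 0" "\<And>a j. a \<in> S \<Longrightarrow> partial j u a 0 = 0"
  shows "flat 2 u"
  unfolding flat_def
proof (intro allI impI ballI)
  fix ws :: "'n list" and a assume "length ws < 2" and a: "a \<in> S"
  then have "ws = [] \<or> (\<exists>j. ws = [j])" by (cases ws) auto
  then show "partials ws u a 0 = 0" using assms a by auto
qed

text \<open>By \<open>m * \<nu>_i0 = 1\<close> the coordinate function solves the equation to first
  order, which starts the recursion at order 2; hence the shift in \<open>q + 2\<close>. All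
  corrections are flat to order at least 2 and leave the linear part unchanged.\<close>

lemma jets:
  assumes i0: "\<And>a. a \<in> S \<Longrightarrow> m a * \<nu> a $ i0 = 1"
  shows "\<exists>p. \<forall>q. (smooth_family \<Omega> (p q) \<and> flat 2 (\<lambda>a x. p q a x - x $ i0) \<and> flat (q + 2) (\<lambda>a x. T (p q) a x - p q a x)) \<and>
    flat (q + 2) (\<lambda>a x. p (Suc q) a x - p q a x)"
proof (rule dependent_nat_choice)
  have c: "smooth_family \<Omega> (\<lambda>a x. x $ i0)" by (rule smooth_family_coord[OF so])
  have "flat 2 (\<lambda>a x. T (\<lambda>a x. x $ i0) a x - x $ i0)"
  proof (rule flat2I)
    fix a j assume a: "a \<in> S"
    have a0: "(a, 0) \<in> \<Omega>" using a R_pos by simp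
    show "T (\<lambda>a x. x $ i0) a 0 - 0 $ i0 = 0" using f0[OF a] by (simp add: T_def)
    have "partial j (\<lambda>a x. T (\<lambda>a x. x $ i0) a x - x $ i0) a 0 = partial j (T (\<lambda>a x. x $ i0)) a 0 - partial j (\<lambda>a x. x $ i0) a 0"
      using partials_diff[OF so smooth_family_T[OF c] c a0, of "[j]"] by simp
    also have "partial j (T (\<lambda>a x. x $ i0)) a 0 = m a * partial j (\<lambda>a x. f a x $ i0) a 0"
      using partials_cmult[OF so smooth_family_f fst_\<Omega>[OF m_cont] a0, of "[j]" i0] by (simp add: T_def[abs_def])
    finally show "partial j (\<lambda>a x. T (\<lambda>a x. x $ i0) a x - x $ i0) a 0 = 0"
      using i0[OF a] by (simp add: df[OF a])
  qed
  moreover have "flat 2 (\<lambda>a x. x $ i0 - x $ i0)" by (rule flat2I) simp_all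
  ultimately show "\<exists>p. smooth_family \<Omega> p \<and> flat 2 (\<lambda>a x. p a x - x $ i0) \<and> flat (0 + 2) (\<lambda>a x. T p a x - p a x)"
    using c by (intro exI[of _ "\<lambda>a x. x $ i0"]) (simp add: numeral_2_eq_2)
next
  fix p q
  assume p: "smooth_family \<Omega> p \<and> flat 2 (\<lambda>a x. p a x - x $ i0) \<and> flat (q + 2) (\<lambda>a x. T p a x - p a x)"
  from jet_step[of p "q + 2"] p obtain h where h: "smooth_family \<Omega> h" "flat (q + 2) h"
    "flat (Suc (q + 2)) (\<lambda>a x. T (\<lambda>a x. p a x + h a x) a x - (p a x + h a x))" by auto
  have "flat 2 (\<lambda>a x. (p a x - x $ i0) + h a x)"
    by (rule flat_add[OF smooth_family_diff[OF so _ smooth_family_coord[OF so]] h(1) _ flat_mono[OF h(2)]]) (use p in auto)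
  then show "\<exists>p'. (smooth_family \<Omega> p' \<and> flat 2 (\<lambda>a x. p' a x - x $ i0) \<and> flat (Suc q + 2) (\<lambda>a x. T p' a x - p' a x)) \<and>
    flat (q + 2) (\<lambda>a x. p' a x - p a x)"
    using h p smooth_family_add[OF so _ h(1), of p]
    by (intro exI[of _ "\<lambda>a x. p a x + h a x"]) (simp add: algebra_simps)
qed

text \<open>\<open>n\<close> is the order of vanishing of the error that remains after
  \<open>k\<close> derivatives. \<open>B * \<theta> ^ n < 1\<close> makes the series of corrections
  converge in \<open>C^k\<close>; \<open>Q \<le> n\<close> keeps its sum of order \<open>Q\<close>
  at the origin, as the comparison of solutions requires.\<close>

lemma approximate_eigenfunction:
  assumes \<rho>: "0 < \<rho>" "\<rho> < R" and p: "smooth_family \<Omega> p" and fl: "flat q (\<lambda>a x. T p a x - p a x)"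
    and B: "B \<ge> 0" "\<forall>b C n. smooth_family \<Omega> b \<longrightarrow> C \<ge> 0 \<longrightarrow>
    (\<forall>vs. length vs \<le> k \<longrightarrow> (\<forall>a\<in>S. \<forall>x\<in>cball 0 \<rho>. \<bar>partials vs b a x\<bar> \<le> C * norm x ^ n)) \<longrightarrow>
    (\<forall>N vs. length vs \<le> k \<longrightarrow> (\<forall>a\<in>S. \<forall>x\<in>cball 0 \<rho>. \<bar>partials vs ((T ^^ N) b) a x\<bar> \<le> C * (B * \<theta> ^ n) ^ N * norm x ^ n))"
    and n: "n = q - k" "B * \<theta> ^ n < 1" "Q \<le> n"
  shows "\<exists>\<psi> C. Ck_family k (S \<times> ball 0 \<rho>) \<psi> \<and> C \<ge> 0 \<and> (\<forall>a\<in>S. \<forall>x\<in>ball 0 \<rho>. \<psi> a x = T \<psi> a x) \<and>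
    (\<forall>a\<in>S. \<forall>x\<in>ball 0 \<rho>. \<bar>\<psi> a x - p a x\<bar> \<le> C * norm x ^ Q)"
proof -
  define b where "b = (\<lambda>a x. T p a x - p a x)"
  have bS: "smooth_family \<Omega> b" unfolding b_def by (rule smooth_family_diff[OF so smooth_family_T[OF p] p])
  from flat_bounds[OF \<rho>(2) bS[unfolded b_def] fl, of k]
  obtain C where C: "C \<ge> 0" "\<forall>vs. length vs \<le> k \<longrightarrow> (\<forall>a\<in>S. \<forall>x\<in>cball 0 \<rho>. \<bar>partials vs b a x\<bar> \<le> C * norm x ^ n)"
    unfolding b_def n(1) by (elim exE conjE)
  define r where "r = B * \<theta> ^ n"
  have r: "0 \<le> r" "r < 1" using B(1) \<theta> n(2) by (auto simp: r_def)
  define w where "w N = (T ^^ N) b" for N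
  have wS: "smooth_family \<Omega> (w N)" for N unfolding w_def by (induction N) (simp_all add: bS smooth_family_T)
  have bd: "\<bar>partials vs (w N) a x\<bar> \<le> C * r ^ N * norm x ^ n"
    if "length vs \<le> k" "a \<in> S" "x \<in> ball 0 \<rho>" for vs N a x
    unfolding w_def r_def using B(2)[rule_format, OF bS C(1) C(2)[rule_format] that(1,2), of x N] that(3) by simp
  have sub: "S \<times> ball 0 \<rho> \<subseteq> \<Omega>" using \<rho> by auto
  have wS': "smooth_family (S \<times> ball 0 \<rho>) (w N)" for N by (rule smooth_family_subset[OF wS sub])
  have sK: "summable (\<lambda>N. C * r ^ N)" using r by (intro summable_mult summable_geometric) auto
  define u where "u a x = (\<Sum>N. w N a x)" for a x
  have uC: "Ck_family k (S \<times> ball 0 \<rho>) u"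
    unfolding u_def[abs_def]
  proof (rule Ck_family_suminf[OF sK wS'])
    fix vs :: "'n list" and N a x assume *: "length vs \<le> k" "a \<in> S" "x \<in> ball (0::real^'n) \<rho>"
    have "norm x ^ n \<le> 1" using * \<rho> R_le1 by (intro power_le_one) auto
    then have "C * r ^ N * norm x ^ n \<le> C * r ^ N * 1" using C(1) r by (intro mult_left_mono) auto
    then show "\<bar>partials vs (w N) a x\<bar> \<le> C * r ^ N" using bd[OF *, of N] by simp
  qed
  have bd0: "\<bar>w N a x\<bar> \<le> C * r ^ N * norm x ^ n" if "a \<in> S" "x \<in> ball 0 \<rho>" for N a x
    using bd[of "[]" a x N] that by simp
  have sx: "summable (\<lambda>N. C * r ^ N * norm x ^ n)" for x :: "real^'n" by (rule summable_mult2[OF sK])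
  have sw: "summable (\<lambda>N. w N a x)" if "a \<in> S" "x \<in> ball 0 \<rho>" for a x
    by (rule summable_comparison_test'[OF sx[of x], of 0]) (simp add: bd0[OF that])
  have ub: "\<bar>u a x\<bar> \<le> (C / (1 - r)) * norm x ^ Q" if ax: "a \<in> S" "x \<in> ball 0 \<rho>" for a x
  proof -
    have "norm (\<Sum>N. w N a x) \<le> (\<Sum>N. C * r ^ N * norm x ^ n)"
      by (rule norm_suminf_le[OF _ sx]) (simp add: bd0[OF ax])
    also have "\<dots> = C * (1 / (1 - r)) * norm x ^ n"
      using r by (simp add: suminf_mult2[symmetric] suminf_mult suminf_geometric summable_mult summable_geometric)
    also have "\<dots> \<le> C * (1 / (1 - r)) * norm x ^ Q"
      using C(1) r ax \<rho> R_le1 n(3) by (intro mult_left_mono power_decreasing) auto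
    finally show ?thesis by (simp add: u_def)
  qed
  \<comment> \<open>Applying \<open>T\<close> shifts the index of the series, so it only loses its
    first term \<open>b\<close>.\<close>
  have Tu: "T u a x = u a x - b a x" if ax: "a \<in> S" "x \<in> ball 0 \<rho>" for a x
  proof -
    have fx: "f a x \<in> ball 0 \<rho>" using f_ball[OF ax(1), of x \<rho>] ax(2) \<rho> by simp
    have "u a x = (\<Sum>N. w (Suc N) a x) + w 0 a x"
      unfolding u_def using suminf_split_head[OF sw[OF ax]] by simp
    also have "(\<Sum>N. w (Suc N) a x) = (\<Sum>N. m a * w N (t a) (f a x))"
      by (simp add: w_def T_def)
    also have "\<dots> = T u a x"
      unfolding T_def u_def by (rule suminf_mult[OF sw[OF tS[OF ax(1)] fx]])
    finally show ?thesis by (simp add: w_def)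
  qed
  define \<psi> where "\<psi> a x = p a x + u a x" for a x
  have "Ck_family k (S \<times> ball 0 \<rho>) \<psi>"
    unfolding \<psi>_def[abs_def] by (rule Ck_family_add[OF _ Ck_family_subset[OF smooth_family_Ck_family[OF p] sub] uC]) simp
  moreover have "\<psi> a x = T \<psi> a x" if "a \<in> S" "x \<in> ball 0 \<rho>" for a x
    using Tu[OF that] by (simp add: \<psi>_def T_def b_def algebra_simps)
  moreover have "\<bar>\<psi> a x - p a x\<bar> \<le> (C / (1 - r)) * norm x ^ Q" if "a \<in> S" "x \<in> ball 0 \<rho>" for a x
    using ub[OF that] by (simp add: \<psi>_def)
  moreover have "C / (1 - r) \<ge> 0" using C(1) r by simp
  ultimately show ?thesis by (intro exI[of _ \<psi>] exI[of _ "C / (1 - r)"]) simp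
qed

text \<open>The ball is fixed beforehand and the solutions for all \<open>k\<close> live on it. Each
  is compared with the same approximation \<open>p Q\<close>, so any two of them differ by a fixed
  point of order \<open>Q\<close>, which is zero; a single function is therefore of every class
  \<open>C^k\<close>.\<close>

theorem eigenfunction:
  assumes i0: "\<And>a. a \<in> S \<Longrightarrow> m a * \<nu> a $ i0 = 1" and \<rho>: "0 < \<rho>" "\<rho> < R"
  shows "\<exists>\<psi>. smooth_family (S \<times> ball 0 \<rho>) \<psi> \<and> (\<forall>a\<in>S. \<psi> a 0 = 0) \<and>
    (\<forall>a\<in>S. \<forall>j. partial j \<psi> a 0 = (if j = i0 then 1 else 0)) \<and>
    (\<forall>a\<in>S. \<forall>x\<in>ball 0 \<rho>. \<psi> a x = T \<psi> a x)"
proof -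
  obtain p where p: "\<forall>q. (smooth_family \<Omega> (p q) \<and> flat 2 (\<lambda>a x. p q a x - x $ i0) \<and> flat (q + 2) (\<lambda>a x. T (p q) a x - p q a x)) \<and>
    flat (q + 2) (\<lambda>a x. p (Suc q) a x - p q a x)" using jets[OF i0] by (rule exE)
  have pS: "smooth_family \<Omega> (p q)" for q using p by simp
  obtain Q mb where Q: "Q \<ge> 2" "mb \<ge> 0" "\<forall>a\<in>S. \<bar>m a\<bar> \<le> mb" "mb * \<theta> ^ Q < 1"
    using ex_contraction_order by (elim exE conjE)
  \<comment> \<open>From index \<open>Q\<close> on, each step of the recursion alters only orders
    above \<open>Q\<close>, so all later approximations agree with \<open>p Q\<close> to this
    order.\<close>
  have dp: "flat Q (\<lambda>a x. p (Q + d) a x - p Q a x)" for d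
  proof (induction d)
    case 0
    have "partials ws (\<lambda>a x. 0) a (0::real^'n) = 0" if "a \<in> S" for ws and a :: 'x
      using partials_diff[OF so pS[of 0] pS[of 0], where vs = ws, of a 0] that R_pos by simp
    then show ?case by (simp add: flat_def)
  next
    case (Suc d)
    have "flat Q (\<lambda>a x. p (Suc (Q + d)) a x - p (Q + d) a x)"
      by (rule flat_mono[of "Q + d + 2"]) (use p in auto)
    from flat_add[OF smooth_family_diff[OF so pS pS] smooth_family_diff[OF so pS pS] this Suc]
    show ?case by simp
  qed
  have sol: "\<exists>\<psi> C. Ck_family k (S \<times> ball 0 \<rho>) \<psi> \<and> C \<ge> 0 \<and> (\<forall>a\<in>S. \<forall>x\<in>ball 0 \<rho>. \<psi> a x = T \<psi> a x) \<and>
    (\<forall>a\<in>S. \<forall>x\<in>ball 0 \<rho>. \<bar>\<psi> a x - p Q a x\<bar> \<le> C * norm x ^ Q)" for k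
  proof -
    from T_iter_bound[OF \<rho>(2), of k]
    obtain B where B: "B \<ge> 0" "\<forall>b C n. smooth_family \<Omega> b \<longrightarrow> C \<ge> 0 \<longrightarrow>
      (\<forall>vs. length vs \<le> k \<longrightarrow> (\<forall>a\<in>S. \<forall>x\<in>cball 0 \<rho>. \<bar>partials vs b a x\<bar> \<le> C * norm x ^ n)) \<longrightarrow>
      (\<forall>N vs. length vs \<le> k \<longrightarrow> (\<forall>a\<in>S. \<forall>x\<in>cball 0 \<rho>. \<bar>partials vs ((T ^^ N) b) a x\<bar> \<le> C * (B * \<theta> ^ n) ^ N * norm x ^ n))"
      by (elim exE conjE)
    obtain n0 where n0: "\<theta> ^ n0 < 1 / (B + 1)" using real_arch_pow_inv[of "1 / (B + 1)" \<theta>] \<theta> B(1) by auto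
    \<comment> \<open>Then \<open>n = Q + n0 + 2\<close>: large enough for
      \<open>B * \<theta> ^ n < 1\<close> and for \<open>Q \<le> n\<close>, whatever
      \<open>k\<close> is.\<close>
    define d where "d = n0 + k"
    define n where "n = (Q + d + 2) - k"
    have "\<theta> ^ n \<le> \<theta> ^ n0" using \<theta> by (intro power_decreasing) (auto simp: n_def d_def)
    then have "\<theta> ^ n < 1 / (B + 1)" using n0 by linarith
    then have "(B + 1) * \<theta> ^ n < 1" using B(1) by (simp add: pos_less_divide_eq mult.commute)
    moreover have "B * \<theta> ^ n \<le> (B + 1) * \<theta> ^ n" using \<theta> by (intro mult_right_mono) auto
    ultimately have n1: "B * \<theta> ^ n < 1" by linarith
    have n2: "Q \<le> n" by (simp add: n_def d_def)
    from approximate_eigenfunction[OF \<rho> pS _ B n_def n1 n2, of "Q + d"] p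
    obtain \<psi> C where \<psi>: "Ck_family k (S \<times> ball 0 \<rho>) \<psi>" "C \<ge> 0" "\<forall>a\<in>S. \<forall>x\<in>ball 0 \<rho>. \<psi> a x = T \<psi> a x"
      "\<forall>a\<in>S. \<forall>x\<in>ball 0 \<rho>. \<bar>\<psi> a x - p (Q + d) a x\<bar> \<le> C * norm x ^ Q" by blast
    from flat_pointwise[OF \<rho>(2) smooth_family_diff[OF so pS pS] dp, of d]
    obtain C' where C': "C' \<ge> 0" "\<forall>a\<in>S. \<forall>x\<in>cball 0 \<rho>. \<bar>p (Q + d) a x - p Q a x\<bar> \<le> C' * norm x ^ Q"
      by (elim exE conjE)
    have "\<bar>\<psi> a x - p Q a x\<bar> \<le> (C + C') * norm x ^ Q" if "a \<in> S" "x \<in> ball 0 \<rho>" for a x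
      using \<psi>(4)[rule_format, OF that] C'(2)[rule_format, of a x] that by (simp add: distrib_right)
    then show ?thesis using \<psi>(1-3) C'(1) by (intro exI[of _ \<psi>] exI[of _ "C + C'"]) simp
  qed
  from sol[of 0] obtain \<psi> C where \<psi>: "C \<ge> 0" "\<forall>a\<in>S. \<forall>x\<in>ball 0 \<rho>. \<psi> a x = T \<psi> a x"
    "\<forall>a\<in>S. \<forall>x\<in>ball 0 \<rho>. \<bar>\<psi> a x - p Q a x\<bar> \<le> C * norm x ^ Q" by (elim exE conjE)
  have "Ck_family k (S \<times> ball 0 \<rho>) \<psi>" for k
  proof -
    from sol[of k] obtain \<phi> D where \<phi>: "Ck_family k (S \<times> ball 0 \<rho>) \<phi>" "D \<ge> 0" "\<forall>a\<in>S. \<forall>x\<in>ball 0 \<rho>. \<phi> a x = T \<phi> a x"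
      "\<forall>a\<in>S. \<forall>x\<in>ball 0 \<rho>. \<bar>\<phi> a x - p Q a x\<bar> \<le> D * norm x ^ Q" by (elim exE conjE)
    define w where "w a x = \<phi> a x - \<psi> a x" for a x
    have "w a x = 0" if a: "a \<in> S" and x: "x \<in> ball 0 \<rho>" for a x
    proof (rule fixed_point_zero[where C = "C + D" and w = w, OF _ Q(2-4) _ _ _ a x])
      fix a x assume ax: "a \<in> S" "x \<in> ball (0::real^'n) \<rho>"
      show "w a x = T w a x"
        using \<phi>(3)[rule_format, OF ax] \<psi>(2)[rule_format, OF ax] by (simp add: w_def T_def algebra_simps)
      show "\<bar>w a x\<bar> \<le> (C + D) * norm x ^ Q"
        using \<phi>(4)[rule_format, OF ax] \<psi>(3)[rule_format, OF ax] unfolding w_def distrib_right by linarith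
    qed (use \<rho> \<psi>(1) \<phi>(2) in auto)
    then show ?thesis
      by (intro Ck_family_cong[OF _ _ \<phi>(1)]) (auto simp: w_def)
  qed
  then have \<psi>S: "smooth_family (S \<times> ball 0 \<rho>) \<psi>" by (simp add: smooth_family_def)
  have SFc: "smooth_family \<Omega> (\<lambda>a x. p Q a x - x $ i0)" by (rule smooth_family_diff[OF so pS smooth_family_coord[OF so]])
  from flat_pointwise[OF \<rho>(2) SFc, of 2] p
  obtain C' where C': "C' \<ge> 0" "\<forall>a\<in>S. \<forall>x\<in>cball 0 \<rho>. \<bar>p Q a x - x $ i0\<bar> \<le> C' * norm x ^ 2" by auto
  \<comment> \<open>Both \<open>\<psi> - p Q\<close> and \<open>p Q - x_i0\<close> are at least
    quadratically small. This fixes the value and the derivative at \<open>0\<close> without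
    differentiating the series.\<close>
  have q: "\<bar>\<psi> a x - x $ i0\<bar> \<le> (C + C') * norm x ^ 2" if a: "a \<in> S" and x: "x \<in> ball 0 \<rho>" for a x
  proof -
    have "norm x ^ Q \<le> norm x ^ 2" using x \<rho> R_le1 Q(1) by (intro power_decreasing) auto
    from mult_left_mono[OF this \<psi>(1)] show ?thesis
      using \<psi>(3)[rule_format, OF a x] C'(2)[rule_format, OF a, of x] x unfolding distrib_right by simp
  qed
  have z: "\<psi> a 0 = 0" if "a \<in> S" for a using q[OF that, of 0] \<rho> by simp
  have "partial j \<psi> a 0 = (if j = i0 then 1 else 0)" if a: "a \<in> S" for a j
  proof (rule partial_eqI)
    have 1: "((\<lambda>x. \<psi> a x - x $ i0) has_derivative (\<lambda>h. 0)) (at 0)"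
      by (rule has_derivative_zero_of_quadratic[OF \<rho>(1) _ q[OF a]]) (use \<psi>(1) C'(1) in auto)
    have 2: "((\<lambda>x::real^'n. x $ i0) has_derivative (\<lambda>h. h $ i0)) (at 0)"
      by (rule bounded_linear_imp_has_derivative[OF bounded_linear_vec_nth])
    have "(\<lambda>h::real^'n. \<Sum>j\<in>UNIV. h $ j * (if j = i0 then 1 else 0)) = (\<lambda>h. h $ i0)"
      by (simp add: if_distrib[of "\<lambda>x. _ * x"] cong: if_cong)
    then show "(\<psi> a has_derivative (\<lambda>h. \<Sum>j\<in>UNIV. h $ j * (if j = i0 then 1 else 0))) (at 0)"
      using has_derivative_add[OF 1 2] by simp
  qed
  then show ?thesis using \<psi>S z \<psi>(2) by (intro exI[of _ \<psi>]) simp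
qed

end

section \<open>Linearization of expanding families\<close>

lemma smooth_vfamily_id: "slice_open \<Omega> \<Longrightarrow> smooth_vfamily \<Omega> (\<lambda>a x. x)"
  by (simp add: smooth_vfamily_def smooth_family_coord)

lemma smooth_vfamily_small_near_zero:
  fixes U :: "'x::topological_space \<Rightarrow> real^'n::finite \<Rightarrow> real^'n"
  assumes "compact S" "R > 0" "smooth_vfamily (S \<times> ball 0 R) U" "\<And>a. a \<in> S \<Longrightarrow> U a 0 = 0" "e > 0"
  shows "\<exists>\<rho>>0. \<rho> < R \<and> (\<forall>a\<in>S. \<forall>x\<in>ball 0 \<rho>. U a x \<in> ball 0 e)"
proof -
  have "continuous_on (S \<times> ball 0 R) (\<lambda>z. norm (case_prod U z))"
    by (rule continuous_on_norm[OF smooth_vfamily_continuous[OF assms(3)]])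
  then have c: "continuous_on (S \<times> ball 0 R) (case_prod (\<lambda>a x. norm (U a x)))"
    by (simp add: case_prod_beta)
  from small_near_zero[OF assms(1,2) c, of e] show ?thesis using assms(4,5) by simp
qed

text \<open>The chain rule at \<open>0\<close> for \<open>U a \<circ> V a = id\<close>: with a
  diagonal derivative only one term of the sum remains.\<close>

lemma partial_inverse_diag:
  fixes U V :: "'x::topological_space \<Rightarrow> real^'n::finite \<Rightarrow> real^'n"
  assumes U: "smooth_vfamily (S \<times> ball 0 \<rho>) U" and V: "smooth_vfamily (S \<times> ball 0 r) V" and pos: "\<rho> > 0" "r > 0"
    and a: "a \<in> S" and V0: "V a 0 = 0" and UV: "\<And>y. y \<in> ball 0 r \<Longrightarrow> U a (V a y) = y"
    and dU: "\<And>i j. partial j (\<lambda>a x. U a x $ i) a 0 = (if i = j then \<mu> $ i else 0)" and nz: "\<And>i. \<mu> $ i \<noteq> 0"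
  shows "partial j (\<lambda>a x. V a x $ i) a 0 = (if i = j then inverse (\<mu> $ i) else 0)"
proof -
  let ?u = "\<lambda>a x. U a x $ i"
  \<comment> \<open>The parameter is frozen because the identity is assumed at \<open>a\<close>
    only; a partial derivative sees nothing but the slice over \<open>a\<close>.\<close>
  have "partial j (\<lambda>a' y. ?u a (V a y)) a 0 = partial j (\<lambda>a' y. y $ i) a 0"
    unfolding partial_def
    by (rule fun_cong[OF frechet_derivative_cong_open[OF open_ball[of 0 r]]]) (use pos UV in auto)
  then have 1: "partial j (\<lambda>a' y. ?u a' (V a' y)) a 0 = (if j = i then 1 else 0)"
    unfolding partial_coord by (simp add: partial_def)
  have "partial j (\<lambda>a' y. ?u a' (V a' y)) a 0
    = (\<Sum>k\<in>UNIV. partial k ?u a (V a 0) * partial j (\<lambda>a x. V a x $ k) a 0)"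
    by (rule partial_comp[where u = ?u and s = "\<lambda>a. a" and V = V and \<Omega> = "S \<times> ball 0 r" and \<Psi> = "S \<times> ball 0 \<rho>"])
      (use U V a pos V0 in \<open>auto simp: smooth_vfamily_def\<close>)
  also have "\<dots> = (\<Sum>k\<in>UNIV. if k = i then \<mu> $ i * partial j (\<lambda>a x. V a x $ i) a 0 else 0)"
    unfolding V0 dU by (rule sum.cong) auto
  finally have "\<mu> $ i * partial j (\<lambda>a x. V a x $ i) a 0 = (if j = i then 1 else 0)" using 1 by simp
  then show ?thesis using nz[of i] by (auto simp: field_simps split: if_splits)
qed

text \<open>\<open>G a\<close> maps a neighbourhood of \<open>0\<close> in the fibre over
  \<open>a\<close> to the fibre over \<open>s a\<close>. The diagonal form of the derivative at
  \<open>0\<close> is what splits the linearization problem into scalar equations.\<close>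

locale expanding_family =
  fixes S :: "'x::topological_space set" and s t :: "'x \<Rightarrow> 'x" and R :: real
    and G :: "'x \<Rightarrow> real^'n::finite \<Rightarrow> real^'n" and \<mu> :: "'x \<Rightarrow> real^'n"
  assumes compact_S: "compact S" and t_cont: "continuous_on S t" and t_S: "t ` S \<subseteq> S"
    and s_cont: "continuous_on S s" and s_S: "s ` S \<subseteq> S"
    and ts: "\<And>a. a \<in> S \<Longrightarrow> t (s a) = a" and st: "\<And>a. a \<in> S \<Longrightarrow> s (t a) = a"
    and R_pos: "R > 0" and \<mu>_cont: "continuous_on S \<mu>" and \<mu>_gt: "\<And>a i. a \<in> S \<Longrightarrow> \<bar>\<mu> a $ i\<bar> > 1"
    and G_smooth_vfamily: "smooth_vfamily (S \<times> ball 0 R) G" and G0: "\<And>a. a \<in> S \<Longrightarrow> G a 0 = 0"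
    and dG: "\<And>a i j. a \<in> S \<Longrightarrow> partial j (\<lambda>a x. G a x $ i) a 0 = (if i = j then \<mu> a $ i else 0)"
    and nonres: "\<And>i vs. 2 \<le> length vs \<Longrightarrow>
      (\<forall>a\<in>S. \<bar>\<mu> a $ i\<bar> < prod_list (map (\<lambda>v. \<bar>\<mu> a $ v\<bar>) vs)) \<or>
      (\<forall>a\<in>S. \<bar>\<mu> a $ i\<bar> > prod_list (map (\<lambda>v. \<bar>\<mu> a $ v\<bar>) vs))"
begin

lemma tS: "a \<in> S \<Longrightarrow> t a \<in> S" and sS: "a \<in> S \<Longrightarrow> s a \<in> S" using t_S s_S by auto

lemma \<mu>_nz: "a \<in> S \<Longrightarrow> \<mu> a $ i \<noteq> 0" using \<mu>_gt[of a i] by auto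

lemma \<mu>_uniform: "\<exists>lam>1. \<forall>a\<in>S. \<forall>i. lam \<le> \<bar>\<mu> a $ i\<bar>"
proof (cases "S = {}")
  case False
  have "\<exists>b\<in>S. \<forall>a\<in>S. \<bar>\<mu> b $ i\<bar> \<le> \<bar>\<mu> a $ i\<bar>" for i
    by (rule continuous_attains_inf[OF compact_S False continuous_on_rabs[OF continuous_on_component[OF \<mu>_cont]]])
  then have "\<forall>i. \<exists>b. b \<in> S \<and> (\<forall>a\<in>S. \<bar>\<mu> b $ i\<bar> \<le> \<bar>\<mu> a $ i\<bar>)" by blast
  from choice[OF this] obtain b where b: "\<forall>i. b i \<in> S \<and> (\<forall>a\<in>S. \<bar>\<mu> (b i) $ i\<bar> \<le> \<bar>\<mu> a $ i\<bar>)" by (rule exE)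
  define lam where "lam = Min (range (\<lambda>i. \<bar>\<mu> (b i) $ i\<bar>))"
  have "lam > 1" unfolding lam_def using b \<mu>_gt by (subst Min_gr_iff) auto
  moreover have "lam \<le> \<bar>\<mu> a $ i\<bar>" if "a \<in> S" for a i
  proof -
    have "lam \<le> \<bar>\<mu> (b i) $ i\<bar>" unfolding lam_def by (rule Min_le) auto
    also have "\<dots> \<le> \<bar>\<mu> a $ i\<bar>" using b that by blast
    finally show ?thesis .
  qed
  ultimately show ?thesis by blast
qed (auto intro: exI[of _ 2])

text \<open>The diagonal of the derivative of the inverse branch that leaves the fibre over
  \<open>a\<close>: it inverts \<open>G (t a)\<close>, hence the argument
  \<open>t a\<close>.\<close>

definition \<nu> :: "'x \<Rightarrow> real^'n" where "\<nu> a = (\<chi> i. inverse (\<mu> (t a) $ i))"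

lemma \<mu>t_cont: "continuous_on S (\<lambda>a. \<mu> (t a))"
  by (rule continuous_on_compose2[OF \<mu>_cont t_cont t_S])

lemma \<nu>_cont: "continuous_on S \<nu>"
  unfolding \<nu>_def[abs_def]
  by (intro continuous_on_vec_lambda continuous_on_inverse continuous_on_component \<mu>t_cont) (simp add: \<mu>_nz tS)

lemma diag_\<nu>: "a \<in> S \<Longrightarrow> diag (\<mu> (t a)) (diag (\<nu> a) x) = x"
  by (simp add: vec_eq_iff \<nu>_def \<mu>_nz tS)

text \<open>For component \<open>i\<close> the multiplier is \<open>\<mu> (t a) $ i\<close>, and its
  product with the \<open>\<nu>\<close> along a word has modulus \<open>\<bar>\<mu>_i\<bar>\<close>
  divided by the product of the \<open>\<bar>\<mu>_v\<bar>\<close>. Comparing this with 1 is the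
  nonresonance alternative at the point \<open>t a\<close>.\<close>

lemma cocycle:
  assumes r: "0 < r" "r \<le> 1" and \<theta>: "0 < \<theta>" "\<theta> < 1" and f: "smooth_vfamily (S \<times> ball 0 r) f"
    and fc: "\<And>a x. a \<in> S \<Longrightarrow> x \<in> ball 0 r \<Longrightarrow> norm (f a x) \<le> \<theta> * norm x"
    and df: "\<And>a i j. a \<in> S \<Longrightarrow> partial j (\<lambda>a x. f a x $ i) a 0 = (if i = j then \<nu> a $ i else 0)"
  shows "contraction_cocycle S s t r \<theta> f \<nu> (\<lambda>a. \<mu> (t a) $ i)"
proof
  fix vs :: "'n list" assume vs: "2 \<le> length vs"
  have *: "\<bar>\<mu> (t a) $ i * prod_list (map (($) (\<nu> a)) vs)\<bar>
    = \<bar>\<mu> (t a) $ i\<bar> / prod_list (map (\<lambda>v. \<bar>\<mu> (t a) $ v\<bar>) vs)" for a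
  proof -
    have "\<bar>prod_list (map (($) (\<nu> a)) vs)\<bar> = inverse (prod_list (map (\<lambda>v. \<bar>\<mu> (t a) $ v\<bar>) vs))"
      by (induction vs) (simp_all add: \<nu>_def abs_mult)
    then show ?thesis by (simp add: abs_mult divide_inverse)
  qed
  have pos: "prod_list (map (\<lambda>v. \<bar>\<mu> a $ v\<bar>) vs) > 0" if "a \<in> S" for a
    by (induction vs) (simp_all add: \<mu>_nz[OF that])
  from nonres[OF vs, of i]
  show "(\<forall>a\<in>S. \<bar>\<mu> (t a) $ i * prod_list (map (($) (\<nu> a)) vs)\<bar> < 1) \<or>
      (\<forall>a\<in>S. 1 < \<bar>\<mu> (t a) $ i * prod_list (map (($) (\<nu> a)) vs)\<bar>)"
  proof
    assume "\<forall>a\<in>S. \<bar>\<mu> a $ i\<bar> < prod_list (map (\<lambda>v. \<bar>\<mu> a $ v\<bar>) vs)"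
    then show ?thesis unfolding * using pos tS by (simp add: divide_less_eq)
  next
    assume "\<forall>a\<in>S. \<bar>\<mu> a $ i\<bar> > prod_list (map (\<lambda>v. \<bar>\<mu> a $ v\<bar>) vs)"
    then show ?thesis unfolding * using pos tS by (simp add: less_divide_eq)
  qed
qed (use compact_S t_cont t_S s_cont s_S ts st r \<theta> f fc df \<nu>_cont continuous_on_component[OF \<mu>t_cont] in auto)

text \<open>Both maps are needed later: \<open>\<phi>\<close> provides the charts, and
  \<open>\<psi>\<close> is composed with a competing linearization in the proof of
  uniqueness.\<close>

theorem linearization_exists:
  "\<exists>\<rho> r \<psi> \<phi>. 0 < r \<and> 0 < \<rho> \<and> \<rho> \<le> R \<and> smooth_vfamily (S \<times> ball 0 \<rho>) \<psi> \<and> smooth_vfamily (S \<times> ball 0 r) \<phi> \<and>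
    (\<forall>a\<in>S. \<forall>y\<in>ball 0 r. \<phi> a y \<in> ball 0 \<rho> \<and> \<psi> a (\<phi> a y) = y) \<and>
    (\<forall>a\<in>S. \<forall>x\<in>ball 0 \<rho>. \<psi> a x \<in> ball 0 r \<longrightarrow> \<phi> a (\<psi> a x) = x) \<and>
    (\<forall>a\<in>S. \<phi> a 0 = 0 \<and> (\<forall>i j. partial j (\<lambda>a x. \<phi> a x $ i) a 0 = (if i = j then 1 else 0))) \<and>
    (\<forall>a\<in>S. \<psi> a 0 = 0 \<and> (\<forall>i j. partial j (\<lambda>a x. \<psi> a x $ i) a 0 = (if i = j then 1 else 0))) \<and>
    (\<forall>a\<in>S. \<forall>y. diag (\<mu> a) y \<in> ball 0 r \<longrightarrow> \<phi> (s a) (diag (\<mu> a) y) = G a (\<phi> a y)) \<and>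
    (\<forall>a\<in>S. \<forall>x\<in>ball 0 \<rho>. G a x \<in> ball 0 \<rho> \<longrightarrow> \<psi> (s a) (G a x) = diag (\<mu> a) (\<psi> a x))"
proof -
  obtain lam where lam: "lam > 1" "\<forall>a\<in>S. \<forall>i. lam \<le> \<bar>\<mu> a $ i\<bar>" using \<mu>_uniform by (elim exE conjE)
  \<comment> \<open>The bound \<open>1/2\<close> is what \<open>inverse_family\<close> asks for;
    \<open>(lam - 1) / 2\<close> leaves \<open>G\<close> the rate of expansion
    \<open>lam - (lam - 1) / 2 = (lam + 1) / 2\<close>, whose reciprocal is \<open>\<theta>\<close>
    below.\<close>
  define \<epsilon> where "\<epsilon> = min (1/2) ((lam - 1) / 2)"
  have \<epsilon>: "0 < \<epsilon>" "\<epsilon> \<le> 1/2" "\<epsilon> \<le> (lam - 1) / 2" using lam(1) by (auto simp: \<epsilon>_def min_def)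
  have \<mu>1: "1 \<le> \<bar>\<mu> a $ i\<bar>" if "a \<in> S" for a i using \<mu>_gt[OF that, of i] by simp
  have "\<exists>\<rho> r V. 0 < \<rho> \<and> \<rho> < R \<and> 0 < r \<and> smooth_vfamily (S \<times> ball 0 r) V \<and>
    (\<forall>a\<in>S. \<forall>y\<in>ball 0 r. V a y \<in> ball 0 \<rho> \<and> G a (V a y) = y) \<and>
    (\<forall>a\<in>S. \<forall>x\<in>ball 0 \<rho>. G a x \<in> ball 0 r \<longrightarrow> V a (G a x) = x) \<and>
    (\<forall>a\<in>S. \<forall>x\<in>ball 0 \<rho>. norm (G a x - diag (\<mu> a) x) \<le> \<epsilon> * norm x)"
    by (rule inverse_family[OF compact_S R_pos G_smooth_vfamily G0 dG \<mu>_cont \<mu>1 \<epsilon>(1,2)])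
  then obtain \<rho>1 r1 V where V: "0 < \<rho>1" "\<rho>1 < R" "0 < r1" "smooth_vfamily (S \<times> ball 0 r1) V"
    "\<forall>a\<in>S. \<forall>y\<in>ball 0 r1. V a y \<in> ball 0 \<rho>1 \<and> G a (V a y) = y"
    "\<forall>a\<in>S. \<forall>x\<in>ball 0 \<rho>1. G a x \<in> ball 0 r1 \<longrightarrow> V a (G a x) = x"
    "\<forall>a\<in>S. \<forall>x\<in>ball 0 \<rho>1. norm (G a x - diag (\<mu> a) x) \<le> \<epsilon> * norm x"
    by (elim exE conjE)
  have V0: "V a 0 = 0" if "a \<in> S" for a using V(6)[rule_format, OF that, of 0] V(1,3) G0[OF that] by simp
  define \<theta> where "\<theta> = 2 / (lam + 1)"
  have \<theta>: "0 < \<theta>" "\<theta> < 1" using lam(1) by (auto simp: \<theta>_def)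
  have Vc: "norm (V a y) \<le> \<theta> * norm y" if a: "a \<in> S" and y: "y \<in> ball 0 r1" for a y
  proof -
    have x: "V a y \<in> ball 0 \<rho>1" "G a (V a y) = y" using V(5) a y by auto
    have "lam * norm (V a y) \<le> norm (diag (\<mu> a) (V a y))"
      by (rule norm_diag_ge) (use lam a in auto)
    also have "\<dots> \<le> norm y + norm (G a (V a y) - diag (\<mu> a) (V a y))"
      using norm_triangle_ineq2[of "diag (\<mu> a) (V a y)" y] x(2) by (simp add: norm_minus_commute)
    also have "\<dots> \<le> norm y + \<epsilon> * norm (V a y)" using V(7) a x(1) by simp
    also have "\<epsilon> * norm (V a y) \<le> (lam - 1) / 2 * norm (V a y)" by (rule mult_right_mono[OF \<epsilon>(3)]) simp
    finally have "(lam + 1) / 2 * norm (V a y) \<le> norm y" by (simp add: field_simps)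
    then show ?thesis using lam(1) by (simp add: \<theta>_def field_simps)
  qed
  \<comment> \<open>The cocycle locale requires a radius of at most 1.\<close>
  define r2 where "r2 = min r1 1"
  have r2: "0 < r2" "r2 \<le> 1" "r2 \<le> r1" using V(3) by (auto simp: r2_def)
  \<comment> \<open>The inverse branch is reindexed by its source: \<open>V (t a)\<close> inverts
    \<open>G (t a)\<close>, which maps into the fibre over \<open>a\<close>.\<close>
  define f where "f a y = V (t a) y" for a y
  have fS: "smooth_vfamily (S \<times> ball 0 r2) f"
    unfolding f_def[abs_def]
    by (rule smooth_vfamily_comp[where U = V and \<Psi> = "S \<times> ball 0 r1" and s = t and V = "\<lambda>a x. x", OF _ V(4) smooth_vfamily_id])
      (use r2 tS in \<open>auto intro!: continuous_on_subset[OF t_cont]\<close>)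
  have cc: "contraction_cocycle S s t r2 \<theta> f \<nu> (\<lambda>a. \<mu> (t a) $ i)" for i
  proof (rule cocycle[OF r2(1,2) \<theta> fS])
    show "norm (f a x) \<le> \<theta> * norm x" if "a \<in> S" "x \<in> ball 0 r2" for a x
      unfolding f_def by (rule Vc[OF tS[OF that(1)]]) (use that r2 in auto)
    show "partial j (\<lambda>a x. f a x $ i) a 0 = (if i = j then \<nu> a $ i else 0)" if a: "a \<in> S" for a i j
    proof -
      have "partial j (\<lambda>a x. f a x $ i) a 0 = partial j (\<lambda>a x. V a x $ i) (t a) 0" by (simp add: partial_def f_def)
      also have "\<dots> = (if i = j then inverse (\<mu> (t a) $ i) else 0)"
        by (rule partial_inverse_diag[OF G_smooth_vfamily V(4) R_pos V(3) tS[OF a] V0[OF tS[OF a]] _ dG[OF tS[OF a]] \<mu>_nz[OF tS[OF a]]])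
          (use V(5) tS[OF a] in auto)
      finally show ?thesis by (simp add: \<nu>_def)
    qed
  qed
  define \<rho>2 where "\<rho>2 = r2 / 2"
  have \<rho>2: "0 < \<rho>2" "\<rho>2 < r2" using r2 by (auto simp: \<rho>2_def)
  have "\<exists>\<psi>. smooth_family (S \<times> ball 0 \<rho>2) \<psi> \<and> (\<forall>a\<in>S. \<psi> a 0 = 0) \<and>
    (\<forall>a\<in>S. \<forall>j. partial j \<psi> a 0 = (if j = i then 1 else 0)) \<and>
    (\<forall>a\<in>S. \<forall>x\<in>ball 0 \<rho>2. \<psi> a x = contraction_cocycle.T t f (\<lambda>a. \<mu> (t a) $ i) \<psi> a x)" for i
    by (rule contraction_cocycle.eigenfunction[OF cc _ \<rho>2]) (simp add: \<nu>_def \<mu>_nz tS)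
  then have "\<forall>i. \<exists>\<psi>. smooth_family (S \<times> ball 0 \<rho>2) \<psi> \<and> (\<forall>a\<in>S. \<psi> a 0 = 0) \<and>
    (\<forall>a\<in>S. \<forall>j. partial j \<psi> a 0 = (if j = i then 1 else 0)) \<and>
    (\<forall>a\<in>S. \<forall>x\<in>ball 0 \<rho>2. \<psi> a x = contraction_cocycle.T t f (\<lambda>a. \<mu> (t a) $ i) \<psi> a x)" by (rule allI)
  from choice[OF this] obtain P where P: "\<forall>i. smooth_family (S \<times> ball 0 \<rho>2) (P i) \<and> (\<forall>a\<in>S. P i a 0 = 0) \<and>
    (\<forall>a\<in>S. \<forall>j. partial j (P i) a 0 = (if j = i then 1 else 0)) \<and>
    (\<forall>a\<in>S. \<forall>x\<in>ball 0 \<rho>2. P i a x = contraction_cocycle.T t f (\<lambda>a. \<mu> (t a) $ i) (P i) a x)" by (rule exE)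
  define \<psi> where "\<psi> a x = (\<chi> i. P i a x)" for a x
  have \<psi>i: "(\<lambda>a x. \<psi> a x $ i) = P i" for i by (simp add: \<psi>_def)
  have \<psi>S: "smooth_vfamily (S \<times> ball 0 \<rho>2) \<psi>" using P by (simp add: smooth_vfamily_def \<psi>i)
  have \<psi>0: "\<psi> a 0 = 0" if "a \<in> S" for a using P that by (simp add: \<psi>_def vec_eq_iff)
  \<comment> \<open>The entry 1 is written as a component of the vector of ones, the
    \<open>\<mu>\<close> with which \<open>inverse_family\<close> is applied to
    \<open>\<psi>\<close>.\<close>
  have d\<psi>: "partial j (\<lambda>a x. \<psi> a x $ i) a 0 = (if i = j then (\<chi> i. 1) $ i else 0)" if "a \<in> S" for a i j
    using P that by (auto simp: \<psi>i)
  have \<psi>T: "\<psi> a y = diag (\<mu> (t a)) (\<psi> (t a) (f a y))" if "a \<in> S" "y \<in> ball 0 \<rho>2" for a y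
    using P that by (simp add: \<psi>_def vec_eq_iff contraction_cocycle.T_def[OF cc])
  have \<psi>G: "\<psi> (s a) (G a x) = diag (\<mu> a) (\<psi> a x)"
    if a: "a \<in> S" and x: "x \<in> ball 0 \<rho>1" "G a x \<in> ball 0 \<rho>2" for a x
  proof -
    have "f (s a) (G a x) = x" using V(6) a x r2 \<rho>2 ts[OF a] by (simp add: f_def)
    then show ?thesis using \<psi>T[OF sS[OF a] x(2)] ts[OF a] by simp
  qed
  define R3 where "R3 = min \<rho>1 \<rho>2"
  have R3: "0 < R3" "R3 \<le> \<rho>1" "R3 \<le> \<rho>2" using V(1) \<rho>2 by (auto simp: R3_def)
  have \<psi>S3: "smooth_vfamily (S \<times> ball 0 R3) \<psi>" by (rule smooth_vfamily_subset[OF \<psi>S]) (use R3 in auto)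
  have "\<exists>\<rho> r \<phi>. 0 < \<rho> \<and> \<rho> < R3 \<and> 0 < r \<and> smooth_vfamily (S \<times> ball 0 r) \<phi> \<and>
    (\<forall>a\<in>S. \<forall>y\<in>ball 0 r. \<phi> a y \<in> ball 0 \<rho> \<and> \<psi> a (\<phi> a y) = y) \<and>
    (\<forall>a\<in>S. \<forall>x\<in>ball 0 \<rho>. \<psi> a x \<in> ball 0 r \<longrightarrow> \<phi> a (\<psi> a x) = x) \<and>
    (\<forall>a\<in>S. \<forall>x\<in>ball 0 \<rho>. norm (\<psi> a x - diag (\<chi> i. 1) x) \<le> \<epsilon> * norm x)"
    by (rule inverse_family[OF compact_S R3(1) \<psi>S3 \<psi>0 d\<psi> continuous_on_const _ \<epsilon>(1,2)]) simp_all
  then obtain \<rho>3 r3 \<phi> where \<phi>: "0 < \<rho>3" "\<rho>3 < R3" "0 < r3" "smooth_vfamily (S \<times> ball 0 r3) \<phi>"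
    "\<forall>a\<in>S. \<forall>y\<in>ball 0 r3. \<phi> a y \<in> ball 0 \<rho>3 \<and> \<psi> a (\<phi> a y) = y"
    "\<forall>a\<in>S. \<forall>x\<in>ball 0 \<rho>3. \<psi> a x \<in> ball 0 r3 \<longrightarrow> \<phi> a (\<psi> a x) = x" by (elim exE conjE)
  have \<phi>0: "\<phi> a 0 = 0" if "a \<in> S" for a using \<phi>(6)[rule_format, OF that, of 0] \<phi>(1,3) \<psi>0[OF that] by simp
  \<comment> \<open>The radii are chosen backwards: \<open>\<phi>\<close> must send the ball of
    radius \<open>r\<close> into a region that \<open>G\<close> keeps inside the ball of radius
    \<open>\<rho>3\<close>, where \<open>\<phi>\<close> undoes \<open>\<psi>\<close>.\<close>
  obtain \<rho>4 where \<rho>4: "\<rho>4 > 0" "\<rho>4 < R" "\<forall>a\<in>S. \<forall>x\<in>ball 0 \<rho>4. G a x \<in> ball 0 \<rho>3"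
    using smooth_vfamily_small_near_zero[where U = G, OF compact_S R_pos G_smooth_vfamily _ \<phi>(1)] G0 by auto
  obtain r where r: "r > 0" "r < r3" "\<forall>a\<in>S. \<forall>x\<in>ball 0 r. \<phi> a x \<in> ball 0 \<rho>4"
    using smooth_vfamily_small_near_zero[where U = \<phi>, OF compact_S \<phi>(3,4) _ \<rho>4(1)] \<phi>0 by auto
  have d\<phi>: "partial j (\<lambda>a x. \<phi> a x $ i) a 0 = (if i = j then 1 else 0)" if a: "a \<in> S" for a i j
    using partial_inverse_diag[OF \<psi>S3 \<phi>(4) R3(1) \<phi>(3) a \<phi>0[OF a] _ d\<psi>[OF a], of j i] \<phi>(5) a by simp
  have conj: "\<phi> (s a) (diag (\<mu> a) y) = G a (\<phi> a y)" if a: "a \<in> S" and y: "diag (\<mu> a) y \<in> ball 0 r" for a y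
  proof -
    have "1 * norm y \<le> norm (diag (\<mu> a) y)" by (rule norm_diag_ge) (use \<mu>1[OF a] in auto)
    then have y': "y \<in> ball 0 r" using y by simp
    then have x: "\<phi> a y \<in> ball 0 \<rho>4" "\<phi> a y \<in> ball 0 \<rho>3" "\<psi> a (\<phi> a y) = y" using r \<phi>(5) a by auto
    have Gx: "G a (\<phi> a y) \<in> ball 0 \<rho>3" using \<rho>4(3) a x by blast
    have "\<psi> (s a) (G a (\<phi> a y)) = diag (\<mu> a) y"
      using \<psi>G[OF a, of "\<phi> a y"] x Gx R3 \<phi>(2) by simp
    then show ?thesis using \<phi>(6)[rule_format, OF sS[OF a] Gx] y r(2) by simp
  qed
  show ?thesis
  proof (rule exI[of _ \<rho>3], rule exI[of _ r], rule exI[of _ \<psi>], rule exI[of _ \<phi>], intro conjI)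
    show "smooth_vfamily (S \<times> ball 0 \<rho>3) \<psi>" by (rule smooth_vfamily_subset[OF \<psi>S]) (use R3 \<phi>(2) in auto)
    show "smooth_vfamily (S \<times> ball 0 r) \<phi>" by (rule smooth_vfamily_subset[OF \<phi>(4)]) (use r in auto)
    show "\<forall>a\<in>S. \<forall>x\<in>ball 0 \<rho>3. G a x \<in> ball 0 \<rho>3 \<longrightarrow> \<psi> (s a) (G a x) = diag (\<mu> a) (\<psi> a x)"
      using \<psi>G R3 \<phi>(2) by simp
    show "\<forall>a\<in>S. \<psi> a 0 = 0 \<and> (\<forall>i j. partial j (\<lambda>a x. \<psi> a x $ i) a 0 = (if i = j then 1 else 0))"
      using \<psi>0 d\<psi> by simp
  qed (use \<phi> r R3 V(2) \<phi>0 d\<phi> conj in auto)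
qed

text \<open>For the linear cocycle the coordinate functions are fixed points of the operators too.
  The difference between a component of \<open>\<psi> \<circ> \<xi>\<close> and its coordinate is
  then a fixed point that vanishes to second order, and \<open>flat_unique\<close> applies.\<close>

theorem linearization_unique:
  assumes \<psi>: "smooth_vfamily (S \<times> ball 0 \<rho>) \<psi>" "0 < \<rho>"
    and \<psi>0: "\<And>a. a \<in> S \<Longrightarrow> \<psi> a 0 = 0"
    and d\<psi>: "\<And>a i j. a \<in> S \<Longrightarrow> partial j (\<lambda>a x. \<psi> a x $ i) a 0 = (if i = j then 1 else 0)"
    and \<psi>G: "\<And>a x. a \<in> S \<Longrightarrow> x \<in> ball 0 \<rho> \<Longrightarrow> G a x \<in> ball 0 \<rho> \<Longrightarrow> \<psi> (s a) (G a x) = diag (\<mu> a) (\<psi> a x)"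
    and \<xi>: "smooth_vfamily (S \<times> ball 0 \<epsilon>) \<xi>" "0 < \<epsilon>"
    and \<xi>0: "\<And>a. a \<in> S \<Longrightarrow> \<xi> a 0 = 0"
    and d\<xi>: "\<And>a i j. a \<in> S \<Longrightarrow> partial j (\<lambda>a x. \<xi> a x $ i) a 0 = (if i = j then 1 else 0)"
    and \<xi>G: "\<And>a y. a \<in> S \<Longrightarrow> diag (\<mu> a) y \<in> ball 0 \<epsilon> \<Longrightarrow> \<xi> (s a) (diag (\<mu> a) y) = G a (\<xi> a y)"
  shows "\<exists>\<delta>>0. \<delta> < \<epsilon> \<and> (\<forall>a\<in>S. \<forall>y\<in>ball 0 \<delta>. \<xi> a y \<in> ball 0 \<rho> \<and> \<psi> a (\<xi> a y) = y)"
proof -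
  obtain e0 where e0: "e0 > 0" "e0 < \<epsilon>" "\<forall>a\<in>S. \<forall>y\<in>ball 0 e0. \<xi> a y \<in> ball 0 \<rho>"
    using smooth_vfamily_small_near_zero[where U = \<xi>, OF compact_S \<xi>(2,1) _ \<psi>(2)] \<xi>0 by auto
  define e where "e = min e0 1"
  have e: "0 < e" "e \<le> 1" "e < \<epsilon>" "\<forall>a\<in>S. \<forall>y\<in>ball 0 e. \<xi> a y \<in> ball 0 \<rho>" using e0 by (auto simp: e_def)
  obtain lam where lam: "lam > 1" "\<forall>a\<in>S. \<forall>i. lam \<le> \<bar>\<mu> a $ i\<bar>" using \<mu>_uniform by (elim exE conjE)
  \<comment> \<open>The inverse of the linear model; it contracts by \<open>1 / lam\<close>.\<close>
  define f where "f a y = diag (\<nu> a) y" for a and y :: "real^'n"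
  have so: "slice_open (S \<times> ball (0::real^'n) e)" by simp
  have fst: "continuous_on (fst ` (S \<times> ball (0::real^'n) e)) c" if "continuous_on S c" for c :: "'x \<Rightarrow> real"
    by (rule continuous_on_subset[OF that]) auto
  have cc: "contraction_cocycle S s t e (1 / lam) f \<nu> (\<lambda>a. \<mu> (t a) $ i)" for i
  proof (rule cocycle[OF e(1,2)])
    show "smooth_vfamily (S \<times> ball 0 e) f"
      unfolding smooth_vfamily_def f_def diag_nth
      by (intro allI smooth_family_mult[OF so smooth_family_param[OF so fst] smooth_family_coord[OF so]] continuous_on_component[OF \<nu>_cont])
    show "norm (f a x) \<le> 1 / lam * norm x" if a: "a \<in> S" for a x
    proof -
      have "lam * norm (f a x) \<le> norm (diag (\<mu> (t a)) (f a x))" by (rule norm_diag_ge) (use lam tS[OF a] in auto)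
      then show ?thesis using lam(1) diag_\<nu>[OF a] by (simp add: f_def field_simps)
    qed
    show "partial j (\<lambda>a x. f a x $ i) a 0 = (if i = j then \<nu> a $ i else 0)" if "a \<in> S" for a i j
    proof (rule partial_eqI)
      have "((\<lambda>x. \<nu> a $ i * x $ i) has_derivative (\<lambda>h. \<nu> a $ i * h $ i)) (at 0)"
        by (intro has_derivative_mult_right bounded_linear_imp_has_derivative[OF bounded_linear_vec_nth])
      then show "((\<lambda>x. f a x $ i) has_derivative (\<lambda>h. \<Sum>j\<in>UNIV. h $ j * (if i = j then \<nu> a $ i else 0))) (at 0)"
        by (simp add: f_def if_distrib[of "\<lambda>x. _ * x"] mult.commute cong: if_cong)
    qed
  qed (use lam in auto)
  define \<eta> where "\<eta> a y = \<psi> a (\<xi> a y)" for a y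
  have \<xi>e: "smooth_vfamily (S \<times> ball 0 e) \<xi>" by (rule smooth_vfamily_subset[OF \<xi>(1)]) (use e in auto)
  have \<eta>S: "smooth_vfamily (S \<times> ball 0 e) \<eta>"
    unfolding \<eta>_def[abs_def]
    by (rule smooth_vfamily_comp[where U = \<psi> and V = \<xi> and s = "\<lambda>a. a" and \<Psi> = "S \<times> ball 0 \<rho>", OF so \<psi>(1) \<xi>e])
      (use e(4) in auto)
  have \<eta>S': "smooth_family (S \<times> ball 0 e) (\<lambda>a x. \<eta> a x $ i)" for i using \<eta>S by (simp add: smooth_vfamily_def)
  have d\<eta>: "partial j (\<lambda>a x. \<eta> a x $ i) a 0 = (if i = j then 1 else 0)" if a: "a \<in> S" for a i j
  proof -
    have "partial j (\<lambda>a x. \<psi> a (\<xi> a x) $ i) a 0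
      = (\<Sum>k\<in>UNIV. partial k (\<lambda>a x. \<psi> a x $ i) a (\<xi> a 0) * partial j (\<lambda>a x. \<xi> a x $ k) a 0)"
      by (rule partial_comp[where u = "\<lambda>a x. \<psi> a x $ i" and s = "\<lambda>a. a" and V = \<xi>
            and \<Omega> = "S \<times> ball 0 e" and \<Psi> = "S \<times> ball 0 \<rho>"])
        (use \<psi> \<xi>e a e \<xi>0[OF a] in \<open>auto simp: smooth_vfamily_def\<close>)
    also have "\<dots> = (\<Sum>k\<in>UNIV. if k = i then if i = j then 1 else 0 else 0)"
      unfolding \<xi>0[OF a] d\<psi>[OF a] d\<xi>[OF a] by (rule sum.cong) auto
    finally show ?thesis by (simp add: \<eta>_def)
  qed
  have \<eta>T: "\<eta> a y = diag (\<mu> (t a)) (\<eta> (t a) (f a y))" if a: "a \<in> S" and y: "y \<in> ball 0 e" for a y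
  proof -
    \<comment> \<open>Only invariance of the ball under \<open>f\<close> is taken from the locale
      here. It is the same for every component, so an arbitrary index will do.\<close>
    interpret contraction_cocycle S s t e "1 / lam" f \<nu> "\<lambda>a. \<mu> (t a) $ undefined" by (rule cc)
    have fy: "f a y \<in> ball 0 e" using f_ball[OF a, of y e] y by simp
    have dfy: "diag (\<mu> (t a)) (f a y) = y" using diag_\<nu>[OF a] by (simp add: f_def)
    have *: "\<xi> a y = G (t a) (\<xi> (t a) (f a y))"
      using \<xi>G[OF tS[OF a], of "f a y"] dfy y e(3) st[OF a] by simp
    moreover have "\<psi> (s (t a)) (G (t a) (\<xi> (t a) (f a y))) = diag (\<mu> (t a)) (\<psi> (t a) (\<xi> (t a) (f a y)))"
      using e(4)[rule_format, OF a y] e(4)[rule_format, OF tS[OF a] fy]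
      unfolding * by (intro \<psi>G[OF tS[OF a]])
    ultimately show ?thesis using st[OF a] * by (simp add: \<eta>_def)
  qed
  \<comment> \<open>The radius is halved because \<open>flat_unique\<close> works on balls strictly
    inside the domain of the family.\<close>
  have id: "\<eta> a y = y" if a: "a \<in> S" and y: "y \<in> ball 0 (e / 2)" for a y
  proof -
    have "\<eta> a y $ i - y $ i = 0" for i
    proof -
      interpret contraction_cocycle S s t e "1 / lam" f \<nu> "\<lambda>a. \<mu> (t a) $ i" by (rule cc)
      have w: "smooth_family (S \<times> ball 0 e) (\<lambda>a y. \<eta> a y $ i - y $ i)" by (rule smooth_family_diff[OF so \<eta>S' smooth_family_coord[OF so]])
      show ?thesis
      proof (rule flat_unique[where w = "\<lambda>a y. \<eta> a y $ i - y $ i", OF _ w _ _ a y])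
        show "flat 2 (\<lambda>a y. \<eta> a y $ i - y $ i)"
        proof (rule flat2I)
          fix a j assume a: "a \<in> S"
          show "\<eta> a 0 $ i - 0 $ i = 0" using \<xi>0[OF a] \<psi>0[OF a] by (simp add: \<eta>_def)
          have "partial j (\<lambda>a y. \<eta> a y $ i - y $ i) a 0 = partial j (\<lambda>a y. \<eta> a y $ i) a 0 - partial j (\<lambda>a y. y $ i) a 0"
            using partials_diff[OF so \<eta>S' smooth_family_coord[OF so], where vs = "[j]", of a 0] a e(1) by simp
          then show "partial j (\<lambda>a y. \<eta> a y $ i - y $ i) a 0 = 0" by (simp add: d\<eta>[OF a])
        qed
        fix a x assume "(a, x) \<in> S \<times> ball (0::real^'n) e"
        then have ax: "a \<in> S" "x \<in> ball 0 e" by auto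
        have "x $ i = \<mu> (t a) $ i * f a x $ i"
          using arg_cong[OF diag_\<nu>[OF ax(1), of x], of "\<lambda>z. z $ i"] by (simp add: f_def)
        moreover have "\<eta> a x $ i = \<mu> (t a) $ i * \<eta> (t a) (f a x) $ i" by (subst \<eta>T[OF ax]) simp
        ultimately show "\<eta> a x $ i - x $ i = T (\<lambda>a y. \<eta> a y $ i - y $ i) a x"
          by (simp add: T_def algebra_simps)
      qed (use e(1) in simp)
    qed
    then show ?thesis by (simp add: vec_eq_iff)
  qed
  have "\<xi> a y \<in> ball 0 \<rho>" if "a \<in> S" "y \<in> ball 0 (e / 2)" for a y
    using e(4)[rule_format, OF that(1), of y] that(2) e(1) by simp
  then show ?thesis using id e(1,3) unfolding \<eta>_def by (intro exI[of _ "e / 2"]) auto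
qed

end

section \<open>Locally constant choices\<close>

text \<open>In a compact Hausdorff space components are quasi-components. A point that is its own
  component is thus separated by a clopen set from the compact complement of any of its
  neighbourhoods.\<close>

lemma clopen_neighbourhood:
  fixes S :: "'x::topological_space set"
  assumes S: "compact S" and H: "Hausdorff_space (top_of_set S)"
    and td: "\<And>C. C \<subseteq> S \<Longrightarrow> connected C \<Longrightarrow> (\<forall>x\<in>C. \<forall>y\<in>C. x = y)"
    and b: "b \<in> S" and U: "open U" "b \<in> U"
  shows "\<exists>W. openin (top_of_set S) W \<and> closedin (top_of_set S) W \<and> b \<in> W \<and> W \<subseteq> U"
proof -
  let ?X = "top_of_set S"
  have cs: "compact_space ?X" using S by (simp add: compact_space_subtopology)
  let ?C = "connected_component_of_set ?X b"
  have "connectedin ?X ?C" by (rule connectedin_connected_component_of)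
  then have "connected ?C" "?C \<subseteq> S" by (auto simp: connectedin_subtopology)
  moreover have "b \<in> ?C" using b by (simp add: connected_component_of_refl)
  ultimately have "?C = {b}" using td by blast
  then have "{b} \<in> connected_components_of ?X"
    using b by (force simp: connected_components_of_def)
  then have q: "{b} \<in> quasi_components_of ?X"
    using quasi_eq_connected_components_of[of ?X] cs H by simp
  have "closedin ?X (S - U)" using U(1) by (metis closedin_closed_Int Diff_eq closed_Compl)
  then have "compactin ?X (S - U)" by (rule closedin_compact_space[OF cs])
  then have "separated_between ?X {b} (S - U)"
    using separated_between_quasi_component_compact[OF q] U(2) by (simp add: disjnt_def)
  then obtain W where W: "closedin ?X W" "openin ?X W" "{b} \<subseteq> W" "S - U \<subseteq> topspace ?X - W"
    unfolding separated_between by (elim exE conjE)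
  have "W \<subseteq> S" using W(1) by (rule closedin_imp_subset)
  then show ?thesis using W by (intro exI[of _ W]) auto
qed

text \<open>Finitely many clopen sets, each with a valid choice, cover \<open>S\<close>. The choices
  are overwritten on one set after another; a clopen set has no boundary at which local constancy
  could fail.\<close>

lemma locally_constant_choice:
  fixes S :: "'x::topological_space set" and P :: "'o \<Rightarrow> 'x \<Rightarrow> bool"
  assumes S: "compact S" and H: "Hausdorff_space (top_of_set S)"
    and td: "\<And>C. C \<subseteq> S \<Longrightarrow> connected C \<Longrightarrow> (\<forall>x\<in>C. \<forall>y\<in>C. x = y)"
    and loc: "\<And>b. b \<in> S \<Longrightarrow> \<exists>U z. open U \<and> b \<in> U \<and> (\<forall>a\<in>S \<inter> U. P z a)"
  shows "\<exists>ch. (\<forall>a\<in>S. P (ch a) a) \<and> (\<forall>b\<in>S. \<exists>U. open U \<and> b \<in> U \<and> (\<forall>a\<in>S \<inter> U. ch a = ch b))"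
proof -
  have "\<exists>W z. openin (top_of_set S) W \<and> closedin (top_of_set S) W \<and> b \<in> W \<and> (\<forall>a\<in>W. P z a)" if b: "b \<in> S" for b
  proof -
    from loc[OF b] obtain U z where U: "open U" "b \<in> U" "\<forall>a\<in>S \<inter> U. P z a" by (elim exE conjE)
    from clopen_neighbourhood[OF S H td b U(1,2)] obtain W where
      W: "openin (top_of_set S) W" "closedin (top_of_set S) W" "b \<in> W" "W \<subseteq> U" by auto
    have "W \<subseteq> S" using W(2) by (rule closedin_imp_subset)
    then show ?thesis using W U(3) by (intro exI[of _ W] exI[of _ z]) auto
  qed
  then have "\<forall>b. \<exists>Wz. b \<in> S \<longrightarrow> openin (top_of_set S) (fst Wz) \<and> closedin (top_of_set S) (fst Wz) \<and> b \<in> fst Wz \<and> (\<forall>a\<in>fst Wz. P (snd Wz) a)"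
    by (metis fst_conv snd_conv)
  from choice[OF this] obtain Wz where
    Wz: "\<forall>b. b \<in> S \<longrightarrow> openin (top_of_set S) (fst (Wz b)) \<and> closedin (top_of_set S) (fst (Wz b)) \<and> b \<in> fst (Wz b) \<and> (\<forall>a\<in>fst (Wz b). P (snd (Wz b)) a)"
    by (rule exE)
  define W where "W b = fst (Wz b)" for b
  have Wo: "\<exists>T. open T \<and> W b = S \<inter> T" "\<exists>T. open T \<and> S - W b = S \<inter> T" and Wb: "b \<in> W b" if "b \<in> S" for b
  proof -
    show "\<exists>T. open T \<and> W b = S \<inter> T" "b \<in> W b" using Wz that by (auto simp: openin_open W_def)
    have "openin (top_of_set S) (S - W b)" using Wz that by (auto simp: closedin_def W_def)
    then show "\<exists>T. open T \<and> S - W b = S \<inter> T" by (auto simp: openin_open)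
  qed
  obtain T where T: "\<And>b. b \<in> S \<Longrightarrow> open (T b) \<and> W b = S \<inter> T b" using Wo(1) by metis
  obtain C where C: "C \<subseteq> S" "finite C" "S \<subseteq> (\<Union>c\<in>C. T c)"
  proof (rule compactE_image[OF S, of S T])
    show "S \<subseteq> (\<Union>c\<in>S. T c)" using T Wb by blast
  qed (use T in auto)
  have "\<exists>ch. (\<forall>a\<in>(\<Union>c\<in>D. W c). P (ch a) a) \<and> (\<forall>b\<in>S. \<exists>U. open U \<and> b \<in> U \<and> (\<forall>a\<in>S \<inter> U. ch a = ch b))"
    if "finite D" "D \<subseteq> S" for D
    using that
  proof (induction D)
    case empty
    show ?case by (intro exI[of _ "\<lambda>_. undefined"]) (auto intro: exI[of _ UNIV])
  next
    case (insert c D)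
    then have c: "c \<in> S" by simp
    from insert obtain ch where ch: "\<forall>a\<in>(\<Union>c\<in>D. W c). P (ch a) a"
      "\<forall>b\<in>S. \<exists>U. open U \<and> b \<in> U \<and> (\<forall>a\<in>S \<inter> U. ch a = ch b)" by auto
    define ch' where "ch' a = (if a \<in> W c then snd (Wz c) else ch a)" for a
    have "\<exists>U. open U \<and> b \<in> U \<and> (\<forall>a\<in>S \<inter> U. ch' a = ch' b)" if b: "b \<in> S" for b
    proof (cases "b \<in> W c")
      case True
      then show ?thesis using T[OF c] by (intro exI[of _ "T c"]) (auto simp: ch'_def)
    next
      case False
      obtain T' where T': "open T'" "S - W c = S \<inter> T'" using Wo(2)[OF c] by (elim exE conjE)
      obtain U where U: "open U" "b \<in> U" "\<forall>a\<in>S \<inter> U. ch a = ch b" using bspec[OF ch(2) b] by (elim exE conjE)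
      have "b \<in> T'" using T'(2) b False by auto
      moreover have "ch' a = ch' b" if "a \<in> S \<inter> (U \<inter> T')" for a
      proof -
        have "a \<notin> W c" using that T'(2) by auto
        then show ?thesis using False U(3) that by (simp add: ch'_def)
      qed
      ultimately show ?thesis using U T' by (intro exI[of _ "U \<inter> T'"]) auto
    qed
    moreover have "P (ch' a) a" if "a \<in> (\<Union>c\<in>insert c D. W c)" for a
    proof (cases "a \<in> W c")
      case True
      have "\<forall>a\<in>W c. P (snd (Wz c)) a" using Wz c by (simp add: W_def)
      then show ?thesis using True by (simp add: ch'_def)
    next
      case False
      then have "a \<in> (\<Union>c\<in>D. W c)" using that by auto
      then show ?thesis using bspec[OF ch(1), of a] False by (simp add: ch'_def)
    qed
    ultimately show ?case by (intro exI[of _ ch']) simp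
  qed
  from this[OF C(2,1)] obtain ch where ch: "\<forall>a\<in>(\<Union>c\<in>C. W c). P (ch a) a"
    "\<forall>b\<in>S. \<exists>U. open U \<and> b \<in> U \<and> (\<forall>a\<in>S \<inter> U. ch a = ch b)" by (elim exE conjE)
  have cov: "a \<in> (\<Union>c\<in>C. W c)" if "a \<in> S" for a using C(1,3) T that by blast
  have "\<forall>a\<in>S. P (ch a) a" by (rule ballI, rule bspec[OF ch(1)], rule cov)
  then show ?thesis using ch(2) by (intro exI[of _ ch] conjI)
qed

section \<open>Gluing continuity and smoothness over open sets of parameters\<close>

lemma continuous_on_local:
  assumes "\<And>z. z \<in> \<Omega> \<Longrightarrow> \<exists>W. open W \<and> z \<in> W \<and> continuous_on (\<Omega> \<inter> W) f"
  shows "continuous_on \<Omega> f"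
  unfolding continuous_on_def
proof
  fix z assume z: "z \<in> \<Omega>"
  obtain W where W: "open W" "z \<in> W" "continuous_on (\<Omega> \<inter> W) f" using assms[OF z] by (elim exE conjE)
  have "at z within (\<Omega> \<inter> W) = at z within \<Omega>" by (rule at_within_nhd[OF W(2,1)]) auto
  then show "(f \<longlongrightarrow> f z) (at z within \<Omega>)" using W z unfolding continuous_on_def by force
qed

lemma Ck_family_local:
  assumes "\<And>b. b \<in> S \<Longrightarrow> \<exists>U. open U \<and> b \<in> U \<and> Ck_family k (\<Omega> \<inter> (U \<times> UNIV)) u" and \<Omega>: "\<Omega> \<subseteq> S \<times> UNIV"
  shows "Ck_family k \<Omega> u"
  using assms(1)
proof (induction k arbitrary: u)
  have c: "continuous_on \<Omega> (case_prod u)"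
    if "\<And>b. b \<in> S \<Longrightarrow> \<exists>U. open U \<and> b \<in> U \<and> continuous_on (\<Omega> \<inter> (U \<times> UNIV)) (case_prod u)" for u :: "'a \<Rightarrow> real^'b \<Rightarrow> real"
  proof (rule continuous_on_local)
    fix z assume "z \<in> \<Omega>"
    then have "fst z \<in> S" using \<Omega> by auto
    from that[OF this] obtain U where "open U" "fst z \<in> U" "continuous_on (\<Omega> \<inter> (U \<times> UNIV)) (case_prod u)"
      by (elim exE conjE)
    then show "\<exists>W. open W \<and> z \<in> W \<and> continuous_on (\<Omega> \<inter> W) (case_prod u)"
      by (intro exI[of _ "U \<times> UNIV"]) (auto simp: open_Times mem_Times_iff)
  qed
  {
    case 0
    show ?case using c[OF 0[simplified]] by simp
  next
    case (Suc k)
    have 1: "continuous_on \<Omega> (case_prod u)"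
      by (rule c) (use Suc.prems in force)
    have 2: "Ck_family k \<Omega> (partial j u)" for j
    proof (rule Suc.IH)
      fix b assume "b \<in> S"
      from Suc.prems[OF this] obtain U where "open U" "b \<in> U" "Ck_family (Suc k) (\<Omega> \<inter> (U \<times> UNIV)) u" by (elim exE conjE)
      then show "\<exists>U. open U \<and> b \<in> U \<and> Ck_family k (\<Omega> \<inter> (U \<times> UNIV)) (partial j u)"
        by (intro exI[of _ U]) simp
    qed
    have "u a differentiable (at x)" if "(a, x) \<in> \<Omega>" for a x
    proof -
      have "a \<in> S" using that \<Omega> by auto
      from Suc.prems[OF this] obtain U where "a \<in> U" "Ck_family (Suc k) (\<Omega> \<inter> (U \<times> UNIV)) u" by (elim exE conjE)
      from differentiableI[OF Ck_family_SucD(1)[OF this(2), of a x]] show ?thesis using that \<open>a \<in> U\<close> by simp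
    qed
    with 1 2 show ?case by auto
  }
qed

lemma smooth_vfamily_local:
  assumes loc: "\<And>b. b \<in> S \<Longrightarrow> \<exists>U. open U \<and> b \<in> U \<and> smooth_vfamily (\<Omega> \<inter> (U \<times> UNIV)) u" and \<Omega>: "\<Omega> \<subseteq> S \<times> UNIV"
  shows "smooth_vfamily \<Omega> u"
  unfolding smooth_vfamily_def smooth_family_def
proof (intro allI)
  fix i k show "Ck_family k \<Omega> (\<lambda>a x. u a x $ i)"
  proof (rule Ck_family_local[OF _ \<Omega>])
    fix b assume "b \<in> S"
    from loc[OF this] obtain U where "open U" "b \<in> U" "smooth_vfamily (\<Omega> \<inter> (U \<times> UNIV)) u" by (elim exE conjE)
    then show "\<exists>U. open U \<and> b \<in> U \<and> Ck_family k (\<Omega> \<inter> (U \<times> UNIV)) (\<lambda>a x. u a x $ i)"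
      by (intro exI[of _ U]) (simp add: smooth_vfamily_def smooth_family_def)
  qed
qed

section \<open>Manifolds and tangent maps\<close>

locale manifold_atlas =
  fixes A :: "('m::{t2_space, second_countable_topology}, 'n::finite) chart set"
  assumes atlas: "smooth_atlas A"
begin

lemma chartD:
  assumes "c \<in> A"
  shows "is_chart c" "open (fst c)" "open (snd c ` fst c)"
    "continuous_on (fst c) (snd c)" "continuous_on (snd c ` fst c) (chart_inv c)"
  using assms atlas unfolding smooth_atlas_def is_chart_def homeomorphism_def by auto

lemma is_chart_inv:
  assumes "is_chart c"
  shows "x \<in> fst c \<Longrightarrow> chart_inv c (snd c x) = x"
    "y \<in> snd c ` fst c \<Longrightarrow> snd c (chart_inv c y) = y"
    "y \<in> snd c ` fst c \<Longrightarrow> chart_inv c y \<in> fst c"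
  using assms unfolding is_chart_def homeomorphism_def by (auto 4 3)

lemmas chart_inv = is_chart_inv[OF chartD(1)]

lemma chart_at: "chart_at A x \<in> A" "x \<in> fst (chart_at A x)"
proof -
  have "\<exists>c. c \<in> A \<and> x \<in> fst c" using atlas unfolding smooth_atlas_def by blast
  from someI_ex[OF this] show "chart_at A x \<in> A" "x \<in> fst (chart_at A x)" unfolding chart_at_def by auto
qed

lemma open_image:
  assumes c: "c \<in> A" and U: "open U" "U \<subseteq> fst c"
  shows "open (snd c ` U)"
proof -
  have "snd c ` U = snd c ` fst c \<inter> chart_inv c -` U"
    using U(2) chart_inv[OF c] by force
  moreover have "open (snd c ` fst c \<inter> chart_inv c -` U)"
    using continuous_open_preimage[OF chartD(5)[OF c] chartD(3)[OF c] U(1)] .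
  ultimately show ?thesis by simp
qed

lemma transition_smooth: "c \<in> A \<Longrightarrow> d \<in> A \<Longrightarrow> smooth_on (snd c ` (fst c \<inter> fst d)) (snd d \<circ> chart_inv c)"
  using atlas unfolding smooth_atlas_def compatible_def by blast

lemma transition_open: "c \<in> A \<Longrightarrow> d \<in> A \<Longrightarrow> open (snd c ` (fst c \<inter> fst d))"
  by (rule open_image) (auto simp: chartD)

lemma smooth_on_has_derivative:
  fixes f :: "real^'k::finite \<Rightarrow> real^'k"
  assumes "smooth_on V f" "open V" "y \<in> V"
  shows "(f has_derivative frechet_derivative f (at y)) (at y)"
proof -
  have "iter_deriv V [] f differentiable (at y within V)" using assms unfolding smooth_on_def by blast
  then have "f differentiable (at y)" using at_within_open[OF assms(3,2)] by simp
  then show ?thesis by (simp only: frechet_derivative_works)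
qed

text \<open>The derivative at the point \<open>x\<close> of the transition map from \<open>c\<close> to \<open>d\<close>.\<close>

definition tr :: "('m, 'n) chart \<Rightarrow> ('m, 'n) chart \<Rightarrow> 'm \<Rightarrow> real^'n \<Rightarrow> real^'n" where
  "tr c d x = frechet_derivative (snd d \<circ> chart_inv c) (at (snd c x))"

lemma tr_derivative:
  assumes "c \<in> A" "d \<in> A" "x \<in> fst c" "x \<in> fst d"
  shows "((snd d \<circ> chart_inv c) has_derivative tr c d x) (at (snd c x))"
  unfolding tr_def
  by (rule smooth_on_has_derivative[OF transition_smooth transition_open]) (use assms in auto)

lemma tr_compose:
  assumes "c \<in> A" "d \<in> A" "e \<in> A" "x \<in> fst c" "x \<in> fst d" "x \<in> fst e"
  shows "tr d e x (tr c d x v) = tr c e x v"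
proof -
  have "((snd e \<circ> chart_inv d) has_derivative tr d e x) (at ((snd d \<circ> chart_inv c) (snd c x)))"
    using tr_derivative[OF assms(2,3,5,6)] chart_inv(1)[OF assms(1,4)] by simp
  from diff_chain_at[OF tr_derivative[OF assms(1,2,4,5)] this]
  have 1: "((snd e \<circ> chart_inv d) \<circ> (snd d \<circ> chart_inv c) has_derivative tr d e x \<circ> tr c d x) (at (snd c x))" .
  have "(snd e \<circ> chart_inv c has_derivative tr d e x \<circ> tr c d x) (at (snd c x))"
  proof (rule has_derivative_transform_within_open[OF 1 transition_open[OF assms(1,2)]])
    show "snd c x \<in> snd c ` (fst c \<inter> fst d)" using assms by auto
    fix y assume "y \<in> snd c ` (fst c \<inter> fst d)"
    then show "((snd e \<circ> chart_inv d) \<circ> (snd d \<circ> chart_inv c)) y = (snd e \<circ> chart_inv c) y"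
      using chart_inv(1)[OF assms(1)] chart_inv(1)[OF assms(2)] by auto
  qed
  from has_derivative_unique[OF this tr_derivative[OF assms(1,3,4,6)]]
  show ?thesis by (metis comp_apply)
qed

lemma tr_self:
  assumes "c \<in> A" "x \<in> fst c"
  shows "tr c c x v = v"
proof -
  have "((\<lambda>y. y) has_derivative (\<lambda>v. v)) (at (snd c x))" by (rule has_derivative_ident)
  then have "((snd c \<circ> chart_inv c) has_derivative (\<lambda>v. v)) (at (snd c x))"
    by (rule has_derivative_transform_within_open[OF _ chartD(3)[OF assms(1)]])
      (use assms chart_inv(2)[OF assms(1)] in auto)
  from has_derivative_unique[OF this tr_derivative[OF assms(1,1,2,2)]] show ?thesis by metis
qed

lemma tr_linear:
  assumes "c \<in> A" "d \<in> A" "x \<in> fst c" "x \<in> fst d"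
  shows "linear (tr c d x)"
  by (rule has_derivative_linear[OF tr_derivative[OF assms]])

lemma to_coord_tr: "to_coord A c x = tr (chart_at A x) c x"
  by (simp add: to_coord_def tr_def)

lemma of_coord_tr: "of_coord A c x = tr c (chart_at A x) x"
  by (simp add: of_coord_def tr_def)

lemma to_of_coord: "c \<in> A \<Longrightarrow> x \<in> fst c \<Longrightarrow> to_coord A c x (of_coord A c x v) = v"
  unfolding to_coord_tr of_coord_tr by (simp add: tr_compose tr_self chart_at)

lemma of_to_coord: "c \<in> A \<Longrightarrow> x \<in> fst c \<Longrightarrow> of_coord A c x (to_coord A c x v) = v"
  unfolding to_coord_tr of_coord_tr by (simp add: tr_compose tr_self chart_at)

lemma to_coord_linear: "c \<in> A \<Longrightarrow> x \<in> fst c \<Longrightarrow> linear (to_coord A c x)"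
  unfolding to_coord_tr by (simp add: tr_linear chart_at)

lemma of_coord_linear: "c \<in> A \<Longrightarrow> x \<in> fst c \<Longrightarrow> linear (of_coord A c x)"
  unfolding of_coord_tr by (simp add: tr_linear chart_at)

lemma smooth_map_on:
  assumes g: "smooth_map A g" and c: "c \<in> A" and d: "d \<in> A"
  shows "smooth_on (snd c ` (fst c \<inter> g -` fst d)) (snd d \<circ> g \<circ> chart_inv c)"
    "open (snd c ` (fst c \<inter> g -` fst d))"
proof -
  show "smooth_on (snd c ` (fst c \<inter> g -` fst d)) (snd d \<circ> g \<circ> chart_inv c)"
    using g c d unfolding smooth_map_def by blast
  have "open (g -` fst d)" using g chartD(2)[OF d] unfolding smooth_map_def by (metis open_vimage)
  then show "open (snd c ` (fst c \<inter> g -` fst d))" by (intro open_image c) (auto simp: chartD c)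
qed

text \<open>\<open>tangent_map\<close> is defined through the charts \<open>chart_at\<close>, which
  may jump from point to point. The chain rule with the two transition maps expresses it in any pair
  of charts; the three-fold composition agrees with \<open>g\<close> in charts only near
  \<open>snd c x\<close>, hence the restriction to an open set.\<close>

lemma tangent_map_derivative:
  assumes g: "smooth_map A g" and c: "c \<in> A" "x \<in> fst c" and d: "d \<in> A" "g x \<in> fst d"
  shows "((snd d \<circ> g \<circ> chart_inv c) has_derivative
    (\<lambda>v. to_coord A d (g x) (tangent_map A g x (of_coord A c x v)))) (at (snd c x))"
proof -
  let ?c = "chart_at A x" and ?d = "chart_at A (g x)"
  have 1: "((snd ?d \<circ> g \<circ> chart_inv ?c) has_derivative tangent_map A g x) (at (snd ?c x))"
    unfolding tangent_map_def
    by (rule smooth_on_has_derivative[OF smooth_map_on[OF g]]) (auto simp: chart_at)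
  have e1: "(snd ?c \<circ> chart_inv c) (snd c x) = snd ?c x" using chart_inv(1)[OF c] by simp
  have e2: "(snd ?d \<circ> g \<circ> chart_inv ?c) (snd ?c x) = snd ?d (g x)" using chart_inv(1)[OF chart_at] by simp
  have D1: "((snd ?c \<circ> chart_inv c) has_derivative of_coord A c x) (at (snd c x))"
    unfolding of_coord_tr by (rule tr_derivative) (use c chart_at in auto)
  have D2: "((snd d \<circ> chart_inv ?d) has_derivative to_coord A d (g x)) (at (snd ?d (g x)))"
    unfolding to_coord_tr by (rule tr_derivative) (use d chart_at in auto)
  have "((snd d \<circ> chart_inv ?d) \<circ> ((snd ?d \<circ> g \<circ> chart_inv ?c) \<circ> (snd ?c \<circ> chart_inv c)) has_derivative
      to_coord A d (g x) \<circ> (tangent_map A g x \<circ> of_coord A c x)) (at (snd c x))"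
  proof (rule diff_chain_at[OF diff_chain_at[OF D1]])
    show "((snd ?d \<circ> g \<circ> chart_inv ?c) has_derivative tangent_map A g x) (at ((snd ?c \<circ> chart_inv c) (snd c x)))"
      unfolding e1 by (rule 1)
    have "((snd ?d \<circ> g \<circ> chart_inv ?c) \<circ> (snd ?c \<circ> chart_inv c)) (snd c x) = snd ?d (g x)"
      using e1 e2 by simp
    then show "((snd d \<circ> chart_inv ?d) has_derivative to_coord A d (g x))
       (at (((snd ?d \<circ> g \<circ> chart_inv ?c) \<circ> (snd ?c \<circ> chart_inv c)) (snd c x)))" using D2 by simp
  qed
  moreover have "open (snd c ` (fst c \<inter> (fst ?c \<inter> g -` fst ?d)))"
  proof (rule open_image[OF c(1)])
    have "open (g -` fst ?d)" using g chartD(2)[OF chart_at(1)] unfolding smooth_map_def by (metis open_vimage)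
    then show "open (fst c \<inter> (fst ?c \<inter> g -` fst ?d))" using chartD(2)[OF chart_at(1)] chartD(2)[OF c(1)] by auto
  qed auto
  ultimately have "((snd d \<circ> g \<circ> chart_inv c) has_derivative
      to_coord A d (g x) \<circ> (tangent_map A g x \<circ> of_coord A c x)) (at (snd c x))"
  proof (rule has_derivative_transform_within_open)
    show "snd c x \<in> snd c ` (fst c \<inter> (fst ?c \<inter> g -` fst ?d))" using c chart_at by auto
    fix y assume "y \<in> snd c ` (fst c \<inter> (fst ?c \<inter> g -` fst ?d))"
    then show "((snd d \<circ> chart_inv ?d) \<circ> ((snd ?d \<circ> g \<circ> chart_inv ?c) \<circ> (snd ?c \<circ> chart_inv c))) y = (snd d \<circ> g \<circ> chart_inv c) y"
      using chart_inv(1)[OF c(1)] chart_inv(1)[OF chart_at(1)] by auto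
  qed
  then show ?thesis by (simp add: comp_def)
qed

lemma tangent_map_linear: "smooth_map A g \<Longrightarrow> linear (tangent_map A g x)"
  unfolding tangent_map_def
  by (rule has_derivative_linear, rule smooth_on_has_derivative[OF smooth_map_on]) (auto simp: chart_at)

end

section \<open>The smooth topology\<close>

lemma iter_deriv_rel_open:
  assumes Q: "open Q" and v: "v \<in> C \<inter> Q"
  shows "iter_deriv C vs f v = iter_deriv (C \<inter> Q) vs f v"
  using v
proof (induction vs arbitrary: v)
  case (Cons x vs)
  have "at v within C = at v within (C \<inter> Q)"
    by (rule at_within_nhd[OF _ Q]) (use Cons.prems in auto)
  moreover have "frechet_derivative (iter_deriv C vs f) (at v within (C \<inter> Q))
      = frechet_derivative (iter_deriv (C \<inter> Q) vs f) (at v within (C \<inter> Q))"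
    unfolding frechet_derivative_def
    using has_derivative_within_cong[OF Cons.prems, of "iter_deriv C vs f" "iter_deriv (C \<inter> Q) vs f"] Cons.IH by simp
  ultimately show ?case by simp
qed simp

lemma smooth_on_iter_deriv_continuous:
  assumes "smooth_on T f"
  shows "continuous_on T (iter_deriv T vs f)"
  using assms unfolding smooth_on_def
  by (intro differentiable_imp_continuous_on) (simp add: differentiable_on_def)

text \<open>The tube lemma again, for a compact fibre \<open>L\<close>. It makes conditions of the
  form "for all \<open>v\<close> in \<open>L\<close>" open in the parameter, and these are the
  conditions defining the smooth topology.\<close>

lemma openin_all_fibre:
  fixes S' :: "'x::topological_space set" and L :: "'e::topological_space set"
  assumes L: "compact L" and Z: "openin (top_of_set (S' \<times> L)) Z"
  shows "openin (top_of_set S') {a \<in> S'. {a} \<times> L \<subseteq> Z}"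
proof (subst openin_subopen, intro ballI)
  fix a assume "a \<in> {a \<in> S'. {a} \<times> L \<subseteq> Z}"
  then have a: "a \<in> S'" "{a} \<times> L \<subseteq> Z" by auto
  have "prod_topology (top_of_set S') (top_of_set L) = top_of_set (S' \<times> L)"
    by (simp add: subtopology_Times[symmetric] euclidean_product_topology)
  then have Z': "openin (prod_topology (top_of_set S') (top_of_set L)) Z" using Z by simp
  have cL: "compactin (top_of_set L) L" using L by (simp add: compactin_subtopology)
  obtain U V where UV: "openin (top_of_set S') U" "a \<in> U" "L \<subseteq> V" "U \<times> V \<subseteq> Z"
    using tube_lemma_right[OF Z' cL, of a] a by auto
  then have "U \<subseteq> S'" by (simp add: openin_imp_subset)
  then have "U \<subseteq> {a \<in> S'. {a} \<times> L \<subseteq> Z}" using UV by auto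
  then show "\<exists>T. openin (top_of_set S') T \<and> a \<in> T \<and> T \<subseteq> {a \<in> S'. {a} \<times> L \<subseteq> Z}"
    using UV by blast
qed

context manifold_atlas
begin

lemma tr_continuous_at:
  assumes c: "c \<in> A" and e: "e \<in> A"
  shows "continuous_on (fst c \<inter> fst e) (\<lambda>x. tr c e x w)"
proof -
  let ?V = "snd c ` (fst c \<inter> fst e)"
  have "continuous_on ?V (iter_deriv ?V [w] (snd e \<circ> chart_inv c))"
    by (rule smooth_on_iter_deriv_continuous[OF transition_smooth[OF c e]])
  then have "continuous_on (fst c \<inter> fst e) (\<lambda>x. iter_deriv ?V [w] (snd e \<circ> chart_inv c) (snd c x))"
    by (rule continuous_on_compose2) (auto intro: continuous_on_subset[OF chartD(4)[OF c]])
  moreover have "iter_deriv ?V [w] (snd e \<circ> chart_inv c) (snd c x) = tr c e x w" if "x \<in> fst c \<inter> fst e" for x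
    using at_within_open[OF imageI[OF that, of "snd c"] transition_open[OF c e]] by (simp add: tr_def)
  ultimately show ?thesis by (rule continuous_on_eq) simp
qed

lemma tr_continuous:
  fixes p :: "'s::topological_space \<Rightarrow> 'm"
  assumes c: "c \<in> A" and e: "e \<in> A" and p: "continuous_on X p" "\<And>s. s \<in> X \<Longrightarrow> p s \<in> fst c \<inter> fst e"
    and W: "continuous_on X W"
  shows "continuous_on X (\<lambda>s. tr c e (p s) (W s))"
proof -
  have "continuous_on X (\<lambda>s. \<Sum>j\<in>UNIV. W s $ j *\<^sub>R tr c e (p s) (axis j 1))"
    by (intro continuous_on_sum continuous_on_scaleR continuous_on_component W
        continuous_on_compose2[OF tr_continuous_at[OF c e] p(1)]) (use p(2) in auto)
  then show ?thesis
    by (rule continuous_on_eq) (use linear_expand_axis[OF tr_linear[OF c e]] p(2) in auto)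
qed

lemma atlas_nonempty: "\<exists>c. c \<in> A" using chart_at by blast

text \<open>The family must be smooth on a relatively open set around the closed balls, so that
  derivatives at the boundary are restrictions of jointly continuous ones. The preimage of a
  subbasic set then consists of the parameters whose fibre \<open>{a} \<times> L\<close> lies in a
  relatively open set \<open>Z\<close>.\<close>

lemma continuous_into_smooth_topology:
  fixes S' :: "'x::topological_space set" and h :: "'x \<Rightarrow> real^'n \<Rightarrow> 'm"
  assumes r: "r > 0" and sub: "S' \<times> cball 0 r \<subseteq> \<Omega>" and \<Omega>: "openin (top_of_set (S' \<times> UNIV)) \<Omega>"
    and hc: "continuous_on \<Omega> (case_prod h)"
    and hS: "\<And>e. e \<in> A \<Longrightarrow> smooth_vfamily {z \<in> \<Omega>. case_prod h z \<in> fst e} (\<lambda>a w. snd e (h a w))"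
  shows "continuous_map (top_of_set S') (smooth_topology A r) h"
proof -
  define \<Omega>e where "\<Omega>e e = {z \<in> \<Omega>. case_prod h z \<in> fst e}" for e :: "('m, 'n) chart"
  let ?C = "cball (0::real^'n) r"
  have \<Omega>eo: "openin (top_of_set (S' \<times> UNIV)) (\<Omega>e e)" if "e \<in> A" for e
  proof -
    have "openin (top_of_set \<Omega>) (\<Omega> \<inter> case_prod h -` fst e)"
      by (rule continuous_openin_preimage_gen[OF hc chartD(2)[OF that]])
    then have "openin (top_of_set \<Omega>) (\<Omega>e e)" by (simp add: \<Omega>e_def Int_def vimage_def)
    then show ?thesis using \<Omega> by (rule openin_trans)
  qed
  have so: "slice_open (\<Omega>e e)" if e: "e \<in> A" for e
  proof -
    obtain T where T: "open T" "\<Omega>e e = (S' \<times> UNIV) \<inter> T" using \<Omega>eo[OF e] by (auto simp: openin_open)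
    have "open {x. (a, x) \<in> \<Omega>e e}" for a
    proof (cases "a \<in> S'")
      case True
      have "open ((\<lambda>x. (a, x)) -` T)" by (rule open_vimage[OF T(1)]) (intro continuous_intros)
      moreover have "{x. (a, x) \<in> \<Omega>e e} = (\<lambda>x. (a, x)) -` T" using T(2) True by auto
      ultimately show ?thesis by simp
    next
      case False
      then have "{x. (a, x) \<in> \<Omega>e e} = {}" using T(2) by auto
      then show ?thesis by simp
    qed
    then show ?thesis by (simp add: slice_open_def)
  qed
  have Tdef: "?C \<inter> h a -` fst e = ?C \<inter> {x. (a, x) \<in> \<Omega>e e}" if "a \<in> S'" for a e
    using sub that by (auto simp: \<Omega>e_def)
  \<comment> \<open>A ball cut with an open set: derivatives within it are unique even at boundary
    points of the ball.\<close>
  have gd: "unique_deriv_domain (?C \<inter> {x. (a, x) \<in> \<Omega>e e})" if "e \<in> A" for a e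
    by (rule unique_deriv_domain_convex) (use r slice_openD[OF so[OF that], of a] in auto)
  have sb: "smooth_ball_map A r (h a)" if a: "a \<in> S'" for a
    unfolding smooth_ball_map_def
  proof (intro conjI ballI)
    have "continuous_on ?C (\<lambda>x. case_prod h (a, x))"
      by (rule continuous_on_compose2[OF hc]) (use sub a in \<open>auto intro!: continuous_intros\<close>)
    then show "continuous_on ?C (h a)" by simp
    fix e assume e: "e \<in> A"
    have "smooth_on (?C \<inter> {x. (a, x) \<in> \<Omega>e e}) (\<lambda>w. snd e (h a w))"
      by (rule smooth_vfamily_smooth_on[OF so[OF e] hS[OF e, folded \<Omega>e_def] _ gd[OF e]]) auto
    then show "smooth_on (?C \<inter> h a -` fst e) (snd e \<circ> h a)"
      unfolding Tdef[OF a] comp_def .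
  qed
  show ?thesis
    unfolding smooth_topology_def continuous_on_generated_topo_iff
  proof (intro conjI allI impI)
    fix U assume "U \<in> {{h. smooth_ball_map A r h \<and> h ` L \<subseteq> fst c \<and>
          (\<forall>v\<in>L. dist (iter_deriv (cball 0 r) vs (snd c \<circ> h) v)
                        (iter_deriv (cball 0 r) vs (snd c \<circ> f) v) < e)}
      |f c L vs e. smooth_ball_map A r f \<and> c \<in> A \<and> compact L \<and> L \<subseteq> cball 0 r \<and>
          f ` L \<subseteq> fst c \<and> e > 0}"
    then obtain f c L vs e where U: "U = {h. smooth_ball_map A r h \<and> h ` L \<subseteq> fst c \<and>
          (\<forall>v\<in>L. dist (iter_deriv (cball 0 r) vs (snd c \<circ> h) v)
                        (iter_deriv (cball 0 r) vs (snd c \<circ> f) v) < e)}"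
      and f: "smooth_ball_map A r f" and c: "c \<in> A" and L: "compact L" "L \<subseteq> ?C" "f ` L \<subseteq> fst c" and e: "e > 0"
      by (elim CollectE exE conjE)
    define ref where "ref = iter_deriv ?C vs (snd c \<circ> f)"
    have refc: "continuous_on L ref"
    proof -
      have "continuous_on ?C f" using f by (simp add: smooth_ball_map_def)
      then have "openin (top_of_set ?C) (?C \<inter> f -` fst c)"
        by (rule continuous_openin_preimage_gen[OF _ chartD(2)[OF c]])
      then obtain Q where Q: "open Q" "?C \<inter> f -` fst c = ?C \<inter> Q" by (auto simp: openin_open)
      have "smooth_on (?C \<inter> f -` fst c) (snd c \<circ> f)" using f c by (simp add: smooth_ball_map_def)
      then have "smooth_on (?C \<inter> Q) (snd c \<circ> f)" unfolding Q(2) .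
      from smooth_on_iter_deriv_continuous[OF this, of vs]
      have "continuous_on (?C \<inter> Q) ref"
        by (rule continuous_on_eq) (unfold ref_def, rule iter_deriv_rel_open[OF Q(1), symmetric])
      then show ?thesis by (rule continuous_on_subset) (use L Q(2) in auto)
    qed
    obtain W where W: "smooth_vfamily (\<Omega>e c) W" "\<And>a T x. T \<subseteq> {x. (a, x) \<in> \<Omega>e c} \<Longrightarrow> unique_deriv_domain T \<Longrightarrow> x \<in> T \<Longrightarrow>
        iter_deriv T vs (\<lambda>w. snd c (h a w)) x = W a x"
      using iter_deriv_smooth_vfamily[OF so[OF c] hS[OF c, folded \<Omega>e_def], of vs] by auto
    have WC: "iter_deriv ?C vs (snd c \<circ> h a) v = W a v" if "v \<in> ?C" "(a, v) \<in> \<Omega>e c" for a v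
    proof -
      have "iter_deriv ?C vs (snd c \<circ> h a) v = iter_deriv (?C \<inter> {x. (a, x) \<in> \<Omega>e c}) vs (snd c \<circ> h a) v"
        by (rule iter_deriv_rel_open[OF slice_openD[OF so[OF c]]]) (use that in auto)
      also have "\<dots> = W a v" unfolding comp_def
        by (rule W(2)[OF _ gd[OF c]]) (use that in auto)
      finally show ?thesis .
    qed
    define Y where "Y = \<Omega>e c \<inter> (S' \<times> L)"
    have Yo: "openin (top_of_set (S' \<times> L)) Y"
    proof -
      obtain T where "open T" "\<Omega>e c = (S' \<times> UNIV) \<inter> T" using \<Omega>eo[OF c] by (auto simp: openin_open)
      then have "Y = (S' \<times> L) \<inter> T" by (auto simp: Y_def)
      then show ?thesis using \<open>open T\<close> by (auto simp: openin_open)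
    qed
    define Z where "Z = {z \<in> Y. dist (W (fst z) (snd z)) (ref (snd z)) < e}"
    have "continuous_on Y (\<lambda>z. dist (W (fst z) (snd z)) (ref (snd z)))"
    proof (intro continuous_on_dist)
      show "continuous_on Y (\<lambda>z. W (fst z) (snd z))"
        using continuous_on_subset[OF smooth_vfamily_continuous[OF W(1)], of Y] by (simp add: Y_def case_prod_beta)
      show "continuous_on Y (\<lambda>z. ref (snd z))"
        by (rule continuous_on_compose2[OF refc]) (auto simp: Y_def intro!: continuous_intros)
    qed
    then have "openin (top_of_set Y) (Y \<inter> (\<lambda>z. dist (W (fst z) (snd z)) (ref (snd z))) -` {..<e})"
      by (rule continuous_openin_preimage_gen) simp
    then have "openin (top_of_set Y) Z" by (simp add: Z_def Int_def vimage_def)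
    then have Zo: "openin (top_of_set (S' \<times> L)) Z" using Yo by (rule openin_trans)
    have "h -` U \<inter> topspace (top_of_set S') = {a \<in> S'. {a} \<times> L \<subseteq> Z}"
    proof (intro equalityI subsetI)
      fix a assume "a \<in> h -` U \<inter> topspace (top_of_set S')"
      then have a: "a \<in> S'" "h a \<in> U" by auto
      have "(a, v) \<in> Z" if v: "v \<in> L" for v
      proof -
        have 1: "(a, v) \<in> \<Omega>e c" "v \<in> ?C" using a v sub L by (auto simp: \<Omega>e_def U)
        have "dist (iter_deriv ?C vs (snd c \<circ> h a) v) (iter_deriv ?C vs (snd c \<circ> f) v) < e"
          using a(2) v unfolding U by blast
        then show ?thesis using 1 a(1) v unfolding WC[OF 1(2,1)] by (simp add: Z_def Y_def ref_def)
      qed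
      then show "a \<in> {a \<in> S'. {a} \<times> L \<subseteq> Z}" using a by auto
    next
      fix a assume "a \<in> {a \<in> S'. {a} \<times> L \<subseteq> Z}"
      then have a: "a \<in> S'" "\<And>v. v \<in> L \<Longrightarrow> (a, v) \<in> Z" by auto
      have "h a v \<in> fst c \<and> dist (iter_deriv ?C vs (snd c \<circ> h a) v) (iter_deriv ?C vs (snd c \<circ> f) v) < e" if v: "v \<in> L" for v
      proof -
        have 1: "(a, v) \<in> \<Omega>e c" "v \<in> ?C" using a(2)[OF v] v L by (auto simp: Z_def Y_def)
        then show ?thesis using a(2)[OF v] WC[OF 1(2,1)] by (simp add: Z_def ref_def \<Omega>e_def)
      qed
      then have "h a \<in> U" using sb[OF a(1)] by (auto simp: U)
      then show "a \<in> h -` U \<inter> topspace (top_of_set S')" using a by simp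
    qed
    then show "openin (top_of_set S') (h -` U \<inter> topspace (top_of_set S'))"
      using openin_all_fibre[OF L(1) Zo] by simp
  next
    obtain c where c: "c \<in> A" using atlas_nonempty by (rule exE)
    show "h ` topspace (top_of_set S') \<subseteq> \<Union> {{h. smooth_ball_map A r h \<and> h ` L \<subseteq> fst c \<and>
          (\<forall>v\<in>L. dist (iter_deriv (cball 0 r) vs (snd c \<circ> h) v)
                        (iter_deriv (cball 0 r) vs (snd c \<circ> f) v) < e)}
      |f c L vs e. smooth_ball_map A r f \<and> c \<in> A \<and> compact L \<and> L \<subseteq> cball 0 r \<and>
          f ` L \<subseteq> fst c \<and> e > 0}"
    proof
      fix k assume "k \<in> h ` topspace (top_of_set S')"
      then have k: "smooth_ball_map A r k" using sb by auto
      \<comment> \<open>For \<open>L = {}\<close> the conditions on the chart and on the derivatives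
        are void, so every smooth map of the ball belongs to some subbasic set.\<close>
      have "k \<in> {h. smooth_ball_map A r h \<and> h ` {} \<subseteq> fst c \<and>
          (\<forall>v\<in>{}. dist (iter_deriv (cball 0 r) [] (snd c \<circ> h) v)
                        (iter_deriv (cball 0 r) [] (snd c \<circ> k) v) < 1)}" using k by simp
      moreover have "{h. smooth_ball_map A r h \<and> h ` {} \<subseteq> fst c \<and>
          (\<forall>v\<in>{}. dist (iter_deriv (cball 0 r) [] (snd c \<circ> h) v)
                        (iter_deriv (cball 0 r) [] (snd c \<circ> k) v) < 1)} \<in>
        {{h. smooth_ball_map A r h \<and> h ` L \<subseteq> fst c \<and>
          (\<forall>v\<in>L. dist (iter_deriv (cball 0 r) vs (snd c \<circ> h) v)
                        (iter_deriv (cball 0 r) vs (snd c \<circ> f) v) < e)}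
      |f c L vs e. smooth_ball_map A r f \<and> c \<in> A \<and> compact L \<and> L \<subseteq> cball 0 r \<and>
          f ` L \<subseteq> fst c \<and> e > 0}"
        using k c by (intro CollectI exI[of _ k] exI[of _ c] exI[of _ "{}"] exI[of _ "[]"] exI[of _ 1]) simp
      ultimately show "k \<in> \<Union> {{h. smooth_ball_map A r h \<and> h ` L \<subseteq> fst c \<and>
          (\<forall>v\<in>L. dist (iter_deriv (cball 0 r) vs (snd c \<circ> h) v)
                        (iter_deriv (cball 0 r) vs (snd c \<circ> f) v) < e)}
      |f c L vs e. smooth_ball_map A r f \<and> c \<in> A \<and> compact L \<and> L \<subseteq> cball 0 r \<and>
          f ` L \<subseteq> fst c \<and> e > 0}" by (rule UnionI[rotated])
    qed
  qed
qed

text \<open>The converse on the open ball. A derivative at a nearby pair \<open>(b, y)\<close> is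
  compared with the one at \<open>(a, y)\<close> through a subbasic neighbourhood with
  \<open>L\<close> a closed ball around \<open>x\<close>, and then with the one at
  \<open>(a, x)\<close> through smoothness of \<open>h a\<close> alone.\<close>

lemma continuous_from_smooth_topology:
  fixes S' :: "'x::topological_space set" and h :: "'x \<Rightarrow> real^'n \<Rightarrow> 'm"
  assumes r: "r > 0" and h: "continuous_map (top_of_set S') (smooth_topology A r) h" and e: "e \<in> A"
  defines "\<Omega> \<equiv> {(a, w). a \<in> S' \<and> w \<in> ball 0 r \<and> h a w \<in> fst e}"
  shows "openin (top_of_set (S' \<times> UNIV)) \<Omega> \<and> slice_open \<Omega> \<and> smooth_vfamily \<Omega> (\<lambda>a w. snd e (h a w))"
proof -
  let ?C = "cball (0::real^'n) r"
  define sl where "sl a = {x. (a, x) \<in> \<Omega>}" for a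
  have near: "\<exists>U. open U \<and> a \<in> U \<and> (\<forall>b\<in>S' \<inter> U. h b ` L \<subseteq> fst e \<and>
      (\<forall>v\<in>L. dist (iter_deriv ?C vs (snd e \<circ> h b) v) (iter_deriv ?C vs (snd e \<circ> h a) v) < \<epsilon>))"
    if a: "a \<in> S'" and sa: "smooth_ball_map A r (h a)" and L: "compact L" "L \<subseteq> ?C" "h a ` L \<subseteq> fst e" and \<epsilon>: "\<epsilon> > 0" for a L vs \<epsilon>
  proof -
    define U where "U = {k. smooth_ball_map A r k \<and> k ` L \<subseteq> fst e \<and>
          (\<forall>v\<in>L. dist (iter_deriv ?C vs (snd e \<circ> k) v) (iter_deriv ?C vs (snd e \<circ> h a) v) < \<epsilon>)}"
    have "U \<in> {{h. smooth_ball_map A r h \<and> h ` L \<subseteq> fst c \<and>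
          (\<forall>v\<in>L. dist (iter_deriv (cball 0 r) vs (snd c \<circ> h) v)
                        (iter_deriv (cball 0 r) vs (snd c \<circ> f) v) < e)}
      |f c L vs e. smooth_ball_map A r f \<and> c \<in> A \<and> compact L \<and> L \<subseteq> cball 0 r \<and>
          f ` L \<subseteq> fst c \<and> e > 0}"
      unfolding U_def using sa L \<epsilon> e
      by (intro CollectI exI[of _ "h a"] exI[of _ e] exI[of _ L] exI[of _ vs] exI[of _ \<epsilon>]) simp
    then have "openin (smooth_topology A r) U" unfolding smooth_topology_def by (rule topology_generated_by_Basis)
    from openin_continuous_map_preimage[OF h this]
    have "openin (top_of_set S') {b \<in> S'. h b \<in> U}" by simp
    then obtain T where T: "open T" "{b \<in> S'. h b \<in> U} = S' \<inter> T" by (auto simp: openin_open)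
    have "h a \<in> U" using sa L \<epsilon> by (simp add: U_def)
    then have "a \<in> T" using T(2) a by auto
    moreover have "h b \<in> U" if "b \<in> S' \<inter> T" for b using that T(2) by auto
    ultimately show ?thesis using T(1) by (intro exI[of _ T]) (auto simp: U_def)
  qed
  \<comment> \<open>The points of the topology are the members of subbasic sets, all of them smooth;
    so continuity into it already contains smoothness of each \<open>h a\<close>.\<close>
  have sb: "smooth_ball_map A r (h a)" if "a \<in> S'" for a
  proof -
    have "h a \<in> topspace (smooth_topology A r)" using h that by (auto simp: continuous_map_def)
    then show ?thesis unfolding smooth_topology_def topology_generated_by_topspace by auto
  qed
  have slo: "open (sl a)" for a
  proof (cases "a \<in> S'")
    case True
    have "continuous_on (ball 0 r) (h a)"
      using sb[OF True] unfolding smooth_ball_map_def by (meson ball_subset_cball continuous_on_subset)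
    from continuous_open_preimage[OF this open_ball chartD(2)[OF e]]
    show ?thesis using True by (simp add: sl_def \<Omega>_def Int_def vimage_def)
  next
    case False
    then show ?thesis by (simp add: sl_def \<Omega>_def)
  qed
  then have so: "slice_open \<Omega>" by (simp add: slice_open_def sl_def)
  have slC: "sl a \<subseteq> ?C" for a by (auto simp: sl_def \<Omega>_def)
  have sm: "smooth_on (sl a) (snd e \<circ> h a)" for a
  proof (cases "a \<in> S'")
    case True
    then have "smooth_on (?C \<inter> h a -` fst e) (snd e \<circ> h a)"
      using sb e by (simp add: smooth_ball_map_def)
    then show ?thesis by (rule smooth_on_subset_open[OF slo, rotated]) (auto simp: sl_def \<Omega>_def)
  next
    case False
    then show ?thesis by (simp add: sl_def \<Omega>_def smooth_on_def)
  qed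
  have box: "\<exists>\<delta>>0. cball x \<delta> \<subseteq> sl a" if "(a, x) \<in> \<Omega>" for a x
    using open_contains_cball[of "sl a"] slo that by (auto simp: sl_def)
  have "openin (top_of_set (S' \<times> UNIV)) \<Omega>"
  proof (subst openin_subopen, intro ballI)
    fix z assume "z \<in> \<Omega>"
    then obtain a x where z: "z = (a, x)" "(a, x) \<in> \<Omega>" "a \<in> S'" by (auto simp: \<Omega>_def)
    obtain \<delta> where \<delta>: "\<delta> > 0" "cball x \<delta> \<subseteq> sl a" using box[OF z(2)] by (elim exE conjE)
    have hL: "h a ` cball x \<delta> \<subseteq> fst e" using \<delta>(2) by (auto simp: sl_def \<Omega>_def)
    \<comment> \<open>The empty word and the distance 1 are arbitrary: what is taken from this
      neighbourhood is that the image of the ball stays in the domain of \<open>e\<close>.\<close>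
    obtain U where U: "open U" "a \<in> U" "\<forall>b\<in>S' \<inter> U. h b ` cball x \<delta> \<subseteq> fst e \<and>
          (\<forall>v\<in>cball x \<delta>. dist (iter_deriv ?C [] (snd e \<circ> h b) v) (iter_deriv ?C [] (snd e \<circ> h a) v) < 1)"
      using near[OF z(3) sb[OF z(3)] compact_cball order_trans[OF \<delta>(2) slC] hL zero_less_one, of "[]"]
      by (elim exE conjE)
    have op: "openin (top_of_set (S' \<times> UNIV)) ((S' \<inter> U) \<times> ball x \<delta>)"
      by (rule openin_Times[OF openin_open_Int[OF U(1)]]) simp
    have "sl a \<subseteq> ball 0 r" by (auto simp: sl_def \<Omega>_def)
    then have "ball x \<delta> \<subseteq> ball 0 r" using \<delta>(2) ball_subset_cball[of x \<delta>] by blast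
    moreover have "h b y \<in> fst e" if "b \<in> S' \<inter> U" "y \<in> ball x \<delta>" for b y
      using conjunct1[OF bspec[OF U(3) that(1)]] that(2) by auto
    ultimately have "(S' \<inter> U) \<times> ball x \<delta> \<subseteq> \<Omega>" unfolding \<Omega>_def by blast
    then show "\<exists>T. openin (top_of_set (S' \<times> UNIV)) T \<and> z \<in> T \<and> T \<subseteq> \<Omega>"
      using op z U(1,2) \<delta> by (intro exI[of _ "(S' \<inter> U) \<times> ball x \<delta>"]) auto
  qed
  moreover have "smooth_vfamily \<Omega> (\<lambda>a w. snd e (h a w))"
  proof (rule smooth_on_smooth_vfamily[OF so])
    show "smooth_on {x. (a, x) \<in> \<Omega>} (\<lambda>w. snd e (h a w))" for a
      using sm[of a] by (simp add: sl_def comp_def)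
    fix vs
    define D where "D a x = iter_deriv (sl a) vs (snd e \<circ> h a) x" for a x
    have DC: "D a x = iter_deriv ?C vs (snd e \<circ> h a) x" if "x \<in> sl a" for a x
      unfolding D_def by (rule iter_deriv_open_subset[OF slo slC that, symmetric])
    have "continuous_on \<Omega> (case_prod D)"
      unfolding continuous_on_def
    proof (intro ballI tendstoI)
      fix z and \<epsilon> :: real assume z: "z \<in> \<Omega>" and \<epsilon>: "\<epsilon> > 0"
      then obtain a x where z: "z = (a, x)" "(a, x) \<in> \<Omega>" "a \<in> S'" by (auto simp: \<Omega>_def)
      obtain \<delta> where \<delta>: "\<delta> > 0" "cball x \<delta> \<subseteq> sl a" using box[OF z(2)] by (elim exE conjE)
      have hL: "h a ` cball x \<delta> \<subseteq> fst e" using \<delta>(2) by (auto simp: sl_def \<Omega>_def)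
      have \<epsilon>2: "\<epsilon> / 2 > 0" using \<epsilon> by simp
      obtain U where U: "open U" "a \<in> U" "\<forall>b\<in>S' \<inter> U. h b ` cball x \<delta> \<subseteq> fst e \<and>
          (\<forall>v\<in>cball x \<delta>. dist (iter_deriv ?C vs (snd e \<circ> h b) v) (iter_deriv ?C vs (snd e \<circ> h a) v) < \<epsilon> / 2)"
        using near[OF z(3) sb[OF z(3)] compact_cball order_trans[OF \<delta>(2) slC] hL \<epsilon>2, of vs] by (elim exE conjE)
      have "continuous_on (sl a) (D a)"
        unfolding D_def[abs_def] by (rule smooth_on_iter_deriv_continuous[OF sm])
      moreover have xs: "x \<in> sl a" using z by (simp add: sl_def)
      ultimately have "isCont (D a) x" using slo by (simp add: continuous_on_eq_continuous_at)
      then obtain \<delta>' where \<delta>': "\<delta>' > 0" "\<forall>y. dist y x < \<delta>' \<longrightarrow> dist (D a y) (D a x) < \<epsilon> / 2"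
        using \<epsilon>2 unfolding continuous_at_eps_delta by blast
      have "dist (case_prod D q) (D a x) < \<epsilon>" if q: "q \<in> U \<times> (ball x \<delta> \<inter> ball x \<delta>')" "q \<in> \<Omega>" for q
      proof -
        obtain b y where bq: "q = (b, y)" "b \<in> S'" "b \<in> U" "y \<in> cball x \<delta>" "dist y x < \<delta>'" "y \<in> sl b"
          using q by (auto simp: \<Omega>_def sl_def dist_commute)
        have ya: "y \<in> sl a" using \<delta>(2) bq(4) by auto
        have "dist (D b y) (D a y) < \<epsilon> / 2"
          unfolding DC[OF bq(6)] DC[OF ya] using U(3) bq by auto
        moreover have "dist (D a y) (D a x) < \<epsilon> / 2" using \<delta>' bq by blast
        ultimately show ?thesis using bq(1) dist_triangle[of "D b y" "D a x" "D a y"] by simp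
      qed
      then show "\<forall>\<^sub>F q in at z within \<Omega>. dist (case_prod D q) (case_prod D z) < \<epsilon>"
        unfolding eventually_at_topological
        using U(1,2) \<delta>(1) \<delta>'(1) z(1)
        by (intro exI[of _ "U \<times> (ball x \<delta> \<inter> ball x \<delta>')"]) (auto intro!: open_Times open_Int)
    qed
    then show "continuous_on \<Omega> (\<lambda>(a, x). iter_deriv {x. (a, x) \<in> \<Omega>} vs (\<lambda>w. snd e (h a w)) x)"
      by (simp add: D_def[abs_def] sl_def comp_def)
  qed
  ultimately show ?thesis using so by blast
qed

end

section \<open>Riemannian metrics\<close>

locale riemannian_atlas = manifold_atlas A
  for A :: "('m::{t2_space, second_countable_topology}, 'n::finite) chart set" +
  fixes G :: "'m \<Rightarrow> real^'n \<Rightarrow> real^'n \<Rightarrow> real"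
  assumes metric: "riemannian_metric A G"
begin

lemma G_bilinear: "bilinear (G x)" and G_sym: "G x u v = G x v u" and G_pos: "v \<noteq> 0 \<Longrightarrow> G x v v > 0"
  using metric unfolding riemannian_metric_def by auto

lemma G_zero: "G x 0 v = 0" "G x v 0 = 0"
  using bilinear_lzero[OF G_bilinear] bilinear_rzero[OF G_bilinear] by auto

lemma tnorm_zero: "tnorm G x 0 = 0" by (simp add: tnorm_def G_zero)

lemma tnorm_pos: "v \<noteq> 0 \<Longrightarrow> tnorm G x v > 0" by (simp add: tnorm_def G_pos)

lemma tnorm_scale: "tnorm G x (k *\<^sub>R v) = \<bar>k\<bar> * tnorm G x v"
  by (simp add: tnorm_def bilinear_lmul[OF G_bilinear] bilinear_rmul[OF G_bilinear] real_sqrt_mult power2_eq_square[symmetric] mult.assoc[symmetric])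

text \<open>The metric in the coordinates of \<open>c\<close>. Unlike \<open>G\<close>, it depends
  continuously on \<open>x\<close> over the domain of \<open>c\<close>, because the jumps of
  \<open>chart_at\<close> cancel.\<close>

definition H :: "('m, 'n) chart \<Rightarrow> 'm \<Rightarrow> real^'n \<Rightarrow> real^'n \<Rightarrow> real" where
  "H c x u v = G x (of_coord A c x u) (of_coord A c x v)"

lemma H_sym: "H c x u v = H c x v u" unfolding H_def by (rule G_sym)

lemma H_linear: "c \<in> A \<Longrightarrow> x \<in> fst c \<Longrightarrow> linear (H c x u)" "c \<in> A \<Longrightarrow> x \<in> fst c \<Longrightarrow> linear (\<lambda>u. H c x u v)"
  using G_bilinear[of x] linear_compose[OF of_coord_linear] unfolding H_def bilinear_def comp_def by blast+

lemma H_continuous_at: "c \<in> A \<Longrightarrow> continuous_on (fst c) (\<lambda>x. H c x u v)"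
proof -
  assume c: "c \<in> A"
  have "smooth_on (snd c ` fst c) (\<lambda>y. H c (chart_inv c y) u v)"
    using metric c unfolding riemannian_metric_def H_def by blast
  then have "continuous_on (snd c ` fst c) (\<lambda>y. H c (chart_inv c y) u v)"
    by (rule smooth_on_imp_continuous)
  then have "continuous_on (fst c) (\<lambda>x. H c (chart_inv c (snd c x)) u v)"
    by (rule continuous_on_compose2[OF _ chartD(4)[OF c]]) auto
  then show ?thesis by (rule continuous_on_eq) (simp add: chart_inv(1)[OF c])
qed

lemma H_continuous:
  fixes p :: "'s::topological_space \<Rightarrow> 'm"
  assumes c: "c \<in> A" and p: "continuous_on X p" "\<And>s. s \<in> X \<Longrightarrow> p s \<in> fst c"
    and V: "continuous_on X V" and W: "continuous_on X W"
  shows "continuous_on X (\<lambda>s. H c (p s) (V s) (W s))"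
proof -
  have "continuous_on X (\<lambda>s. \<Sum>i\<in>UNIV. \<Sum>j\<in>UNIV. V s $ i * (W s $ j * H c (p s) (axis i 1) (axis j 1)))"
    by (intro continuous_on_sum continuous_on_mult continuous_on_component V W
        continuous_on_compose2[OF H_continuous_at[OF c] p(1)]) (use p(2) in auto)
  moreover have "(\<Sum>i\<in>UNIV. \<Sum>j\<in>UNIV. V s $ i * (W s $ j * H c (p s) (axis i 1) (axis j 1))) = H c (p s) (V s) (W s)"
    if s: "s \<in> X" for s
  proof -
    have "H c (p s) (V s) (W s) = (\<Sum>i\<in>UNIV. V s $ i *\<^sub>R H c (p s) (axis i 1) (W s))"
      by (rule linear_expand_axis[OF H_linear(2)[OF c p(2)[OF s]]])
    also have "\<dots> = (\<Sum>i\<in>UNIV. V s $ i *\<^sub>R (\<Sum>j\<in>UNIV. W s $ j *\<^sub>R H c (p s) (axis i 1) (axis j 1)))"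
      by (subst linear_expand_axis[OF H_linear(1)[OF c p(2)[OF s]], of _ "W s"]) simp
    finally show ?thesis by (simp add: sum_distrib_left)
  qed
  ultimately show ?thesis by (rule continuous_on_eq)
qed

text \<open>Gram-Schmidt applied to the coordinate vectors, pointwise in \<open>x\<close> and by
  formulas that preserve continuity. The vanishing of the coordinates outside \<open>I\<close>
  records that the fields lie in the span of the vectors already treated.\<close>

lemma H_orthonormal_fields:
  assumes c: "c \<in> A" and I: "finite I"
  shows "\<exists>W. \<forall>i\<in>I. continuous_on (fst c) (W i) \<and> (\<forall>x\<in>fst c. (\<forall>j\<in>I. H c x (W i x) (W j x) = (if i = j then 1 else 0)) \<and>
    (\<forall>j. j \<notin> I \<longrightarrow> W i x $ j = 0))"
  using I
proof (induction I)
  case (insert k I)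
  from insert.IH obtain W where W: "\<forall>i\<in>I. continuous_on (fst c) (W i) \<and> (\<forall>x\<in>fst c. (\<forall>j\<in>I. H c x (W i x) (W j x) = (if i = j then 1 else 0)) \<and>
    (\<forall>j. j \<notin> I \<longrightarrow> W i x $ j = 0))" by (rule exE)
  define w where "w x = axis k 1 - (\<Sum>i\<in>I. H c x (axis k 1) (W i x) *\<^sub>R W i x)" for x
  define n where "n x = sqrt (H c x (w x) (w x))" for x
  define W' where "W' i x = (if i = k then inverse (n x) *\<^sub>R w x else W i x)" for i x
  have Wc: "continuous_on (fst c) (W i)" if "i \<in> I" for i using W that by blast
  have wc: "continuous_on (fst c) w"
    unfolding w_def
    by (intro continuous_on_diff continuous_on_const continuous_on_sum continuous_on_scaleR Wc
        H_continuous[OF c continuous_on_id]) auto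
  \<comment> \<open>The previous fields have zero coordinate \<open>k\<close>, so the new vector
    keeps that of \<open>axis k 1\<close>; it is therefore nonzero and can be normalized.\<close>
  have wk: "w x $ k = 1" if "x \<in> fst c" for x
  proof -
    have "(\<Sum>i\<in>I. (H c x (axis k 1) (W i x) *\<^sub>R W i x) $ k) = 0"
      using W that insert.hyps(2) by (intro sum.neutral) simp
    then show ?thesis by (simp add: w_def)
  qed
  have npos: "H c x (w x) (w x) > 0" if x: "x \<in> fst c" for x
  proof -
    have "of_coord A c x (w x) \<noteq> 0"
      using to_of_coord[OF c x, of "w x"] wk[OF x] linear_0[OF to_coord_linear[OF c x]] by force
    then show ?thesis unfolding H_def by (rule G_pos)
  qed
  have n0: "n x > 0" if "x \<in> fst c" for x using npos[OF that] by (simp add: n_def)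
  have nc: "continuous_on (fst c) n"
    unfolding n_def by (intro continuous_on_real_sqrt H_continuous[OF c continuous_on_id _ wc wc])
  have orth: "H c x (w x) (W j x) = 0" if x: "x \<in> fst c" and j: "j \<in> I" for x j
  proof -
    note lin = H_linear(2)[OF c x, of "W j x"]
    have "H c x (w x) (W j x) = H c x (axis k 1) (W j x) - (\<Sum>i\<in>I. H c x (axis k 1) (W i x) *\<^sub>R H c x (W i x) (W j x))"
      unfolding w_def by (simp only: linear_diff[OF lin] linear_sum[OF lin] linear_scale[OF lin])
    also have "(\<Sum>i\<in>I. H c x (axis k 1) (W i x) *\<^sub>R H c x (W i x) (W j x)) = (\<Sum>i\<in>I. if i = j then H c x (axis k 1) (W j x) else 0)"
      by (rule sum.cong) (use W x j in auto)
    also have "\<dots> = H c x (axis k 1) (W j x)" using j insert.hyps(1) by simp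
    finally show ?thesis by simp
  qed
  show ?case
  proof (intro exI[of _ W'] ballI conjI allI impI)
    fix i assume i: "i \<in> insert k I"
    show "continuous_on (fst c) (W' i)"
    proof (cases "i = k")
      case True
      have "continuous_on (fst c) (\<lambda>x. inverse (n x) *\<^sub>R w x)"
        by (intro continuous_on_scaleR continuous_on_inverse nc wc) (use n0 in force)
      then show ?thesis using True by (simp add: W'_def[abs_def])
    next
      case False
      then show ?thesis using i Wc by (simp add: W'_def[abs_def])
    qed
    fix x assume x: "x \<in> fst c"
    show "W' i x $ j = 0" if "j \<notin> insert k I" for j
    proof -
      have "(\<Sum>i\<in>I. (H c x (axis k 1) (W i x) *\<^sub>R W i x) $ j) = 0"
        using W x that by (intro sum.neutral) simp
      then have "w x $ j = 0" using that by (simp add: w_def axis_def)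
      then show ?thesis using W x that i by (auto simp: W'_def)
    qed
    fix j assume j: "j \<in> insert k I"
    have kk: "H c x (inverse (n x) *\<^sub>R w x) (inverse (n x) *\<^sub>R w x) = 1"
    proof -
      have "H c x (inverse (n x) *\<^sub>R w x) (inverse (n x) *\<^sub>R w x) = inverse (n x) * (inverse (n x) * H c x (w x) (w x))"
        using linear_scale[OF H_linear(1)[OF c x]] linear_scale[OF H_linear(2)[OF c x]] by simp
      also have "H c x (w x) (w x) = n x * n x" using npos[OF x] by (simp add: n_def)
      finally show ?thesis using n0[OF x] by (simp add: mult.assoc[symmetric])
    qed
    have kj: "H c x (inverse (n x) *\<^sub>R w x) (W j x) = 0" if "j \<in> I" for j
      using linear_scale[OF H_linear(2)[OF c x]] orth[OF x that] by simp
    show "H c x (W' i x) (W' j x) = (if i = j then 1 else 0)"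
      using i j kk kj[of i] kj[of j] insert.hyps(2) W x H_sym[of c x "W i x" "inverse (n x) *\<^sub>R w x"]
      by (auto simp: W'_def)
  qed
qed simp

text \<open>\<open>continuous_family\<close> asks for such a frame near each base point; it comes
  from the orthonormal fields of a chart.\<close>

lemma orthonormal_frame_exists: "\<exists>U \<sigma>. open U \<and> b \<in> U \<and> orthonormal_frame A G U \<sigma>"
proof -
  define c where "c = chart_at A b"
  have c: "c \<in> A" "b \<in> fst c" using chart_at by (auto simp: c_def)
  obtain W where W: "\<forall>i\<in>(UNIV::'n set). continuous_on (fst c) (W i) \<and> (\<forall>x\<in>fst c. (\<forall>j\<in>(UNIV::'n set). H c x (W i x) (W j x) = (if i = j then 1 else 0)) \<and>
    (\<forall>j. j \<notin> (UNIV::'n set) \<longrightarrow> W i x $ j = 0))" using H_orthonormal_fields[where I = UNIV, OF c(1) finite] by (rule exE)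
  define L where "L x v = (\<Sum>i\<in>UNIV. v $ i *\<^sub>R W i x)" for x and v :: "real^'n"
  define \<sigma> where "\<sigma> x v = of_coord A c x (L x v)" for x v
  have linL: "linear (L x)" for x
    unfolding L_def by (rule linearI) (simp_all add: scaleR_left_distrib sum.distrib scaleR_sum_right)
  have lin: "linear (\<sigma> x)" if "x \<in> fst c" for x
    unfolding \<sigma>_def using linear_compose[OF linL of_coord_linear[OF c(1) that]] by (simp add: comp_def)
  have nrm: "tnorm G x (\<sigma> x v) = norm v" if x: "x \<in> fst c" for x v
  proof -
    have "H c x (L x v) (L x v) = (\<Sum>i\<in>UNIV. v $ i * (\<Sum>j\<in>UNIV. v $ j * H c x (W i x) (W j x)))"
      unfolding L_def linear_sum[OF H_linear(2)[OF c(1) x]] linear_sum[OF H_linear(1)[OF c(1) x]]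
        linear_scale[OF H_linear(2)[OF c(1) x]] linear_scale[OF H_linear(1)[OF c(1) x]]
      by (simp add: sum_distrib_left mult_ac H_sym)
    also have "\<dots> = (\<Sum>i\<in>UNIV. v $ i * v $ i)"
      using W x by (simp add: if_distrib[of "\<lambda>x. _ * x"] cong: if_cong)
    also have "\<dots> = (norm v)\<^sup>2" by (simp add: power2_norm_eq_inner inner_vec_def)
    finally show ?thesis by (simp add: tnorm_def \<sigma>_def H_def)
  qed
  have "continuous_section A (fst c) id (\<lambda>x. \<sigma> x v)" for v
    unfolding continuous_section_def
  proof
    fix e assume e: "e \<in> A"
    have "continuous_on (fst c \<inter> fst e) (\<lambda>x. tr c e x (L x v))"
      unfolding L_def
      by (intro tr_continuous[OF c(1) e continuous_on_id] continuous_on_sum continuous_on_scaleR continuous_on_const)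
        (use W in \<open>auto intro: continuous_on_subset\<close>)
    moreover have "tr c e x (L x v) = to_coord A e x (\<sigma> x v)" if "x \<in> fst c \<inter> fst e" for x
      unfolding \<sigma>_def of_coord_tr to_coord_tr using that c(1) e by (simp add: tr_compose chart_at)
    ultimately have "continuous_on (fst c \<inter> fst e) (\<lambda>x. to_coord A e x (\<sigma> x v))"
      by (rule continuous_on_eq)
    then show "continuous_on (fst c \<inter> id -` fst e) (\<lambda>x. to_coord A e (id x) (\<sigma> x v))" by simp
  qed
  then have "orthonormal_frame A G (fst c) \<sigma>" unfolding orthonormal_frame_def using lin nrm by blast
  then show ?thesis using chartD(2)[OF c(1)] c(2) by (intro exI[of _ "fst c"] exI[of _ \<sigma>]) simp
qed

end

section \<open>Coordinates adapted to the splitting\<close>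

text \<open>Cramer's rule once more: the entries of the inverse are quotients of
  determinants.\<close>

lemma continuous_on_matrix_inv:
  fixes M :: "'x::topological_space \<Rightarrow> real^'n^'n::finite"
  assumes M: "continuous_on X M" and inv: "\<And>a. a \<in> X \<Longrightarrow> invertible (M a)"
  shows "continuous_on X (\<lambda>a. matrix_inv (M a))"
proof -
  have comp: "continuous_on X (\<lambda>a. matrix_inv (M a) $ k $ j)" for k j
  proof -
  have Mij: "continuous_on X (\<lambda>a. M a $ i $ l)" for i l
    by (intro continuous_on_component M)
  have "continuous_on X (\<lambda>a. (if l = k then axis j 1 $ i else M a $ i $ l))" for i l
    by (cases "l = k") (simp_all add: Mij)
  then have c: "continuous_on X (\<lambda>a. det (\<chi> i l. if l = k then axis j 1 $ i else M a $ i $ l) / det (M a))"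
    unfolding det_def
    by (intro continuous_on_divide continuous_on_sum continuous_on_mult continuous_on_const continuous_on_prod)
      (use Mij inv in \<open>auto simp: invertible_det_nz det_def\<close>)
  have "det (\<chi> i l. if l = k then axis j 1 $ i else M a $ i $ l) / det (M a) = matrix_inv (M a) $ k $ j"
    if a: "a \<in> X" for a
  proof -
    have "M a ** matrix_inv (M a) = mat 1"
      using someI_ex[OF inv[OF a, unfolded invertible_def]] by (simp add: matrix_inv_def)
    then have "M a *v (matrix_inv (M a) *v axis j 1) = axis j 1"
      by (simp add: matrix_vector_mul_assoc)
    then have "matrix_inv (M a) *v axis j 1 = (\<chi> k. det (\<chi> i l. if l = k then axis j 1 $ i else M a $ i $ l) / det (M a))"
      using cramer[of "M a" "matrix_inv (M a) *v axis j 1" "axis j 1"] inv[OF a] by (simp add: invertible_det_nz)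
    then have "column j (matrix_inv (M a)) $ k = det (\<chi> i l. if l = k then axis j 1 $ i else M a $ i $ l) / det (M a)"
      by (simp add: matrix_vector_mult_basis)
    then show ?thesis by (simp add: column_def)
  qed
  with c show "continuous_on X (\<lambda>a. matrix_inv (M a) $ k $ j)" by (rule continuous_on_eq)
  qed
  have "continuous_on X (\<lambda>a. \<chi> k j. matrix_inv (M a) $ k $ j)"
    by (intro continuous_on_vec_lambda comp)
  then show ?thesis by simp
qed

lemma matrix_inv_mul:
  fixes A :: "real^'n^'n::finite"
  assumes "invertible A"
  shows "matrix_inv A *v (A *v x) = x" "A *v (matrix_inv A *v x) = x"
proof -
  have "A ** matrix_inv A = mat 1 \<and> matrix_inv A ** A = mat 1"
    using someI_ex[OF assms[unfolded invertible_def]] by (simp add: matrix_inv_def)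
  then show "matrix_inv A *v (A *v x) = x" "A *v (matrix_inv A *v x) = x"
    by (simp_all add: matrix_vector_mul_assoc)
qed

lemma invertible_of_inj:
  fixes A :: "real^'n^'n::finite"
  assumes "\<And>x. A *v x = 0 \<Longrightarrow> x = 0"
  shows "invertible A"
proof -
  have "inj ((*v) A)"
  proof (rule injI)
    fix x y assume "A *v x = A *v y"
    then have "A *v (x - y) = 0" by (simp add: matrix_vector_mult_diff_distrib)
    then show "x = y" using assms by fastforce
  qed
  then show ?thesis using matrix_left_invertible_injective[of A] invertible_left_inverse[of A] by simp
qed

lemma continuous_on_matrix_vector_mult:
  fixes M :: "'x::topological_space \<Rightarrow> real^'n::finite^'m::finite"
  assumes "continuous_on X M" "continuous_on X v"
  shows "continuous_on X (\<lambda>a. M a *v v a)"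
  unfolding matrix_vector_mult_def
  by (intro continuous_on_vec_lambda continuous_on_sum continuous_on_mult continuous_on_component assms)

lemma slice_open_restrict:
  assumes "slice_open \<Omega>" shows "slice_open (\<Omega> \<inter> (U \<times> UNIV))"
  unfolding slice_open_def
proof
  fix a
  have "{x. (a, x) \<in> \<Omega> \<inter> (U \<times> UNIV)} = (if a \<in> U then {x. (a, x) \<in> \<Omega>} else {})" by auto
  then show "open {x. (a, x) \<in> \<Omega> \<inter> (U \<times> UNIV)}" using slice_openD[OF assms, of a] by simp
qed

text \<open>The line bundles are represented by nowhere zero sections \<open>X i\<close> over the
  whole inverse limit, with \<open>\<mu>\<close> the signed factors by which \<open>Dg\<close>
  stretches them. As the chart \<open>c a\<close> is locally constant in \<open>a\<close>,
  continuity of \<open>X i\<close> can be stated in a single formula. \<open>expand\<close> concerns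
  the Riemannian norm, for which the balls are defined.\<close>

locale adapted_coordinates = riemannian_atlas A G
  for A :: "('m::{t2_space, second_countable_topology}, 'n::finite) chart set"
    and G :: "'m \<Rightarrow> real^'n \<Rightarrow> real^'n \<Rightarrow> real" +
  fixes g :: "'m \<Rightarrow> 'm" and K :: "'m set" and c :: "(int \<Rightarrow> 'm) \<Rightarrow> ('m, 'n) chart"
    and X :: "'n \<Rightarrow> (int \<Rightarrow> 'm) \<Rightarrow> real^'n" and \<mu> :: "(int \<Rightarrow> 'm) \<Rightarrow> real^'n"
  assumes g: "smooth_map A g" and compact_S: "compact (inverse_limit g K)"
    and cA: "\<And>a. a \<in> inverse_limit g K \<Longrightarrow> c a \<in> A" and c0: "\<And>a. a \<in> inverse_limit g K \<Longrightarrow> a 0 \<in> fst (c a)"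
    and c_loc: "\<And>b. b \<in> inverse_limit g K \<Longrightarrow> \<exists>U. open U \<and> b \<in> U \<and> (\<forall>a\<in>inverse_limit g K \<inter> U. c a = c b)"
    and X_cont: "\<And>i. continuous_on (inverse_limit g K) (\<lambda>a. to_coord A (c a) (a 0) (X i a))"
    and X_indep: "\<And>a y. a \<in> inverse_limit g K \<Longrightarrow> (\<Sum>i\<in>UNIV. y $ i *\<^sub>R X i a) = 0 \<Longrightarrow> y = 0"
    and X_tan: "\<And>a i. a \<in> inverse_limit g K \<Longrightarrow> tangent_map A g (a 0) (X i a) = \<mu> a $ i *\<^sub>R X i (shift a)"
    and \<mu>_gt: "\<And>a i. a \<in> inverse_limit g K \<Longrightarrow> \<bar>\<mu> a $ i\<bar> > 1"
    and nonres: "\<And>i vs. 2 \<le> length vs \<Longrightarrow>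
      (\<forall>a\<in>inverse_limit g K. \<bar>\<mu> a $ i\<bar> < prod_list (map (\<lambda>v. \<bar>\<mu> a $ v\<bar>) vs)) \<or>
      (\<forall>a\<in>inverse_limit g K. \<bar>\<mu> a $ i\<bar> > prod_list (map (\<lambda>v. \<bar>\<mu> a $ v\<bar>) vs))"
    and expand: "\<And>a v. a \<in> inverse_limit g K \<Longrightarrow> tnorm G (a 0) v \<le> tnorm G (g (a 0)) (tangent_map A g (a 0) v)"
begin

abbreviation "S \<equiv> inverse_limit g K"

definition unshift :: "(int \<Rightarrow> 'm) \<Rightarrow> int \<Rightarrow> 'm" where "unshift a = (\<lambda>i. a (i - 1))"

text \<open>\<open>frame a\<close> and \<open>frame_coords a\<close> identify \<open>real ^ 'n\<close> with the tangent space at \<open>a 0\<close>, turning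
  the line bundles into coordinate axes; \<open>param a\<close> parametrizes a neighbourhood of \<open>a 0\<close>
  accordingly, and \<open>local_map a\<close> is \<open>g\<close> read in these parametrizations.\<close>

definition base_coords :: "(int \<Rightarrow> 'm) \<Rightarrow> real^'n" where "base_coords a = snd (c a) (a 0)"
definition frame :: "(int \<Rightarrow> 'm) \<Rightarrow> real^'n \<Rightarrow> real^'n" where "frame a y = (\<Sum>i\<in>UNIV. y $ i *\<^sub>R X i a)"
definition frame_matrix :: "(int \<Rightarrow> 'm) \<Rightarrow> real^'n^'n" where "frame_matrix a = (\<chi> k i. to_coord A (c a) (a 0) (X i a) $ k)"
definition inv_frame_matrix :: "(int \<Rightarrow> 'm) \<Rightarrow> real^'n^'n" where "inv_frame_matrix a = matrix_inv (frame_matrix a)"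
definition frame_coords :: "(int \<Rightarrow> 'm) \<Rightarrow> real^'n \<Rightarrow> real^'n" where "frame_coords a v = inv_frame_matrix a *v to_coord A (c a) (a 0) v"
definition param :: "(int \<Rightarrow> 'm) \<Rightarrow> real^'n \<Rightarrow> 'm" where "param a y = chart_inv (c a) (base_coords a + frame_matrix a *v y)"
definition local_map :: "(int \<Rightarrow> 'm) \<Rightarrow> real^'n \<Rightarrow> real^'n" where
  "local_map a y = inv_frame_matrix (shift a) *v (snd (c (shift a)) (g (param a y)) - base_coords (shift a))"

lemma c0_loc: "a \<in> S \<Longrightarrow> c a = d \<Longrightarrow> a 0 \<in> fst d"
  using c0 by auto

lemma shift_S: "a \<in> S \<Longrightarrow> shift a \<in> S" and unshift_S: "a \<in> S \<Longrightarrow> unshift a \<in> S"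
  and shift_unshift: "shift (unshift a) = a" and unshift_shift: "unshift (shift a) = a"
  and g0: "a \<in> S \<Longrightarrow> g (a 0) = shift a 0"
  unfolding inverse_limit_def shift_def unshift_def by auto

lemma coord_cont: "continuous_on Y (\<lambda>a::int \<Rightarrow> 'm. a i)"
  by (rule continuous_on_subset[OF continuous_on_product_coordinates]) simp

lemma shift_cont: "continuous_on Y (shift :: _ \<Rightarrow> int \<Rightarrow> 'm)"
  unfolding shift_def[abs_def] by (intro continuous_on_coordinatewise_then_product coord_cont)

lemma unshift_cont: "continuous_on Y unshift"
  unfolding unshift_def[abs_def] by (intro continuous_on_coordinatewise_then_product coord_cont)

lemma frame_linear: "linear (frame a)"
  unfolding frame_def by (rule linearI) (simp_all add: scaleR_left_distrib sum.distrib scaleR_sum_right)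

lemma frame_matrix_frame: "a \<in> S \<Longrightarrow> frame_matrix a *v y = to_coord A (c a) (a 0) (frame a y)"
proof -
  assume a: "a \<in> S"
  note lin = to_coord_linear[OF cA[OF a] c0[OF a]]
  show ?thesis
    unfolding frame_def linear_sum[OF lin] linear_scale[OF lin]
    by (simp add: frame_matrix_def matrix_vector_mult_def vec_eq_iff mult.commute)
qed

lemma of_frame_matrix: "a \<in> S \<Longrightarrow> of_coord A (c a) (a 0) (frame_matrix a *v y) = frame a y"
  by (simp add: frame_matrix_frame of_to_coord cA c0)

lemma frame_matrix_inv: "a \<in> S \<Longrightarrow> invertible (frame_matrix a)"
proof (rule invertible_of_inj)
  fix y assume a: "a \<in> S" and "frame_matrix a *v y = 0"
  then have "frame a y = 0" using of_frame_matrix[OF a, of y] linear_0[OF of_coord_linear[OF cA[OF a] c0[OF a]]] by simp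
  then show "y = 0" using X_indep[OF a] by (simp add: frame_def)
qed

lemma inv_frame_matrix_frame_matrix: "a \<in> S \<Longrightarrow> inv_frame_matrix a *v (frame_matrix a *v y) = y" "a \<in> S \<Longrightarrow> frame_matrix a *v (inv_frame_matrix a *v y) = y"
  unfolding inv_frame_matrix_def by (simp_all add: matrix_inv_mul frame_matrix_inv)

lemma frame_coords_frame: "a \<in> S \<Longrightarrow> frame_coords a (frame a y) = y"
  by (simp add: frame_coords_def frame_matrix_frame[symmetric] inv_frame_matrix_frame_matrix)

lemma frame_frame_coords: "a \<in> S \<Longrightarrow> frame a (frame_coords a v) = v"
  by (simp add: frame_coords_def of_frame_matrix[symmetric] inv_frame_matrix_frame_matrix of_to_coord cA c0)

lemma frame_coords_linear: "a \<in> S \<Longrightarrow> linear (frame_coords a)"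
  unfolding frame_coords_def
  using linear_compose[OF to_coord_linear[OF cA c0] matrix_vector_mul_linear[of "inv_frame_matrix a"], of a] by (simp add: comp_def)

lemma c_loc2:
  assumes b: "b \<in> S"
  shows "\<exists>U. open U \<and> b \<in> U \<and> (\<forall>a\<in>S \<inter> U. c a = c b \<and> c (shift a) = c (shift b))"
proof -
  obtain U where U: "open U" "b \<in> U" "\<forall>a\<in>S \<inter> U. c a = c b" using c_loc[OF b] by (elim exE conjE)
  obtain U' where U': "open U'" "shift b \<in> U'" "\<forall>a\<in>S \<inter> U'. c a = c (shift b)"
    using c_loc[OF shift_S[OF b]] by (elim exE conjE)
  have "open (shift -` U')" by (rule open_vimage[OF U'(1) shift_cont])
  then show ?thesis using U U' shift_S by (intro exI[of _ "U \<inter> shift -` U'"]) auto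
qed

lemma cont_locI:
  assumes "\<And>b. b \<in> S \<Longrightarrow> \<exists>U. open U \<and> b \<in> U \<and> continuous_on (S \<inter> U) f"
  shows "continuous_on S f"
  by (rule continuous_on_local) (rule assms)

lemma base_coords_cont: "continuous_on S base_coords"
proof (rule cont_locI)
  fix b assume b: "b \<in> S"
  obtain U where U: "open U" "b \<in> U" "\<forall>a\<in>S \<inter> U. c a = c b" using c_loc[OF b] by (elim exE conjE)
  have "continuous_on (S \<inter> U) (\<lambda>a. snd (c b) (a 0))"
    by (rule continuous_on_compose2[OF chartD(4)[OF cA[OF b]] coord_cont]) (use U in \<open>auto intro!: c0_loc\<close>)
  then have "continuous_on (S \<inter> U) base_coords" by (rule continuous_on_eq) (use U in \<open>simp add: base_coords_def\<close>)
  then show "\<exists>U. open U \<and> b \<in> U \<and> continuous_on (S \<inter> U) base_coords" using U by blast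
qed

lemma frame_matrix_cont: "continuous_on S frame_matrix"
  unfolding frame_matrix_def[abs_def] by (intro continuous_on_vec_lambda continuous_on_component X_cont)

lemma inv_frame_matrix_cont: "continuous_on S inv_frame_matrix"
  unfolding inv_frame_matrix_def[abs_def] by (rule continuous_on_matrix_inv[OF frame_matrix_cont frame_matrix_inv])

lemma kap0: "a \<in> S \<Longrightarrow> param a 0 = a 0"
  by (simp add: param_def base_coords_def chart_inv(1)[OF cA c0])

lemma tangent_frame: "a \<in> S \<Longrightarrow> tangent_map A g (a 0) (frame a y) = frame (shift a) (diag (\<mu> a) y)"
  unfolding frame_def linear_sum[OF tangent_map_linear[OF g]] linear_scale[OF tangent_map_linear[OF g]]
  by (simp add: X_tan mult.commute)

lemma frame_coords_tangent: "a \<in> S \<Longrightarrow> frame_coords (shift a) (tangent_map A g (a 0) v) = diag (\<mu> a) (frame_coords a v)"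
  using tangent_frame[of a "frame_coords a v"] by (simp add: frame_frame_coords frame_coords_frame shift_S)

lemma affine_smooth_vfamily:
  assumes so: "slice_open \<Omega>" and \<Omega>: "fst ` \<Omega> \<subseteq> S" and V: "smooth_vfamily \<Omega> V"
  shows "smooth_vfamily \<Omega> (\<lambda>a y. base_coords a + frame_matrix a *v V a y)"
  by (rule smooth_vfamily_affine[OF so continuous_on_subset[OF frame_matrix_cont \<Omega>] continuous_on_subset[OF base_coords_cont \<Omega>] V])

lemma inv_frame_matrix_smooth_vfamily:
  assumes so: "slice_open \<Omega>" and \<Omega>: "fst ` \<Omega> \<subseteq> S" and V: "smooth_vfamily \<Omega> V"
  shows "smooth_vfamily \<Omega> (\<lambda>a y. inv_frame_matrix a *v (V a y - base_coords a))"
proof -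
  have "smooth_vfamily \<Omega> (\<lambda>a y. - (inv_frame_matrix a *v base_coords a) + inv_frame_matrix a *v V a y)"
    by (rule smooth_vfamily_affine[OF so continuous_on_subset[OF inv_frame_matrix_cont \<Omega>] _ V])
      (intro continuous_on_minus continuous_on_matrix_vector_mult continuous_on_subset[OF inv_frame_matrix_cont \<Omega>] continuous_on_subset[OF base_coords_cont \<Omega>])
  then show ?thesis by (simp add: matrix_vector_mult_diff_distrib)
qed

text \<open>The points where \<open>local_map\<close> involves no junk value of \<open>chart_inv\<close>.\<close>

definition \<Omega>1 :: "((int \<Rightarrow> 'm) \<times> (real^'n)) set" where
  "\<Omega>1 = {(a, y). a \<in> S \<and> base_coords a + frame_matrix a *v y \<in> snd (c a) ` (fst (c a) \<inter> g -` fst (c (shift a)))}"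

lemma affine_cont: "continuous_on (S \<times> UNIV) (\<lambda>z. base_coords (fst z) + frame_matrix (fst z) *v snd z)"
  by (intro continuous_on_add continuous_on_matrix_vector_mult continuous_on_compose2[OF base_coords_cont]
      continuous_on_compose2[OF frame_matrix_cont] continuous_on_fst continuous_on_snd continuous_on_id) auto

lemma \<Omega>1_open: "openin (top_of_set (S \<times> UNIV)) \<Omega>1"
proof (subst openin_subopen, intro ballI)
  fix z assume "z \<in> \<Omega>1"
  then obtain b y where z: "z = (b, y)" "b \<in> S" "(b, y) \<in> \<Omega>1" by (auto simp: \<Omega>1_def)
  obtain U where U: "open U" "b \<in> U" "\<forall>a\<in>S \<inter> U. c a = c b \<and> c (shift a) = c (shift b)"
    using c_loc2[OF z(2)] by (elim exE conjE)
  let ?V = "snd (c b) ` (fst (c b) \<inter> g -` fst (c (shift b)))"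
  let ?T = "((S \<times> UNIV) \<inter> (\<lambda>z. base_coords (fst z) + frame_matrix (fst z) *v snd z) -` ?V) \<inter> (U \<times> UNIV)"
  have "openin (top_of_set (S \<times> UNIV)) ((S \<times> UNIV) \<inter> (\<lambda>z. base_coords (fst z) + frame_matrix (fst z) *v snd z) -` ?V)"
    by (rule continuous_openin_preimage_gen[OF affine_cont smooth_map_on(2)[OF g cA[OF z(2)] cA[OF shift_S[OF z(2)]]]])
  then have "openin (top_of_set (S \<times> UNIV)) ?T"
    by (rule openin_Int_open) (use U in \<open>simp add: open_Times\<close>)
  moreover have "?T \<subseteq> \<Omega>1" using U(3) by (auto simp: \<Omega>1_def)
  moreover have "z \<in> ?T" using z(2,3) U(2) unfolding z(1) by (simp add: \<Omega>1_def)
  ultimately show "\<exists>T. openin (top_of_set (S \<times> UNIV)) T \<and> z \<in> T \<and> T \<subseteq> \<Omega>1" by blast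
qed

lemma ex_R: "\<exists>R>0. S \<times> ball 0 R \<subseteq> \<Omega>1"
proof (rule tube_radius[OF compact_S \<Omega>1_open])
  fix a assume a: "a \<in> S"
  have "a 0 \<in> fst (c a) \<inter> g -` fst (c (shift a))" using c0[OF a] c0[OF shift_S[OF a]] g0[OF a] by simp
  then show "(a, 0) \<in> \<Omega>1" using a by (auto simp: \<Omega>1_def base_coords_def)
qed

definition R :: real where "R = (SOME R. R > 0 \<and> S \<times> ball 0 R \<subseteq> \<Omega>1)"

lemma R: "R > 0" "S \<times> ball 0 R \<subseteq> \<Omega>1"
  using someI_ex[OF ex_R] unfolding R_def by auto

lemma param_in:
  assumes "a \<in> S" "y \<in> ball 0 R"
  shows "param a y \<in> fst (c a)" "g (param a y) \<in> fst (c (shift a))" "snd (c a) (param a y) = base_coords a + frame_matrix a *v y"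
    "base_coords a + frame_matrix a *v y \<in> snd (c a) ` (fst (c a) \<inter> g -` fst (c (shift a)))"
proof -
  have "(a, y) \<in> \<Omega>1" using R(2) assms by auto
  then show 1: "base_coords a + frame_matrix a *v y \<in> snd (c a) ` (fst (c a) \<inter> g -` fst (c (shift a)))" by (simp add: \<Omega>1_def)
  then obtain x where x: "x \<in> fst (c a)" "g x \<in> fst (c (shift a))" "base_coords a + frame_matrix a *v y = snd (c a) x" by auto
  then have "param a y = x" by (simp add: param_def chart_inv(1)[OF cA[OF assms(1)]])
  then show "param a y \<in> fst (c a)" "g (param a y) \<in> fst (c (shift a))" "snd (c a) (param a y) = base_coords a + frame_matrix a *v y"
    using x by auto
qed

text \<open>Near \<open>b\<close> the charts at \<open>a\<close> and at \<open>shift a\<close> are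
  both constant. There \<open>local_map\<close> is one smooth map, \<open>g\<close> in two fixed
  charts, between affine maps whose coefficients depend continuously on \<open>a\<close>.\<close>

lemma local_map_smooth_vfamily: "smooth_vfamily (S \<times> ball 0 R) local_map"
proof (rule smooth_vfamily_local[where S = S])
  fix b assume b: "b \<in> S"
  obtain U where U: "open U" "b \<in> U" "\<forall>a\<in>S \<inter> U. c a = c b \<and> c (shift a) = c (shift b)"
    using c_loc2[OF b] by (elim exE conjE)
  let ?\<Omega> = "(S \<times> ball (0::real^'n) R) \<inter> (U \<times> UNIV)"
  let ?\<Omega>' = "(S \<times> ball (0::real^'n) R) \<inter> (shift -` U \<times> UNIV)"
  have so: "slice_open ?\<Omega>" by (rule slice_open_restrict) simp
  have f\<Omega>: "fst ` ?\<Omega> \<subseteq> S" by auto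
  define k where "k = snd (c (shift b)) \<circ> g \<circ> chart_inv (c b)"
  let ?Q = "snd (c b) ` (fst (c b) \<inter> g -` fst (c (shift b)))"
  have "smooth_vfamily ?\<Omega> (\<lambda>a y. k (base_coords a + frame_matrix a *v y))"
  proof (rule smooth_vfamily_comp[where U = "\<lambda>_. k" and s = "\<lambda>a. a" and \<Psi> = "UNIV \<times> ?Q" and V = "\<lambda>a y. base_coords a + frame_matrix a *v y", OF so])
    show "smooth_vfamily (UNIV \<times> ?Q) (\<lambda>_::int \<Rightarrow> 'm. k)"
      unfolding k_def by (rule smooth_on_smooth_vfamily_const) (use smooth_map_on[OF g cA[OF b] cA[OF shift_S[OF b]]] in auto)
    show "smooth_vfamily ?\<Omega> (\<lambda>a y. base_coords a + frame_matrix a *v y)" by (rule affine_smooth_vfamily[OF so f\<Omega> smooth_vfamily_id[OF so]])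
    show "(a, base_coords a + frame_matrix a *v y) \<in> UNIV \<times> ?Q" if "(a, y) \<in> ?\<Omega>" for a y
      using param_in(4)[of a y] that U(3) by auto
  qed (rule continuous_on_id)
  then have "smooth_vfamily ?\<Omega> (\<lambda>a y. - (inv_frame_matrix (shift a) *v base_coords (shift a)) + inv_frame_matrix (shift a) *v k (base_coords a + frame_matrix a *v y))"
    by (intro smooth_vfamily_affine[OF so] continuous_on_minus continuous_on_matrix_vector_mult
        continuous_on_compose2[OF inv_frame_matrix_cont shift_cont] continuous_on_compose2[OF base_coords_cont shift_cont])
      (use shift_S in auto)
  then have "smooth_vfamily ?\<Omega> local_map"
    by (rule smooth_vfamily_cong[OF so, rotated]) (use U(3) in \<open>auto simp: local_map_def k_def param_def matrix_vector_mult_diff_distrib\<close>)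
  then show "\<exists>U. open U \<and> b \<in> U \<and> smooth_vfamily ((S \<times> ball 0 R) \<inter> (U \<times> UNIV)) local_map" using U by blast
qed auto

text \<open>This is \<open>Dg\<close> read in the frames at \<open>a\<close> and
  \<open>shift a\<close>; invariance of the line bundles makes it diagonal.\<close>

lemma local_map_derivative:
  assumes a: "a \<in> S"
  shows "(local_map a has_derivative diag (\<mu> a)) (at 0)"
proof -
  have sa: "shift a \<in> S" by (rule shift_S[OF a])
  have "((\<lambda>y. base_coords a + frame_matrix a *v y) has_derivative (\<lambda>h. frame_matrix a *v h)) (at 0)"
    using has_derivative_add[OF has_derivative_const[of "base_coords a"] linear_imp_has_derivative[OF matrix_vector_mul_linear[of "frame_matrix a"]]]
    by simp
  moreover have "((snd (c (shift a)) \<circ> g \<circ> chart_inv (c a)) has_derivative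
    (\<lambda>v. to_coord A (c (shift a)) (g (a 0)) (tangent_map A g (a 0) (of_coord A (c a) (a 0) v)))) (at (base_coords a + frame_matrix a *v 0))"
    using tangent_map_derivative[OF g cA[OF a] c0[OF a] cA[OF sa]] c0[OF sa] g0[OF a] by (simp add: base_coords_def)
  ultimately have "((\<lambda>y. (snd (c (shift a)) \<circ> g \<circ> chart_inv (c a)) (base_coords a + frame_matrix a *v y)) has_derivative
    (\<lambda>h. to_coord A (c (shift a)) (g (a 0)) (tangent_map A g (a 0) (of_coord A (c a) (a 0) (frame_matrix a *v h))))) (at 0)"
    by (rule has_derivative_compose)
  moreover have "to_coord A (c (shift a)) (g (a 0)) (tangent_map A g (a 0) (of_coord A (c a) (a 0) (frame_matrix a *v h)))
      = frame_matrix (shift a) *v (diag (\<mu> a) h)" for h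
    unfolding of_frame_matrix[OF a] tangent_frame[OF a] g0[OF a] frame_matrix_frame[OF sa] ..
  ultimately have 1: "((\<lambda>y. snd (c (shift a)) (g (param a y))) has_derivative (\<lambda>h. frame_matrix (shift a) *v (diag (\<mu> a) h))) (at 0)"
    by (simp add: param_def)
  have "((\<lambda>y. inv_frame_matrix (shift a) *v (snd (c (shift a)) (g (param a y)) - base_coords (shift a))) has_derivative
      (\<lambda>h. inv_frame_matrix (shift a) *v (frame_matrix (shift a) *v (diag (\<mu> a) h) - 0))) (at 0)"
    by (rule bounded_linear.has_derivative[OF matrix_vector_mul_bounded_linear
          has_derivative_diff[OF 1 has_derivative_const]])
  then show ?thesis by (simp add: local_map_def[abs_def] inv_frame_matrix_frame_matrix sa)
qed

lemma partial_of_diag_derivative: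
  fixes U :: "(int \<Rightarrow> 'm) \<Rightarrow> real^'n \<Rightarrow> real^'n"
  assumes "(U a has_derivative diag m) (at 0)"
  shows "partial j (\<lambda>a x. U a x $ i) a 0 = (if i = j then m $ i else 0)"
proof (rule partial_eqI)
  have "((\<lambda>x. U a x $ i) has_derivative (\<lambda>h. diag m h $ i)) (at 0)"
    by (rule bounded_linear.has_derivative[OF bounded_linear_vec_nth assms])
  then show "((\<lambda>x. U a x $ i) has_derivative (\<lambda>h. \<Sum>j\<in>UNIV. h $ j * (if i = j then m $ i else 0))) (at 0)"
    by (simp add: if_distrib[of "\<lambda>x. _ * x"] mult.commute cong: if_cong)
qed

lemma Gf0: "a \<in> S \<Longrightarrow> local_map a 0 = 0"
  by (simp add: local_map_def kap0 g0 base_coords_def)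

text \<open>Continuity of \<open>\<mu>\<close> is read off from \<open>local_map\<close>: its
  components are partial derivatives at \<open>0\<close> of a smooth family.\<close>

lemma \<mu>_cont: "continuous_on S \<mu>"
proof (rule continuous_on_vecI)
  fix i
  have "smooth_family (S \<times> ball 0 R) (partial i (\<lambda>a x. local_map a x $ i))"
    using smooth_family_partial local_map_smooth_vfamily by (auto simp: smooth_vfamily_def)
  from continuous_on_compose2[OF smooth_family_continuous[OF this], of S "\<lambda>a. (a, 0)"]
  have "continuous_on S (\<lambda>a. partial i (\<lambda>a x. local_map a x $ i) a 0)"
    using R(1) by (simp add: continuous_on_Pair image_subset_iff)
  then show "continuous_on S (\<lambda>a. \<mu> a $ i)"
    by (rule continuous_on_eq) (simp add: partial_of_diag_derivative[OF local_map_derivative])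
qed

sublocale ef: expanding_family S shift unshift R local_map \<mu>
proof
  show "\<And>a i j. a \<in> S \<Longrightarrow> partial j (\<lambda>a x. local_map a x $ i) a 0 = (if i = j then \<mu> a $ i else 0)"
    by (rule partial_of_diag_derivative[OF local_map_derivative])
qed (use compact_S shift_cont unshift_cont shift_S unshift_S shift_unshift unshift_shift R(1) \<mu>_cont \<mu>_gt local_map_smooth_vfamily Gf0 nonres in auto)

text \<open>By homogeneity the quotient of the two norms is governed by its values on
  \<open>S \<times> sphere 0 1\<close>, where it is continuous and positive and hence, by
  compactness, attains positive extrema.\<close>

lemma tnorm_bounds: "\<exists>m M. m > 0 \<and> M > 0 \<and> (\<forall>a\<in>S. \<forall>v. m * norm (frame_coords a v) \<le> tnorm G (a 0) v \<and> tnorm G (a 0) v \<le> M * norm (frame_coords a v))"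
proof (cases "S = {}")
  case False
  let ?N = "\<lambda>z. tnorm G (fst z 0) (frame (fst z) (snd z))"
  have N: "continuous_on (S \<times> sphere 0 1) ?N"
  proof (rule continuous_on_local)
    fix z assume "z \<in> S \<times> sphere (0::real^'n) 1"
    then have b: "fst z \<in> S" by auto
    obtain U where U: "open U" "fst z \<in> U" "\<forall>a\<in>S \<inter> U. c a = c (fst z)" using c_loc[OF b] by (elim exE conjE)
    let ?D = "(S \<times> sphere (0::real^'n) 1) \<inter> (U \<times> UNIV)"
    have "continuous_on ?D (\<lambda>z. frame_matrix (fst z) *v snd z)"
      by (intro continuous_on_matrix_vector_mult continuous_on_compose2[OF frame_matrix_cont] continuous_intros) auto
    then have "continuous_on ?D (\<lambda>w. sqrt (H (c (fst z)) (fst w 0) (frame_matrix (fst w) *v snd w) (frame_matrix (fst w) *v snd w)))"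
      by (intro continuous_on_real_sqrt H_continuous[OF cA[OF b]] continuous_on_compose2[OF coord_cont continuous_on_fst[OF continuous_on_id]])
        (use U(3) in \<open>auto intro!: c0_loc\<close>)
    then have "continuous_on ?D ?N"
      by (rule continuous_on_eq) (use U(3) in \<open>auto simp: H_def tnorm_def of_frame_matrix[symmetric]\<close>)
    then show "\<exists>W. open W \<and> z \<in> W \<and> continuous_on ((S \<times> sphere 0 1) \<inter> W) ?N"
      using U by (intro exI[of _ "U \<times> UNIV"]) (auto simp: open_Times mem_Times_iff)
  qed
  have cpt: "compact (S \<times> sphere (0::real^'n) 1)" by (intro compact_Times compact_S compact_sphere)
  have ne: "S \<times> sphere (0::real^'n) 1 \<noteq> {}"
    using False norm_axis_1[of undefined] by (metis SigmaI all_not_in_conv mem_sphere_0)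
  obtain z1 where z1: "z1 \<in> S \<times> sphere 0 1" "\<forall>z\<in>S \<times> sphere 0 1. ?N z1 \<le> ?N z"
    using continuous_attains_inf[OF cpt ne N] by (elim bexE)
  obtain z2 where z2: "z2 \<in> S \<times> sphere 0 1" "\<forall>z\<in>S \<times> sphere 0 1. ?N z \<le> ?N z2"
    using continuous_attains_sup[OF cpt ne N] by (elim bexE)
  have pos: "?N z > 0" if "z \<in> S \<times> sphere 0 1" for z
  proof (rule tnorm_pos)
    show "frame (fst z) (snd z) \<noteq> 0" using X_indep[of "fst z" "snd z"] that by (auto simp: frame_def)
  qed
  have "?N z1 * norm (frame_coords a v) \<le> tnorm G (a 0) v \<and> tnorm G (a 0) v \<le> ?N z2 * norm (frame_coords a v)" if a: "a \<in> S" for a v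
  proof (cases "frame_coords a v = 0")
    case True
    then have "v = 0" using frame_frame_coords[OF a, of v] linear_0[OF frame_linear] by metis
    then show ?thesis using True by (simp add: tnorm_zero)
  next
    case nz: False
    define y where "y = inverse (norm (frame_coords a v)) *\<^sub>R frame_coords a v"
    have y: "(a, y) \<in> S \<times> sphere 0 1" using a nz by (simp add: y_def)
    have "v = norm (frame_coords a v) *\<^sub>R frame a y"
      unfolding y_def linear_scale[OF frame_linear] frame_frame_coords[OF a] using nz by simp
    then have "tnorm G (a 0) v = norm (frame_coords a v) * ?N (a, y)" by (metis abs_norm_cancel fst_conv snd_conv tnorm_scale)
    then show ?thesis using z1(2)[rule_format, OF y] z2(2)[rule_format, OF y] by (simp add: mult.commute mult_left_mono)
  qed
  then show ?thesis using pos[OF z1(1)] pos[OF z2(1)] by (intro exI[of _ "?N z1"] exI[of _ "?N z2"]) blast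
qed (auto intro: exI[of _ 1])

end

section \<open>The linearizing charts\<close>

lemma linear_as_matrix:
  fixes F :: "real^'n::finite \<Rightarrow> real^'m::finite"
  assumes "linear F"
  shows "\<exists>M. \<forall>v. F v = M *v v"
proof (intro exI[of _ "\<chi> i j. F (axis j 1) $ i"] allI)
  fix v
  show "F v = (\<chi> i j. F (axis j 1) $ i) *v v"
    using linear_expand_axis[OF assms, of v]
    by (simp add: matrix_vector_mult_def vec_eq_iff mult.commute)
qed

context manifold_atlas
begin

text \<open>The chart is \<open>k \<circ> snd c\<close> on the part of the domain of
  \<open>c\<close> lying over \<open>Z\<close>. Its transition maps are those of \<open>c\<close>
  composed with \<open>f\<close> or \<open>k\<close>, hence smooth.\<close>

lemma chart_of_parametrization:
  assumes c: "c \<in> A" and V: "open V" and Z: "open Z" "Z \<subseteq> snd c ` fst c"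
    and f: "smooth_on V f" "f ` V \<subseteq> Z" and k: "smooth_on Z k" "k ` Z \<subseteq> V"
    and kf: "\<And>v. v \<in> V \<Longrightarrow> k (f v) = v" and fk: "\<And>y. y \<in> Z \<Longrightarrow> f (k y) = y"
  shows "\<exists>d. is_chart d \<and> (\<forall>e\<in>A. compatible d e) \<and> snd d ` fst d = V \<and> (\<forall>v\<in>V. chart_inv d v = chart_inv c (f v))"
proof -
  define d where "d = (chart_inv c ` Z, \<lambda>m. k (snd c m))"
  have d1: "fst d = chart_inv c ` Z" and d2: "snd d = (\<lambda>m. k (snd c m))" by (simp_all add: d_def)
  have D: "fst d = fst c \<inter> snd c -` Z"
  proof (intro equalityI subsetI)
    fix m assume "m \<in> fst d"
    then obtain y where y: "y \<in> Z" "m = chart_inv c y" by (auto simp: d1)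
    then have "y \<in> snd c ` fst c" using Z(2) by auto
    then show "m \<in> fst c \<inter> snd c -` Z" using y chart_inv(2,3)[OF c] by auto
  next
    fix m assume "m \<in> fst c \<inter> snd c -` Z"
    then have "m = chart_inv c (snd c m)" "snd c m \<in> Z" using chart_inv(1)[OF c] by auto
    then show "m \<in> fst d" unfolding d1 by (rule image_eqI)
  qed
  have Do: "open (fst d)"
    unfolding D by (rule continuous_open_preimage[OF chartD(4)[OF c] chartD(2)[OF c] Z(1)])
  have fin: "chart_inv c (f v) \<in> fst d" "snd d (chart_inv c (f v)) = v" "snd c (chart_inv c (f v)) = f v"
    if "v \<in> V" for v
  proof -
    have fv: "f v \<in> Z" "f v \<in> snd c ` fst c" using f(2) that Z(2) by auto
    then show "snd c (chart_inv c (f v)) = f v" using chart_inv(2)[OF c] by simp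
    then show "snd d (chart_inv c (f v)) = v" by (simp add: d2 kf that)
    show "chart_inv c (f v) \<in> fst d" unfolding d1 using fv by (rule_tac imageI)
  qed
  have fd: "snd d m \<in> V" "chart_inv c (f (snd d m)) = m" if "m \<in> fst d" for m
  proof -
    have m: "m \<in> fst c" "snd c m \<in> Z" using that by (auto simp: D)
    then show "snd d m \<in> V" using k(2) by (auto simp: d2)
    show "chart_inv c (f (snd d m)) = m" using m by (simp add: d2 fk chart_inv(1)[OF c])
  qed
  have im: "snd d ` fst d = V"
  proof (intro equalityI subsetI)
    fix v assume "v \<in> V"
    then show "v \<in> snd d ` fst d" using fin[of v] by (metis imageI)
  qed (use fd in auto)
  have inj: "inj_on (snd d) (fst d)" by (rule inj_on_inverseI[of _ "\<lambda>v. chart_inv c (f v)"]) (rule fd(2))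
  have ci: "chart_inv d v = chart_inv c (f v)" if "v \<in> V" for v
    unfolding chart_inv_def[of d] by (rule inv_into_f_eq[OF inj fin(1,2)[OF that]])
  have cont_d: "continuous_on (fst d) (snd d)"
    unfolding d2 by (rule continuous_on_compose2[OF smooth_on_imp_continuous[OF k(1)]])
      (auto simp: D intro: continuous_on_subset[OF chartD(4)[OF c]])
  have cont_ci: "continuous_on V (chart_inv d)"
  proof -
    have "continuous_on V (\<lambda>v. chart_inv c (f v))"
      by (rule continuous_on_compose2[OF chartD(5)[OF c] smooth_on_imp_continuous[OF f(1)]]) (use f(2) Z(2) in auto)
    then show ?thesis by (rule continuous_on_eq) (simp add: ci)
  qed
  have "is_chart d"
    unfolding is_chart_def im homeomorphism_def
  proof (intro conjI ballI)
    show "chart_inv d ` V = fst d"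
    proof (intro equalityI subsetI)
      fix m assume "m \<in> fst d"
      then show "m \<in> chart_inv d ` V" using fd[of m] ci by (metis imageI)
    qed (use ci fin in auto)
    show "chart_inv d (snd d m) = m" if "m \<in> fst d" for m using fd[OF that] ci by simp
    show "snd d (chart_inv d v) = v" if "v \<in> V" for v using fin[OF that] ci[OF that] by simp
  qed (fact refl Do V cont_d cont_ci)+
  moreover have "compatible d e" if e: "e \<in> A" for e
    unfolding compatible_def
  proof
    let ?W = "snd d ` (fst d \<inter> fst e)"
    have W: "?W = V \<inter> f -` (snd c ` (fst c \<inter> fst e))"
    proof (intro equalityI subsetI)
      fix v assume "v \<in> ?W"
      then obtain m where m: "m \<in> fst d" "m \<in> fst e" "v = snd d m" by auto
      have "f v = snd c m" using m fd[OF m(1)] fin(3)[of v] by simp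
      then show "v \<in> V \<inter> f -` (snd c ` (fst c \<inter> fst e))" using m fd[OF m(1)] D by auto
    next
      fix v assume "v \<in> V \<inter> f -` (snd c ` (fst c \<inter> fst e))"
      then obtain m where m: "v \<in> V" "m \<in> fst c" "m \<in> fst e" "f v = snd c m" by auto
      then have "chart_inv c (f v) = m" using chart_inv(1)[OF c] by simp
      then show "v \<in> ?W" using fin[OF m(1)] m(3) by (metis IntI imageI)
    qed
    have Wo: "open ?W"
      unfolding W by (rule continuous_open_preimage[OF smooth_on_imp_continuous[OF f(1)] V transition_open[OF c e]])
    have "smooth_on ?W ((snd e \<circ> chart_inv c) \<circ> f)"
    proof (rule smooth_on_compose[OF Wo transition_open[OF c e] _ transition_smooth[OF c e]])
      show "smooth_on ?W f" by (rule smooth_on_subset_open[OF Wo _ f(1)]) (use W in auto)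
    qed (use W in auto)
    then show "smooth_on ?W (snd e \<circ> chart_inv d)"
      by (rule smooth_on_cong[rotated]) (use W ci in auto)
    let ?W' = "snd e ` (fst d \<inter> fst e)"
    have Wo': "open ?W'" by (rule open_image[OF e]) (use Do chartD(2)[OF e] in auto)
    have W'sub: "?W' \<subseteq> snd e ` (fst e \<inter> fst c)" using D by auto
    have "smooth_on ?W' (k \<circ> (snd c \<circ> chart_inv e))"
    proof (rule smooth_on_compose[OF Wo' Z(1) _ k(1)])
      show "smooth_on ?W' (snd c \<circ> chart_inv e)"
        by (rule smooth_on_subset_open[OF Wo' W'sub transition_smooth[OF e c]])
      show "(snd c \<circ> chart_inv e) ` ?W' \<subseteq> Z" using D chart_inv(1)[OF e] by auto
    qed
    then show "smooth_on ?W' (snd d \<circ> chart_inv e)" by (simp add: d2 comp_def)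
  qed
  ultimately show ?thesis using im ci by blast
qed

end

context adapted_coordinates
begin

text \<open>The matrix that turns coordinates in an orthonormal frame, used by
  \<open>continuous_family\<close>, into coordinates along the line bundles.\<close>

definition frame_change :: "('m \<Rightarrow> real^'n \<Rightarrow> real^'n) \<Rightarrow> (int \<Rightarrow> 'm) \<Rightarrow> real^'n^'n" where
  "frame_change \<sigma> a = (\<chi> k j. frame_coords a (\<sigma> (a 0) (axis j 1)) $ k)"

lemma frameD:
  assumes "orthonormal_frame A G U \<sigma>"
  shows "x \<in> U \<Longrightarrow> linear (\<sigma> x)" "x \<in> U \<Longrightarrow> tnorm G x (\<sigma> x v) = norm v"
    "e \<in> A \<Longrightarrow> continuous_on (U \<inter> fst e) (\<lambda>x. to_coord A e x (\<sigma> x v))"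
  using assms unfolding orthonormal_frame_def continuous_section_def by auto

lemma frame_change:
  assumes \<sigma>: "orthonormal_frame A G U \<sigma>" and a: "a \<in> S" "a 0 \<in> U"
  shows "frame_change \<sigma> a *v w = frame_coords a (\<sigma> (a 0) w)" "invertible (frame_change \<sigma> a)"
    "\<sigma> (a 0) (matrix_inv (frame_change \<sigma> a) *v y) = frame a y"
proof -
  have lin: "linear (\<lambda>w. frame_coords a (\<sigma> (a 0) w))"
    using linear_compose[OF frameD(1)[OF \<sigma> a(2)] frame_coords_linear[OF a(1)]] by (simp add: comp_def)
  show 1: "frame_change \<sigma> a *v w = frame_coords a (\<sigma> (a 0) w)" for w
    using linear_expand_axis[OF lin, of w]
    by (simp add: frame_change_def matrix_vector_mult_def vec_eq_iff mult.commute)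
  show 2: "invertible (frame_change \<sigma> a)"
  proof (rule invertible_of_inj)
    fix w assume "frame_change \<sigma> a *v w = 0"
    then have "\<sigma> (a 0) w = 0" using frame_frame_coords[OF a(1), of "\<sigma> (a 0) w"] linear_0[OF frame_linear] by (simp add: 1)
    then show "w = 0" using frameD(2)[OF \<sigma> a(2), of w] by (simp add: tnorm_zero)
  qed
  have "frame_coords a (\<sigma> (a 0) (matrix_inv (frame_change \<sigma> a) *v y)) = y"
    unfolding 1[symmetric] by (rule matrix_inv_mul(2)[OF 2])
  then show "\<sigma> (a 0) (matrix_inv (frame_change \<sigma> a) *v y) = frame a y" using frame_frame_coords[OF a(1)] by metis
qed

lemma frame_change_cont:
  assumes \<sigma>: "orthonormal_frame A G U \<sigma>"
  shows "continuous_on {a \<in> S. a 0 \<in> U} (frame_change \<sigma>)"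
  unfolding frame_change_def[abs_def]
proof (intro continuous_on_vec_lambda continuous_on_component continuous_on_local)
  fix j b assume "b \<in> {a \<in> S. a 0 \<in> U}"
  then have b: "b \<in> S" by simp
  obtain N where N: "open N" "b \<in> N" "\<forall>a\<in>S \<inter> N. c a = c b" using c_loc[OF b] by (elim exE conjE)
  let ?D = "{a \<in> S. a 0 \<in> U} \<inter> N"
  have "continuous_on ?D (\<lambda>a. to_coord A (c b) (a 0) (\<sigma> (a 0) (axis j 1)))"
    by (rule continuous_on_compose2[OF frameD(3)[OF \<sigma> cA[OF b]] coord_cont]) (use N(3) in \<open>auto intro!: c0_loc\<close>)
  then have "continuous_on ?D (\<lambda>a. inv_frame_matrix a *v to_coord A (c b) (a 0) (\<sigma> (a 0) (axis j 1)))"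
    by (intro continuous_on_matrix_vector_mult continuous_on_subset[OF inv_frame_matrix_cont]) auto
  then have "continuous_on ?D (\<lambda>a. frame_coords a (\<sigma> (a 0) (axis j 1)))"
    by (rule continuous_on_eq) (use N(3) in \<open>auto simp: frame_coords_def\<close>)
  then show "\<exists>W. open W \<and> b \<in> W \<and> continuous_on ({a \<in> S. a 0 \<in> U} \<inter> W) (\<lambda>a. frame_coords a (\<sigma> (a 0) (axis j 1)))"
    using N by blast
qed

lemma param_inv_frame_matrix:
  assumes "a \<in> S" "m \<in> fst (c a)"
  shows "param a (inv_frame_matrix a *v (snd (c a) m - base_coords a)) = m"
  using assms by (simp add: param_def inv_frame_matrix_frame_matrix chart_inv(1)[OF cA])

lemma param_local_map:
  assumes a: "a \<in> S" and x: "x \<in> ball 0 R"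
  shows "param (shift a) (local_map a x) = g (param a x)"
  unfolding local_map_def by (rule param_inv_frame_matrix[OF shift_S[OF a] param_in(2)[OF a x]])

end

text \<open>The data delivered by \<open>ef.linearization_exists\<close>, fixed for both the
  construction and the uniqueness of the charts.\<close>

locale linearized = adapted_coordinates A G g K c X \<mu>
  for A :: "('m::{t2_space, second_countable_topology}, 'n::finite) chart set" and G g K c X \<mu> +
  fixes \<rho> r1 :: real and \<psi> \<phi> :: "(int \<Rightarrow> 'm) \<Rightarrow> real^'n \<Rightarrow> real^'n"
  assumes r1: "0 < r1" and \<rho>: "0 < \<rho>" "\<rho> \<le> R"
    and \<psi>_smooth_vfamily: "smooth_vfamily (S \<times> ball 0 \<rho>) \<psi>" and \<phi>_smooth_vfamily: "smooth_vfamily (S \<times> ball 0 r1) \<phi>"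
    and \<phi>_in: "\<And>a y. a \<in> S \<Longrightarrow> y \<in> ball 0 r1 \<Longrightarrow> \<phi> a y \<in> ball 0 \<rho>"
    and \<psi>\<phi>: "\<And>a y. a \<in> S \<Longrightarrow> y \<in> ball 0 r1 \<Longrightarrow> \<psi> a (\<phi> a y) = y"
    and \<phi>\<psi>: "\<And>a x. a \<in> S \<Longrightarrow> x \<in> ball 0 \<rho> \<Longrightarrow> \<psi> a x \<in> ball 0 r1 \<Longrightarrow> \<phi> a (\<psi> a x) = x"
    and \<phi>0: "\<And>a. a \<in> S \<Longrightarrow> \<phi> a 0 = 0"
    and d\<phi>: "\<And>a i j. a \<in> S \<Longrightarrow> partial j (\<lambda>a x. \<phi> a x $ i) a 0 = (if i = j then 1 else 0)"
    and \<psi>0: "\<And>a. a \<in> S \<Longrightarrow> \<psi> a 0 = 0"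
    and d\<psi>: "\<And>a i j. a \<in> S \<Longrightarrow> partial j (\<lambda>a x. \<psi> a x $ i) a 0 = (if i = j then 1 else 0)"
    and \<phi>_conj: "\<And>a y. a \<in> S \<Longrightarrow> diag (\<mu> a) y \<in> ball 0 r1 \<Longrightarrow> \<phi> (shift a) (diag (\<mu> a) y) = local_map a (\<phi> a y)"
    and \<psi>_conj: "\<And>a x. a \<in> S \<Longrightarrow> x \<in> ball 0 \<rho> \<Longrightarrow> local_map a x \<in> ball 0 \<rho> \<Longrightarrow> \<psi> (shift a) (local_map a x) = diag (\<mu> a) (\<psi> a x)"
begin

definition \<Phi> :: "(int \<Rightarrow> 'm) \<Rightarrow> real^'n \<Rightarrow> 'm" where "\<Phi> a v = param a (\<phi> a (frame_coords a v))"

lemma \<phi>_R: "a \<in> S \<Longrightarrow> norm y < r1 \<Longrightarrow> \<phi> a y \<in> ball 0 R"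
  using \<phi>_in[of a y] \<rho> by auto

lemma \<Phi>_zero: "a \<in> S \<Longrightarrow> \<Phi> a 0 = a 0"
  by (simp add: \<Phi>_def linear_0[OF frame_coords_linear] \<phi>0 kap0)

lemma norm_diag_mu: "a \<in> S \<Longrightarrow> norm y \<le> norm (diag (\<mu> a) y)"
  using norm_diag_ge[of 1 "\<mu> a" y] \<mu>_gt[of a] by (simp add: less_imp_le)

text \<open>Smallness of the image vector suffices: \<open>diag (\<mu> a)\<close> does not decrease
  norms, so the coordinates of \<open>v\<close> lie in the domain of \<open>\<phi>\<close> as
  well.\<close>

lemma \<Phi>_conj:
  assumes a: "a \<in> S" and v: "norm (frame_coords (shift a) (tangent_map A g (a 0) v)) < r1"
  shows "\<Phi> (shift a) (tangent_map A g (a 0) v) = g (\<Phi> a v)"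
proof -
  have d: "norm (diag (\<mu> a) (frame_coords a v)) < r1" using v by (simp add: frame_coords_tangent[OF a])
  then have "norm (frame_coords a v) < r1" using norm_diag_mu[OF a, of "frame_coords a v"] by simp
  then have "\<phi> a (frame_coords a v) \<in> ball 0 R" by (rule \<phi>_R[OF a])
  then show ?thesis
    unfolding \<Phi>_def frame_coords_tangent[OF a] using \<phi>_conj[OF a, of "frame_coords a v"] d by (simp add: param_local_map[OF a])
qed

lemma \<phi>_derivative: "a \<in> S \<Longrightarrow> (\<phi> a has_derivative (\<lambda>h. h)) (at 0)"
proof -
  assume a: "a \<in> S"
  have "(\<phi> a has_derivative (\<lambda>h. \<chi> i. \<Sum>j\<in>UNIV. h $ j * partial j (\<lambda>a x. \<phi> a x $ i) a 0)) (at 0)"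
    by (rule smooth_vfamily_has_derivative[OF \<phi>_smooth_vfamily]) (use a r1 in auto)
  moreover have "(\<lambda>h. \<chi> i. \<Sum>j\<in>UNIV. h $ j * partial j (\<lambda>a x. \<phi> a x $ i) a 0) = (\<lambda>h. h)"
    by (simp add: fun_eq_iff vec_eq_iff d\<phi>[OF a] if_distrib[of "\<lambda>x. _ * x"] cong: if_cong)
  ultimately show ?thesis by simp
qed

lemma \<Phi>_derivative:
  assumes a: "a \<in> S"
  shows "((snd (chart_at A (a 0)) \<circ> \<Phi> a) has_derivative id) (at 0)"
proof -
  have "(frame_coords a has_derivative frame_coords a) (at 0)" by (rule linear_imp_has_derivative[OF frame_coords_linear[OF a]])
  moreover have "(\<phi> a has_derivative (\<lambda>h. h)) (at (frame_coords a 0))"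
    using \<phi>_derivative[OF a] by (simp add: linear_0[OF frame_coords_linear[OF a]])
  ultimately have "((\<lambda>v. \<phi> a (frame_coords a v)) has_derivative frame_coords a) (at 0)" by (rule has_derivative_compose)
  from has_derivative_add[OF has_derivative_const[of "base_coords a"] bounded_linear.has_derivative[OF matrix_vector_mul_bounded_linear[of "frame_matrix a"] this]]
  have 1: "((\<lambda>v. base_coords a + frame_matrix a *v \<phi> a (frame_coords a v)) has_derivative (\<lambda>h. frame_matrix a *v frame_coords a h)) (at 0)" by simp
  have "((snd (chart_at A (a 0)) \<circ> chart_inv (c a)) has_derivative of_coord A (c a) (a 0)) (at (snd (c a) (a 0)))"
    unfolding of_coord_tr by (rule tr_derivative[OF cA[OF a] _ c0[OF a]]) (auto simp: chart_at)
  then have "((snd (chart_at A (a 0)) \<circ> chart_inv (c a)) has_derivative of_coord A (c a) (a 0)) (at (base_coords a + frame_matrix a *v \<phi> a (frame_coords a 0)))"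
    by (simp add: linear_0[OF frame_coords_linear[OF a]] \<phi>0[OF a] base_coords_def)
  from has_derivative_compose[OF 1 this]
  show ?thesis by (simp add: of_frame_matrix[OF a] frame_frame_coords[OF a] \<Phi>_def[abs_def] param_def comp_def id_def)
qed

text \<open>\<open>f\<close> is \<open>\<Phi> a\<close> read in the chart \<open>c a\<close>, and
  \<open>k\<close> is its inverse, built from \<open>\<psi>\<close>. With the explicit inverse on
  the open set \<open>Z\<close>, these two form a smooth pair to which
  \<open>chart_of_parametrization\<close> applies.\<close>

lemma \<Phi>_ball_chart:
  assumes a: "a \<in> S" and r: "r > 0" and rr: "\<And>v. v \<in> tcball G (a 0) r \<Longrightarrow> norm (frame_coords a v) < r1"
  shows "ball_chart A G (a 0) r (\<Phi> a)"
proof -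
  have frame_coords_c: "continuous_on Y (frame_coords a)" for Y using frame_coords_linear[OF a] by (simp add: linear_continuous_on linear_conv_bounded_linear)
  define V where "V = {v. frame_coords a v \<in> ball 0 r1}"
  define Z where "Z = {y. inv_frame_matrix a *v (y - base_coords a) \<in> ball 0 \<rho> \<and> \<psi> a (inv_frame_matrix a *v (y - base_coords a)) \<in> ball 0 r1}"
  define f where "f v = base_coords a + frame_matrix a *v \<phi> a (frame_coords a v)" for v
  define k where "k y = frame a (\<psi> a (inv_frame_matrix a *v (y - base_coords a)))" for y
  have Vo: "open V"
  proof -
    have "V = frame_coords a -` ball 0 r1" by (auto simp: V_def)
    then show ?thesis using open_vimage[OF open_ball frame_coords_c] by simp
  qed
  have BIc: "continuous_on Y (\<lambda>y. inv_frame_matrix a *v (y - base_coords a))" for Y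
    by (intro continuous_on_matrix_vector_mult continuous_intros)
  have Zo: "open Z"
  proof -
    let ?Z1 = "(\<lambda>y. inv_frame_matrix a *v (y - base_coords a)) -` ball 0 \<rho>"
    have o1: "open ?Z1" by (rule open_vimage[OF open_ball BIc])
    have "continuous_on ?Z1 (\<lambda>y. case_prod \<psi> (a, inv_frame_matrix a *v (y - base_coords a)))"
      by (rule continuous_on_compose2[OF smooth_vfamily_continuous[OF \<psi>_smooth_vfamily]]) (use a in \<open>auto intro!: continuous_on_Pair BIc\<close>)
    then have "continuous_on ?Z1 (\<lambda>y. \<psi> a (inv_frame_matrix a *v (y - base_coords a)))" by simp
    from continuous_open_preimage[OF this o1 open_ball[of 0 r1]]
    show ?thesis by (simp add: Z_def Int_def vimage_def)
  qed
  have Zsub: "Z \<subseteq> snd (c a) ` fst (c a)"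
  proof
    fix y assume "y \<in> Z"
    then have "inv_frame_matrix a *v (y - base_coords a) \<in> ball 0 R" using \<rho> by (auto simp: Z_def)
    from param_in(4)[OF a this] show "y \<in> snd (c a) ` fst (c a)" by (auto simp: inv_frame_matrix_frame_matrix[OF a])
  qed
  \<comment> \<open>Over the single parameter \<open>a\<close> the rules for families become
    statements about single maps.\<close>
  have so: "slice_open ({a} \<times> Y)" if "open Y" for Y :: "(real^'n) set" using that by simp
  obtain TM :: "real^'n^'n" where TM: "\<And>v. frame_coords a v = TM *v v" using linear_as_matrix[OF frame_coords_linear[OF a]] by blast
  obtain TTM :: "real^'n^'n" where TTM: "\<And>y. frame a y = TTM *v y" using linear_as_matrix[OF frame_linear[of a]] by blast
  have lin_smooth_vfamily: "smooth_vfamily ({a} \<times> Y) (\<lambda>b v. q + M *v W b v)" if "open Y" "smooth_vfamily ({a} \<times> Y) W" for Y q M and W :: "_ \<Rightarrow> real^'n \<Rightarrow> real^'n"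
    by (rule smooth_vfamily_affine[OF so[OF that(1)] _ _ that(2)]) auto
  have sing: "smooth_on Y (W a)" if "open Y" "smooth_vfamily ({a} \<times> Y) W" for Y and W :: "_ \<Rightarrow> real^'n \<Rightarrow> real^'n"
    by (rule smooth_vfamily_smooth_on[OF so[OF that(1)] that(2)]) (auto intro: unique_deriv_domain_open that)
  have "smooth_vfamily ({a} \<times> V) (\<lambda>b v. \<phi> b (frame_coords a v))"
  proof (rule smooth_vfamily_comp[where U = \<phi> and s = "\<lambda>a. a" and V = "\<lambda>b v. frame_coords a v" and \<Psi> = "S \<times> ball 0 r1", OF so[OF Vo] \<phi>_smooth_vfamily])
    show "smooth_vfamily ({a} \<times> V) (\<lambda>b v. frame_coords a v)"
      using lin_smooth_vfamily[OF Vo smooth_vfamily_id[OF so[OF Vo]], of 0 TM] by (simp add: TM)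
  qed (use a in \<open>auto simp: V_def\<close>)
  from lin_smooth_vfamily[OF Vo this, of "base_coords a" "frame_matrix a"] have "smooth_vfamily ({a} \<times> V) (\<lambda>b v. base_coords a + frame_matrix a *v \<phi> b (frame_coords a v))" .
  from sing[OF Vo this] have fs: "smooth_on V f" by (simp add: f_def[abs_def])
  have "smooth_vfamily ({a} \<times> Z) (\<lambda>b y. \<psi> b (- (inv_frame_matrix a *v base_coords a) + inv_frame_matrix a *v y))"
  proof (rule smooth_vfamily_comp[where U = \<psi> and s = "\<lambda>a. a" and V = "\<lambda>b y. - (inv_frame_matrix a *v base_coords a) + inv_frame_matrix a *v y" and \<Psi> = "S \<times> ball 0 \<rho>", OF so[OF Zo] \<psi>_smooth_vfamily])
    show "smooth_vfamily ({a} \<times> Z) (\<lambda>b y. - (inv_frame_matrix a *v base_coords a) + inv_frame_matrix a *v y)" by (rule lin_smooth_vfamily[OF Zo smooth_vfamily_id[OF so[OF Zo]]])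
  qed (use a in \<open>auto simp: Z_def matrix_vector_mult_diff_distrib\<close>)
  from lin_smooth_vfamily[OF Zo this, of 0 TTM]
  have "smooth_vfamily ({a} \<times> Z) (\<lambda>b y. frame a (\<psi> b (inv_frame_matrix a *v (y - base_coords a))))" by (simp add: TTM matrix_vector_mult_diff_distrib)
  from sing[OF Zo this] have ks: "smooth_on Z k" by (simp add: k_def[abs_def])
  have kf: "k (f v) = v" and fZ: "f v \<in> Z" if "v \<in> V" for v
    using that \<phi>_in[OF a] \<psi>\<phi>[OF a] by (auto simp: k_def f_def Z_def V_def inv_frame_matrix_frame_matrix[OF a] frame_frame_coords[OF a])
  have fk: "f (k y) = y" and kV: "k y \<in> V" if "y \<in> Z" for y
    using that \<phi>\<psi>[OF a] by (auto simp: k_def f_def Z_def V_def frame_coords_frame[OF a] inv_frame_matrix_frame_matrix[OF a])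
  obtain d where d: "is_chart d" "\<forall>e\<in>A. compatible d e" "snd d ` fst d = V" "\<forall>v\<in>V. chart_inv d v = chart_inv (c a) (f v)"
    using chart_of_parametrization[OF cA[OF a] Vo Zo Zsub fs _ ks _ kf fk] fZ kV by blast
  have sub: "tcball G (a 0) r \<subseteq> V" using rr by (auto simp: V_def)
  have \<Phi>d: "\<Phi> a v = chart_inv d v" if "v \<in> V" for v using d(4) that by (simp add: \<Phi>_def param_def f_def)
  have "a 0 \<in> interior (\<Phi> a ` tcball G (a 0) r)"
  proof -
    obtain m M where mM: "m > 0" "M > 0" "\<forall>a\<in>S. \<forall>v. m * norm (frame_coords a v) \<le> tnorm G (a 0) v \<and> tnorm G (a 0) v \<le> M * norm (frame_coords a v)"
      using tnorm_bounds by (elim exE conjE)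
    \<comment> \<open>An open neighbourhood of \<open>0\<close> inside the ball; by the comparison
      of norms, coordinates below \<open>r / M\<close> mean Riemannian norm below \<open>r\<close>.
      Its image is open because it is a preimage under the chart.\<close>
    define W where "W = {v. frame_coords a v \<in> ball 0 (min r1 (r / M))}"
    have "W = frame_coords a -` ball 0 (min r1 (r / M))" by (auto simp: W_def)
    then have Wo: "open W" using open_vimage[OF open_ball frame_coords_c] by simp
    have WV: "W \<subseteq> V" by (auto simp: W_def V_def)
    have WB: "W \<subseteq> tcball G (a 0) r"
    proof
      fix v assume "v \<in> W"
      then have "norm (frame_coords a v) < r / M" by (simp add: W_def)
      then have "M * norm (frame_coords a v) < r" using mM(2) by (simp add: pos_less_divide_eq mult.commute)
      then show "v \<in> tcball G (a 0) r" 
        using conjunct2[OF mM(3)[rule_format, OF a, of v]] unfolding tcball_def mem_Collect_eq by linarith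
    qed
    have "chart_inv d ` W = fst d \<inter> snd d -` W"
    proof (intro equalityI subsetI)
      fix m assume "m \<in> chart_inv d ` W"
      then show "m \<in> fst d \<inter> snd d -` W" using is_chart_inv(2,3)[OF d(1)] d(3) WV by auto
    next
      fix m assume "m \<in> fst d \<inter> snd d -` W"
      then have "m = chart_inv d (snd d m)" "snd d m \<in> W" using is_chart_inv(1)[OF d(1)] by auto
      then show "m \<in> chart_inv d ` W" by (rule image_eqI)
    qed
    moreover have "open (fst d \<inter> snd d -` W)"
      using d(1) unfolding is_chart_def homeomorphism_def by (intro continuous_open_preimage Wo) auto
    ultimately have "open (\<Phi> a ` W)" using \<Phi>d WV by (metis (no_types, lifting) image_cong subsetD)
    moreover have "a 0 \<in> \<Phi> a ` W"
    proof (rule image_eqI)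
      show "a 0 = \<Phi> a 0" using \<Phi>_zero[OF a] by simp
      show "0 \<in> W" using r1 r mM(2) by (simp add: W_def linear_0[OF frame_coords_linear[OF a]])
    qed
    ultimately show ?thesis using interior_maximal[OF image_mono[OF WB]] by blast
  qed
  moreover have "\<exists>d. is_chart d \<and> (\<forall>c\<in>A. compatible d c) \<and> tcball G (a 0) r \<subseteq> snd d ` fst d \<and>
     (\<forall>v\<in>tcball G (a 0) r. \<Phi> a v = chart_inv d v)"
    by (rule exI[of _ d], intro conjI ballI, rule d(1), rule bspec[OF d(2)], assumption)
      (simp add: d(3) sub, rule \<Phi>d, rule subsetD[OF sub])
  ultimately show ?thesis unfolding ball_chart_def by (intro conjI)
qed

text \<open>In an orthonormal frame \<open>\<Phi> a\<close> is a composition of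
  \<open>\<phi>\<close>, affine maps with continuous coefficients and the inverse of a locally
  constant chart, all defined beyond the closed ball of radius \<open>r\<close>.\<close>

lemma \<Phi>_family:
  assumes r: "r > 0" and rr: "\<And>a v. a \<in> S \<Longrightarrow> v \<in> tcball G (a 0) r \<Longrightarrow> norm (frame_coords a v) < r1"
  shows "continuous_family A G S r \<Phi>"
  unfolding continuous_family_def
proof
  fix b assume b: "b \<in> S"
  obtain U \<sigma> where U: "open U" "b 0 \<in> U" and \<sigma>: "orthonormal_frame A G U \<sigma>"
    using orthonormal_frame_exists[of "b 0"] by (elim exE conjE)
  define S' where "S' = {a \<in> S. a 0 \<in> U}"
  have S': "a \<in> S" "a 0 \<in> U" if "a \<in> S'" for a using that by (auto simp: S'_def)
  \<comment> \<open>By \<open>rr\<close> this open set contains the closed balls of radius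
    \<open>r\<close>, the margin that the smooth topology needs at their boundary.\<close>
  define \<Omega> where "\<Omega> = {z \<in> S' \<times> UNIV. frame_change \<sigma> (fst z) *v snd z \<in> ball 0 r1}"
  have Qc: "continuous_on S' (frame_change \<sigma>)" unfolding S'_def by (rule frame_change_cont[OF \<sigma>])
  have Qvc: "continuous_on (S' \<times> UNIV) (\<lambda>z. frame_change \<sigma> (fst z) *v snd z)"
    by (intro continuous_on_matrix_vector_mult continuous_on_compose2[OF Qc] continuous_intros) auto
  have \<Omega>o: "openin (top_of_set (S' \<times> UNIV)) \<Omega>"
    using continuous_openin_preimage_gen[OF Qvc open_ball[of 0 r1]] by (simp add: \<Omega>_def Int_def vimage_def)
  have so: "slice_open \<Omega>"
    unfolding slice_open_def
  proof
    fix a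
    have "open ((\<lambda>w. frame_change \<sigma> a *v w) -` ball 0 r1)"
      by (rule open_vimage[OF open_ball]) (intro continuous_on_matrix_vector_mult continuous_intros)
    moreover have "{x. (a, x) \<in> \<Omega>} = (if a \<in> S' then (\<lambda>w. frame_change \<sigma> a *v w) -` ball 0 r1 else {})"
      by (auto simp: \<Omega>_def)
    ultimately show "open {x. (a, x) \<in> \<Omega>}" by simp
  qed
  let ?h = "\<lambda>a. \<Phi> a \<circ> \<sigma> (a 0)"
  have h: "?h a w = chart_inv (c a) (base_coords a + frame_matrix a *v \<phi> a (frame_change \<sigma> a *v w))" if "a \<in> S'" for a w
    using frame_change(1)[OF \<sigma> S'[OF that]] by (simp add: \<Phi>_def param_def)
  have inn: "base_coords a + frame_matrix a *v \<phi> a (frame_change \<sigma> a *v w) \<in> snd (c a) ` fst (c a)" if "(a, w) \<in> \<Omega>" for a w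
  proof -
    have "a \<in> S" "norm (frame_change \<sigma> a *v w) < r1" using that S' by (auto simp: \<Omega>_def)
    from param_in(4)[OF this(1) \<phi>_R[OF this]] show ?thesis by auto
  qed
  have ySF: "smooth_vfamily \<Omega> (\<lambda>a w. base_coords a + frame_matrix a *v \<phi> a (frame_change \<sigma> a *v w))"
  proof (rule affine_smooth_vfamily[OF so])
    show "fst ` \<Omega> \<subseteq> S" using S' by (auto simp: \<Omega>_def)
    show "smooth_vfamily \<Omega> (\<lambda>a w. \<phi> a (frame_change \<sigma> a *v w))"
    proof (rule smooth_vfamily_comp[where U = \<phi> and s = "\<lambda>a. a" and V = "\<lambda>a w. frame_change \<sigma> a *v w" and \<Psi> = "S \<times> ball 0 r1", OF so \<phi>_smooth_vfamily])
      have "smooth_vfamily \<Omega> (\<lambda>a w. 0 + frame_change \<sigma> a *v w)"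
        by (rule smooth_vfamily_affine[OF so continuous_on_subset[OF Qc] _ smooth_vfamily_id[OF so]]) (auto simp: \<Omega>_def)
      then show "smooth_vfamily \<Omega> (\<lambda>a w. frame_change \<sigma> a *v w)" by simp
    qed (use S' in \<open>auto simp: \<Omega>_def\<close>)
  qed
  have "continuous_map (top_of_set S') (smooth_topology A r) ?h"
  proof (rule continuous_into_smooth_topology[OF r _ \<Omega>o])
    show "S' \<times> cball 0 r \<subseteq> \<Omega>"
    proof
      fix z assume "z \<in> S' \<times> cball (0::real^'n) r"
      then obtain a w where z: "z = (a, w)" "a \<in> S'" "norm w \<le> r" by auto
      have "\<sigma> (a 0) w \<in> tcball G (a 0) r" using frameD(2)[OF \<sigma> S'(2)[OF z(2)]] z(3) by (simp add: tcball_def)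
      from rr[OF S'(1)[OF z(2)] this] show "z \<in> \<Omega>" using z frame_change(1)[OF \<sigma> S'[OF z(2)]] by (simp add: \<Omega>_def)
    qed
    show "continuous_on \<Omega> (case_prod ?h)"
    proof (rule continuous_on_local)
      fix z assume "z \<in> \<Omega>"
      then have z: "fst z \<in> S" using S' by (auto simp: \<Omega>_def)
      obtain N where N: "open N" "fst z \<in> N" "\<forall>a\<in>S \<inter> N. c a = c (fst z)" using c_loc[OF z] by (elim exE conjE)
      let ?D = "\<Omega> \<inter> (N \<times> UNIV)"
      have "continuous_on ?D (\<lambda>q. chart_inv (c (fst z)) (base_coords (fst q) + frame_matrix (fst q) *v \<phi> (fst q) (frame_change \<sigma> (fst q) *v snd q)))"
      proof (rule continuous_on_compose2[OF chartD(5)[OF cA[OF z]]])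
        show "continuous_on ?D (\<lambda>q. base_coords (fst q) + frame_matrix (fst q) *v \<phi> (fst q) (frame_change \<sigma> (fst q) *v snd q))"
          using continuous_on_subset[OF smooth_vfamily_continuous[OF ySF], of ?D] by (simp add: case_prod_beta)
        show "(\<lambda>q. base_coords (fst q) + frame_matrix (fst q) *v \<phi> (fst q) (frame_change \<sigma> (fst q) *v snd q)) ` ?D \<subseteq> snd (c (fst z)) ` fst (c (fst z))"
        proof
          fix y assume "y \<in> (\<lambda>q. base_coords (fst q) + frame_matrix (fst q) *v \<phi> (fst q) (frame_change \<sigma> (fst q) *v snd q)) ` ?D"
          then obtain a w where aw: "(a, w) \<in> \<Omega>" "a \<in> N" "y = base_coords a + frame_matrix a *v \<phi> a (frame_change \<sigma> a *v w)" by auto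
          have "a \<in> S \<inter> N" using aw S' by (auto simp: \<Omega>_def)
          then show "y \<in> snd (c (fst z)) ` fst (c (fst z))" using inn[OF aw(1)] aw(3) bspec[OF N(3)] by metis
        qed
      qed
      then have "continuous_on ?D (case_prod ?h)"
      proof (rule continuous_on_eq)
        fix q assume "q \<in> ?D"
        then obtain a w where aw: "(a, w) \<in> \<Omega>" "a \<in> N" "q = (a, w)" "a \<in> S'" "a \<in> S" using S' by (cases q) (auto simp: \<Omega>_def)
        then show "chart_inv (c (fst z)) (base_coords (fst q) + frame_matrix (fst q) *v \<phi> (fst q) (frame_change \<sigma> (fst q) *v snd q)) = case_prod ?h q"
          using h[OF aw(4), of w] bspec[OF N(3), of a] by simp
      qed
      then show "\<exists>W. open W \<and> z \<in> W \<and> continuous_on (\<Omega> \<inter> W) (case_prod ?h)"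
        using N by (intro exI[of _ "N \<times> UNIV"]) (auto simp: open_Times mem_Times_iff)
    qed
    fix e assume e: "e \<in> A"
    let ?E = "{z \<in> \<Omega>. case_prod ?h z \<in> fst e}"
    show "smooth_vfamily ?E (\<lambda>a w. snd e (?h a w))"
    proof (rule smooth_vfamily_local[where S = S'])
      fix b assume "b \<in> S'"
      then have bS: "b \<in> S" by (rule S')
      obtain N where N: "open N" "b \<in> N" "\<forall>a\<in>S \<inter> N. c a = c b" using c_loc[OF bS] by (elim exE conjE)
      \<comment> \<open>The same set as \<open>?E \<inter> (N \<times> UNIV)\<close>, described in
        the fixed chart \<open>c b\<close>; in this form its slices are visibly open.\<close>
      let ?Y = "{z \<in> \<Omega> \<inter> (N \<times> UNIV). base_coords (fst z) + frame_matrix (fst z) *v \<phi> (fst z) (frame_change \<sigma> (fst z) *v snd z) \<in> snd (c b) ` (fst (c b) \<inter> fst e)}"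
      let ?F = "\<lambda>a w. base_coords a + frame_matrix a *v \<phi> a (frame_change \<sigma> a *v w)"
      have soY: "slice_open ?Y"
        unfolding slice_open_def
      proof
        fix a
        have "continuous_on {w. (a, w) \<in> \<Omega>} (\<lambda>w. case_prod ?F (a, w))"
          by (rule continuous_on_compose2[OF smooth_vfamily_continuous[OF ySF]]) (auto intro!: continuous_intros)
        then have "continuous_on {w. (a, w) \<in> \<Omega>} (?F a)" by simp
        from continuous_open_preimage[OF this slice_openD[OF so] transition_open[OF cA[OF bS] e]]
        have "open ({w. (a, w) \<in> \<Omega>} \<inter> ?F a -` (snd (c b) ` (fst (c b) \<inter> fst e)))" .
        moreover have "{w. (a, w) \<in> ?Y} = (if a \<in> N then {w. (a, w) \<in> \<Omega>} \<inter> ?F a -` (snd (c b) ` (fst (c b) \<inter> fst e)) else {})"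
          by auto
        ultimately show "open {w. (a, w) \<in> ?Y}" by simp
      qed
      have Yeq: "?E \<inter> (N \<times> UNIV) = ?Y"
      proof (intro equalityI subsetI)
        fix z assume z: "z \<in> ?E \<inter> (N \<times> UNIV)"
        then obtain a w where aw: "z = (a, w)" "(a, w) \<in> \<Omega>" "a \<in> N" "?h a w \<in> fst e" "a \<in> S'" "a \<in> S"
          using S' by (cases z) (auto simp: \<Omega>_def)
        have ca: "c a = c b" using bspec[OF N(3), of a] aw by simp
        obtain m where m: "m \<in> fst (c b)" "?F a w = snd (c b) m" using inn[OF aw(2)] unfolding ca by auto
        then have "?h a w = m" using h[OF aw(5), of w] chart_inv(1)[OF cA[OF bS] m(1)] ca by simp
        then show "z \<in> ?Y" using aw m by auto
      next
        fix z assume z: "z \<in> ?Y"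
        then obtain a w where aw: "z = (a, w)" "(a, w) \<in> \<Omega>" "a \<in> N" "a \<in> S'" "a \<in> S"
          using S' by (cases z) (auto simp: \<Omega>_def)
        have ca: "c a = c b" using bspec[OF N(3), of a] aw by simp
        obtain m where m: "m \<in> fst (c b)" "m \<in> fst e" "?F a w = snd (c b) m" using z aw(1) by auto
        then have "?h a w = m" using h[OF aw(4), of w] chart_inv(1)[OF cA[OF bS] m(1)] ca by simp
        then show "z \<in> ?E \<inter> (N \<times> UNIV)" using aw m by simp
      qed
      have "smooth_vfamily ?Y (\<lambda>a w. (snd e \<circ> chart_inv (c b)) (?F a w))"
      proof (rule smooth_vfamily_comp[where U = "\<lambda>_. snd e \<circ> chart_inv (c b)" and s = "\<lambda>a. a" and V = ?F
            and \<Psi> = "UNIV \<times> snd (c b) ` (fst (c b) \<inter> fst e)", OF soY])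
        show "smooth_vfamily (UNIV \<times> snd (c b) ` (fst (c b) \<inter> fst e)) (\<lambda>_::int \<Rightarrow> 'm. snd e \<circ> chart_inv (c b))"
          by (rule smooth_on_smooth_vfamily_const[OF transition_open[OF cA[OF bS] e] transition_smooth[OF cA[OF bS] e]])
        show "smooth_vfamily ?Y ?F" by (rule smooth_vfamily_subset[OF ySF]) auto
      qed auto
      then have "smooth_vfamily ?Y (\<lambda>a w. snd e (?h a w))"
      proof (rule smooth_vfamily_cong[OF soY, rotated])
        fix a w assume "(a, w) \<in> ?Y"
        then have aw: "a \<in> N" "a \<in> S'" "a \<in> S" using S' by (auto simp: \<Omega>_def)
        then show "(snd e \<circ> chart_inv (c b)) (?F a w) = snd e (?h a w)"
          using h[OF aw(2), of w] bspec[OF N(3), of a] by simp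
      qed
      then show "\<exists>N. open N \<and> b \<in> N \<and> smooth_vfamily (?E \<inter> (N \<times> UNIV)) (\<lambda>a w. snd e (?h a w))"
        using N Yeq by (intro exI[of _ N]) simp
    qed (auto simp: \<Omega>_def)
  qed
  then show "\<exists>U \<sigma>. open U \<and> b 0 \<in> U \<and> orthonormal_frame A G U \<sigma> \<and>
      continuous_map (top_of_set {a \<in> S. a 0 \<in> U}) (smooth_topology A r) (\<lambda>a. \<Phi> a \<circ> \<sigma> (a 0))"
    using U \<sigma> by (intro exI[of _ U] exI[of _ \<sigma>]) (simp add: S'_def)
qed

lemma \<Phi>_linearizing:
  assumes r: "r > 0" and rr: "\<And>a v. a \<in> S \<Longrightarrow> v \<in> tcball G (a 0) r \<Longrightarrow> norm (frame_coords a v) < r1"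
  shows "linearizing_family A G g K r \<Phi>"
  unfolding linearizing_family_def
proof (intro conjI ballI allI impI)
  show "continuous_family A G S r \<Phi>" by (rule \<Phi>_family[OF r rr])
  fix a assume a: "a \<in> S"
  show "ball_chart A G (a 0) r (\<Phi> a)" by (rule \<Phi>_ball_chart[OF a r rr[OF a]])
  show "\<Phi> a 0 = a 0" by (rule \<Phi>_zero[OF a])
  show "((snd (chart_at A (a 0)) \<circ> \<Phi> a) has_derivative id) (at 0)" by (rule \<Phi>_derivative[OF a])
  fix v assume "tangent_map A g (a 0) v \<in> tcball G (g (a 0)) r"
  then show "\<Phi> (shift a) (tangent_map A g (a 0) v) = g (\<Phi> a v)"
    using \<Phi>_conj[OF a] rr[OF shift_S[OF a]] g0[OF a] by simp
qed

end

section \<open>Uniqueness\<close>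

lemma slice_open_openin:
  fixes \<Omega> :: "('x::topological_space \<times> (real^'n::finite)) set"
  assumes "openin (top_of_set (S \<times> UNIV)) \<Omega>"
  shows "slice_open \<Omega>"
  unfolding slice_open_def
proof
  fix a
  obtain T where T: "open T" "\<Omega> = (S \<times> UNIV) \<inter> T" using assms by (auto simp: openin_open)
  have "open ((\<lambda>x. (a, x)) -` T)" by (rule open_vimage[OF T(1)]) (intro continuous_intros)
  moreover have "{x. (a, x) \<in> \<Omega>} = (if a \<in> S then (\<lambda>x. (a, x)) -` T else {})" using T(2) by auto
  ultimately show "open {x. (a, x) \<in> \<Omega>}" by simp
qed

context linearized
begin

text \<open>Vectors enter through coordinates along the line bundles. The strict inequality stays
  off the boundary of the ball, where derivatives within the ball are one-sided.\<close>

definition chart_region :: "((int \<Rightarrow> 'm) \<Rightarrow> real^'n \<Rightarrow> 'm) \<Rightarrow> real \<Rightarrow> ('m, 'n) chart \<Rightarrow> ((int \<Rightarrow> 'm) \<times> (real^'n)) set" where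
  "chart_region \<zeta> r e = {(a, y). a \<in> S \<and> tnorm G (a 0) (frame a y) < r \<and> \<zeta> a (frame a y) \<in> fst e}"

text \<open>The continuity of the family is known in an orthonormal frame. The inverse of
  \<open>frame_change\<close> is continuous in \<open>a\<close> and linear in \<open>y\<close>, so
  it carries openness and smoothness over to the coordinates along the line bundles.\<close>

lemma chart_region_local:
  assumes r: "r > 0" and \<zeta>: "continuous_family A G S r \<zeta>" and b: "b \<in> S" and e: "e \<in> A"
  shows "\<exists>N. open N \<and> b \<in> N \<and> openin (top_of_set (S \<times> UNIV)) (chart_region \<zeta> r e \<inter> (N \<times> UNIV)) \<and>
    smooth_vfamily (chart_region \<zeta> r e \<inter> (N \<times> UNIV)) (\<lambda>a y. snd e (\<zeta> a (frame a y)))"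
proof -
  obtain U \<sigma> where U: "open U" "b 0 \<in> U" and \<sigma>: "orthonormal_frame A G U \<sigma>"
    and cm: "continuous_map (top_of_set {a \<in> S. a 0 \<in> U}) (smooth_topology A r) (\<lambda>a. \<zeta> a \<circ> \<sigma> (a 0))"
    using \<zeta> b unfolding continuous_family_def by (elim ballE exE conjE) auto
  define S' where "S' = {a \<in> S. a 0 \<in> U}"
  have S': "a \<in> S" "a 0 \<in> U" if "a \<in> S'" for a using that by (auto simp: S'_def)
  define N where "N = (\<lambda>a::int \<Rightarrow> 'm. a 0) -` U"
  have N: "open N" "b \<in> N" unfolding N_def using U open_vimage[OF U(1) coord_cont[of UNIV 0]] by auto
  have SN: "S' = S \<inter> N" by (auto simp: S'_def N_def)
  define \<Omega> where "\<Omega> = {(a, w). a \<in> S' \<and> w \<in> ball 0 r \<and> (\<zeta> a \<circ> \<sigma> (a 0)) w \<in> fst e}"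
  have \<Omega>: "openin (top_of_set (S' \<times> UNIV)) \<Omega>" "smooth_vfamily \<Omega> (\<lambda>a w. snd e ((\<zeta> a \<circ> \<sigma> (a 0)) w))"
    using continuous_from_smooth_topology[OF r cm e] unfolding \<Omega>_def S'_def by auto
  let ?Q = "\<lambda>a. matrix_inv (frame_change \<sigma> a)"
  have Qc: "continuous_on S' ?Q"
    unfolding S'_def by (rule continuous_on_matrix_inv[OF frame_change_cont[OF \<sigma>]]) (use frame_change(2)[OF \<sigma>] in auto)
  have \<sigma>Q: "\<sigma> (a 0) (?Q a *v y) = frame a y" if "a \<in> S'" for a y
    by (rule frame_change(3)[OF \<sigma> S'[OF that]])
  have nQ: "norm (?Q a *v y) = tnorm G (a 0) (frame a y)" if "a \<in> S'" for a y
    using frameD(2)[OF \<sigma> S'(2)[OF that], of "?Q a *v y"] \<sigma>Q[OF that] by simp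
  have in\<Omega>: "(a, ?Q a *v y) \<in> \<Omega> \<longleftrightarrow> (a, y) \<in> chart_region \<zeta> r e" if "a \<in> S'" for a y
    using that S'(1)[OF that] by (simp add: \<Omega>_def chart_region_def nQ \<sigma>Q)
  let ?k = "\<lambda>z. (fst z, ?Q (fst z) *v snd z)"
  have kc: "continuous_on (S' \<times> UNIV) ?k"
    by (intro continuous_on_Pair continuous_on_matrix_vector_mult continuous_on_compose2[OF Qc] continuous_intros) auto
  have Weq: "chart_region \<zeta> r e \<inter> (N \<times> UNIV) = (S' \<times> UNIV) \<inter> ?k -` \<Omega>"
    using in\<Omega> by (auto simp: chart_region_def SN)
  have "openin (top_of_set (S' \<times> UNIV)) ((S' \<times> UNIV) \<inter> ?k -` \<Omega>)"
    by (rule continuous_openin_preimage[OF kc _ \<Omega>(1)]) auto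
  moreover have "openin (top_of_set (S \<times> UNIV)) (S' \<times> (UNIV :: (real^'n) set))"
    unfolding SN by (rule openin_Times[OF openin_open_Int[OF N(1)]]) simp
  ultimately have Wo: "openin (top_of_set (S \<times> UNIV)) (chart_region \<zeta> r e \<inter> (N \<times> UNIV))"
    unfolding Weq by (rule openin_trans)
  note so = slice_open_openin[OF Wo]
  let ?W = "chart_region \<zeta> r e \<inter> (N \<times> UNIV)"
  have fW: "fst ` ?W \<subseteq> S'" by (auto simp: chart_region_def SN)
  have "smooth_vfamily ?W (\<lambda>a y. snd e ((\<zeta> a \<circ> \<sigma> (a 0)) (?Q a *v y)))"
  proof (rule smooth_vfamily_comp[where U = "\<lambda>a w. snd e ((\<zeta> a \<circ> \<sigma> (a 0)) w)" and s = "\<lambda>a. a" and V = "\<lambda>a y. ?Q a *v y" and \<Psi> = \<Omega>, OF so \<Omega>(2)])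
    have "smooth_vfamily ?W (\<lambda>a y. 0 + ?Q a *v y)"
      by (rule smooth_vfamily_affine[OF so continuous_on_subset[OF Qc fW] _ smooth_vfamily_id[OF so]]) simp
    then show "smooth_vfamily ?W (\<lambda>a y. ?Q a *v y)" by simp
    show "(a, ?Q a *v y) \<in> \<Omega>" if "(a, y) \<in> ?W" for a y
      using in\<Omega>[of a y] that fW by force
  qed simp
  then have "smooth_vfamily ?W (\<lambda>a y. snd e (\<zeta> a (frame a y)))"
    by (rule smooth_vfamily_cong[OF so, rotated]) (use \<sigma>Q fW in force)
  then show ?thesis using N Wo by blast
qed

text \<open>Near \<open>0\<close> the competitor, read in coordinates as \<open>\<theta>\<close>, is
  a right inverse of \<open>\<psi>\<close> and thus equals \<open>\<phi>\<close>. A vector farther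
  out is pulled back along the orbit until its coordinates are small; the two conjugacies then give
  the same value at the original vector.\<close>

theorem \<Phi>_unique:
  assumes r: "r > 0" and rr: "\<And>a v. a \<in> S \<Longrightarrow> v \<in> tcball G (a 0) r \<Longrightarrow> norm (frame_coords a v) < r1"
    and \<zeta>: "linearizing_family A G g K r \<zeta>" and a: "a \<in> S" and v: "v \<in> tcball G (a 0) r"
  shows "\<zeta> a v = \<Phi> a v"
proof -
  have cf: "continuous_family A G S r \<zeta>" using \<zeta> by (simp add: linearizing_family_def)
  have \<zeta>0: "\<zeta> a 0 = a 0" and \<zeta>d: "((snd (chart_at A (a 0)) \<circ> \<zeta> a) has_derivative id) (at 0)"
    and \<zeta>g: "tangent_map A g (a 0) v \<in> tcball G (g (a 0)) r \<Longrightarrow> \<zeta> (shift a) (tangent_map A g (a 0) v) = g (\<zeta> a v)"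
    if "a \<in> S" for a v
    using \<zeta> that unfolding linearizing_family_def by auto
  define \<theta> where "\<theta> a y = inv_frame_matrix a *v (snd (c a) (\<zeta> a (frame a y)) - base_coords a)" for a y
  define W where "W = {(a, y). a \<in> S \<and> tnorm G (a 0) (frame a y) < r \<and> \<zeta> a (frame a y) \<in> fst (c a)}"
  have loc: "\<exists>N. open N \<and> b \<in> N \<and> openin (top_of_set (S \<times> UNIV)) (W \<inter> (N \<times> UNIV)) \<and> smooth_vfamily (W \<inter> (N \<times> UNIV)) \<theta>"
    if b: "b \<in> S" for b
  proof -
    obtain N where N: "open N" "b \<in> N" "openin (top_of_set (S \<times> UNIV)) (chart_region \<zeta> r (c b) \<inter> (N \<times> UNIV))"
      "smooth_vfamily (chart_region \<zeta> r (c b) \<inter> (N \<times> UNIV)) (\<lambda>a y. snd (c b) (\<zeta> a (frame a y)))"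
      using chart_region_local[OF r cf b cA[OF b]] by (elim exE conjE)
    obtain U where U: "open U" "b \<in> U" "\<forall>a\<in>S \<inter> U. c a = c b" using c_loc[OF b] by (elim exE conjE)
    let ?N = "N \<inter> U"
    let ?W = "W \<inter> (?N \<times> UNIV)"
    have ca: "c a = c b" if "a \<in> S" "a \<in> U" for a using U(3) that by blast
    have eq: "?W = (chart_region \<zeta> r (c b) \<inter> (N \<times> UNIV)) \<inter> (U \<times> UNIV)"
      using ca by (auto simp: W_def chart_region_def)
    have Wo: "openin (top_of_set (S \<times> UNIV)) ?W"
      unfolding eq by (rule openin_Int_open[OF N(3)]) (use U in \<open>simp add: open_Times\<close>)
    note so = slice_open_openin[OF Wo]
    have sW: "smooth_vfamily ?W (\<lambda>a y. snd (c b) (\<zeta> a (frame a y)))" by (rule smooth_vfamily_subset[OF N(4)]) (use eq in blast)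
    have fW: "fst ` ?W \<subseteq> S" by (auto simp: W_def)
    have "smooth_vfamily ?W (\<lambda>a y. inv_frame_matrix a *v (snd (c b) (\<zeta> a (frame a y)) - base_coords a))" by (rule inv_frame_matrix_smooth_vfamily[OF so fW sW])
    then have "smooth_vfamily ?W \<theta>" by (rule smooth_vfamily_cong[OF so, rotated]) (use ca in \<open>auto simp: \<theta>_def W_def\<close>)
    then show ?thesis using N(1,2) U(1,2) Wo by (intro exI[of _ ?N]) auto
  qed
  have Wo: "openin (top_of_set (S \<times> UNIV)) W"
  proof (subst openin_subopen, intro ballI)
    fix z assume z: "z \<in> W"
    then have "fst z \<in> S" by (auto simp: W_def)
    from loc[OF this] obtain N where "fst z \<in> N" "openin (top_of_set (S \<times> UNIV)) (W \<inter> (N \<times> UNIV))" by (elim exE conjE)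
    then show "\<exists>T. openin (top_of_set (S \<times> UNIV)) T \<and> z \<in> T \<and> T \<subseteq> W"
      using z by (intro exI[of _ "W \<inter> (N \<times> UNIV)"]) (auto simp: mem_Times_iff)
  qed
  have W0: "(a, 0) \<in> W" if "a \<in> S" for a
    using that \<zeta>0[OF that] c0[OF that] r by (simp add: W_def linear_0[OF frame_linear] tnorm_zero)
  have "\<exists>\<rho>>0. S \<times> ball 0 \<rho> \<subseteq> W" by (rule tube_radius[OF compact_S Wo W0])
  then obtain \<epsilon> where \<epsilon>: "\<epsilon> > 0" "S \<times> ball 0 \<epsilon> \<subseteq> W" by (elim exE conjE)
  have \<theta>S: "smooth_vfamily (S \<times> ball 0 \<epsilon>) \<theta>"
  proof (rule smooth_vfamily_local[where S = S])
    fix b assume "b \<in> S"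
    from loc[OF this] obtain N where "open N" "b \<in> N" "smooth_vfamily (W \<inter> (N \<times> UNIV)) \<theta>" by (elim exE conjE)
    then show "\<exists>U. open U \<and> b \<in> U \<and> smooth_vfamily ((S \<times> ball 0 \<epsilon>) \<inter> (U \<times> UNIV)) \<theta>"
      using \<epsilon>(2) by (intro exI[of _ N]) (auto intro: smooth_vfamily_subset)
  qed auto
  have \<theta>0: "\<theta> a 0 = 0" if "a \<in> S" for a
    using \<zeta>0[OF that] by (simp add: \<theta>_def linear_0[OF frame_linear] base_coords_def)
  have d\<theta>: "(\<theta> a has_derivative diag (\<chi> i. 1)) (at 0)" if a: "a \<in> S" for a
  proof -
    \<comment> \<open>The derivative at \<open>0\<close> is normalized in this chart. Passing to
      \<open>c a\<close> is legitimate on the set \<open>V\<close> where the values stay in the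
      domain of \<open>e\<close>, a neighbourhood of \<open>0\<close>.\<close>
    define e where "e = chart_at A (a 0)"
    have e: "e \<in> A" "a 0 \<in> fst e" using chart_at by (auto simp: e_def)
    obtain N where N: "a \<in> N" "openin (top_of_set (S \<times> UNIV)) (chart_region \<zeta> r e \<inter> (N \<times> UNIV))"
      using chart_region_local[OF r cf a e(1)] by (elim exE conjE)
    define V where "V = {y. (a, y) \<in> chart_region \<zeta> r e \<inter> (N \<times> UNIV)}"
    have Vo: "open V" unfolding V_def by (rule slice_openD[OF slice_open_openin[OF N(2)]])
    have V0: "0 \<in> V" using a N(1) \<zeta>0[OF a] e(2) r by (simp add: V_def chart_region_def linear_0[OF frame_linear] tnorm_zero)
    have "((snd e \<circ> \<zeta> a) has_derivative id) (at (frame a 0))"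
      using \<zeta>d[OF a] by (simp add: e_def linear_0[OF frame_linear])
    from has_derivative_compose[OF linear_imp_has_derivative[OF frame_linear] this]
    have 1: "((\<lambda>y. snd e (\<zeta> a (frame a y))) has_derivative frame a) (at 0)" by (simp add: comp_def)
    have "((snd (c a) \<circ> chart_inv e) has_derivative to_coord A (c a) (a 0)) (at (snd e (a 0)))"
      unfolding to_coord_tr e_def by (rule tr_derivative[OF _ cA[OF a] _ c0[OF a]]) (auto simp: chart_at)
    then have "((snd (c a) \<circ> chart_inv e) has_derivative to_coord A (c a) (a 0)) (at (snd e (\<zeta> a (frame a 0))))"
      by (simp add: \<zeta>0[OF a] linear_0[OF frame_linear])
    from has_derivative_compose[OF 1 this]
    have "((\<lambda>y. (snd (c a) \<circ> chart_inv e) (snd e (\<zeta> a (frame a y)))) has_derivative (\<lambda>h. to_coord A (c a) (a 0) (frame a h))) (at 0)" .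
    then have "((\<lambda>y. snd (c a) (\<zeta> a (frame a y))) has_derivative (\<lambda>h. to_coord A (c a) (a 0) (frame a h))) (at 0)"
    proof (rule has_derivative_transform_within_open[OF _ Vo V0])
      fix y assume "y \<in> V"
      then have "\<zeta> a (frame a y) \<in> fst e" by (simp add: V_def chart_region_def)
      then show "(snd (c a) \<circ> chart_inv e) (snd e (\<zeta> a (frame a y))) = snd (c a) (\<zeta> a (frame a y))"
        by (simp add: chart_inv(1)[OF e(1)])
    qed
    from bounded_linear.has_derivative[OF matrix_vector_mul_bounded_linear[of "inv_frame_matrix a"] has_derivative_diff[OF this has_derivative_const[of "base_coords a"]]]
    have "(\<theta> a has_derivative (\<lambda>h. inv_frame_matrix a *v (to_coord A (c a) (a 0) (frame a h) - 0))) (at 0)"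
      by (simp add: \<theta>_def[abs_def])
    moreover have "inv_frame_matrix a *v (to_coord A (c a) (a 0) (frame a h) - 0) = diag (\<chi> i. 1) h" for h
      by (simp add: frame_matrix_frame[OF a, symmetric] inv_frame_matrix_frame_matrix[OF a] vec_eq_iff)
    ultimately show ?thesis by simp
  qed
  have param\<theta>: "param a (\<theta> a y) = \<zeta> a (frame a y)" if "a \<in> S" "y \<in> ball 0 \<epsilon>" for a y
  proof -
    have "(a, y) \<in> W" using that \<epsilon>(2) by blast
    then show ?thesis unfolding \<theta>_def by (intro param_inv_frame_matrix that) (simp add: W_def)
  qed
  have \<theta>G: "\<theta> (shift a) (diag (\<mu> a) y) = local_map a (\<theta> a y)" if a: "a \<in> S" and y: "diag (\<mu> a) y \<in> ball 0 \<epsilon>" for a y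
  proof -
    have "y \<in> ball 0 \<epsilon>" using norm_diag_mu[OF a, of y] y by simp
    note k = param\<theta>[OF a this]
    have "(shift a, diag (\<mu> a) y) \<in> W" using \<epsilon>(2) shift_S[OF a] y by blast
    then have "tnorm G (shift a 0) (frame (shift a) (diag (\<mu> a) y)) < r" by (simp add: W_def)
    then have "tangent_map A g (a 0) (frame a y) \<in> tcball G (g (a 0)) r"
      by (simp add: tangent_frame[OF a] g0[OF a] tcball_def)
    from \<zeta>g[OF a this] have "\<zeta> (shift a) (frame (shift a) (diag (\<mu> a) y)) = g (\<zeta> a (frame a y))" by (simp add: tangent_frame[OF a])
    then show ?thesis by (simp add: \<theta>_def[of "shift a"] local_map_def k)
  qed
  have partial\<theta>: "partial j (\<lambda>a x. \<theta> a x $ i) a 0 = (if i = j then 1 else 0)" if "a \<in> S" for a i j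
    using partial_of_diag_derivative[where U = \<theta>, OF d\<theta>[OF that], of j i] by simp
  have "\<exists>\<delta>>0. \<delta> < \<epsilon> \<and> (\<forall>a\<in>S. \<forall>y\<in>ball 0 \<delta>. \<theta> a y \<in> ball 0 \<rho> \<and> \<psi> a (\<theta> a y) = y)"
    by (rule ef.linearization_unique[OF \<psi>_smooth_vfamily \<rho>(1) \<psi>0 d\<psi> \<psi>_conj \<theta>S \<epsilon>(1) \<theta>0 partial\<theta> \<theta>G])
  then obtain \<delta> where \<delta>: "\<delta> > 0" "\<delta> < \<epsilon>" "\<forall>a\<in>S. \<forall>y\<in>ball 0 \<delta>. \<theta> a y \<in> ball 0 \<rho> \<and> \<psi> a (\<theta> a y) = y"
    by (elim exE conjE)
  define d where "d = min \<delta> r1"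
  have d: "d > 0" using \<delta>(1) r1 by (simp add: d_def)
  have small: "\<zeta> a v = \<Phi> a v" if a: "a \<in> S" and v: "norm (frame_coords a v) < d" for a v
  proof -
    let ?y = "frame_coords a v"
    have y: "?y \<in> ball 0 \<delta>" "?y \<in> ball 0 r1" "?y \<in> ball 0 \<epsilon>" using v \<delta>(2) by (auto simp: d_def)
    have t: "\<theta> a ?y \<in> ball 0 \<rho>" "\<psi> a (\<theta> a ?y) = ?y" using \<delta>(3) a y(1) by auto
    have "\<phi> a ?y = \<theta> a ?y" using \<phi>\<psi>[OF a t(1)] t(2) y(2) by simp
    then show ?thesis using param\<theta>[OF a y(3)] by (simp add: \<Phi>_def frame_frame_coords[OF a])
  qed
  obtain q where q: "q > 1" "\<forall>a\<in>S. \<forall>i. q \<le> \<bar>\<mu> a $ i\<bar>" using ef.\<mu>_uniform by (elim exE conjE)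
  \<comment> \<open>The induction counts the backward steps needed: each divides the norm of the
    coordinates by at least \<open>q\<close>.\<close>
  have big: "\<zeta> a v = \<Phi> a v" if "a \<in> S" "v \<in> tcball G (a 0) r" "norm (frame_coords a v) < q ^ n * d" for n a v
    using that
  proof (induction n arbitrary: a v)
    case 0
    then show ?case using small by simp
  next
    case (Suc n)
    define b where "b = unshift a"
    have b: "b \<in> S" "shift b = a" using unshift_S[OF Suc.prems(1)] by (auto simp: b_def shift_unshift)
    have gb: "g (b 0) = a 0" using g0[OF b(1)] b(2) by simp
    \<comment> \<open>The coordinates of the preimage of \<open>v\<close> under \<open>Dg\<close>
      over the preceding point \<open>b\<close>. By \<open>expand\<close> this preimage again lies
      in the ball of radius \<open>r\<close>, where the conjugacy of \<open>\<zeta>\<close> may be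
      used.\<close>
    define y where "y = diag (\<chi> i. inverse (\<mu> b $ i)) (frame_coords a v)"
    have y: "diag (\<mu> b) y = frame_coords a v"
      using \<mu>_gt[OF b(1)] by (simp add: y_def vec_eq_iff) (metis abs_zero less_irrefl not_one_less_zero right_inverse mult.assoc mult_1)
    define w where "w = frame b y"
    have tw: "frame_coords b w = y" by (simp add: w_def frame_coords_frame[OF b(1)])
    have tv: "tangent_map A g (b 0) w = v"
      by (simp add: w_def tangent_frame[OF b(1)] y b(2) frame_frame_coords[OF Suc.prems(1)])
    have vin: "tangent_map A g (b 0) w \<in> tcball G (g (b 0)) r" using Suc.prems(2) by (simp add: tv gb)
    have "tnorm G (b 0) w \<le> tnorm G (g (b 0)) (tangent_map A g (b 0) w)" by (rule expand[OF b(1)])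
    then have wb: "w \<in> tcball G (b 0) r" using vin by (simp add: tcball_def)
    have "q * norm y \<le> norm (frame_coords a v)" unfolding y[symmetric] by (rule norm_diag_ge) (use q b(1) in auto)
    also have "\<dots> < q * (q ^ n * d)" using Suc.prems(3) by (simp add: mult.assoc)
    finally have "norm (frame_coords b w) < q ^ n * d" using q(1) by (simp add: tw)
    from Suc.IH[OF b(1) wb this] have eq: "\<zeta> b w = \<Phi> b w" .
    have "\<zeta> a v = g (\<zeta> b w)" using \<zeta>g[OF b(1) vin] by (simp add: tv b(2))
    moreover have "\<Phi> a v = g (\<Phi> b w)"
      using \<Phi>_conj[OF b(1), of w] rr[OF Suc.prems(1,2)] by (simp add: tv b(2))
    ultimately show ?case using eq by simp
  qed
  obtain n where "norm (frame_coords a v) / d < q ^ n" using real_arch_pow[OF q(1)] by blast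
  then have "norm (frame_coords a v) < q ^ n * d" using d by (simp add: pos_divide_less_eq)
  then show ?thesis by (rule big[OF a v])
qed

end

context adapted_coordinates
begin

theorem unique_linearizing_family:
  "\<exists>r0>0. \<forall>r. 0 < r \<and> r < r0 \<longrightarrow>
     (\<exists>\<phi>. linearizing_family A G g K r \<phi> \<and>
       (\<forall>\<psi>. linearizing_family A G g K r \<psi> \<longrightarrow> (\<forall>a\<in>S. \<forall>v\<in>tcball G (a 0) r. \<psi> a v = \<phi> a v)))"
proof -
  obtain \<rho> r1 \<psi> \<phi> where L: "0 < r1" "0 < \<rho>" "\<rho> \<le> R" "smooth_vfamily (S \<times> ball 0 \<rho>) \<psi>" "smooth_vfamily (S \<times> ball 0 r1) \<phi>"
    "\<forall>a\<in>S. \<forall>y\<in>ball 0 r1. \<phi> a y \<in> ball 0 \<rho> \<and> \<psi> a (\<phi> a y) = y"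
    "\<forall>a\<in>S. \<forall>x\<in>ball 0 \<rho>. \<psi> a x \<in> ball 0 r1 \<longrightarrow> \<phi> a (\<psi> a x) = x"
    "\<forall>a\<in>S. \<phi> a 0 = 0 \<and> (\<forall>i j. partial j (\<lambda>a x. \<phi> a x $ i) a 0 = (if i = j then 1 else 0))"
    "\<forall>a\<in>S. \<psi> a 0 = 0 \<and> (\<forall>i j. partial j (\<lambda>a x. \<psi> a x $ i) a 0 = (if i = j then 1 else 0))"
    "\<forall>a\<in>S. \<forall>y. diag (\<mu> a) y \<in> ball 0 r1 \<longrightarrow> \<phi> (shift a) (diag (\<mu> a) y) = local_map a (\<phi> a y)"
    "\<forall>a\<in>S. \<forall>x\<in>ball 0 \<rho>. local_map a x \<in> ball 0 \<rho> \<longrightarrow> \<psi> (shift a) (local_map a x) = diag (\<mu> a) (\<psi> a x)"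
    using ef.linearization_exists by (elim exE conjE)
  interpret linearized A G g K c X \<mu> \<rho> r1 \<psi> \<phi>
    by unfold_locales (use L in auto)
  obtain m M where m: "m > 0" "\<forall>a\<in>S. \<forall>v. m * norm (frame_coords a v) \<le> tnorm G (a 0) v \<and> tnorm G (a 0) v \<le> M * norm (frame_coords a v)"
    using tnorm_bounds by (elim exE conjE)
  show ?thesis
  \<comment> \<open>If the Riemannian norm is below \<open>m * r1\<close>, the lower norm bound puts
    the coordinates inside the ball of radius \<open>r1\<close> on which \<open>\<phi>\<close> is
    defined.\<close>
  proof (intro exI[of _ "m * r1"] conjI allI impI)
    show "m * r1 > 0" using m(1) L(1) by simp
    fix r assume r: "0 < r \<and> r < m * r1"
    have rr: "norm (frame_coords a v) < r1" if "a \<in> S" "v \<in> tcball G (a 0) r" for a v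
    proof -
      have "m * norm (frame_coords a v) \<le> r" using conjunct1[OF m(2)[rule_format, OF that(1), of v]] that(2) by (simp add: tcball_def)
      then have "m * norm (frame_coords a v) < m * r1" using r by linarith
      then show ?thesis using m(1) by simp
    qed
    show "\<exists>\<phi>. linearizing_family A G g K r \<phi> \<and>
       (\<forall>\<psi>. linearizing_family A G g K r \<psi> \<longrightarrow> (\<forall>a\<in>S. \<forall>v\<in>tcball G (a 0) r. \<psi> a v = \<phi> a v))"
    proof (intro exI[of _ \<Phi>] conjI allI impI ballI)
      show "linearizing_family A G g K r \<Phi>" by (rule \<Phi>_linearizing[OF conjunct1[OF r] rr])
      show "\<zeta> a v = \<Phi> a v" if "linearizing_family A G g K r \<zeta>" "a \<in> S" "v \<in> tcball G (a 0) r" for \<zeta> a v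
        by (rule \<Phi>_unique[OF conjunct1[OF r] rr that])
    qed
  qed
qed

end

section \<open>Invariant line bundles over a Cantor set\<close>

text \<open>Tychonoff: the orbit condition is closed in each index, so the inverse limit is a closed
  subset of a product of copies of \<open>K\<close>.\<close>

lemma compact_inverse_limit:
  fixes g :: "'m::t2_space \<Rightarrow> 'm"
  assumes K: "compact K" and g: "continuous_on UNIV g"
  shows "compact (inverse_limit g K)"
proof -
  have "compactin (product_topology (\<lambda>i::int. euclidean) UNIV) (PiE UNIV (\<lambda>i. K))"
    using K by (simp add: compactin_PiE)
  then have c: "compact (PiE (UNIV::int set) (\<lambda>i. K))" by (simp add: euclidean_product_topology)
  have "closed {a::int \<Rightarrow> 'm. g (a i) = a (i + 1)}" for i
    by (intro closed_Collect_eq continuous_on_compose2[OF g] continuous_on_product_coordinates) auto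
  then have "closed (\<Inter>i. {a::int \<Rightarrow> 'm. g (a i) = a (i + 1)})" by blast
  from compact_Int_closed[OF c this]
  have "compact (PiE (UNIV::int set) (\<lambda>i. K) \<inter> (\<Inter>i. {a. g (a i) = a (i + 1)}))" .
  moreover have "PiE (UNIV::int set) (\<lambda>i. K) \<inter> (\<Inter>i. {a. g (a i) = a (i + 1)}) = inverse_limit g K"
    by (auto simp: inverse_limit_def)
  ultimately show ?thesis by simp
qed

lemma Hausdorff_space_functions: "Hausdorff_space (top_of_set (S :: ('i \<Rightarrow> 'm::t2_space) set))"
proof (rule Hausdorff_space_subtopology)
  have "Hausdorff_space (euclidean :: 'm topology)"
    unfolding Hausdorff_space_def
  proof (intro allI impI, elim conjE)
    fix x y :: 'm assume "x \<noteq> y"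
    from hausdorff[OF this] obtain U V where "open U" "open V" "x \<in> U" "y \<in> V" "U \<inter> V = {}" by (elim exE conjE)
    then show "\<exists>U V. openin euclidean U \<and> openin euclidean V \<and> x \<in> U \<and> y \<in> V \<and> disjnt U V"
      by (intro exI[of _ U] exI[of _ V]) (simp add: disjnt_def)
  qed
  then have "Hausdorff_space (product_topology (\<lambda>i::'i. euclidean :: 'm topology) UNIV)"
    by (simp add: Hausdorff_space_product_topology)
  then show "Hausdorff_space (euclidean :: ('i \<Rightarrow> 'm) topology)" by (simp add: euclidean_product_topology)
qed

text \<open>Every coordinate projection maps a connected set to a connected subset of
  \<open>K\<close>, that is, to at most one point.\<close>

lemma inverse_limit_totally_disconnected:
  assumes K: "cantor_set K" and C: "C \<subseteq> inverse_limit g K" "connected C" and xy: "x \<in> C" "y \<in> C"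
  shows "x = y"
proof
  fix i
  have "connected ((\<lambda>a. a i) ` C)"
    by (rule connected_continuous_image[OF continuous_on_subset[OF continuous_on_product_coordinates] C(2)]) (rule subset_UNIV)
  moreover have "(\<lambda>a. a i) ` C \<subseteq> K" using C(1) by (auto simp: inverse_limit_def)
  moreover have "x i \<in> (\<lambda>a. a i) ` C" "y i \<in> (\<lambda>a. a i) ` C" using xy by auto
  ultimately show "x i = y i" using K unfolding cantor_set_def by metis
qed

text \<open>With the next lemma this translates words of directions, which index iterated
  derivatives, into the multiindices of the nonresonance hypothesis.\<close>

lemma sum_count_mset: "(\<Sum>j\<in>(UNIV::'n::finite set). count (mset vs) j) = length vs"
proof (induction vs)
  case (Cons v vs)
  have "count (mset (v # vs)) j = (if j = v then 1 else 0) + count (mset vs) j" for j by simp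
  then show ?case using Cons by (simp only: sum.distrib) simp
qed simp

lemma prod_power_count_mset:
  fixes f :: "'n::finite \<Rightarrow> 'a::comm_monoid_mult"
  shows "(\<Prod>j\<in>UNIV. f j ^ count (mset vs) j) = prod_list (map f vs)"
proof (induction vs)
  case (Cons v vs)
  have "f j ^ count (mset (v # vs)) j = (if j = v then f j else 1) * f j ^ count (mset vs) j" for j by simp
  then show ?case using Cons by (simp add: prod.distrib)
qed simp

lemma line_multiple:
  fixes V :: "'a::euclidean_space set"
  assumes V: "subspace V" "dim V = 1" and x: "x \<in> V" "x \<noteq> 0" and v: "v \<in> V"
  shows "\<exists>k. v = k *\<^sub>R x"
proof -
  have "span {x} \<subseteq> V" using V(1) x(1) by (simp add: span_minimal)
  moreover have "dim (span {x}) = 1" using dim_eq_card_independent[of "{x}"] x(2) by (simp add: dim_span)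
  ultimately have "span {x} = V" using subspace_dim_equal[OF subspace_span V(1)] V(2) by simp
  then show ?thesis using v by (auto simp: span_singleton)
qed

lemma subbundle_subspace: "subbundle A S p V \<Longrightarrow> s \<in> S \<Longrightarrow> subspace (V s)"
  unfolding subbundle_def by (metis IntI subspace_span)

context riemannian_atlas
begin

text \<open>A subbundle of rank one has locally a nowhere zero continuous section; its norm is
  continuous in a chart, so the section can be normalized.\<close>

lemma unit_section:
  fixes p :: "'s::topological_space \<Rightarrow> 'm"
  assumes V: "subbundle A S p V" and dim: "\<And>s. s \<in> S \<Longrightarrow> dim (V s) = 1" and p: "continuous_on UNIV p"
    and b: "b \<in> S" and c: "c \<in> A" "p b \<in> fst c"
  shows "\<exists>U X. open U \<and> b \<in> U \<and> (\<forall>t\<in>S \<inter> U. p t \<in> fst c \<and> X t \<in> V t \<and> tnorm G (p t) (X t) = 1) \<and>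
     continuous_on (S \<inter> U) (\<lambda>t. to_coord A c (p t) (X t))"
proof -
  obtain U k Y where U: "open U" "b \<in> U" and Y: "\<forall>i<k. continuous_section A (S \<inter> U) p (Y i)"
    and sp: "\<forall>t\<in>S \<inter> U. inj_on (\<lambda>i. Y i t) {..<k} \<and> independent ((\<lambda>i. Y i t) ` {..<k::nat}) \<and> span ((\<lambda>i. Y i t) ` {..<k}) = V t"
    using bspec[OF V[unfolded subbundle_def] b] by (elim exE conjE)
  have "dim (V b) = k"
  proof -
    have "dim (V b) = dim ((\<lambda>i. Y i b) ` {..<k})" using sp b U(2) by (metis IntI dim_span)
    also have "\<dots> = card ((\<lambda>i. Y i b) ` {..<k})" by (rule dim_eq_card_independent) (use sp b U(2) in blast)
    also have "\<dots> = k" using sp b U(2) by (simp add: card_image)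
    finally show ?thesis .
  qed
  then have k: "k = 1" using dim[OF b] by simp
  let ?Y = "Y 0" and ?U = "U \<inter> p -` fst c"
  have Yt: "?Y t \<in> V t" "?Y t \<noteq> 0" if "t \<in> S" "t \<in> U" for t
  proof -
    have "independent {?Y t}" "span {?Y t} = V t" using sp that by (auto simp: k lessThan_Suc)
    then show "?Y t \<in> V t" "?Y t \<noteq> 0" using span_base[of "?Y t" "{?Y t}"] by auto
  qed
  have oU: "open ?U" using open_vimage[OF chartD(2)[OF c(1)] p] U(1) by blast
  have Yc: "continuous_on (S \<inter> ?U) (\<lambda>t. to_coord A c (p t) (?Y t))"
  proof -
    have "continuous_on (S \<inter> U \<inter> p -` fst c) (\<lambda>t. to_coord A c (p t) (?Y t))"
      using Y c(1) unfolding continuous_section_def k by blast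
    then show ?thesis by (simp add: Int_assoc)
  qed
  have nY: "tnorm G (p t) (?Y t) = sqrt (H c (p t) (to_coord A c (p t) (?Y t)) (to_coord A c (p t) (?Y t)))"
    if "t \<in> S \<inter> ?U" for t
    using that by (simp add: tnorm_def H_def of_to_coord[OF c(1)])
  have "continuous_on (S \<inter> ?U) (\<lambda>t. sqrt (H c (p t) (to_coord A c (p t) (?Y t)) (to_coord A c (p t) (?Y t))))"
    by (intro continuous_on_real_sqrt H_continuous[OF c(1) continuous_on_subset[OF p] _ Yc Yc]) auto
  then have nc: "continuous_on (S \<inter> ?U) (\<lambda>t. tnorm G (p t) (?Y t))"
    by (rule continuous_on_eq) (simp add: nY)
  have pos: "tnorm G (p t) (?Y t) > 0" if "t \<in> S \<inter> ?U" for t using Yt[of t] that by (intro tnorm_pos) auto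
  define X where "X t = (1 / tnorm G (p t) (?Y t)) *\<^sub>R ?Y t" for t
  have "continuous_on (S \<inter> ?U) (\<lambda>t. (1 / tnorm G (p t) (?Y t)) *\<^sub>R to_coord A c (p t) (?Y t))"
    by (intro continuous_on_scaleR continuous_on_divide continuous_on_const nc Yc) (use pos in force)
  then have "continuous_on (S \<inter> ?U) (\<lambda>t. to_coord A c (p t) (X t))"
    by (rule continuous_on_eq) (simp add: X_def linear_cmul[OF to_coord_linear[OF c(1)]])
  moreover have "X t \<in> V t" if "t \<in> S \<inter> ?U" for t
    using Yt(1)[of t] that subbundle_subspace[OF V, of t] by (auto simp: X_def subspace_scale)
  moreover have "tnorm G (p t) (X t) = 1" if "t \<in> S \<inter> ?U" for t
    using pos[OF that] by (simp add: X_def tnorm_scale)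
  ultimately show ?thesis using oU U(2) c(2) by (intro exI[of _ ?U] exI[of _ X]) auto
qed

text \<open>The unit vectors of a line are \<open>X\<close> and \<open>-X\<close>, so the supremum
  is taken over a constant.\<close>

lemma restricted_norm_line:
  assumes V: "subspace V" "dim V = 1" and X: "X \<in> V" "tnorm G x X = 1"
    and g: "smooth_map A g" and m: "tangent_map A g x X = m *\<^sub>R Y" and Y: "tnorm G (g x) Y = 1"
  shows "restricted_norm A G g x V = \<bar>m\<bar>"
proof -
  have X0: "X \<noteq> 0" using X(2) tnorm_zero[of x] by auto
  have "tnorm G (g x) (tangent_map A g x u) = \<bar>m\<bar>" if u: "u \<in> V" "tnorm G x u = 1" for u
  proof -
    obtain k where k: "u = k *\<^sub>R X" using line_multiple[OF V X(1) X0 u(1)] by (elim exE)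
    then have "\<bar>k\<bar> = 1" using u(2) X(2) by (simp add: tnorm_scale)
    then show ?thesis by (simp add: k linear_cmul[OF tangent_map_linear[OF g]] m tnorm_scale Y abs_mult)
  qed
  then have "restricted_norm A G g x V = (SUP u\<in>{u\<in>V. tnorm G x u = 1}. \<bar>m\<bar>)"
    unfolding restricted_norm_def by (intro SUP_cong) auto
  also have "\<dots> = \<bar>m\<bar>" by (rule cSUP_const) (use X in blast)
  finally show ?thesis .
qed

text \<open>Locally a chart and unit sections exist. Total disconnectedness makes one consistent
  choice possible over the whole inverse limit, signs of the sections included.\<close>

theorem adapted_coordinates_exist:
  fixes F :: "nat \<Rightarrow> (int \<Rightarrow> 'm) \<Rightarrow> (real ^ 'n) set"
  assumes g: "smooth_map A g" and K: "cantor_set K" and ex: "expanding A G g K"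
    and F: "invariant_splitting A g K E F"
    and ne: "\<And>(i::nat) (k::nat \<Rightarrow> nat) a. i \<in> {1..CARD('n)} \<Longrightarrow> (\<Sum>l=1..CARD('n). k l) \<noteq> 1 \<Longrightarrow>
           a \<in> inverse_limit g K \<Longrightarrow>
           restricted_norm A G g (a 0) (F i a) \<noteq>
           (\<Prod>l=1..CARD('n). restricted_norm A G g (a 0) (F l a) ^ k l)"
    and sg: "\<And>(i::nat) (k::nat \<Rightarrow> nat) a b. i \<in> {1..CARD('n)} \<Longrightarrow> (\<Sum>l=1..CARD('n). k l) \<noteq> 1 \<Longrightarrow>
           a \<in> inverse_limit g K \<Longrightarrow> b \<in> inverse_limit g K \<Longrightarrow>
           sgn (restricted_norm A G g (a 0) (F i a) -
                (\<Prod>l=1..CARD('n). restricted_norm A G g (a 0) (F l a) ^ k l)) =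
           sgn (restricted_norm A G g (b 0) (F i b) -
                (\<Prod>l=1..CARD('n). restricted_norm A G g (b 0) (F l b) ^ k l))"
  shows "\<exists>c X \<mu>. adapted_coordinates A G g K c X \<mu>"
proof -
  let ?S = "inverse_limit g K"
  have Sc: "compact ?S"
    using K g by (intro compact_inverse_limit) (auto simp: cantor_set_def smooth_map_def)
  have p: "continuous_on UNIV (\<lambda>a::int \<Rightarrow> 'm. a 0)" by (rule continuous_on_product_coordinates)
  have S0: "a 0 \<in> K" "g (a 0) = shift a 0" "shift a \<in> ?S" if "a \<in> ?S" for a
    using that by (auto simp: inverse_limit_def shift_def)
  \<comment> \<open>The bundles are numbered from 1 to \<open>CARD('n)\<close>, whereas coordinates
    are indexed by the type \<open>'n\<close>.\<close>
  obtain ix :: "'n \<Rightarrow> nat" where ix: "bij_betw ix UNIV {1..CARD('n)}"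
    using finite_same_card_bij[of "UNIV :: 'n set" "{1..CARD('n)}"] by auto
  define J where "J = inv_into UNIV ix"
  have J: "J (ix i) = i" for i using ix unfolding J_def by (simp add: bij_betw_def)
  have ixI: "ix i \<in> {1..CARD('n)}" for i using bij_betwE[OF ix] by simp
  have Fs: "subbundle A ?S (\<lambda>a. a 0) (F (ix i))" for i using F ixI[of i] unfolding invariant_splitting_def by blast
  have F1: "dim (F (ix i) a) = 1" "tangent_map A g (a 0) ` F (ix i) a = F (ix i) (shift a)" if "a \<in> ?S" for i a
    using F ixI[of i] that unfolding invariant_splitting_def by blast+
  have Fd: "direct_sum {1..CARD('n)} (\<lambda>l. F l a) UNIV" if "a \<in> ?S" for a
    using F that unfolding invariant_splitting_def by blast
  \<comment> \<open>A chart, all sections and their common domain are chosen together as one object,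
    so that a single locally constant choice suffices.\<close>
  define P where "P z a \<longleftrightarrow> (case z of (c, X, U) \<Rightarrow> open U \<and> a \<in> U \<and> c \<in> A \<and>
     (\<forall>i. (\<forall>t\<in>?S \<inter> U. t 0 \<in> fst c \<and> X i t \<in> F (ix i) t \<and> tnorm G (t 0) (X i t) = 1) \<and>
        continuous_on (?S \<inter> U) (\<lambda>t. to_coord A c (t 0) (X i t))))"
    for z :: "('m, 'n) chart \<times> ('n \<Rightarrow> (int \<Rightarrow> 'm) \<Rightarrow> real^'n) \<times> (int \<Rightarrow> 'm) set" and a
  have loc: "\<exists>U z. open U \<and> b \<in> U \<and> (\<forall>a\<in>?S \<inter> U. P z a)" if b: "b \<in> ?S" for b
  proof -
    define c where "c = chart_at A (b 0)"
    have c: "c \<in> A" "b 0 \<in> fst c" using chart_at by (auto simp: c_def)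
    have "\<forall>i. \<exists>U X. open U \<and> b \<in> U \<and> (\<forall>t\<in>?S \<inter> U. t 0 \<in> fst c \<and> X t \<in> F (ix i) t \<and> tnorm G (t 0) (X t) = 1) \<and>
     continuous_on (?S \<inter> U) (\<lambda>t. to_coord A c (t 0) (X t))"
    proof
      fix i
      show "\<exists>U X. open U \<and> b \<in> U \<and> (\<forall>t\<in>?S \<inter> U. t 0 \<in> fst c \<and> X t \<in> F (ix i) t \<and> tnorm G (t 0) (X t) = 1) \<and>
          continuous_on (?S \<inter> U) (\<lambda>t. to_coord A c (t 0) (X t))"
        by (rule unit_section[where p = "\<lambda>a. a 0" and b = b and V = "F (ix i)", OF Fs F1(1) p b c])
    qed
    from choice[OF this] obtain U where "\<forall>i. \<exists>X. open (U i) \<and> b \<in> U i \<and>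
       (\<forall>t\<in>?S \<inter> U i. t 0 \<in> fst c \<and> X t \<in> F (ix i) t \<and> tnorm G (t 0) (X t) = 1) \<and>
       continuous_on (?S \<inter> U i) (\<lambda>t. to_coord A c (t 0) (X t))" ..
    from choice[OF this] obtain X where UX: "\<forall>i. open (U i) \<and> b \<in> U i \<and>
       (\<forall>t\<in>?S \<inter> U i. t 0 \<in> fst c \<and> X i t \<in> F (ix i) t \<and> tnorm G (t 0) (X i t) = 1) \<and>
       continuous_on (?S \<inter> U i) (\<lambda>t. to_coord A c (t 0) (X i t))" ..
    let ?U = "\<Inter>i. U i"
    have oU: "open ?U" "b \<in> ?U" using UX by auto
    have "P (c, X, ?U) a" if "a \<in> ?U" for a
      unfolding P_def prod.case
    proof (intro conjI allI ballI oU(1) that c(1))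
      fix i
      show "continuous_on (?S \<inter> ?U) (\<lambda>t. to_coord A c (t 0) (X i t))"
        by (rule continuous_on_subset[of "?S \<inter> U i"]) (use UX in auto)
      fix t assume t: "t \<in> ?S \<inter> ?U"
      then have "t \<in> ?S \<inter> U i" by blast
      then show "t 0 \<in> fst c" "X i t \<in> F (ix i) t" "tnorm G (t 0) (X i t) = 1" using UX by blast+
    qed
    then show ?thesis using oU by (intro exI[of _ ?U] exI[of _ "(c, X, ?U)"]) simp
  qed
  have td: "\<forall>x\<in>C. \<forall>y\<in>C. x = y" if "C \<subseteq> ?S" "connected C" for C
    using inverse_limit_totally_disconnected[OF K that] by blast
  have "\<exists>ch. (\<forall>a\<in>?S. P (ch a) a) \<and> (\<forall>b\<in>?S. \<exists>U. open U \<and> b \<in> U \<and> (\<forall>a\<in>?S \<inter> U. ch a = ch b))"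
    by (rule locally_constant_choice[OF Sc Hausdorff_space_functions td loc])
  then obtain ch where chP: "\<forall>a\<in>?S. P (ch a) a" and chl: "\<forall>b\<in>?S. \<exists>U. open U \<and> b \<in> U \<and> (\<forall>a\<in>?S \<inter> U. ch a = ch b)"
    by (elim exE conjE)
  define c where "c a = fst (ch a)" for a
  \<comment> \<open>What is locally constant is the chosen section; its value at \<open>a\<close>
    still varies, and it varies continuously.\<close>
  define X where "X i a = fst (snd (ch a)) i a" for i a
  have chD: "open (snd (snd (ch a)))" "a \<in> snd (snd (ch a))" "c a \<in> A"
      "t \<in> ?S \<Longrightarrow> t \<in> snd (snd (ch a)) \<Longrightarrow> t 0 \<in> fst (c a) \<and> fst (snd (ch a)) i t \<in> F (ix i) t \<and> tnorm G (t 0) (fst (snd (ch a)) i t) = 1"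
      "continuous_on (?S \<inter> snd (snd (ch a))) (\<lambda>t. to_coord A (c a) (t 0) (fst (snd (ch a)) i t))"
    if "a \<in> ?S" for a t i
    using bspec[OF chP that] unfolding P_def c_def by (auto simp: case_prod_unfold)
  have XF: "X i a \<in> F (ix i) a" and X1: "tnorm G (a 0) (X i a) = 1" if "a \<in> ?S" for i a
    using chD(4)[OF that that chD(2)[OF that]] by (auto simp: X_def)
  have X0: "X i a \<noteq> 0" if "a \<in> ?S" for i a using X1[OF that, of i] tnorm_zero[of "a 0"] by auto
  have tl: "linear (tangent_map A g x)" for x by (rule tangent_map_linear[OF g])
  have "\<exists>m. tangent_map A g (a 0) (X i a) = m *\<^sub>R X i (shift a)" if a: "a \<in> ?S" for a i
  proof (rule line_multiple[OF subbundle_subspace[OF Fs S0(3)[OF a]] F1(1)[OF S0(3)[OF a]] XF X0])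
    show "tangent_map A g (a 0) (X i a) \<in> F (ix i) (shift a)" using F1(2)[OF a, of i] XF[OF a, of i] by blast
  qed (use S0(3)[OF a] in auto)
  then have "\<forall>a i. \<exists>m. a \<in> ?S \<longrightarrow> tangent_map A g (a 0) (X i a) = m *\<^sub>R X i (shift a)" by blast
  \<comment> \<open>The factors carry signs; their absolute values are the restricted norms, by
    \<open>rn\<close> below.\<close>
  then obtain m where m: "\<And>a i. a \<in> ?S \<Longrightarrow> tangent_map A g (a 0) (X i a) = m a i *\<^sub>R X i (shift a)" by metis
  have rn: "restricted_norm A G g (a 0) (F (ix i) a) = \<bar>m a i\<bar>" if a: "a \<in> ?S" for a i
    by (rule restricted_norm_line[OF subbundle_subspace[OF Fs a] F1(1)[OF a] XF[OF a] X1[OF a] g m[OF a]])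
      (simp add: S0[OF a] X1)
  have big: "tnorm G (g (a 0)) (tangent_map A g (a 0) u) > 1" if "a \<in> ?S" "tnorm G (a 0) u = 1" for a u
    using ex S0(1)[OF that(1)] that(2) unfolding expanding_def by blast
  have "adapted_coordinates A G g K c X (\<lambda>a. \<chi> i. m a i)"
  proof (unfold_locales)
    show "smooth_map A g" by (rule g)
    show "compact ?S" by (rule Sc)
    show "c a \<in> A" if "a \<in> ?S" for a by (rule chD(3)[OF that])
    show "a 0 \<in> fst (c a)" if "a \<in> ?S" for a using chD(4)[OF that that chD(2)[OF that]] by blast
    show "\<exists>U. open U \<and> b \<in> U \<and> (\<forall>a\<in>?S \<inter> U. c a = c b)" if "b \<in> ?S" for b
      using bspec[OF chl that] unfolding c_def by (elim exE conjE) (intro exI conjI, assumption+, simp)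
    show "continuous_on ?S (\<lambda>a. to_coord A (c a) (a 0) (X i a))" for i
    proof (rule continuous_on_local)
      fix b assume b: "b \<in> ?S"
      obtain N where N: "open N" "b \<in> N" "\<forall>a\<in>?S \<inter> N. ch a = ch b" using bspec[OF chl b] by (elim exE conjE)
      let ?W = "N \<inter> snd (snd (ch b))"
      have "continuous_on (?S \<inter> ?W) (\<lambda>t. to_coord A (c b) (t 0) (fst (snd (ch b)) i t))"
        by (rule continuous_on_subset[OF chD(5)[OF b]]) auto
      then have "continuous_on (?S \<inter> ?W) (\<lambda>a. to_coord A (c a) (a 0) (X i a))"
        by (rule continuous_on_eq) (use N(3) in \<open>simp add: c_def X_def\<close>)
      then show "\<exists>W. open W \<and> b \<in> W \<and> continuous_on (?S \<inter> W) (\<lambda>a. to_coord A (c a) (a 0) (X i a))"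
        using N(1,2) chD(1,2)[OF b] by (intro exI[of _ ?W]) auto
    qed
    show "y = 0" if a: "a \<in> ?S" and y: "(\<Sum>i\<in>UNIV. y $ i *\<^sub>R X i a) = 0" for a y
    proof -
      define u where "u l = y $ J l *\<^sub>R X (J l) a" for l
      have "(\<Sum>l\<in>{1..CARD('n)}. u l) = (\<Sum>i\<in>UNIV. u (ix i))"
        by (rule sum.reindex_bij_betw[OF ix, symmetric])
      then have s: "(\<Sum>l\<in>{1..CARD('n)}. u l) = 0" using y by (simp add: u_def J)
      have uF: "u (ix i) \<in> F (ix i) a" for i
        using subspace_scale[OF subbundle_subspace[OF Fs a] XF[OF a]] by (simp add: u_def J)
      have "u l \<in> F l a" if "l \<in> {1..CARD('n)}" for l
        using uF that bij_betw_imp_surj_on[OF ix] by (metis imageE)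
      then have u0: "\<forall>l\<in>{1..CARD('n)}. u l = 0" using Fd[OF a] s unfolding direct_sum_def by blast
      have "y $ i = 0" for i using bspec[OF u0 ixI[of i]] X0[OF a, of i] by (simp add: u_def J)
      then show "y = 0" by (simp add: vec_eq_iff)
    qed
    show "tangent_map A g (a 0) (X i a) = (\<chi> i. m a i) $ i *\<^sub>R X i (shift a)" if "a \<in> ?S" for a i
      using m[OF that] by simp
    show "\<bar>(\<chi> i. m a i) $ i\<bar> > 1" if a: "a \<in> ?S" for a i
      using big[OF a X1[OF a, of i]] by (simp add: m[OF a] tnorm_scale S0(2)[OF a] X1[OF S0(3)[OF a]])
    show "tnorm G (a 0) v \<le> tnorm G (g (a 0)) (tangent_map A g (a 0) v)" if a: "a \<in> ?S" for a v
    proof (cases "v = 0")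
      case True
      then show ?thesis by (simp add: linear_0[OF tl] tnorm_zero)
    next
      case False
      let ?t = "tnorm G (a 0) v"
      have t: "?t > 0" by (rule tnorm_pos[OF False])
      have "tnorm G (a 0) ((1 / ?t) *\<^sub>R v) = 1" using t by (simp add: tnorm_scale)
      from big[OF a this] have "tnorm G (g (a 0)) (tangent_map A g (a 0) v) / ?t > 1"
        using t by (simp add: linear_cmul[OF tl] tnorm_scale)
      then show ?thesis using t by (simp add: field_simps)
    qed
    show "(\<forall>a\<in>?S. \<bar>(\<chi> i. m a i) $ i\<bar> < prod_list (map (\<lambda>v. \<bar>(\<chi> i. m a i) $ v\<bar>) vs)) \<or>
      (\<forall>a\<in>?S. prod_list (map (\<lambda>v. \<bar>(\<chi> i. m a i) $ v\<bar>) vs) < \<bar>(\<chi> i. m a i) $ i\<bar>)"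
      if vs: "2 \<le> length vs" for i vs
    proof -
      \<comment> \<open>The exponent of a bundle is the number of times its direction occurs in the
        word; the exponents add up to \<open>length vs\<close>, which is at least 2.\<close>
      define k where "k l = count (mset vs) (J l)" for l
      have "(\<Sum>l=1..CARD('n). k l) = (\<Sum>j\<in>UNIV. k (ix j))" by (rule sum.reindex_bij_betw[OF ix, symmetric])
      also have "\<dots> = length vs" by (simp add: k_def J sum_count_mset)
      finally have k1: "(\<Sum>l=1..CARD('n). k l) \<noteq> 1" using vs by simp
      have pr: "(\<Prod>l=1..CARD('n). restricted_norm A G g (a 0) (F l a) ^ k l) = prod_list (map (\<lambda>v. \<bar>m a v\<bar>) vs)"
        if a: "a \<in> ?S" for a
      proof -
        have "(\<Prod>l=1..CARD('n). restricted_norm A G g (a 0) (F l a) ^ k l) =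
          (\<Prod>j\<in>UNIV. restricted_norm A G g (a 0) (F (ix j) a) ^ k (ix j))"
          by (rule prod.reindex_bij_betw[OF ix, symmetric])
        then show ?thesis by (simp add: k_def J rn[OF a] prod_power_count_mset)
      qed
      \<comment> \<open>The hypotheses say that \<open>D\<close> never vanishes and that its sign is
        the same at all points, which yields the alternative.\<close>
      define D where "D a = \<bar>m a i\<bar> - prod_list (map (\<lambda>v. \<bar>m a v\<bar>) vs)" for a
      have D0: "D a \<noteq> 0" if "a \<in> ?S" for a
        using ne[OF ixI[of i] k1 that] unfolding pr[OF that] rn[OF that] D_def by simp
      have Ds: "sgn (D a) = sgn (D b)" if "a \<in> ?S" "b \<in> ?S" for a b
        using sg[OF ixI[of i] k1 that] unfolding pr[OF that(1)] pr[OF that(2)] rn[OF that(1)] rn[OF that(2)] D_def .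
      have "(\<forall>a\<in>?S. D a < 0) \<or> (\<forall>a\<in>?S. D a > 0)"
      proof (rule ccontr)
        assume "\<not> ?thesis"
        then obtain a b where ab: "a \<in> ?S" "b \<in> ?S" "\<not> D a < 0" "\<not> D b > 0" by blast
        then have "D a > 0" "D b < 0" using D0[OF ab(1)] D0[OF ab(2)] by auto
        then show False using Ds[OF ab(1,2)] by simp
      qed
      then show ?thesis by (simp add: D_def)
    qed
  qed
  then show ?thesis by blast
qed

end

theorem corollary4:
  fixes A :: "('m::{t2_space, second_countable_topology}, 'n::finite) chart set"
    and G :: "'m \<Rightarrow> real ^ 'n \<Rightarrow> real ^ 'n \<Rightarrow> real"
    and g :: "'m \<Rightarrow> 'm"
    and K :: "'m set"
    and E :: "nat \<Rightarrow> 'm \<Rightarrow> (real ^ 'n) set"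
    and F :: "nat \<Rightarrow> (int \<Rightarrow> 'm) \<Rightarrow> (real ^ 'n) set"
  assumes "smooth_atlas A"
    and "riemannian_metric A G"
    and "smooth_map A g"
    and "cantor_set K"
    and "expanding A G g K"
    and "totally_projectively_hyperbolic A G g K E"
    and "invariant_splitting A g K E F"
    and "\<And>(i::nat) (k::nat \<Rightarrow> nat) a. i \<in> {1..CARD('n)} \<Longrightarrow> (\<Sum>l=1..CARD('n). k l) \<noteq> 1 \<Longrightarrow>
           a \<in> inverse_limit g K \<Longrightarrow>
           restricted_norm A G g (a 0) (F i a) \<noteq>
           (\<Prod>l=1..CARD('n). restricted_norm A G g (a 0) (F l a) ^ k l)"
    and "\<And>(i::nat) (k::nat \<Rightarrow> nat) a b. i \<in> {1..CARD('n)} \<Longrightarrow> (\<Sum>l=1..CARD('n). k l) \<noteq> 1 \<Longrightarrow>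
           a \<in> inverse_limit g K \<Longrightarrow> b \<in> inverse_limit g K \<Longrightarrow>
           sgn (restricted_norm A G g (a 0) (F i a) -
                (\<Prod>l=1..CARD('n). restricted_norm A G g (a 0) (F l a) ^ k l)) =
           sgn (restricted_norm A G g (b 0) (F i b) -
                (\<Prod>l=1..CARD('n). restricted_norm A G g (b 0) (F l b) ^ k l))"
  shows "\<exists>r0>0. \<forall>r. 0 < r \<and> r < r0 \<longrightarrow>
           (\<exists>\<phi>. linearizing_family A G g K r \<phi> \<and>
             (\<forall>\<psi>. linearizing_family A G g K r \<psi> \<longrightarrow>
               (\<forall>a\<in>inverse_limit g K. \<forall>v\<in>tcball G (a 0) r. \<psi> a v = \<phi> a v)))"
proof -
  interpret riemannian_atlas A G by unfold_locales (fact assms(1,2))+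
  have "\<exists>c X \<mu>. adapted_coordinates A G g K c X \<mu>"
    by (rule adapted_coordinates_exist[OF assms(3,4,5,7)]) (rule assms(8,9); assumption)+
  then obtain c X \<mu> where "adapted_coordinates A G g K c X \<mu>" by (elim exE)
  then interpret adapted_coordinates A G g K c X \<mu> .
  show ?thesis by (rule unique_linearizing_family)
qed

end
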